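(* Let $\Phi$ be an edge-monotone graph parameter with values in $\mathbb{Q}$ and with finite codomain. \begin{itemize} \item If $\Phi$ is nontrivial, then $\#\mathrm{IndSub}(\Phi)$ and $\#\mathrm{cp\text{-}IndSub}(\Phi)$ are $\#\mathrm{W}[1]$-hard. \item Further, assuming ETH: if the codomain of $\Phi$ is equal to $\{0,\dots,c\}$, then there is a universal constant $\delta_c>0$ (depending only on $c$) such that for every integer $k\ge 3$ on which $\Phi$ is nontrivial, no algorithm (that reads the whole input) computes for every graph $G$ the number $\#\mathrm{IndSub}_{(\Phi,k)}(G)$ (or, for every $k$-vertex graph $H$ and every $H$-colored graph $G$, the number $\#\mathrm{cpIndSub}_{(\Phi,H)}(G)$) in time $O(|V(G)|^{\delta_c k})$. \end{itemize}
   Context: All graphs are finite, simple and undirected. A graph parameter is a computable function $\Phi$ from graphs to $\mathbb{Q}$ that is invariant under isomorphism. $\Phi$ is nontrivial on $n$ if it is not constant on the set of $n$-vertex graphs, and nontrivial if it is nontrivial on infinitely many $n$. An edge-subgraph of $G$ is a graph with vertex set $V(G)$ and edge set a subset of $E(G)$. $\Phi$ is edge-monotone if $\Phi(G)\le \Phi(H)$ whenever $H$ is an edge-subgraph of $G$. For a graph $G$ and integer $k$, $\#\mathrm{IndSub}_{(\Phi,k)}(G)=\sum_{A\subseteq V(G),|A|=k}\Phi(G[A])$; the problem $\#\mathrm{IndSub}(\Phi)$ gets $(k,G)$ and outputs this value, parameterized by $k$. For a graph $H$, an $H$-colored graph is a graph $G$ with a homomorphism $c:V(G)\to V(H)$;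 a set $A\subseteq V(G)$ with $|A|=|V(H)|$ is colorful if $c(A)=V(H)$. Then $\#\mathrm{cpIndSub}_{(\Phi,H)}(G)=\sum_{A \text{ colorful}}\Phi(G[A])$; the problem $\#\mathrm{cp\text{-}IndSub}(\Phi)$ gets a graph $H$ and an $H$-colored graph $G$ and outputs this value, parameterized by $|V(H)|$. A parameterized counting problem is $\#\mathrm{W}[1]$-hard if there is a parameterized Turing reduction from $\#\textsc{Clique}$ (count $k$-cliques in $G$, parameter $k$) to it. ETH is the Exponential-Time Hypothesis. *)

theory Defs
  imports Complex_Main "HOL-Library.Landau_Symbols" "HOL-Library.Log_Nat"
begin

section \<open>Graphs and graph parameters\<close>

text \<open>
  Finite simple undirected graphs. Vertices are natural numbers; every finite graph is isomorphic
  to such a graph, and graph parameters are isomorphism invariant.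
\<close>

record graph =
  verts :: "nat set"
  edges :: "nat set set"

definition graphs :: "graph set" where
  "graphs = {G. finite (verts G) \<and> edges G \<subseteq> {e. e \<subseteq> verts G \<and> card e = 2}}"

definition graph_iso :: "graph \<Rightarrow> graph \<Rightarrow> bool" where
  "graph_iso G H \<longleftrightarrow>
     (\<exists>f. bij_betw f (verts G) (verts H) \<and>
          (\<forall>u\<in>verts G. \<forall>v\<in>verts G. {u, v} \<in> edges G \<longleftrightarrow> {f u, f v} \<in> edges H))"

definition edge_subgraph :: "graph \<Rightarrow> graph \<Rightarrow> bool" where
  "edge_subgraph H G \<longleftrightarrow> verts H = verts G \<and> edges H \<subseteq> edges G"

definition induced :: "graph \<Rightarrow> nat set \<Rightarrow> graph" where
  "induced G A = \<lparr>verts = A, edges = {e \<in> edges G. e \<subseteq> A}\<rparr>"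

text \<open>Since edges have two elements, the image of an edge is an edge only if its ends stay distinct.\<close>

definition graph_hom :: "(nat \<Rightarrow> nat) \<Rightarrow> graph \<Rightarrow> graph \<Rightarrow> bool" where
  "graph_hom c G H \<longleftrightarrow> c ` verts G \<subseteq> verts H \<and> (\<forall>e\<in>edges G. c ` e \<in> edges H)"

definition iso_invariant :: "(graph \<Rightarrow> rat) \<Rightarrow> bool" where
  "iso_invariant \<Phi> \<longleftrightarrow> (\<forall>G\<in>graphs. \<forall>H\<in>graphs. graph_iso G H \<longrightarrow> \<Phi> G = \<Phi> H)"

definition edge_monotone :: "(graph \<Rightarrow> rat) \<Rightarrow> bool" where
  "edge_monotone \<Phi> \<longleftrightarrow> (\<forall>G\<in>graphs. \<forall>H\<in>graphs. edge_subgraph H G \<longrightarrow> \<Phi> G \<le> \<Phi> H)"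

definition nontrivial_on :: "(graph \<Rightarrow> rat) \<Rightarrow> nat \<Rightarrow> bool" where
  "nontrivial_on \<Phi> n \<longleftrightarrow>
     (\<exists>G\<in>graphs. \<exists>H\<in>graphs. card (verts G) = n \<and> card (verts H) = n \<and> \<Phi> G \<noteq> \<Phi> H)"

definition nontrivial :: "(graph \<Rightarrow> rat) \<Rightarrow> bool" where
  "nontrivial \<Phi> \<longleftrightarrow> infinite {n. nontrivial_on \<Phi> n}"

definition indsub :: "(graph \<Rightarrow> rat) \<Rightarrow> nat \<Rightarrow> graph \<Rightarrow> rat" where
  "indsub \<Phi> k G = (\<Sum>A | A \<subseteq> verts G \<and> card A = k. \<Phi> (induced G A))"

definition colorful :: "graph \<Rightarrow> graph \<Rightarrow> (nat \<Rightarrow> nat) \<Rightarrow> nat set \<Rightarrow> bool" where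
  "colorful H G c A \<longleftrightarrow> A \<subseteq> verts G \<and> card A = card (verts H) \<and> c ` A = verts H"

definition cp_indsub :: "(graph \<Rightarrow> rat) \<Rightarrow> graph \<Rightarrow> graph \<Rightarrow> (nat \<Rightarrow> nat) \<Rightarrow> rat" where
  "cp_indsub \<Phi> H G c = (\<Sum>A | colorful H G c A. \<Phi> (induced G A))"

definition num_cliques :: "nat \<Rightarrow> graph \<Rightarrow> nat" where
  "num_cliques k G =
     card {A. A \<subseteq> verts G \<and> card A = k \<and> (\<forall>u\<in>A. \<forall>v\<in>A. u \<noteq> v \<longrightarrow> {u, v} \<in> edges G)}"


section \<open>Binary encodings of inputs\<close>

text \<open>
  An input graph has vertex set \<open>{..<n}\<close> and is given by \<open>n\<close> in unary followed by its adjacency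
  matrix. All encodings are self-delimiting.
\<close>

definition input_graphs :: "graph set" where
  "input_graphs = {G \<in> graphs. verts G = {..<card (verts G)}}"

definition enc_nat :: "nat \<Rightarrow> bool list" where
  "enc_nat n = replicate n True @ [False]"

definition enc_graph :: "graph \<Rightarrow> bool list" where
  "enc_graph G =
     (let n = card (verts G)
      in enc_nat n @ map (\<lambda>(i, j). {i, j} \<in> edges G) (List.product [0..<n] [0..<n]))"

definition enc_coloring :: "graph \<Rightarrow> (nat \<Rightarrow> nat) \<Rightarrow> bool list" where
  "enc_coloring G c = concat (map (\<lambda>v. enc_nat (c v)) [0..<card (verts G)])"

definition enc_colored :: "graph \<Rightarrow> graph \<Rightarrow> (nat \<Rightarrow> nat) \<Rightarrow> bool list" where
  "enc_colored H G c = enc_graph H @ enc_graph G @ enc_coloring G c"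


section \<open>Parameterized counting problems\<close>

text \<open>A problem is the set of all triples (encoded instance, parameter, value).\<close>

type_synonym problem = "(bool list \<times> nat \<times> rat) set"

definition clique_problem :: problem where
  "clique_problem =
     {(enc_nat k @ enc_graph G, k, of_nat (num_cliques k G)) | k G. G \<in> input_graphs}"

definition indsub_problem :: "(graph \<Rightarrow> rat) \<Rightarrow> problem" where
  "indsub_problem \<Phi> =
     {(enc_nat k @ enc_graph G, k, indsub \<Phi> k G) | k G. G \<in> input_graphs}"

definition cp_indsub_problem :: "(graph \<Rightarrow> rat) \<Rightarrow> problem" where
  "cp_indsub_problem \<Phi> =
     {(enc_colored H G c, card (verts H), cp_indsub \<Phi> H G c) | H G c.
        H \<in> input_graphs \<and> G \<in> input_graphs \<and> graph_hom c G H}"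


section \<open>Algorithms\<close>

text \<open>
  Algorithms are structured programs for a random access machine with addition and truncated
  subtraction (and no multiplication) at unit cost, which is polynomially equivalent to Turing
  machines. The memory is a map from addresses to natural numbers; addresses in instructions are
  direct, \<open>Load\<close> and \<open>Store\<close> provide indirect addressing. The input is a read-only bit string:
  \<open>Read r a\<close> puts into cell \<open>r\<close> the input bit whose position is in cell \<open>a\<close>, with 1 and 2 standing
  for the two bits and 0 for a position behind the end of the input.

  \<open>Query r a l\<close> asks the oracle for the bit string that starts at the address in cell \<open>a\<close> and has
  the length in cell \<open>l\<close>; cells \<open>r\<close>, \<open>r + 1\<close>, \<open>r + 2\<close> receive the answer in the output format below.
  Writing the query and reading the answer are charged by their bit lengths.
\<close>

datatype prog =
    Skip
  | Const nat nat
  | Add nat nat nat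
  | Sub nat nat nat
  | Load nat nat
  | Store nat nat
  | Read nat nat
  | Query nat nat nat
  | Seq prog prog
  | IfNZ nat prog prog
  | WhileNZ nat prog

type_synonym mem = "nat \<Rightarrow> nat"

text \<open>Cells \<open>a\<close>, \<open>b\<close>, \<open>d\<close> with \<open>d > 0\<close> represent the rational \<open>(a - b) / d\<close>.\<close>

definition holds_rat :: "mem \<Rightarrow> nat \<Rightarrow> rat \<Rightarrow> bool" where
  "holds_rat s r v \<longleftrightarrow>
     s (r + 2) > 0 \<and> v = (of_nat (s r) - of_nat (s (r + 1))) / of_nat (s (r + 2))"

definition put_rat :: "mem \<Rightarrow> nat \<Rightarrow> rat \<Rightarrow> mem" where
  "put_rat s r v =
     (let (p, q) = quotient_of v in s(r := nat p, r + 1 := nat (- p), r + 2 := nat q))"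

definition rat_length :: "rat \<Rightarrow> nat" where
  "rat_length v = (let (p, q) = quotient_of v in floorlog 2 (nat \<bar>p\<bar>) + floorlog 2 (nat q))"

definition input_symbol :: "bool list \<Rightarrow> nat \<Rightarrow> nat" where
  "input_symbol x i = (if i < length x then if x ! i then 2 else 1 else 0)"

text \<open>
  \<open>exec P x p s t R K s'\<close>: with an oracle for the problem \<open>P\<close> and input \<open>x\<close>, program \<open>p\<close> started in
  memory \<open>s\<close> halts in memory \<open>s'\<close> after time \<open>t\<close>; it reads the input positions in \<open>R\<close>, and \<open>K\<close> is the
  set of parameters of the instances that it queries. A query that does not encode an instance of
  \<open>P\<close> makes the computation fail, so for \<open>P = {}\<close> these are the ordinary, oracle-free computations.
\<close>

inductive exec ::
  "problem \<Rightarrow> bool list \<Rightarrow> prog \<Rightarrow> mem \<Rightarrow> nat \<Rightarrow> nat set \<Rightarrow> nat set \<Rightarrow> mem \<Rightarrow> bool"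
  for P :: problem and x :: "bool list"
where
  "exec P x Skip s 1 {} {} s"
| "exec P x (Const r n) s 1 {} {} (s(r := n))"
| "exec P x (Add r a b) s 1 {} {} (s(r := s a + s b))"
| "exec P x (Sub r a b) s 1 {} {} (s(r := s a - s b))"
| "exec P x (Load r a) s 1 {} {} (s(r := s (s a)))"
| "exec P x (Store a r) s 1 {} {} (s(s a := s r))"
| "exec P x (Read r a) s 1 {s a} {} (s(r := input_symbol x (s a)))"
| "\<lbrakk>y = map (\<lambda>i. s (s a + i) \<noteq> 0) [0..<s l]; (y, k, v) \<in> P\<rbrakk> \<Longrightarrow>
     exec P x (Query r a l) s (1 + length y + rat_length v) {} {k} (put_rat s r v)"
| "\<lbrakk>exec P x p s t R K s'; exec P x q s' t' R' K' s''\<rbrakk> \<Longrightarrow>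
     exec P x (Seq p q) s (t + t') (R \<union> R') (K \<union> K') s''"
| "\<lbrakk>s r \<noteq> 0; exec P x p s t R K s'\<rbrakk> \<Longrightarrow> exec P x (IfNZ r p q) s (1 + t) R K s'"
| "\<lbrakk>s r = 0; exec P x q s t R K s'\<rbrakk> \<Longrightarrow> exec P x (IfNZ r p q) s (1 + t) R K s'"
| "s r = 0 \<Longrightarrow> exec P x (WhileNZ r p) s 1 {} {} s"
| "\<lbrakk>s r \<noteq> 0; exec P x p s t R K s'; exec P x (WhileNZ r p) s' t' R' K' s''\<rbrakk> \<Longrightarrow>
     exec P x (WhileNZ r p) s (1 + t + t') (R \<union> R') (K \<union> K') s''"

definition oracle_run ::
  "problem \<Rightarrow> prog \<Rightarrow> bool list \<Rightarrow> rat \<Rightarrow> nat \<Rightarrow> nat set \<Rightarrow> nat set \<Rightarrow> bool" where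
  "oracle_run P p x v t R K \<longleftrightarrow> (\<exists>s. exec P x p (\<lambda>_. 0) t R K s \<and> holds_rat s 0 v)"

definition outputs :: "prog \<Rightarrow> bool list \<Rightarrow> rat \<Rightarrow> nat \<Rightarrow> bool" where
  "outputs p x v t \<longleftrightarrow> (\<exists>R. oracle_run {} p x v t R {})"

definition reads_all_outputs :: "prog \<Rightarrow> bool list \<Rightarrow> rat \<Rightarrow> nat \<Rightarrow> bool" where
  "reads_all_outputs p x v t \<longleftrightarrow> (\<exists>R. oracle_run {} p x v t R {} \<and> {..<length x} \<subseteq> R)"

definition computable_nat_fun :: "(nat \<Rightarrow> nat) \<Rightarrow> bool" where
  "computable_nat_fun f \<longleftrightarrow> (\<exists>p. \<forall>n. \<exists>t. outputs p (enc_nat n) (of_nat (f n)) t)"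

definition computable_graph_fun :: "(graph \<Rightarrow> rat) \<Rightarrow> bool" where
  "computable_graph_fun \<Phi> \<longleftrightarrow> (\<exists>p. \<forall>G\<in>input_graphs. \<exists>t. outputs p (enc_graph G) (\<Phi> G) t)"

definition graph_parameter :: "(graph \<Rightarrow> rat) \<Rightarrow> bool" where
  "graph_parameter \<Phi> \<longleftrightarrow> computable_graph_fun \<Phi> \<and> iso_invariant \<Phi>"


section \<open>Hardness notions\<close>

definition parameterized_Turing_reducible :: "problem \<Rightarrow> problem \<Rightarrow> bool" where
  "parameterized_Turing_reducible P P' \<longleftrightarrow>
     (\<exists>p f g d. computable_nat_fun f \<and> computable_nat_fun g \<and>
        (\<forall>(x, k, v) \<in> P. \<exists>t R K. oracle_run P' p x v t R K \<and>
           t \<le> f k * length x ^ d \<and> (\<forall>k'\<in>K. k' \<le> g k)))"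

definition sharp_W1_hard :: "problem \<Rightarrow> bool" where
  "sharp_W1_hard P \<longleftrightarrow> parameterized_Turing_reducible clique_problem P"

text \<open>A literal \<open>(b, i)\<close> is satisfied if variable \<open>i\<close> has truth value \<open>b\<close>.\<close>

type_synonym cnf = "(bool \<times> nat) list list"

definition three_cnf :: "cnf \<Rightarrow> bool" where
  "three_cnf F \<longleftrightarrow> (\<forall>C\<in>set F. length C \<le> 3)"

definition cnf_vars :: "cnf \<Rightarrow> nat set" where
  "cnf_vars F = (\<Union>C\<in>set F. snd ` set C)"

definition satisfiable :: "cnf \<Rightarrow> bool" where
  "satisfiable F \<longleftrightarrow> (\<exists>\<alpha>::nat \<Rightarrow> bool. \<forall>C\<in>set F. \<exists>(b, i)\<in>set C. \<alpha> i = b)"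

definition enc_list :: "('a \<Rightarrow> bool list) \<Rightarrow> 'a list \<Rightarrow> bool list" where
  "enc_list e xs = concat (map (\<lambda>y. True # e y) xs) @ [False]"

definition enc_cnf :: "cnf \<Rightarrow> bool list" where
  "enc_cnf = enc_list (enc_list (\<lambda>(b, i). b # enc_nat i))"

text \<open>
  The Exponential-Time Hypothesis: for some \<open>\<epsilon> > 0\<close>, satisfiability of 3-CNF formulas with \<open>n\<close>
  variables cannot be decided in time \<open>2\<^bsup>\<epsilon>n\<^esup>\<close> times a polynomial in the input length.
\<close>

definition ETH :: bool where
  "ETH \<longleftrightarrow>
     (\<exists>\<epsilon>::real. \<epsilon> > 0 \<and>
        \<not> (\<exists>p (C::real) (d::nat). \<forall>F. three_cnf F \<longrightarrow>
             (\<exists>t. outputs p (enc_cnf F) (if satisfiable F then 1 else 0) t \<and>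
                  real t \<le> C * 2 powr (\<epsilon> * real (card (cnf_vars F)))
                               * real (length (enc_cnf F)) ^ d)))"

text \<open>
  Time bounds for fixed \<open>k\<close>, as functions of the number of vertices of the input graph. The
  algorithms considered read their whole input.
\<close>

definition indsub_solvable_in :: "(graph \<Rightarrow> rat) \<Rightarrow> nat \<Rightarrow> (nat \<Rightarrow> real) \<Rightarrow> bool" where
  "indsub_solvable_in \<Phi> k T \<longleftrightarrow>
     (\<exists>p. \<forall>G\<in>input_graphs. \<exists>t.
        reads_all_outputs p (enc_graph G) (indsub \<Phi> k G) t \<and> real t \<le> T (card (verts G)))"

definition cp_indsub_solvable_in :: "(graph \<Rightarrow> rat) \<Rightarrow> nat \<Rightarrow> (nat \<Rightarrow> real) \<Rightarrow> bool" where
  "cp_indsub_solvable_in \<Phi> k T \<longleftrightarrow>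
     (\<exists>p. \<forall>H\<in>input_graphs. \<forall>G\<in>input_graphs. \<forall>c.
        card (verts H) = k \<longrightarrow> graph_hom c G H \<longrightarrow>
        (\<exists>t. reads_all_outputs p (enc_colored H G c) (cp_indsub \<Phi> H G c) t \<and>
             real t \<le> T (card (verts G))))"


section \<open>Sanity checks for the encodings and the machine model\<close>

lemma enc_nat_append_inj: "enc_nat m @ u = enc_nat n @ w \<longleftrightarrow> m = n \<and> u = w"
proof (induction m arbitrary: n)
  case 0
  then show ?case by (cases n) (auto simp: enc_nat_def)
next
  case (Suc m)
  then show ?case by (cases n) (auto simp: enc_nat_def)
qed

lemma enc_graph_append_inj:
  assumes "G \<in> input_graphs" "H \<in> input_graphs" "enc_graph G @ u = enc_graph H @ w"
  shows "G = H \<and> u = w"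
proof -
  define n where "n = card (verts G)"
  let ?m = "\<lambda>G. map (\<lambda>(i, j). {i, j} \<in> edges G) (List.product [0..<n] [0..<n])"
  have n: "card (verts H) = n" and eq: "?m G @ u = ?m H @ w"
    using assms(3) by (auto simp: enc_graph_def Let_def enc_nat_append_inj n_def)
  from eq have m: "?m G = ?m H" and uw: "u = w" by auto
  have V: "verts G = {..<n}" "verts H = {..<n}"
    using assms(1,2) n by (auto simp: input_graphs_def n_def)
  have E: "{i, j} \<in> edges G \<longleftrightarrow> {i, j} \<in> edges H" if "i < n" "j < n" for i j
  proof -
    have "(i, j) \<in> set (List.product [0..<n] [0..<n])" using that by auto
    then show ?thesis using m by (auto simp: map_eq_conv)
  qed
  have sub: "edges A \<subseteq> edges B"
    if "A \<in> input_graphs" "verts A = {..<n}"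
      and AB: "\<And>i j. i < n \<Longrightarrow> j < n \<Longrightarrow> {i, j} \<in> edges A \<Longrightarrow> {i, j} \<in> edges B" for A B
  proof
    fix e assume e: "e \<in> edges A"
    then have "e \<subseteq> {..<n}" "card e = 2"
      using that(1,2) by (auto simp: input_graphs_def graphs_def)
    then obtain i j where "e = {i, j}" "i < n" "j < n" by (auto simp: card_2_iff)
    then show "e \<in> edges B" using AB e by simp
  qed
  have "edges G = edges H"
    using sub[of G H] sub[of H G] assms(1,2) V E by blast
  then show ?thesis using V uw by (auto intro: graph.equality)
qed

lemma enc_coloring_inj:
  assumes "enc_coloring G c = enc_coloring G c'" "v < card (verts G)"
  shows "c v = c' v"
proof -
  have "map c vs = map c' vs"
    if "concat (map (\<lambda>v. enc_nat (c v)) vs) = concat (map (\<lambda>v. enc_nat (c' v)) vs)" for vs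
    using that by (induction vs) (auto simp: enc_nat_append_inj)
  from this[of "[0..<card (verts G)]"] assms show ?thesis
    by (auto simp: enc_coloring_def map_eq_conv)
qed

definition functional :: "problem \<Rightarrow> bool" where
  "functional P \<longleftrightarrow> (\<forall>x k v k' v'. (x, k, v) \<in> P \<longrightarrow> (x, k', v') \<in> P \<longrightarrow> k = k' \<and> v = v')"

lemma enc_graph_inj:
  assumes "G \<in> input_graphs" "H \<in> input_graphs" "enc_graph G = enc_graph H"
  shows "G = H"
  using enc_graph_append_inj[of G H "[]" "[]"] assms by simp

lemma functional_graph_problem:
  "functional {(enc_nat k @ enc_graph G, k, F k G) | k G. G \<in> input_graphs}"
  unfolding functional_def
proof (intro allI impI)
  fix x k v k' v'
  assume "(x, k, v) \<in> {(enc_nat k @ enc_graph G, k, F k G) | k G. G \<in> input_graphs}"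
  then obtain G where G: "G \<in> input_graphs" "x = enc_nat k @ enc_graph G" "v = F k G"
    by blast
  assume "(x, k', v') \<in> {(enc_nat k @ enc_graph G, k, F k G) | k G. G \<in> input_graphs}"
  then obtain G' where G': "G' \<in> input_graphs" "x = enc_nat k' @ enc_graph G'" "v' = F k' G'"
    by blast
  have "k = k'" "enc_graph G = enc_graph G'"
    using G(2) G'(2) enc_nat_append_inj by metis+
  moreover from this have "G = G'" using enc_graph_inj G(1) G'(1) by blast
  ultimately show "k = k' \<and> v = v'" using G(3) G'(3) by blast
qed

lemma functional_clique_problem: "functional clique_problem"
  unfolding clique_problem_def by (rule functional_graph_problem)

lemma functional_indsub_problem: "functional (indsub_problem \<Phi>)"
  unfolding indsub_problem_def by (rule functional_graph_problem)

lemma cp_indsub_cong: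
  assumes "\<And>v. v \<in> verts G \<Longrightarrow> c v = c' v"
  shows "cp_indsub \<Phi> H G c = cp_indsub \<Phi> H G c'"
proof -
  have "c ` A = c' ` A" if "A \<subseteq> verts G" for A
    using that assms by (intro image_cong) auto
  then have "colorful H G c = colorful H G c'"
    unfolding colorful_def fun_eq_iff by metis
  then show ?thesis by (simp add: cp_indsub_def)
qed

lemma functional_cp_indsub_problem: "functional (cp_indsub_problem \<Phi>)"
proof -
  have *: "H = H' \<and> cp_indsub \<Phi> H G c = cp_indsub \<Phi> H' G' c'"
    if "H \<in> input_graphs" "H' \<in> input_graphs" and G: "G \<in> input_graphs" "G' \<in> input_graphs"
      and e: "enc_colored H G c = enc_colored H' G' c'" for H G c H' G' c'
  proof -
    have H: "H = H'" and e': "enc_graph G @ enc_coloring G c = enc_graph G' @ enc_coloring G' c'"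
      using enc_graph_append_inj[OF that(1,2)] e by (auto simp: enc_colored_def)
    have G': "G = G'" and "enc_coloring G c = enc_coloring G' c'"
      using enc_graph_append_inj[OF G e'] by auto
    then have "c v = c' v" if "v \<in> verts G" for v
      using enc_coloring_inj[of G c c' v] that G(1) by (auto simp: input_graphs_def)
    then show ?thesis using H G' cp_indsub_cong[of G c c'] by simp
  qed
  show ?thesis
    unfolding functional_def
  proof (intro allI impI)
    fix x k v k' v'
    assume "(x, k, v) \<in> cp_indsub_problem \<Phi>"
    then obtain H G c where 1: "H \<in> input_graphs" "G \<in> input_graphs"
      "x = enc_colored H G c" "k = card (verts H)" "v = cp_indsub \<Phi> H G c"
      unfolding cp_indsub_problem_def by blast
    assume "(x, k', v') \<in> cp_indsub_problem \<Phi>"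
    then obtain H' G' c' where 2: "H' \<in> input_graphs" "G' \<in> input_graphs"
      "x = enc_colored H' G' c'" "k' = card (verts H')" "v' = cp_indsub \<Phi> H' G' c'"
      unfolding cp_indsub_problem_def by blast
    have "enc_colored H G c = enc_colored H' G' c'" using 1(3) 2(3) by (rule trans[OF sym])
    from *[OF 1(1) 2(1) 1(2) 2(2) this] show "k = k' \<and> v = v'"
      unfolding 1(4,5) 2(4,5) by (elim conjE) (intro conjI, simp_all)
  qed
qed

inductive_cases exec_elims:
  "exec P x Skip s t R K s'"
  "exec P x (Const r n) s t R K s'"
  "exec P x (Add r a b) s t R K s'"
  "exec P x (Sub r a b) s t R K s'"
  "exec P x (Load r a) s t R K s'"
  "exec P x (Store a r) s t R K s'"
  "exec P x (Read r a) s t R K s'"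
  "exec P x (Query r a l) s t R K s'"
  "exec P x (Seq p q) s t R K s'"
  "exec P x (IfNZ r p q) s t R K s'"
  "exec P x (WhileNZ r p) s t R K s'"

lemma exec_deterministic:
  assumes "functional P"
  shows "exec P x p s t R K s' \<Longrightarrow> exec P x p s t' R' K' s'' \<Longrightarrow>
    t' = t \<and> R' = R \<and> K' = K \<and> s'' = s'"
proof (induction arbitrary: t' R' K' s'' rule: exec.induct)
  case (8 y s a l k v r)
  from 8(3) show ?case
  proof (rule exec_elims(8), goal_cases)
    case (1 k' v')
    have "(y, k', v') \<in> P" using 1(5) 8(1) by simp
    with 8(2) have "k' = k \<and> v' = v"
      using assms unfolding functional_def by blast
    with 1 8(1) show ?case by simp
  qed
next
  case (9 p s t R K s' q t2 R2 K2 s2)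
  from 9(5) show ?case by (rule exec_elims(9)) (auto dest!: 9(3,4))
next
  case (10 s r p t R K s' q)
  from 10(4) show ?case by (rule exec_elims(10)) (use 10(1) in \<open>auto dest!: 10(3)\<close>)
next
  case (11 s r q t R K s' p)
  from 11(4) show ?case by (rule exec_elims(10)) (use 11(1) in \<open>auto dest!: 11(3)\<close>)
next
  case (12 s r p)
  from 12(2) show ?case by (rule exec_elims(11)) (use 12(1) in auto)
next
  case (13 s r p t R K s' t2 R2 K2 s2)
  from 13(6) show ?case by (rule exec_elims(11)) (use 13(1) in \<open>auto dest!: 13(4,5)\<close>)
qed (erule exec_elims, simp)+

lemma exec_card_read: "exec P x p s t R K s' \<Longrightarrow> finite R \<and> card R \<le> t"
proof (induction rule: exec.induct)
  case (9 p s t R K s' q t' R' K' s'')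
  then show ?case using card_Un_le[of R R'] by simp
next
  case (13 s r p t R K s' t' R' K' s'')
  then show ?case using card_Un_le[of R R'] by simp
qed simp_all

end

theory Submission
 imports Defs "HOL-Analysis.Analysis" "HOL-Combinatorics.Permutations" "HOL-Computational_Algebra.Primes"
  "HOL-Number_Theory.Cong" "HOL-Real_Asymp.Real_Asymp"
begin

text \<open>
 Let \<open>q\<close> be a power of a prime \<open>p\<close> exceeding the differences between the (integral) values of \<open>\<Phi>\<close>, with
 \<open>p q \<le> k\<close>. On \<open>k\<close> vertices let \<open>D\<close> be the edges between two blocks of \<open>q\<close> vertices. If the alternating
 sum of \<open>\<Phi> (H \<union> S)\<close> over \<open>S \<subseteq> D\<close> vanished for every \<open>H\<close> disjoint from \<open>D\<close>, then letting the cyclic group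
 of order \<open>q\<close> rotate each block, the fixed points \<open>S = {}\<close> and \<open>S = D\<close> show \<open>\<Phi> H = \<Phi> (H \<union> D)\<close> modulo \<open>p\<close>, hence exactly, for
 every rotation invariant \<open>H\<close>; monotonicity spreads this to all graphs on \<open>k\<close> vertices. So if \<open>\<Phi>\<close> is nontrivial
 on \<open>k\<close>, some \<open>H\<close> has a nonzero sum, and inclusion-exclusion over \<open>D\<close> isolates, up to this factor, the number of choices of one
 label per vertex of the two blocks that are compatible along all of \<open>D\<close>.

 Clique counting is such a compatibility problem directly. A 3-CNF formula becomes one after sparsification: labels of the first block
 assign values to a group of variables, labels of the second block pick a true literal in each clause of a group.
\<close>

text \<open>Hardness is a statement about explicit programs, so a verified calculus of programs on
  trees comes with the proof. The base graph \<open>H\<close> is only known to exist: for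
  #W[1]-hardness all candidates are tried, each calibrated on an instance with exactly one
  compatible choice, which reveals its factor; under ETH it is a constant of the program. A
  parameter on which \<Phi> is nontrivial must also be found. By monotonicity this means comparing
  the complete with the edgeless graph, by oracle answers inside the reduction and by a simulated
  program for \<Phi> where bounds must be computable. Under ETH, sparsification leaves O(n) clauses
  and blocks have size \<open>q > k / p ^ 2\<close>. A label then needs O(n / q) bits, query graphs
  have 2^O(n / q) vertices, and time N^(\<delta> k) on them is 2^O(\<delta> n k / q) with
  \<open>k / q\<close> bounded. Small \<open>k\<close> escape this argument; for them reading the
  input is already too slow. The prime is odd so that \<open>q * q\<close> is odd, which gives
  \<open>S = {}\<close> and \<open>S = D\<close> opposite signs.\<close>

section \<open>Trees stored in the memory of the machine\<close>

datatype val = VNat nat | VPair val val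

text \<open>\<open>sz\<close> is the measure for running times. It need not be the number of tree
  nodes: a natural number is a single leaf but is charged in unary.\<close>

class repr =
 fixes val_of :: "'a => val" and sz :: "'a => nat"
 assumes sz_pos: "0 < sz x"

text \<open>A number is the word itself, a pair is the address of two consecutive heap cells. There
  are no tags: \<open>VNat 0\<close>, and so the empty list, differs from a pair only because heap
  addresses are at least 16.\<close>

fun rep :: "mem => nat => val => bool" where
 "rep s w (VNat n) \<longleftrightarrow> w = n"
| "rep s w (VPair a b) \<longleftrightarrow> 16 <= w & w + 1 < s 5 & rep s (s w) a & rep s (s (w + 1)) b"

text \<open>Cell 5 points to the first free cell. Free cells are zero so that a simulated program,
  which expects zeroed memory, can be started there.\<close>

definition heap_ok :: "mem => bool" where
 "heap_ok s \<longleftrightarrow> 16 <= s 5 & (\<forall>a \<ge> s 5. s a = 0)"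

text \<open>Allocated cells are never overwritten, so a representation survives all later
  computation (\<open>rep_mono\<close>).\<close>

definition heap_le :: "mem => mem => bool" where
 "heap_le s s' \<longleftrightarrow> s 5 <= s' 5 & (ALL a. 16 <= a & a < s 5 --> s' a = s a)"

lemma heap_le_refl [simp]: "heap_le s s"
 by (simp add: heap_le_def)

lemma heap_le_trans: "heap_le s s' ==> heap_le s' s'' ==> heap_le s s''"
 by (auto simp: heap_le_def)

lemma rep_mono: "heap_le s s' ==> rep s w v ==> rep s' w v"
 by (induction v arbitrary: w) (auto simp: heap_le_def)

fun eff :: "prog => mem => mem" where
 "eff (Const r n) s = s(r := n)"
| "eff (Add r a b) s = s(r := s a + s b)"
| "eff (Sub r a b) s = s(r := s a - s b)"
| "eff (Load r a) s = s(r := s (s a))"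
| "eff (Store a r) s = s(s a := s r)"
| "eff _ s = s"

fun basic :: "prog => bool" where
 "basic (Const r n) = True"
| "basic (Add r a b) = True"
| "basic (Sub r a b) = True"
| "basic (Load r a) = True"
| "basic (Store a r) = True"
| "basic _ = False"

definition seqs :: "prog list => prog" where
 "seqs is = foldr Seq is Skip"

lemma exec_basic: "basic i ==> exec P x i s 1 {} {} (eff i s)"
 by (cases i) (simp_all only: basic.simps eff.simps exec.intros)

lemma exec_Seq:
 "exec P x p s t R K s' ==> exec P x q s' t' R' K' s'' ==>
 exec P x (Seq p q) s (t + t') (R Un R') (K Un K') s''"
 by (rule exec.intros)

lemma exec_seqs:
 "list_all basic is ==> exec P x (seqs is) s (length is + 1) {} {} (fold eff is s)"
proof (induction "is" arbitrary: s)
 case Nil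
 have "exec P x Skip s 1 {} {} s" by (rule exec.intros)
 thus ?case by (simp add: seqs_def)
next
 case (Cons i js)
 hence b: "basic i" and IH: "exec P x (seqs js) (eff i s) (length js + 1) {} {} (fold eff js (eff i s))"
  by simp_all
 have "seqs (i # js) = Seq i (seqs js)" "length (i # js) + 1 = 1 + (length js + 1)"
  "fold eff (i # js) s = fold eff js (eff i s)"
  by (simp_all add: seqs_def)
 thus ?case using exec_Seq[OF exec_basic[OF b] IH] by (simp only: Un_empty_left)
qed

text \<open>Runs of a program are used with the read set and the query set abstracted away; a bound on
 the latter is recovered by restricting the oracle.\<close>

definition runs :: "problem => bool list => prog => mem => nat => mem => bool" where
 "runs P x p s T s' \<longleftrightarrow> (EX t R K. exec P x p s t R K s' & t <= T)"

lemma runs_seqsI: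
 assumes "list_all basic is" "fold eff is s = s'" "length is + 1 <= T"
 shows "runs P x (seqs is) s T s'"
 using exec_seqs[OF assms(1)] assms(2,3) unfolding runs_def by blast

lemma runs_Seq: "runs P x p s T s' ==> runs P x q s' T' s'' ==> runs P x (Seq p q) s (T + T') s''"
 unfolding runs_def by (meson add_mono exec_Seq)

lemma runs_mono: "runs P x p s T s' ==> T <= T' ==> runs P x p s T' s'"
 unfolding runs_def using le_trans by blast

lemma runs_IfNZ:
 assumes "s r ~= 0 ==> runs P x p s T s'" "s r = 0 ==> runs P x q s T s'"
 shows "runs P x (IfNZ r p q) s (1 + T) s'"
proof (cases "s r = 0")
 case True
 with assms(2) obtain t R K where "exec P x q s t R K s'" "t <= T"
  unfolding runs_def by blast
 thus ?thesis unfolding runs_def using exec.intros(11)[of s r, OF True]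
  by (meson add_left_mono)
next
 case False
 with assms(1) obtain t R K where "exec P x p s t R K s'" "t <= T"
  unfolding runs_def by blast
 thus ?thesis unfolding runs_def using exec.intros(10)[of s r, OF False]
  by (meson add_left_mono)
qed

lemma runs_While_0: "s r = 0 ==> runs P x (WhileNZ r p) s 1 s"
 unfolding runs_def using exec.intros(12) by blast

lemma runs_While_step:
 assumes "s r ~= 0" "runs P x p s T s'" "runs P x (WhileNZ r p) s' T' s''"
 shows "runs P x (WhileNZ r p) s (1 + T + T') s''"
proof -
 obtain t R K t' R' K' where "exec P x p s t R K s'" "t <= T"
  "exec P x (WhileNZ r p) s' t' R' K' s''" "t' <= T'"
  using assms unfolding runs_def by blast
 moreover from this have "exec P x (WhileNZ r p) s (1 + t + t') (R Un R') (K Un K') s''"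
  using exec.intros(13) assms(1) by blast
 ultimately show ?thesis unfolding runs_def by (meson add_mono add_left_mono)
qed

section \<open>Programs that compute functions on trees\<close>

text \<open>The calling convention: cell 3 holds the argument and then the result, cell 4 the stack
  pointer, which is restored, and cell 5 the heap pointer. The remaining cells below 16 are scratch
  space.\<close>

definition impl ::
 "problem => bool list => prog => 'a::repr set => ('a => 'b::repr) => ('a => nat) => bool" where
 "impl P x p D f T \<longleftrightarrow> (ALL s v. heap_ok s --> v : D --> rep s (s 3) (val_of v) -->
  (EX s'. runs P x p s (T v) s' & heap_ok s' & heap_le s s' & s' 4 = s 4 &
     rep s' (s' 3) (val_of (f v))))"

lemma implI:
 assumes "!!s v. heap_ok s ==> v : D ==> rep s (s 3) (val_of v) ==>
  EX s'. runs P x p s (T v) s' & heap_ok s' & heap_le s s' & s' 4 = s 4 &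
     rep s' (s' 3) (val_of (f v))"
 shows "impl P x p D f T"
 using assms unfolding impl_def by blast

lemma implE:
 assumes "impl P x p D f T" "heap_ok s" "v : D" "rep s (s 3) (val_of v)"
 obtains s' where "runs P x p s (T v) s'" "heap_ok s'" "heap_le s s'" "s' 4 = s 4"
  "rep s' (s' 3) (val_of (f v))"
 using assms unfolding impl_def by blast

lemma impl_mono:
 assumes "impl P x p D f T" "D' <= D" "!!v. v : D' ==> f v = f' v" "!!v. v : D' ==> T v <= T' v"
 shows "impl P x p D' f' T'"
proof (rule implI)
 fix s v assume 0: "heap_ok s" "v : D'" "rep s (s 3) (val_of v)"
 obtain s' where "runs P x p s (T v) s'" "heap_ok s'" "heap_le s s'" "s' 4 = s 4"
  "rep s' (s' 3) (val_of (f v))"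
  using implE[OF assms(1) 0(1) _ 0(3)] 0(2) assms(2) by blast
 thus "EX s'. runs P x p s (T' v) s' & heap_ok s' & heap_le s s' & s' 4 = s 4 &
     rep s' (s' 3) (val_of (f' v))"
  using runs_mono[OF _ assms(4)[OF 0(2)]] assms(3)[OF 0(2)] by (intro exI[of _ s']) simp
qed

lemma impl_comp:
 assumes "impl P x p D f T" "impl P x p' D' g T'" "!!v. v : D ==> f v : D'"
 shows "impl P x (Seq p p') D (%v. g (f v)) (%v. T v + T' (f v))"
proof (rule implI)
 fix s v assume 0: "heap_ok s" "v : D" "rep s (s 3) (val_of v)"
 obtain s1 where 1: "runs P x p s (T v) s1" "heap_ok s1" "heap_le s s1" "s1 4 = s 4"
  "rep s1 (s1 3) (val_of (f v))" using implE[OF assms(1) 0] by blast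
 obtain s2 where 2: "runs P x p' s1 (T' (f v)) s2" "heap_ok s2" "heap_le s1 s2" "s2 4 = s1 4"
  "rep s2 (s2 3) (val_of (g (f v)))" using implE[OF assms(2) 1(2) _ 1(5)] assms(3) 0(2) by blast
 show "EX s'. runs P x (Seq p p') s (T v + T' (f v)) s' & heap_ok s' & heap_le s s' & s' 4 = s 4 &
     rep s' (s' 3) (val_of (g (f v)))"
  using runs_Seq[OF 1(1) 2(1)] 1 2 heap_le_trans by auto
qed

lemma impl_basic:
 assumes "list_all basic is" "length is + 1 <= T"
  "!!s v. heap_ok s ==> v : D ==> rep s (s 3) (val_of v) ==>
   heap_ok (fold eff is s) & heap_le s (fold eff is s) & fold eff is s 4 = s 4 &
   rep (fold eff is s) (fold eff is s 3) (val_of (f v))"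
 shows "impl P x (seqs is) D f (%_. T)"
 by (rule implI) (use runs_seqsI[OF assms(1) refl assms(2)] assms(3) in blast)

definition mov :: "nat => nat => prog list" where
 "mov r a = [Const 6 0, Add r a 6]"

text \<open>The stack is itself a linked list in the heap: a frame consists of a saved word and the
  previous stack pointer. Popping only moves the pointer, since memory is never reclaimed.\<close>

definition push :: "prog list" where
 "push = [Store 5 3, Const 6 1, Add 5 5 6, Store 5 4, Sub 4 5 6, Add 5 5 6]"

definition pop :: "prog list" where
 "pop = [Const 6 1, Add 6 4 6, Load 4 6]"

definition alloc :: "prog list" where
 "alloc = [Store 5 7, Const 6 1, Add 5 5 6, Store 5 3, Sub 3 5 6, Add 5 5 6]"

lemma push_correct:
 assumes "heap_ok s"
 defines "s' \<equiv> fold eff push s"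
 shows "heap_ok s'" "heap_le s s'" "s' 3 = s 3" "s' 4 = s 5" "s' 5 = s 5 + 2"
  "s' (s 5) = s 3" "s' (s 5 + 1) = s 4" "s' 7 = s 7" "s' 8 = s 8"
proof -
 obtain h where h: "s 5 = h + 16" using assms(1) by (metis heap_ok_def add.commute le_Suc_ex)
 have z: "!!a. a >= h + 16 ==> s a = 0" using assms(1) h by (auto simp: heap_ok_def)
 have "s' = s(h + 16 := s 3, h + 17 := s 4, 4 := h + 16, 5 := h + 18, 6 := 1)"
  unfolding s'_def push_def by (auto simp: fun_eq_iff h)
 thus "heap_ok s'" "heap_le s s'" "s' 3 = s 3" "s' 4 = s 5" "s' 5 = s 5 + 2"
  "s' (s 5) = s 3" "s' (s 5 + 1) = s 4" "s' 7 = s 7" "s' 8 = s 8"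
  using z by (auto simp: heap_ok_def heap_le_def h)
qed

lemma alloc_correct:
 assumes "heap_ok s"
 defines "s' \<equiv> fold eff alloc s"
 shows "heap_ok s'" "heap_le s s'" "s' 3 = s 5" "s' 4 = s 4" "s' 5 = s 5 + 2"
  "s' (s 5) = s 7" "s' (s 5 + 1) = s 3"
proof -
 obtain h where h: "s 5 = h + 16" using assms(1) by (metis heap_ok_def add.commute le_Suc_ex)
 have z: "!!a. a >= h + 16 ==> s a = 0" using assms(1) h by (auto simp: heap_ok_def)
 have "s' = s(h + 16 := s 7, h + 17 := s 3, 3 := h + 16, 5 := h + 18, 6 := 1)"
  unfolding s'_def alloc_def by (auto simp: fun_eq_iff h)
 thus "heap_ok s'" "heap_le s s'" "s' 3 = s 5" "s' 4 = s 4" "s' 5 = s 5 + 2"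
  "s' (s 5) = s 7" "s' (s 5 + 1) = s 3"
  using z by (auto simp: heap_ok_def heap_le_def h)
qed

lemma alloc_rep:
 assumes "heap_ok s" "rep s (s 7) a" "rep s (s 3) b"
 shows "rep (fold eff alloc s) (fold eff alloc s 3) (VPair a b)"
proof -
 note A = alloc_correct[OF assms(1)]
 have "16 <= s 5" using assms(1) by (simp add: heap_ok_def)
 thus ?thesis
  using A rep_mono[OF A(2) assms(2)] rep_mono[OF A(2) assms(3)] by simp
qed

lemma heap_upd:
 assumes "r < 16" "r ~= 5"
 shows "heap_ok (s(r := n)) \<longleftrightarrow> heap_ok s" "heap_le s' (s(r := n)) \<longleftrightarrow> heap_le s' s"
  "heap_le (s(r := n)) s' \<longleftrightarrow> heap_le s s'"
proof -
 have *: "(s(r := n)) 5 = s 5" for s :: mem using assms by simp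
 have **: "(s(r := n)) a = s a" if "16 <= a" for a and s :: mem using assms that by simp
 show "heap_ok (s(r := n)) \<longleftrightarrow> heap_ok s"
  unfolding heap_ok_def * using ** by (metis le_trans)
 show "heap_le s' (s(r := n)) \<longleftrightarrow> heap_le s' s" "heap_le (s(r := n)) s' \<longleftrightarrow> heap_le s s'"
  unfolding heap_le_def * using ** by auto
qed

lemma rep_upd:
 assumes "r < 16" "r ~= 5"
 shows "rep (s(r := n)) w v \<longleftrightarrow> rep s w v"
 using assms by (induction v arbitrary: w) auto

instantiation nat :: repr begin
definition "val_of n = VNat n"
definition "sz n = Suc n"
instance by standard (simp add: sz_nat_def)
end

instantiation bool :: repr begin
definition "val_of b = VNat (of_bool b)"
definition "sz (b::bool) = (1::nat)"
instance by standard (simp add: sz_bool_def)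
end

instantiation prod :: (repr, repr) repr begin
definition "val_of z = VPair (val_of (fst z)) (val_of (snd z))"
definition "sz z = sz (fst z) + sz (snd z)"
instance by standard (simp add: sz_prod_def sz_pos)
end

instantiation list :: (repr) repr begin
fun val_of_list :: "'a list => val" where
 "val_of_list [] = VNat 0"
| "val_of_list (x # xs) = VPair (val_of x) (val_of_list xs)"
definition "sz xs = Suc (\<Sum>x\<leftarrow>xs. sz x)"
instance by standard (simp add: sz_list_def)
end

text \<open>Natural numbers that are charged as machine words and not in unary.\<close>

datatype big = Big (nob: nat)

instantiation big :: repr begin
definition "val_of b = VNat (nob b)"
definition "sz (b::big) = (1::nat)"
instance by standard (simp add: sz_big_def)
end

lemma sz_Pair [simp]: "sz (a, b) = sz a + sz b" by (simp add: sz_prod_def)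
lemma sz_Nil [simp]: "sz [] = 1" by (simp add: sz_list_def)
lemma sz_Cons [simp]: "sz (x # xs) = sz x + sz xs" by (simp add: sz_list_def)
lemma sz_nat [simp]: "sz (n::nat) = Suc n" by (simp add: sz_nat_def)
lemma sz_bool [simp]: "sz (b::bool) = 1" by (simp add: sz_bool_def)
lemma sz_big [simp]: "sz (b::big) = 1" by (simp add: sz_big_def)
lemma sz_ge_1: "1 <= sz x" using sz_pos[of x] by simp

definition "p_pair p q =
 Seq (seqs push) (Seq p (Seq (seqs (mov 7 3 @ [Load 8 4] @ push @ mov 3 8))
  (Seq q (seqs ([Load 7 4] @ pop @ pop @ alloc)))))"

lemma mov_correct: "fold eff (mov r a) s = s(6 := 0, r := (s(6 := 0)) a + 0)"
 by (simp add: mov_def)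

lemma impl_pair:
 assumes "impl P x p D f T" "impl P x q D g T'"
 shows "impl P x (p_pair p q) D (%v. (f v, g v)) (%v. T v + T' v + 40)"
proof (rule implI)
 fix s v assume 0: "heap_ok s" "v : D" "rep s (s 3) (val_of v)"
 define s1 where "s1 = fold eff push s"
 note P1 = push_correct[OF 0(1), folded s1_def]
 have r1: "rep s1 (s1 3) (val_of v)" using rep_mono[OF P1(2) 0(3)] P1(3) by simp
 obtain s2 where 2: "runs P x p s1 (T v) s2" "heap_ok s2" "heap_le s1 s2" "s2 4 = s1 4"
  "rep s2 (s2 3) (val_of (f v))" using implE[OF assms(1) P1(1) 0(2) r1] by blast
 have h: "16 <= s 5" using 0(1) by (simp add: heap_ok_def)
 \<comment> \<open>The frame is intact after \<open>p\<close>, because \<open>heap_le\<close>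
   protects all heap cells below the heap pointer.\<close>
 have top: "s2 (s2 4) = s 3" "s2 (s2 4 + 1) = s 4"
  using 2(3,4) P1 h unfolding heap_le_def by simp_all
 define s2a where "s2a = s2(6 := 0, 7 := s2 3, 8 := s 3)"
 have ok2a: "heap_ok s2a" using 2(2) by (simp add: s2a_def heap_upd)
 define s3a where "s3a = fold eff push s2a"
 note P3 = push_correct[OF ok2a, folded s3a_def]
 define s3 where "s3 = s3a(6 := 0, 3 := s 3)"
 have e3: "fold eff (mov 7 3 @ [Load 8 4] @ push @ mov 3 8) s2 = s3"
 proof -
  have "s2 4 ~= 6" "s2 4 ~= 7" using 2(4) P1(4) h by auto
  hence "fold eff (mov 7 3 @ [Load 8 4]) s2 = s2a"
   by (auto simp: mov_correct s2a_def fun_eq_iff top(1))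
  hence "fold eff (mov 7 3 @ [Load 8 4] @ push @ mov 3 8) s2 = fold eff (mov 3 8) s3a"
   by (simp add: s3a_def)
  thus ?thesis using P3(9) by (simp add: mov_correct s3_def s2a_def)
 qed
 have le23: "heap_le s2 s3"
  using P3(2) by (simp add: s3_def s2a_def heap_upd)
 have ok3: "heap_ok s3" using P3(1) by (simp add: s3_def heap_upd)
 have le13: "heap_le s1 s3" using heap_le_trans[OF 2(3) le23] .
 have r3: "rep s3 (s3 3) (val_of v)"
  using rep_mono[OF heap_le_trans[OF P1(2) le13] 0(3)] by (simp add: s3_def)
 obtain s4 where 4: "runs P x q s3 (T' v) s4" "heap_ok s4" "heap_le s3 s4" "s4 4 = s3 4"
  "rep s4 (s4 3) (val_of (g v))" using implE[OF assms(2) ok3 0(2) r3] by blast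
 have h2: "16 <= s2 5" using 2(2) by (simp add: heap_ok_def)
 have s34: "s3 4 = s2 5" "s3 (s2 5) = s2 3" "s3 (s2 5 + 1) = s2 4" "s3 5 = s2 5 + 2"
  using P3(4-7) h2 by (simp_all add: s3_def s2a_def)
 have top4: "s4 (s2 5) = s2 3" "s4 (s2 5 + 1) = s1 4" "s4 4 = s2 5"
  using 4(3,4) s34 h2 2(4) unfolding heap_le_def by simp_all
 have h1: "s1 4 >= 16" "s1 4 + 1 < s1 5" using P1 h by simp_all
 have top5: "s4 (s1 4 + 1) = s 4"
  using heap_le_trans[OF le13 4(3)] h1 P1(4,7) unfolding heap_le_def by simp
 define s5 where "s5 = s4(7 := s2 3, 6 := s1 4 + 1, 4 := s 4)"
 have e5: "fold eff ([Load 7 4] @ pop @ pop) s4 = s5"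
 proof -
  have "s2 5 ~= 7" "s2 5 + 1 ~= 7" "s2 5 + 1 ~= 6" "s1 4 + 1 ~= 4" "s1 4 + 1 ~= 6" "s1 4 + 1 ~= 7"
   using h2 h1 by auto
  thus ?thesis
   using top4 top5 by (auto simp: pop_def s5_def fun_eq_iff)
 qed
 have ok5: "heap_ok s5" "heap_le s4 s5" using 4(2) by (simp_all add: s5_def heap_upd)
 have r5: "rep s5 (s5 7) (val_of (f v))" "rep s5 (s5 3) (val_of (g v))"
  using rep_mono[OF heap_le_trans[OF le23 4(3)] 2(5)] 4(5) by (simp_all add: s5_def rep_upd)
 define s6 where "s6 = fold eff alloc s5"
 note A6 = alloc_correct[OF ok5(1), folded s6_def]
 have e6: "fold eff ([Load 7 4] @ pop @ pop @ alloc) s4 = s6"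
  using e5 by (simp add: s6_def)
 have L1: "runs P x (seqs push) s 7 s1"
  by (rule runs_seqsI) (simp_all add: s1_def push_def)
 have L3: "runs P x (seqs (mov 7 3 @ [Load 8 4] @ push @ mov 3 8)) s2 12 s3"
  by (rule runs_seqsI[OF _ e3]) (simp_all add: push_def mov_def)
 have L6: "runs P x (seqs ([Load 7 4] @ pop @ pop @ alloc)) s4 14 s6"
  by (rule runs_seqsI[OF _ e6]) (simp_all add: pop_def alloc_def)
 have "runs P x (p_pair p q) s (7 + (T v + (12 + (T' v + 14)))) s6"
  unfolding p_pair_def by (rule runs_Seq[OF L1 runs_Seq[OF 2(1) runs_Seq[OF L3 runs_Seq[OF 4(1) L6]]]])
 hence "runs P x (p_pair p q) s (T v + T' v + 40) s6" by (rule runs_mono) simp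
 moreover have "heap_le s s6"
  using heap_le_trans[OF P1(2) heap_le_trans[OF le13 heap_le_trans[OF 4(3) heap_le_trans[OF ok5(2) A6(2)]]]] .
 moreover have "s6 4 = s 4" using A6(4) by (simp add: s5_def)
 moreover have "rep s6 (s6 3) (val_of (f v, g v))"
  using alloc_rep[OF ok5(1) r5] by (simp add: s6_def val_of_prod_def)
 ultimately show "EX s'. runs P x (p_pair p q) s (T v + T' v + 40) s' & heap_ok s' & heap_le s s' &
   s' 4 = s 4 & rep s' (s' 3) (val_of (f v, g v))"
  using A6(1) by blast
qed

lemma impl_fst: "impl P x (seqs [Load 3 3]) UNIV fst (%_. 2)"
 by (rule impl_basic) (auto simp: heap_upd rep_upd val_of_prod_def)

lemma impl_snd: "impl P x (seqs [Const 6 1, Add 3 3 6, Load 3 3]) UNIV snd (%_. 4)"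
 by (rule impl_basic) (auto simp: heap_upd rep_upd val_of_prod_def)

lemma impl_id: "impl P x (seqs []) UNIV (%v. v) (%_. 1)"
 by (rule impl_basic) auto

lemma impl_const:
 assumes "val_of c = VNat n"
 shows "impl P x (seqs [Const 3 n]) UNIV (%v. c) (%_. 2)"
 by (rule impl_basic) (auto simp: heap_upd rep_upd assms)

lemma impl_arith:
 assumes "op = Add 3 7 3 & h = (+) | op = Sub 3 7 3 & h = (-)"
  "!!v. EX a b. val_of v = VPair (VNat a) (VNat b) & val_of (f v) = VNat (h a b)"
 shows "impl P x (seqs [Load 7 3, Const 6 1, Add 3 3 6, Load 3 3, op]) UNIV f (%_. 6)"
proof (rule impl_basic, goal_cases)
 case 1
 thus ?case using assms(1) by auto
next
 case 2
 thus ?case by simp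
next
 case (3 s v)
 obtain a b where "val_of v = VPair (VNat a) (VNat b)" "val_of (f v) = VNat (h a b)"
  using assms(2) by blast
 thus ?case using 3 assms(1) by (auto simp: heap_upd)
qed

definition p_if0 :: prog where "p_if0 = IfNZ 3 (seqs [Const 3 0]) (seqs [Const 3 1])"

text \<open>One program serves as zero test, as test for the empty list and as negation: all of them
  ask whether a word is 0, and the address of a pair is not.\<close>

lemma impl_if0:
 fixes f :: "'a::repr => bool"
 assumes "!!v. (EX a. val_of v = VNat a & val_of (f v) = VNat (of_bool (a = 0))) |
         (EX a b. val_of v = VPair a b & val_of (f v) = VNat 0)"
 shows "impl P x p_if0 UNIV f (%_. 3)"
proof (rule implI)
 fix s and v :: 'a assume 0: "heap_ok s" "v : UNIV" "rep s (s 3) (val_of v)"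
 define n where "n = (if s 3 = 0 then 1 else 0::nat)"
 have r: "runs P x p_if0 s (1 + 2) (s(3 := n))"
  unfolding p_if0_def
  by (rule runs_IfNZ; rule runs_seqsI) (simp_all add: n_def)
 have "runs P x p_if0 s 3 (s(3 := n))" by (rule runs_mono[OF r]) simp
 moreover have "val_of (f v) = VNat n" using assms[of v] 0(3) by (auto simp: n_def)
 ultimately show "EX s'. runs P x p_if0 s 3 s' & heap_ok s' & heap_le s s' & s' 4 = s 4 &
     rep s' (s' 3) (val_of (f v))"
  using 0(1) by (intro exI[of _ "s(3 := n)"]) (auto simp: heap_upd rep_upd)
qed

definition "p_test p = Seq (seqs push) (Seq p (seqs (mov 7 3 @ [Load 3 4] @ pop)))"

lemma test_correct:
 assumes "impl P x p D b T" "heap_ok s" "v : D" "rep s (s 3) (val_of v)"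
 obtains s' where "runs P x (p_test p) s (T v + 20) s'" "heap_ok s'" "heap_le s s'" "s' 4 = s 4"
  "rep s' (s' 3) (val_of v)" "s' 7 = of_bool (b v)"
proof -
 define s1 where "s1 = fold eff push s"
 note P1 = push_correct[OF assms(2), folded s1_def]
 have r1: "rep s1 (s1 3) (val_of v)" using rep_mono[OF P1(2) assms(4)] P1(3) by simp
 obtain s2 where 2: "runs P x p s1 (T v) s2" "heap_ok s2" "heap_le s1 s2" "s2 4 = s1 4"
  "rep s2 (s2 3) (val_of (b v))" using implE[OF assms(1) P1(1) assms(3) r1] by blast
 have h: "16 <= s 5" using assms(2) by (simp add: heap_ok_def)
 have top: "s2 (s2 4) = s 3" "s2 (s2 4 + 1) = s 4" "s2 4 = s 5"
  using 2(3,4) P1 h unfolding heap_le_def by simp_all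
 define s3 where "s3 = s2(7 := of_bool (b v), 3 := s 3, 6 := s 5 + 1, 4 := s 4)"
 have e: "fold eff (mov 7 3 @ [Load 3 4] @ pop) s2 = s3"
 proof -
  have "s 5 ~= 6" "s 5 ~= 7" "s 5 + 1 ~= 3" "s 5 + 1 ~= 6" "s 5 + 1 ~= 7" using h by auto
  thus ?thesis using top 2(5) by (auto simp: s3_def pop_def mov_correct fun_eq_iff val_of_bool_def)
 qed
 have le: "heap_le s s3" using heap_le_trans[OF P1(2) 2(3)] by (simp add: s3_def heap_upd)
 have L1: "runs P x (seqs push) s 7 s1"
  by (rule runs_seqsI) (simp_all add: s1_def push_def)
 have L3: "runs P x (seqs (mov 7 3 @ [Load 3 4] @ pop)) s2 7 s3"
  by (rule runs_seqsI[OF _ e]) (simp_all add: pop_def mov_def)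
 have "runs P x (p_test p) s (7 + (T v + 7)) s3"
  unfolding p_test_def by (rule runs_Seq[OF L1 runs_Seq[OF 2(1) L3]])
 hence "runs P x (p_test p) s (T v + 20) s3" by (rule runs_mono) simp
 thus thesis
  using 2(2) le rep_mono[OF le assms(4)] that[of s3] by (simp add: s3_def heap_upd)
qed

lemma impl_if:
 assumes "impl P x p D b T" "impl P x p1 D1 f T1" "impl P x p2 D2 g T2"
  "!!v. v : D ==> b v ==> v : D1" "!!v. v : D ==> ~ b v ==> v : D2"
 shows "impl P x (Seq (p_test p) (IfNZ 7 p1 p2)) D (%v. if b v then f v else g v)
  (%v. T v + 21 + (if b v then T1 v else T2 v))"
proof (rule implI)
 fix s v assume 0: "heap_ok s" "v : D" "rep s (s 3) (val_of v)"
 obtain s1 where 1: "runs P x (p_test p) s (T v + 20) s1" "heap_ok s1" "heap_le s s1" "s1 4 = s 4"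
  "rep s1 (s1 3) (val_of v)" "s1 7 = of_bool (b v)" using test_correct[OF assms(1) 0] by blast
 have "EX s2. runs P x (if b v then p1 else p2) s1 (if b v then T1 v else T2 v) s2 & heap_ok s2 &
  heap_le s1 s2 & s2 4 = s1 4 & rep s2 (s2 3) (val_of (if b v then f v else g v))"
  using assms(2-5) 1(2,5) 0(2) by (auto simp: impl_def)
 then obtain s2 where 2: "runs P x (if b v then p1 else p2) s1 (if b v then T1 v else T2 v) s2"
  "heap_ok s2" "heap_le s1 s2" "s2 4 = s1 4" "rep s2 (s2 3) (val_of (if b v then f v else g v))"
  by blast
 have "runs P x (IfNZ 7 p1 p2) s1 (1 + (if b v then T1 v else T2 v)) s2"
  by (rule runs_IfNZ) (use 2(1) 1(6) in "auto split: if_splits")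
 from runs_Seq[OF 1(1) this]
 have "runs P x (Seq (p_test p) (IfNZ 7 p1 p2)) s (T v + 21 + (if b v then T1 v else T2 v)) s2"
  by (rule runs_mono) simp
 thus "EX s'. runs P x (Seq (p_test p) (IfNZ 7 p1 p2)) s (T v + 21 + (if b v then T1 v else T2 v)) s' &
  heap_ok s' & heap_le s s' & s' 4 = s 4 & rep s' (s' 3) (val_of (if b v then f v else g v))"
  using 1(4) 2 heap_le_trans[OF 1(3) 2(3)] by (intro exI[of _ s2]) simp
qed

definition "p_while pb p = Seq (p_test pb) (WhileNZ 7 (Seq p (p_test pb)))"

text \<open>\<open>W\<close> is given by the unfolding equation of the loop, \<open>T\<close> by the
  matching recurrence for the time; \<mu> only provides termination, by induction.\<close>

lemma impl_while:
 fixes f :: "'a::repr => 'a" and \<mu> :: "'a => nat"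
 assumes "impl P x pb D b Tb" "impl P x p {v : D. b v} f Tf"
  and D: "!!v. v : D ==> b v ==> f v : D"
  and \<mu>: "!!v. v : D ==> b v ==> \<mu> (f v) < \<mu> v"
  and W: "!!v. v : D ==> W v = (if b v then W (f v) else v)"
  and T: "!!v. v : D ==> T v >= Tb v + 22 + (if b v then Tf v + T (f v) else 0)"
 shows "impl P x (p_while pb p) D W T"
proof -
 have loop: "EX s'. runs P x (WhileNZ 7 (Seq p (p_test pb))) s (1 + (if b v then Tf v + T (f v) else 0)) s' &
  heap_ok s' & heap_le s s' & s' 4 = s 4 & rep s' (s' 3) (val_of (W v))"
  if "heap_ok s" "v : D" "rep s (s 3) (val_of v)" "s 7 = of_bool (b v)" for s v
  using that
 proof (induction "\<mu> v" arbitrary: s v rule: less_induct)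
  case less
  show ?case
  proof (cases "b v")
   case False
   hence "runs P x (WhileNZ 7 (Seq p (p_test pb))) s 1 s"
    using less.prems(4) by (intro runs_While_0) simp
   thus ?thesis using False less.prems W[OF less.prems(2)] by auto
  next
   case True
   obtain s1 where 1: "runs P x p s (Tf v) s1" "heap_ok s1" "heap_le s s1" "s1 4 = s 4"
    "rep s1 (s1 3) (val_of (f v))"
    using implE[OF assms(2) less.prems(1) _ less.prems(3)] less.prems(2) True by blast
   obtain s2 where 2: "runs P x (p_test pb) s1 (Tb (f v) + 20) s2" "heap_ok s2" "heap_le s1 s2"
    "s2 4 = s1 4" "rep s2 (s2 3) (val_of (f v))" "s2 7 = of_bool (b (f v))"
    using test_correct[OF assms(1) 1(2) D[OF less.prems(2) True] 1(5)] by blast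
   obtain s3 where 3: "runs P x (WhileNZ 7 (Seq p (p_test pb))) s2
     (1 + (if b (f v) then Tf (f v) + T (f (f v)) else 0)) s3"
    "heap_ok s3" "heap_le s2 s3" "s3 4 = s2 4" "rep s3 (s3 3) (val_of (W (f v)))"
    using less.hyps[OF \<mu>[OF less.prems(2) True] 2(2) D[OF less.prems(2) True] 2(5,6)] by blast
   have "runs P x (WhileNZ 7 (Seq p (p_test pb))) s
    (1 + (Tf v + (Tb (f v) + 20)) + (1 + (if b (f v) then Tf (f v) + T (f (f v)) else 0))) s3"
    using less.prems(4) True by (intro runs_While_step[OF _ runs_Seq[OF 1(1) 2(1)] 3(1)]) simp
   hence "runs P x (WhileNZ 7 (Seq p (p_test pb))) s (1 + (if b v then Tf v + T (f v) else 0)) s3"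
    by (rule runs_mono) (use T[OF D[OF less.prems(2) True]] True in auto)
   moreover have "heap_le s s3" using 1(3) 2(3) 3(3) heap_le_trans by blast
   ultimately show ?thesis
    using 1 2 3 True W[OF less.prems(2)] by auto
  qed
 qed
 show ?thesis
 proof (rule implI)
  fix s v assume 0: "heap_ok s" "v : D" "rep s (s 3) (val_of v)"
  obtain s1 where 1: "runs P x (p_test pb) s (Tb v + 20) s1" "heap_ok s1" "heap_le s s1" "s1 4 = s 4"
   "rep s1 (s1 3) (val_of v)" "s1 7 = of_bool (b v)" using test_correct[OF assms(1) 0] by blast
  obtain s2 where 2: "runs P x (WhileNZ 7 (Seq p (p_test pb))) s1 (1 + (if b v then Tf v + T (f v) else 0)) s2"
   "heap_ok s2" "heap_le s1 s2" "s2 4 = s1 4" "rep s2 (s2 3) (val_of (W v))"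
   using loop[OF 1(2) 0(2) 1(5,6)] by blast
  have "runs P x (p_while pb p) s (T v) s2"
   unfolding p_while_def
   by (rule runs_mono[OF runs_Seq[OF 1(1) 2(1)]]) (use T[OF 0(2)] in auto)
  thus "EX s'. runs P x (p_while pb p) s (T v) s' & heap_ok s' & heap_le s s' & s' 4 = s 4 &
     rep s' (s' 3) (val_of (W v))"
   using 1 2 heap_le_trans by auto
 qed
qed

section \<open>Functions computable in polynomial time\<close>

definition PB :: "('a::repr => nat) => bool" where
 "PB T \<longleftrightarrow> (EX c d. ALL v. T v <= c * sz v ^ d)"

lemma PB_const: "PB (%_. n)"
 unfolding PB_def by (intro exI[of _ n] exI[of _ 0]) simp

lemma PB_sz: "PB (%v. sz v)"
 unfolding PB_def by (intro exI[of _ 1]) simp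

lemma PB_mono: "PB T' ==> (!!v. T v <= T' v) ==> PB T"
 unfolding PB_def by (meson le_trans)

lemma sz_power_mono: "d <= d' ==> sz v ^ d <= sz v ^ d'"
 by (rule power_increasing[OF _ sz_ge_1])

lemma PB_add: assumes "PB T" "PB T'" shows "PB (%v. T v + T' v)"
proof -
 obtain c d c' d' where 1: "!!v. T v <= c * sz v ^ d" "!!v. T' v <= c' * sz v ^ d'"
  using assms unfolding PB_def by blast
 have "T v + T' v <= (c + c') * sz v ^ (d + d')" for v
 proof -
  have "T v <= c * sz v ^ (d + d')" "T' v <= c' * sz v ^ (d + d')"
   by (meson 1 le_trans mult_le_mono2 sz_power_mono le_add1 le_add2)+
  thus ?thesis by (simp add: add_mult_distrib)
 qed
 thus ?thesis unfolding PB_def by blast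
qed

lemma PB_mult: assumes "PB T" "PB T'" shows "PB (%v. T v * T' v)"
proof -
 obtain c d c' d' where 1: "!!v. T v <= c * sz v ^ d" "!!v. T' v <= c' * sz v ^ d'"
  using assms unfolding PB_def by blast
 have "T v * T' v <= (c * c') * sz v ^ (d + d')" for v
  using mult_le_mono[OF 1(1)[of v] 1(2)[of v]] by (simp add: power_add mult_ac)
 thus ?thesis unfolding PB_def by blast
qed

lemma PB_power: "PB T ==> PB (%v. T v ^ d)"
proof (induction d)
 case (Suc d)
 thus ?case using PB_mult[OF Suc.prems Suc.IH] by simp
qed (simp add: PB_const)

lemma PB_comp: assumes "PB T" "PB (%v. sz (f v))" shows "PB (%v. T (f v))"
proof -
 obtain c d c' d' where 1: "!!v. T v <= c * sz v ^ d" "!!v. sz (f v) <= c' * sz v ^ d'"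
  using assms unfolding PB_def by blast
 have "T (f v) <= (c * c' ^ d) * sz v ^ (d' * d)" for v
 proof -
  have "T (f v) <= c * sz (f v) ^ d" by (rule 1)
  also have "... <= c * (c' * sz v ^ d') ^ d" by (intro mult_le_mono2 power_mono 1) simp
  finally show ?thesis by (simp add: power_mult_distrib power_mult mult_ac)
 qed
 thus ?thesis unfolding PB_def by blast
qed

text \<open>Turns a bound in the size of an intermediate value \<open>w\<close> into one in the size
  of the input \<open>v\<close>, once the size of \<open>w\<close> is controlled by that of
  \<open>v\<close>.\<close>

lemma PB_le_sum:
 assumes "PB T" "!!v w. sz w <= B v ==> w : R v ==> True" "PB B"
 obtains T' where "PB T'" "!!v w. sz w <= B v ==> T w <= T' v"
proof -
 obtain c d where 1: "!!v. T v <= c * sz v ^ d" using assms unfolding PB_def by blast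
 have "PB (%v. c * B v ^ d)"
 proof (induction d)
  case 0
  thus ?case by (simp add: PB_const)
 next
  case (Suc d)
  have "PB (%v. B v * (c * B v ^ d))" by (intro PB_mult assms Suc)
  thus ?case by (simp add: mult_ac)
 qed
 moreover have "T w <= c * B v ^ d" if "sz w <= B v" for v w
  using 1[of w] that by (meson le_trans mult_le_mono2 power_mono zero_le)
 ultimately show thesis using that by blast
qed

text \<open>The size bound is a separate requirement. Additions cost one step whereas
  \<open>sz\<close> counts numbers in unary, so the running time does not bound the size of the
  result, and without such a bound composition would fail.\<close>

definition PT :: "('a::repr => 'b::repr) => bool" where
 "PT f \<longleftrightarrow> (EX p T. (ALL P x. impl P x p UNIV f T) & PB T) & PB (%v. sz (f v))"

lemma PTI:
 assumes "!!P x. impl P x p UNIV f T" "PB T" "PB (%v. sz (f v))"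
 shows "PT f"
 using assms unfolding PT_def by blast

lemma PTE:
 assumes "PT f"
 obtains p T where "!!P x. impl P x p UNIV f T" "PB T"
 using assms unfolding PT_def by blast

lemma PT_size: "PT f ==> PB (%v. sz (f v))"
 by (simp add: PT_def)

text \<open>The result types of \<open>f\<close> and \<open>f'\<close> may differ, only the
  represented trees must agree. Hence a change of type, such as reading a nonempty list as a pair,
  costs nothing.\<close>

lemma impl_cong:
 assumes "impl P x p D f T" "!!v. v : D ==> val_of (f v) = val_of (f' v)"
 shows "impl P x p D f' T"
 using assms unfolding impl_def by auto

lemma impl_sub: "impl P x p D f T ==> D' <= D ==> impl P x p D' f T"
 unfolding impl_def by blast

lemma PT_id: "PT (%e. e)"
 by (rule PTI[OF impl_id PB_const PB_sz])

lemma PT_comp: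
 assumes "PT g" "PT f"
 shows "PT (%e. g (f e))"
proof -
 obtain p T where 1: "!!P x. impl P x p UNIV f T" "PB T" by (rule PTE[OF assms(2)]) blast
 obtain p' T' where 2: "!!P x. impl P x p' UNIV g T'" "PB T'" by (rule PTE[OF assms(1)]) blast
 note s = PT_size[OF assms(2)]
 show ?thesis
  by (rule PTI[OF impl_comp[OF 1(1) 2(1)]])
   (auto intro!: PB_add 1 PB_comp[OF 2(2) s] PB_comp[OF PT_size[OF assms(1)] s])
qed

lemma PT_Pair: assumes "PT f" "PT g" shows "PT (%e. (f e, g e))"
proof -
 obtain p T where 1: "!!P x. impl P x p UNIV f T" "PB T" by (rule PTE[OF assms(1)]) blast
 obtain p' T' where 2: "!!P x. impl P x p' UNIV g T'" "PB T'" by (rule PTE[OF assms(2)]) blast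
 show ?thesis
  by (rule PTI[OF impl_pair[OF 1(1) 2(1)]])
   (auto intro!: PB_add PB_const 1 2 PT_size assms)
qed

lemma PT_fst: "PT f ==> PT (%e. fst (f e))"
proof (rule PT_comp[of fst])
 show "PT (fst :: 'b * 'c => 'b)"
  by (rule PTI[OF impl_fst]) (auto intro: PB_const PB_mono[OF PB_sz] simp: sz_prod_def)
qed

lemma PT_snd: "PT f ==> PT (%e. snd (f e))"
proof (rule PT_comp[of snd])
 show "PT (snd :: 'b * 'c => 'c)"
  by (rule PTI[OF impl_snd]) (auto intro: PB_const PB_mono[OF PB_sz] simp: sz_prod_def)
qed

instantiation val :: repr begin
definition "val_of (v::val) = v"
definition "sz (v::val) = (1::nat)"
instance by standard (simp add: sz_val_def)
end

text \<open>A fixed tree is built by a fixed program. Since every value is represented by a tree,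
  constants of all types follow.\<close>

lemma impl_const_val: "EX p n. ALL P x. impl P x p (UNIV :: 'a::repr set) (%_. v :: val) (%_. n)"
proof (induction v)
 case (VNat n)
 thus ?case using impl_const[of "VNat n" n] by (auto simp: val_of_val_def)
next
 case (VPair a b)
 then obtain p n q m where "!!P x. impl P x p (UNIV :: 'a set) (%_. a) (%_. n)"
  "!!P x. impl P x q (UNIV :: 'a set) (%_. b) (%_. m)" by blast
 hence "!!P x. impl P x (p_pair p q) (UNIV :: 'a set) (%_. VPair a b) (%_. n + m + 40)"
  by (intro impl_cong[OF impl_pair]) (auto simp: val_of_val_def val_of_prod_def)
 thus ?case by blast
qed

lemma impl_const': "EX p n. ALL P x. impl P x p (UNIV :: 'a::repr set) (%_. c :: 'b::repr) (%_. n)"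
proof -
 obtain p n where "!!P x. impl P x p (UNIV :: 'a::repr set) (%_. val_of c) (%_. n)"
  using impl_const_val by blast
 hence "!!P x. impl P x p (UNIV :: 'a::repr set) (%_. c) (%_. n)"
  by (rule impl_cong) (simp add: val_of_val_def)
 thus ?thesis by blast
qed

lemma PT_const: "PT (%_. c)"
 using impl_const' PTI[OF _ PB_const PB_const] by blast

lemma PT_if: assumes "PT b" "PT f" "PT g" shows "PT (%e. if b e then f e else g e)"
proof -
 obtain p T where 1: "!!P x. impl P x p UNIV b T" "PB T" by (rule PTE[OF assms(1)]) blast
 obtain p1 T1 where 2: "!!P x. impl P x p1 UNIV f T1" "PB T1" by (rule PTE[OF assms(2)]) blast
 obtain p2 T2 where 3: "!!P x. impl P x p2 UNIV g T2" "PB T2" by (rule PTE[OF assms(3)]) blast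
 show ?thesis
  by (rule PTI[OF impl_if[OF 1(1) 2(1) 3(1)]])
   (auto intro: PB_mono[OF PB_add[OF PB_add[OF PB_add[OF 1(2) PB_const[of 21]] 2(2)] 3(2)]]
    PB_mono[OF PB_add[OF PT_size[OF assms(2)] PT_size[OF assms(3)]]])
qed

lemma PT_arith:
 assumes "op = Add 3 7 3 & h = (+) | op = Sub 3 7 3 & h = (-)"
  "!!v. EX a b. val_of v = VPair (VNat a) (VNat b) & val_of (f v) = VNat (h a b)"
  "!!v. sz (f v) <= sz v"
 shows "PT f"
 by (rule PTI[OF impl_arith[OF assms(1,2)] PB_const PB_mono[OF PB_sz]]) (auto intro: assms)

lemma PT2:
 assumes "PT (%z. h (fst z) (snd z))" "PT f" "PT g"
 shows "PT (%e. h (f e) (g e))"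
 using PT_comp[OF assms(1) PT_Pair[OF assms(2,3)]] by simp

lemma PT_add: "PT f ==> PT g ==> PT (%e. f e + g e :: nat)"
 by (rule PT2[OF PT_arith[where h = "(+)" and op = "Add 3 7 3"]])
  (auto simp: val_of_prod_def val_of_nat_def)

lemma PT_diff: "PT f ==> PT g ==> PT (%e. f e - g e :: nat)"
 by (rule PT2[OF PT_arith[where h = "(-)" and op = "Sub 3 7 3"]])
  (auto simp: val_of_prod_def val_of_nat_def)

definition badd :: "big => big => big" where "badd a b = Big (nob a + nob b)"
definition bsub :: "big => big => big" where "bsub a b = Big (nob a - nob b)"

lemma nob_simps [simp]: "nob (badd a b) = nob a + nob b" "nob (bsub a b) = nob a - nob b"
 by (simp_all add: badd_def bsub_def)

lemma PT_badd: "PT f ==> PT g ==> PT (%e. badd (f e) (g e))"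
 by (rule PT2[OF PT_arith[where h = "(+)" and op = "Add 3 7 3"]])
  (auto simp: val_of_prod_def val_of_big_def)

lemma PT_bsub: "PT f ==> PT g ==> PT (%e. bsub (f e) (g e))"
 by (rule PT2[OF PT_arith[where h = "(-)" and op = "Sub 3 7 3"]])
  (auto simp: val_of_prod_def val_of_big_def)

lemma PT_if0:
 fixes f :: "'a::repr => bool"
 assumes "!!v. (EX a. val_of v = VNat a & val_of (f v) = VNat (of_bool (a = 0))) |
         (EX a b. val_of v = VPair a b & val_of (f v) = VNat 0)"
 shows "PT f"
 by (rule PTI[OF impl_if0[OF assms] PB_const]) (simp add: PB_const)

lemma PT_eq0: "PT f ==> PT (%e. f e = (0::nat))"
 by (rule PT_comp[of "%n. n = 0", OF PT_if0]) (auto simp: val_of_nat_def val_of_bool_def)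

lemma PT_bzero: "PT f ==> PT (%e. nob (f e) = 0)"
 by (rule PT_comp[of "%b. nob b = 0", OF PT_if0]) (auto simp: val_of_big_def val_of_bool_def)

lemma PT_not: "PT f ==> PT (%e. ~ f e)"
 by (rule PT_comp[of "%b. ~ b", OF PT_if0]) (auto simp: val_of_bool_def)

lemma PT_null: "PT f ==> PT (%e. f e = [])"
proof (rule PT_comp[of "%b. b = []", OF PT_if0], goal_cases)
 case (1 v)
 thus ?case by (cases v) (auto simp: val_of_bool_def)
qed

lemma PT_conj: "PT f ==> PT g ==> PT (%e. f e & g e)"
proof -
 assume "PT f" "PT g"
 hence "PT (%e. if f e then g e else False)" by (intro PT_if PT_const)
 moreover have "(%e. if f e then g e else False) = (%e. f e & g e)" by auto
 ultimately show ?thesis by simp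
qed

lemma PT_disj: "PT f ==> PT g ==> PT (%e. f e | g e)"
proof -
 assume "PT f" "PT g"
 hence "PT (%e. if f e then True else g e)" by (intro PT_if PT_const)
 moreover have "(%e. if f e then True else g e) = (%e. f e | g e)" by auto
 ultimately show ?thesis by simp
qed

lemma PT_imp: "PT f ==> PT g ==> PT (%e. f e --> g e)"
 unfolding imp_conv_disj by (intro PT_disj PT_not)

lemma PT_le: "PT f ==> PT g ==> PT (%e. f e <= (g e :: nat))"
 using PT_eq0[OF PT_diff, of f g] by simp

lemma PT_less: "PT f ==> PT g ==> PT (%e. f e < (g e :: nat))"
 using PT_not[OF PT_le, of g f] by (simp add: not_le)

lemma PT_eq_nat: "PT f ==> PT g ==> PT (%e. f e = (g e :: nat))"
 using PT_conj[OF PT_le PT_le, of f g g f] by (simp add: eq_iff)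

lemma PT_eq_bool: "PT f ==> PT g ==> PT (%e. f e = (g e :: bool))"
proof -
 assume "PT f" "PT g"
 hence "PT (%e. if f e then g e else ~ g e)" by (intro PT_if PT_not)
 moreover have "(%e. if f e then g e else ~ g e) = (%e. f e = g e)" by auto
 ultimately show ?thesis by simp
qed

lemma PT_eq_prod:
 "PT (%e. fst (f e) = fst (g e)) ==> PT (%e. snd (f e) = snd (g e)) ==> PT (%e. f e = g e)"
 using PT_conj[of "%e. fst (f e) = fst (g e)" "%e. snd (f e) = snd (g e)"]
 by (simp add: prod_eq_iff)

lemma PT_ble: "PT f ==> PT g ==> PT (%e. nob (f e) <= nob (g e))"
 using PT_bzero[OF PT_bsub, of f g] by simp

lemma PT_of_bool: "PT f ==> PT (%e. of_bool (f e) :: nat)"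
 using PT_if[of f "%_. 1::nat" "%_. 0"] by (simp add: PT_const of_bool_def)

lemma PT_Cons: assumes "PT f" "PT g" shows "PT (%e. f e # g e)"
proof -
 obtain p T where 1: "!!P x. impl P x p UNIV f T" "PB T" by (rule PTE[OF assms(1)]) blast
 obtain p' T' where 2: "!!P x. impl P x p' UNIV g T'" "PB T'" by (rule PTE[OF assms(2)]) blast
 have "impl P x (p_pair p p') UNIV (%e. f e # g e) (%v. T v + T' v + 40)" for P x
  by (rule impl_cong[OF impl_pair[OF 1(1) 2(1)]]) (simp add: val_of_prod_def)
 thus ?thesis
  by (rule PTI) (auto intro!: PB_add PB_const 1 2 PT_size assms)
qed

lemma PT_case_list:
 assumes "PT xs" "PT z" "PT (%w. g (fst w) (fst (snd w)) (snd (snd w)))"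
 shows "PT (%e. case xs e of [] => z e | y # ys => g e y ys)"
proof -
 let ?g = "%w. g (fst w) (fst (snd w)) (snd (snd w))"
 let ?i = "%e. (e, hd (xs e), tl (xs e))"
 obtain p T where 0: "!!P x. impl P x p UNIV (%e. xs e = []) T" "PB T"
  by (rule PTE[OF PT_null[OF assms(1)]]) blast
 obtain p1 T1 where 2: "!!P x. impl P x p1 UNIV z T1" "PB T1" by (rule PTE[OF assms(2)]) blast
 obtain p2 T2 where 3: "!!P x. impl P x p2 UNIV (%e. (e, xs e)) T2" "PB T2"
  by (rule PTE[OF PT_Pair[OF PT_id assms(1)]]) blast
 obtain p3 T3 where 4: "!!P x. impl P x p3 UNIV ?g T3" "PB T3" by (rule PTE[OF assms(3)]) blast
 note 1 = 0 2 3 4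
 \<comment> \<open>A nonempty list is the same tree as the pair of its head and tail, so the program
   for \<open>(e, xs e)\<close> already delivers the triple.\<close>
 have i: "impl P x p2 {e. xs e ~= []} ?i T2" for P x
 proof (rule impl_cong[OF impl_sub[OF 1(5)]])
  fix e assume "e : {e. xs e ~= []}"
  thus "val_of (e, xs e) = val_of (?i e)" by (cases "xs e") (auto simp: val_of_prod_def)
 qed simp
 have sz_i: "sz (?i e) <= sz (e, xs e)" if "xs e ~= []" for e
  using that by (cases "xs e") auto
 have I: "impl P x (Seq (p_test p) (IfNZ 7 p1 (Seq p2 p3))) UNIV
  (%e. if xs e = [] then z e else ?g (?i e))
  (%v. T v + 21 + (if xs v = [] then T1 v else T2 v + T3 (?i v)))" for P x
  by (rule impl_if[OF 1(1) 1(3) impl_comp[OF i 1(7)]]) auto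
 have eq: "(%e. if xs e = [] then z e else ?g (?i e)) = (%e. case xs e of [] => z e | y # ys => g e y ys)"
  by (auto split: list.splits)
 have PBs: "PB (%e. sz (e, xs e))" by (rule PT_size[OF PT_Pair[OF PT_id assms(1)]])
 obtain T3' where T3': "PB T3'" "!!v w. sz w <= sz (v, xs v) ==> T3 w <= T3' v"
  using PB_le_sum[OF 1(8) TrueI PBs] by blast
 obtain S3 where S3: "PB S3" "!!v w. sz w <= sz (v, xs v) ==> sz (?g w) <= S3 v"
  using PB_le_sum[OF PT_size[OF assms(3)] TrueI PBs] by blast
 show ?thesis
 proof (rule PTI[OF I[unfolded eq]])
  show "PB (%v. T v + 21 + (if xs v = [] then T1 v else T2 v + T3 (?i v)))"
   by (rule PB_mono[of "%v. T v + 21 + (T1 v + (T2 v + T3' v))"])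
    (use T3'(2)[OF sz_i] in "auto intro!: PB_add PB_const 1 T3' simp: le_SucI trans_le_add2")
  show "PB (%v. sz (case xs v of [] => z v | y # ys => g v y ys))"
   unfolding eq[symmetric, THEN fun_cong]
   by (rule PB_mono[of "%v. sz (z v) + S3 v"])
    (use S3(2)[OF sz_i] in "auto intro!: PB_add S3 PT_size assms simp: trans_le_add2")
 qed
qed

section \<open>Loops\<close>

primrec fold_time :: "nat => ('a * 'b => nat) => ('a => 'b => 'a) => 'a => 'b list => nat" where
 "fold_time C T g a [] = C"
| "fold_time C T g a (y # ys) = C + T (a, y) + fold_time C T g (g a y) ys"

lemma fold_time_bound:
 "(!!i. i < length xs ==> T (foldl g a (take i xs), xs ! i) <= M) ==>
 fold_time C T g a xs <= (length xs + 1) * (C + M)"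
proof (induction xs arbitrary: a)
 case (Cons y ys)
 have "T (a, y) <= M" using Cons.prems[of 0] by simp
 moreover have "fold_time C T g (g a y) ys <= (length ys + 1) * (C + M)"
  by (rule Cons.IH) (use Cons.prems[of "Suc i" for i] in auto)
 ultimately show ?case by simp
qed simp

definition "p_fold p =
 Seq (p_while (Seq (seqs [Const 6 1, Add 3 3 6, Load 3 3]) (Seq p_if0 p_if0))
  (p_pair (Seq (p_pair (seqs [Load 3 3])
          (Seq (seqs [Const 6 1, Add 3 3 6, Load 3 3]) (seqs [Load 3 3]))) p)
   (Seq (seqs [Const 6 1, Add 3 3 6, Load 3 3]) (seqs [Const 6 1, Add 3 3 6, Load 3 3]))))
 (seqs [Load 3 3])"

text \<open>The loop state is the pair of accumulator and remaining list. The cost of a step may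
  depend on the accumulator, which is why \<open>fold_time\<close> follows its evolution.\<close>

lemma impl_foldl:
 fixes g :: "'a::repr => 'b::repr => 'a"
 assumes "impl P x p {z. snd z : D} (%z. g (fst z) (snd z)) T"
 shows "impl P x (p_fold p) {z. set (snd z) <= D} (%z. foldl g (fst z) (snd z))
  (%z. fold_time 200 T g (fst z) (snd z))"
proof -
 let ?D = "{z :: 'a * 'b list. set (snd z) <= D}"
 let ?snd = "seqs [Const 6 1, Add 3 3 6, Load 3 3]"
 have n0: "impl P x p_if0 UNIV (%xs :: 'b list. xs = []) (%_. 3)"
 proof (rule impl_if0)
  fix v :: "'b list"
  show "(EX a. val_of v = VNat a & val_of (v = []) = VNat (of_bool (a = 0))) |
   (EX a b. val_of v = VPair a b & val_of (v = []) = VNat 0)"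
   by (cases v) (auto simp: val_of_bool_def)
 qed
 have n1: "impl P x p_if0 UNIV Not (%_. 3)"
  by (rule impl_if0) (auto simp: val_of_bool_def)
 have 1: "impl P x (Seq p_if0 p_if0) UNIV (%xs :: 'b list. ~ xs = []) (%_. 3 + 3)"
  using impl_comp[OF n0 n1] by simp
 have b: "impl P x (Seq ?snd (Seq p_if0 p_if0)) ?D (%z. ~ snd z = []) (%_. 4 + (3 + 3))"
  by (rule impl_sub[OF impl_comp[OF impl_snd 1]]) auto
 have as_pair: "impl P x ?snd {z :: 'a * 'b list. snd z ~= []} (%z. (hd (snd z), tl (snd z))) (%_. 4)"
 proof (rule impl_cong[OF impl_sub[OF impl_snd]])
  fix z :: "'a * 'b list" assume "z : {z. snd z ~= []}"
  thus "val_of (snd z) = val_of (hd (snd z), tl (snd z))"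
   by (cases "snd z") (auto simp: val_of_prod_def)
 qed simp
 have hd: "impl P x (Seq ?snd (seqs [Load 3 3])) {z :: 'a * 'b list. snd z ~= []} (%z. hd (snd z)) (%_. 4 + 2)"
  using impl_comp[OF as_pair impl_fst] by simp
 have tl: "impl P x (Seq ?snd ?snd) {z :: 'a * 'b list. snd z ~= []} (%z. tl (snd z)) (%_. 4 + 4)"
  using impl_comp[OF as_pair impl_snd] by simp
 let ?f = "%z. (g (fst z) (hd (snd z)), tl (snd z))"
 let ?E = "{z : ?D. ~ snd z = []}"
 have f0: "impl P x (p_pair (seqs [Load 3 3]) (Seq ?snd (seqs [Load 3 3]))) ?E
  (%z. (fst z, hd (snd z))) (%_. 2 + (4 + 2) + 40)"
  by (rule impl_pair[OF impl_sub[OF impl_fst] impl_sub[OF hd]]) auto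
 have f1: "impl P x (Seq (p_pair (seqs [Load 3 3]) (Seq ?snd (seqs [Load 3 3]))) p) ?E
  (%z. g (fst z) (hd (snd z))) (%z. 2 + (4 + 2) + 40 + T (fst z, hd (snd z)))"
  using impl_comp[OF f0 assms] by (auto simp: subset_iff)
 have f: "impl P x (p_pair (Seq (p_pair (seqs [Load 3 3]) (Seq ?snd (seqs [Load 3 3]))) p) (Seq ?snd ?snd))
  ?E ?f (%z. 2 + (4 + 2) + 40 + T (fst z, hd (snd z)) + (4 + 4) + 40)"
  by (rule impl_pair[OF f1 impl_sub[OF tl]]) auto
 have w: "impl P x (p_while (Seq ?snd (Seq p_if0 p_if0))
   (p_pair (Seq (p_pair (seqs [Load 3 3]) (Seq ?snd (seqs [Load 3 3]))) p) (Seq ?snd ?snd)))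
  ?D (%z. (foldl g (fst z) (snd z), [] :: 'b list)) (%z. fold_time 198 T g (fst z) (snd z))"
 proof (rule impl_while[OF b f, where \<mu> = "%z. length (snd z)"], goal_cases)
  case (1 v)
  thus ?case by (cases "snd v") auto
 next
  case (2 v)
  thus ?case by (cases "snd v") auto
 next
  case (3 v)
  thus ?case by (cases "snd v"; cases v) auto
 next
  case (4 v)
  thus ?case by (cases "snd v") auto
 qed
 have ft: "fold_time 198 T g a xs + 2 <= fold_time 200 T g a xs" for a xs
 proof (induction xs arbitrary: a)
  case (Cons y ys)
  from Cons[of "g a y"] show ?case by simp
 qed simp
 show ?thesis unfolding p_fold_def
  by (rule impl_mono[OF impl_comp[OF w impl_fst]]) (use ft in auto)
qed

lemma sz_append: "sz (xs @ ys) + 1 = sz xs + sz ys"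
 by (induction xs) auto

lemma sz_take: "sz (take i xs) <= sz xs"
proof (induction xs arbitrary: i)
 case (Cons y ys)
 show ?case using Cons[of "i - 1"] sz_ge_1[of "y # ys"] by (cases i) auto
qed simp

lemma length_le_sz: "length ys < sz ys"
proof (induction ys)
 case (Cons y ys)
 thus ?case using sz_ge_1[of y] by simp
qed simp

lemma sz_mem: "y : set ys ==> sz y <= sz ys"
 by (induction ys) auto

lemma sz_nth: "i < length ys ==> sz (ys ! i) <= sz ys"
 by (simp add: sz_mem)

text \<open>A fold of polynomial steps need not be polynomial, since the accumulator could double in
  every round. Hence the bound \<open>B\<close> on all intermediate accumulators.\<close>

lemma PT_foldl_raw:
 assumes "PT (%z. g (fst z) (snd z))" "PT a" "PT xs" "PB B"
  "!!e i. i <= length (xs e) ==> sz (foldl g (a e) (take i (xs e))) <= B e"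
 shows "PT (%e. foldl g (a e) (xs e))"
proof -
 obtain p T where 1: "!!P x. impl P x p UNIV (%z. g (fst z) (snd z)) T" "PB T"
  by (rule PTE[OF assms(1)]) blast
 obtain p1 T1 where 2: "!!P x. impl P x p1 UNIV (%e. (a e, xs e)) T1" "PB T1"
  by (rule PTE[OF PT_Pair[OF assms(2,3)]]) blast
 have PBs: "PB (%e. B e + sz (xs e))" by (intro PB_add assms PT_size)
 obtain T' where T': "PB T'" "!!v w. sz w <= B v + sz (xs v) ==> T w <= T' v"
  using PB_le_sum[OF 1(2) TrueI PBs] by blast
 have I: "impl P x (Seq p1 (p_fold p)) UNIV (%e. foldl g (a e) (xs e))
   (%e. T1 e + fold_time 200 T g (a e) (xs e))" for P x
  using impl_comp[OF 2(1) impl_foldl[of P x p UNIV g T]] 1(1) by simp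
 have "fold_time 200 T g (a e) (xs e) <= (sz (xs e) + 1) * (200 + T' e)" for e
 proof -
  have "fold_time 200 T g (a e) (xs e) <= (length (xs e) + 1) * (200 + T' e)"
  proof (rule fold_time_bound, rule T'(2))
   fix i assume "i < length (xs e)"
   thus "sz (foldl g (a e) (take i (xs e)), xs e ! i) <= B e + sz (xs e)"
    using assms(5)[of i e] sz_nth[of i "xs e"] by simp
  qed
  thus ?thesis using length_le_sz[of "xs e"]
   by (elim le_trans) (intro mult_le_mono1, simp)
 qed
 hence "PB (%e. T1 e + fold_time 200 T g (a e) (xs e))"
  by (rule PB_mono[rotated, OF add_left_mono]) (intro PB_add PB_mult PB_const 2 T' PT_size assms)
 moreover have "PB (%e. sz (foldl g (a e) (xs e)))"
  using assms(5)[of "length (xs e)" e for e] by (intro PB_mono[OF assms(4)]) simp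
 ultimately show ?thesis by (rule PTI[OF I])
qed

text \<open>The step may depend on the environment \<open>e\<close>; it is carried along as a
  component of the accumulator.\<close>

lemma PT_foldl:
 assumes "PT xs" "PT a" "PT (%w. g (fst w) (fst (snd w)) (snd (snd w)))" "PB B"
  "!!e i. i <= length (xs e) ==> sz (foldl (g e) (a e) (take i (xs e))) <= B e"
 shows "PT (%e. foldl (g e) (a e) (xs e))"
proof -
 let ?g = "%z y. (fst z, g (fst z) (snd z) y)"
 have *: "foldl ?g (e, b) ys = (e, foldl (g e) b ys)" for e b ys
  by (induction ys arbitrary: b) auto
 have "PT (%z :: ('a * 'c) * 'b. (fst (fst z), snd (fst z), snd z))"
  by (intro PT_Pair PT_fst PT_snd PT_id)
 from PT_comp[OF assms(3) this] have "PT (%z. ?g (fst z) (snd z))"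
  by (auto intro!: PT_Pair PT_fst PT_snd PT_id)
 hence "PT (%e. foldl ?g (e, a e) (xs e))"
  by (rule PT_foldl_raw[where B = "%e. sz e + B e"])
   (auto intro!: PT_Pair PT_id assms PB_add PB_sz simp: *)
 from PT_snd[OF this] show ?thesis by (simp add: *)
qed

lemma foldl_Cons_rev: "foldl (%a y. f y # a) b ys = rev (map f ys) @ b"
 by (induction ys arbitrary: b) auto

lemma sz_rev: "sz (rev xs) = sz xs"
 by (simp add: sz_list_def rev_map[symmetric] sum_list_rev)

lemma PT_rev_append:
 assumes "PT xs" "PT ys" shows "PT (%e. rev (xs e) @ ys e)"
proof -
 have "PT (%e. foldl (%a y. y # a) (ys e) (xs e))"
 proof (rule PT_foldl[OF assms, where B = "%e. sz (xs e) + sz (ys e)"])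
  fix e i
  have "sz (rev (take i (xs e)) @ ys e) + 1 = sz (rev (take i (xs e))) + sz (ys e)"
   by (rule sz_append)
  thus "sz (foldl (%a y. y # a) (ys e) (take i (xs e))) <= sz (xs e) + sz (ys e)"
   using sz_take[of i "xs e"] by (simp add: foldl_Cons_rev[where f = "%x. x", simplified] sz_rev)
 qed (auto intro!: PT_Cons PT_fst PT_snd PT_id PB_add PT_size assms)
 thus ?thesis by (simp add: foldl_Cons_rev[where f = "%x. x", simplified])
qed

lemma PT_rev: "PT xs ==> PT (%e. rev (xs e))"
 using PT_rev_append[of xs "%_. []"] by (simp add: PT_const)

lemma PT_append: "PT xs ==> PT ys ==> PT (%e. xs e @ ys e)"
 using PT_rev_append[OF PT_rev, of xs ys] by simp

lemma sz_map_le: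
 assumes "!!y. y : set ys ==> sz (f y) <= M"
 shows "sz (map f ys) <= 1 + length ys * M"
 using assms
proof (induction ys)
 case (Cons y ys)
 hence "sz (f y) <= M" "sz (map f ys) <= 1 + length ys * M" by auto
 thus ?case by simp
qed simp

lemma PT_map:
 assumes "PT (%z. g (fst z) (snd z))" "PT xs"
 shows "PT (%e. map (g e) (xs e))"
proof -
 have PBs: "PB (%e. sz e + sz (xs e))" by (intro PB_add PB_sz PT_size assms)
 obtain S where S: "PB S" "!!v w. sz w <= sz v + sz (xs v) ==> sz (g (fst w) (snd w)) <= S v"
  using PB_le_sum[OF PT_size[OF assms(1)] TrueI PBs] by blast
 have "PT (%e. foldl (%a y. g e y # a) [] (xs e))"
 proof (rule PT_foldl[OF assms(2) PT_const, where B = "%e. 1 + sz (xs e) * S e"])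
  show "PT (%w. g (fst w) (snd (snd w)) # fst (snd w))"
   using PT_comp[OF assms(1) PT_Pair[OF PT_fst[OF PT_id] PT_snd[OF PT_snd[OF PT_id]]]]
   by (auto intro!: PT_Cons PT_Pair PT_fst PT_snd PT_id)
  show "PB (%e. 1 + sz (xs e) * S e)" by (intro PB_add PB_mult PB_const S PT_size assms)
  fix e i
  have "sz (g e y) <= S e" if "y : set (take i (xs e))" for y
   using S(2)[of "(e, y)" e] sz_mem[OF in_set_takeD[OF that]] by simp
  hence "sz (map (g e) (take i (xs e))) <= 1 + length (take i (xs e)) * S e"
   by (rule sz_map_le)
  also have "... <= 1 + sz (xs e) * S e"
   using length_le_sz[of "xs e"] by (intro add_left_mono mult_le_mono1) simp
  finally show "sz (foldl (%a y. g e y # a) [] (take i (xs e))) <= 1 + sz (xs e) * S e"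
   by (simp add: foldl_Cons_rev sz_rev)
 qed
 from PT_rev[OF this] show ?thesis by (simp add: foldl_Cons_rev)
qed

lemma PT_concat: fixes xs :: "'a::repr => 'b::repr list list" assumes "PT xs" shows "PT (%e. concat (xs e))"
proof -
 have *: "foldl (%a y. a @ y) b ys = b @ concat ys" for ys :: "'b list list" and b
  by (induction ys arbitrary: b) auto
 have s: "sz (concat ys) <= sz ys" for ys :: "'b list list"
 proof (induction ys)
  case (Cons y ys)
  thus ?case using sz_append[of y "concat ys"] by simp
 qed simp
 have "PT (%e. foldl (%a y. a @ y) [] (xs e))"
 proof (rule PT_foldl[OF assms PT_const, where B = "%e. sz (xs e)"])
  fix e i
  show "sz (foldl (@) [] (take i (xs e))) <= sz (xs e)"
   using s[of "take i (xs e)"] sz_take[of i "xs e"] by (simp add: *)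
 qed (auto intro!: PT_append PT_fst PT_snd PT_id PT_size assms)
 thus ?thesis by (simp add: *)
qed

lemma PT_filter:
 assumes "PT (%z. Q (fst z) (snd z))" "PT xs"
 shows "PT (%e. filter (Q e) (xs e))"
proof -
 have "filter q ys = concat (map (%y. if q y then [y] else []) ys)" for q and ys :: "'b list"
  by (induction ys) auto
 moreover have "PT (%e. concat (map (%y. if Q e y then [y] else []) (xs e)))"
  by (intro PT_concat PT_map PT_if assms PT_Cons PT_snd PT_id PT_const)
 ultimately show ?thesis by simp
qed

lemma foldl_const: "foldl (%a y. f a) b ys = (f ^^ length ys) b"
 by (induction ys arbitrary: b) (auto simp: funpow_swap1)

lemma PT_length: fixes xs :: "'a::repr => 'b::repr list" assumes "PT xs" shows "PT (%e. length (xs e))"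
proof -
 have *: "foldl (%a y. a + 1) 0 ys = length ys" for ys :: "'b list"
  using foldl_const[of "%a. a + 1" "0::nat" ys] by (simp add: Suc_funpow[symmetric] del: Suc_funpow)
   (induction ys, auto)
 have "PT (%e. foldl (%a y. a + 1) (0::nat) (xs e))"
 proof (rule PT_foldl[OF assms PT_const, where B = "%e. sz (xs e)"])
  fix e i
  show "sz (foldl (%a y. a + 1::nat) 0 (take i (xs e))) <= sz (xs e)"
   unfolding * using length_le_sz[of "xs e"] by simp
  show "PT (%w :: 'a * nat * 'b. fst (snd w) + 1)"
   by (intro PT_add PT_const PT_fst PT_snd PT_id)
 qed (intro PT_size assms)
 thus ?thesis by (simp only: *)
qed

lemma PT_Ball:
 assumes "PT (%z. Q (fst z) (snd z))" "PT xs"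
 shows "PT (%e. ALL y:set (xs e). Q e y)"
 using PT_null[OF PT_filter[OF PT_not[OF assms(1)] assms(2)]] by (simp add: filter_empty_conv)

lemma PT_Bex:
 assumes "PT (%z. Q (fst z) (snd z))" "PT xs"
 shows "PT (%e. EX y:set (xs e). Q e y)"
 using PT_not[OF PT_null[OF PT_filter[OF assms]]] by (simp add: filter_empty_conv)

text \<open>Counting down while consing produces the numbers in increasing order.\<close>

lemma PT_upt: assumes "PT n" shows "PT (%e. [0..<n e])"
proof -
 let ?snd = "seqs [Const 6 1, Add 3 3 6, Load 3 3]"
 have b: "PT (%z :: nat * nat list. ~ fst z = 0)"
  by (intro PT_not PT_eq0 PT_fst PT_id)
 have f: "PT (%z :: nat * nat list. (fst z - 1, (fst z - 1) # snd z))"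
  by (intro PT_Pair PT_Cons PT_diff PT_fst PT_snd PT_id PT_const)
 obtain pb Tb p T where 1: "!!P x. impl P x pb UNIV (%z :: nat * nat list. ~ fst z = 0) Tb" "PB Tb"
  "!!P x. impl P x p UNIV (%z :: nat * nat list. (fst z - 1, (fst z - 1) # snd z)) T" "PB T"
  by (rule PTE[OF b], rule PTE[OF f]) blast
 obtain cb db c d where 2: "!!v. Tb v <= cb * sz v ^ db" "!!v. T v <= c * sz v ^ d"
  using 1 unfolding PB_def by blast
 \<comment> \<open>\<open>1 + n + l + n * n\<close> bounds the size of a loop state and does not
   grow along the loop: consing \<open>n - 1\<close> adds \<open>n\<close> to \<open>l\<close>,
   while \<open>n * n\<close> shrinks by \<open>2 * n - 1\<close> and \<open>n\<close> by 1.\<close>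
 let ?M = "%n l. 22 + cb * (1 + n + l + n * n) ^ db + c * (1 + n + l + n * n) ^ d"
 have w: "impl P x (p_while pb p) UNIV (%z. (0::nat, [0..<fst z] @ snd z))
  (%z. (fst z + 1) * ?M (fst z) (sz (snd z)))" for P x
 proof (rule impl_while[OF 1(1) impl_sub[OF 1(3)], where \<mu> = fst], goal_cases)
  case (4 v)
  thus ?case
   by (cases v rule: prod.exhaust; cases "fst v") (simp_all del: upt_Suc add: upt_Suc_append)
 next
  case (5 v)
  obtain m l where v: "v = (m, l)" by (cases v)
  have tb: "Tb v <= cb * (1 + m + sz l + m * m) ^ db"
   by (rule order.trans[OF 2(1)]) (auto simp: v intro!: mult_le_mono2 power_mono)
  have tf: "T v <= c * (1 + m + sz l + m * m) ^ d"
   by (rule order.trans[OF 2(2)]) (auto simp: v intro!: mult_le_mono2 power_mono)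
  show ?case
  proof (cases m)
   case 0
   thus ?thesis using tb by (simp add: v)
  next
   case (Suc m')
   have le: "1 + m' + sz (m' # l) + m' * m' <= 1 + m + sz l + m * m" by (simp add: Suc)
   have "?M m' (sz (m' # l)) <= ?M m (sz l)"
    by (intro add_mono mult_le_mono2 power_mono le order.refl) simp_all
   hence "(m' + 1) * ?M m' (sz (m' # l)) <= (m' + 1) * ?M m (sz l)"
    by (rule mult_le_mono2)
   moreover have "(m + 1) * ?M m (sz l) = ?M m (sz l) + (m' + 1) * ?M m (sz l)"
    by (simp add: Suc)
   moreover have "Tb v + 22 + T v <= ?M m (sz l)" using tb tf by simp
   ultimately show ?thesis by (simp add: v Suc del: sz_Cons)
  qed
 qed auto
 have "PB (%z :: nat * nat list. (fst z + 1) * ?M (fst z) (sz (snd z)))"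
 proof -
  have s: "PB (%z :: nat * nat list. fst z)" "PB (%z :: nat * nat list. sz (snd z))"
   by (rule PB_mono[OF PB_sz]; auto simp: sz_prod_def)+
  show ?thesis
   by (intro PB_mult PB_add PB_const PB_power s)
 qed
 moreover have "PB (%z :: nat * nat list. sz (0::nat, [0..<fst z] @ snd z))"
 proof (rule PB_mono[of "%z. 2 + sz z * sz z + sz z"])
  fix z :: "nat * nat list"
  have "sz (map (%i. i) [0..<fst z]) <= 1 + length [0..<fst z] * sz z"
   by (rule sz_map_le) (simp add: sz_prod_def)
  moreover have "length [0..<fst z] * sz z <= sz z * sz z"
   by (rule mult_le_mono1) (simp add: sz_prod_def)
  ultimately show "sz (0::nat, [0..<fst z] @ snd z) <= 2 + sz z * sz z + sz z"
   using sz_append[of "[0..<fst z]" "snd z"] by (simp add: sz_prod_def)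
 qed (intro PB_add PB_mult PB_const PB_sz)
 ultimately have "PT (%z. (0::nat, [0..<fst z] @ snd z))" by (rule PTI[OF w])
 from PT_comp[OF this PT_Pair[OF assms PT_const[of "[]"]]] PT_snd show ?thesis by fastforce
qed

lemma PT_funpow:
 fixes a :: "'a::repr => 'b::repr" and g :: "'a => 'b => 'b"
 assumes "PT n" "PT a" "PT (%z. g (fst z) (snd z))" "PB B"
  "!!e i. i <= n e ==> sz ((g e ^^ i) (a e)) <= B e"
 shows "PT (%e. (g e ^^ n e) (a e))"
proof -
 have *: "foldl (%a y. f a) b ys = (f ^^ length ys) b" for f :: "'b => 'b" and b and ys :: "nat list"
  by (rule foldl_const)
 have "PT (%e. foldl (%b y. g e b) (a e) [0..<n e])"
  using PT_comp[OF assms(3) PT_Pair[OF PT_fst[OF PT_id] PT_fst[OF PT_snd[OF PT_id]]]]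
  by (intro PT_foldl[where B = B] PT_upt assms)
   (auto simp: * assms intro!: PT_Pair PT_fst PT_snd PT_id)
 thus ?thesis by (simp add: *)
qed

lemma PT_mult: assumes "PT f" "PT g" shows "PT (%e. f e * g e :: nat)"
proof -
 have *: "((%s. s + m) ^^ i) (0::nat) = m * i" for m i
  by (induction i) auto
 have "PT (%e. ((%s. s + f e) ^^ g e) 0)"
 proof (rule PT_funpow[where B = "%e. sz (f e) * sz (g e) + 1"])
  show "sz (((%s. s + f e) ^^ i) 0) <= sz (f e) * sz (g e) + 1" if "i <= g e" for e i
   using mult_le_mono[OF order.refl that, of "f e"] unfolding * sz_nat mult_Suc mult_Suc_right
   by linarith
  show "PT (%z. snd z + f (fst z))"
   using PT_comp[OF assms(1) PT_fst[OF PT_id]] by (intro PT_add PT_snd PT_id)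
 qed (intro PB_add PB_mult PB_const PT_size assms PT_const)+
 thus ?thesis by (simp add: *)
qed

lemma PT_tl: "PT xs ==> PT (%e. tl (xs e))"
proof -
 assume "PT xs"
 hence "PT (%e. case xs e of [] => [] | y # ys => ys)"
  by (intro PT_case_list PT_const PT_snd PT_id)
 thus ?thesis by (simp add: tl_def)
qed

lemma PT_drop: assumes "PT n" "PT xs" shows "PT (%e. drop (n e) (xs e))"
proof -
 have *: "(tl ^^ i) ys = drop i ys" for i and ys :: "'b list"
  by (induction i) (auto simp: drop_Suc drop_tl)
 have s: "sz (drop i ys) <= sz ys" for i and ys :: "'b list"
  by (induction ys arbitrary: i) (auto simp: drop_Cons trans_le_add2 split: nat.splits)
 have "PT (%e. (tl ^^ n e) (xs e))"
  by (rule PT_funpow[where B = "%e. sz (xs e)"]) (auto simp: * s intro!: assms PT_tl PT_snd PT_id PT_size)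
 thus ?thesis by (simp add: *)
qed

text \<open>A total lookup: behind the end of the list \<open>xs ! i\<close> is not a computable
  value.\<close>

definition nthd :: "'a => 'a list => nat => 'a" where
 "nthd d xs i = (case drop i xs of [] => d | y # ys => y)"

lemma nthd_eq: "nthd d xs i = (if i < length xs then xs ! i else d)"
 by (auto simp: nthd_def Cons_nth_drop_Suc[symmetric])

lemma PT_nthd: "PT d ==> PT xs ==> PT i ==> PT (%e. nthd (d e) (xs e) (i e))"
 unfolding nthd_def by (intro PT_case_list PT_drop PT_fst PT_snd PT_id)

lemma PT_take: assumes "PT n" "PT xs" shows "PT (%e. take (n e) (xs e))"
proof -
 have *: "concat (map (%i. case drop i ys of [] => [] | y # _ => [y]) [0..<m]) = take m ys" for m and ys :: "'b list"
 proof (induction m)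
  case (Suc m)
  thus ?case by (cases "m < length ys") (auto simp: take_Suc_conv_app_nth Cons_nth_drop_Suc[symmetric])
 qed simp
 have xs: "PT (%z. xs (fst z))" by (rule PT_comp[OF assms(2) PT_fst[OF PT_id]])
 have "PT (%e. concat (map (%i. case drop i (xs e) of [] => [] | y # _ => [y]) [0..<n e]))"
  by (intro PT_concat PT_map PT_upt PT_case_list PT_drop PT_Cons PT_const PT_fst PT_snd PT_id xs assms)
 thus ?thesis by (simp add: *)
qed

text \<open>Numbers are charged in unary, so counting the \<open>i < a\<close> with
  \<open>(i + 1) * b <= a\<close> is affordable.\<close>

lemma PT_div: assumes "PT f" "PT g" shows "PT (%e. f e div g e :: nat)"
proof -
 have *: "a div b = (if b = 0 then 0 else length (filter (%i. (i + 1) * b <= a) [0..<a]))" for a b :: nat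
 proof (cases "b = 0")
  case False
  have "(i + 1) * b <= a \<longleftrightarrow> i < a div b" for i
   using less_eq_div_iff_mult_less_eq[of b "i + 1" a] False by (simp add: Suc_le_eq)
  hence "filter (%i. (i + 1) * b <= a) [0..<a] = filter (%i. i < a div b) [0..<a]" by simp
  also have "length ... = card {i. i < a & i < a div b}"
   by (subst distinct_card[symmetric]) (auto intro: arg_cong[where f = card])
  also have "{i. i < a & i < a div b} = {..<a div b}"
   using div_le_dividend[of a b] by (auto intro: less_le_trans)
  finally show ?thesis using False by simp
 qed simp
 have fg: "PT (%z. f (fst z))" "PT (%z. g (fst z))" by (intro PT_comp[OF assms(1)] PT_comp[OF assms(2)] PT_fst PT_id)+
 show ?thesis
  unfolding * by (intro PT_if PT_eq0 PT_length PT_filter PT_le PT_mult PT_add PT_upt PT_const PT_snd PT_id fg assms)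
qed

fun dedup :: "'a list => 'a list" where
 "dedup xs = foldl (%a y. if EX z:set a. z = y then a else y # a) [] xs"

lemma dedup: "set (dedup xs) = set xs" "distinct (dedup xs)"
proof -
 let ?f = "%a y. if EX z:set a. z = y then a else y # a"
 have "set (foldl ?f b xs) = set b Un set xs & (distinct b --> distinct (foldl ?f b xs))" for b
  by (induction xs arbitrary: b) auto
 from this[of "[]"] show "set (dedup xs) = set xs" "distinct (dedup xs)" by auto
qed

declare dedup.simps [simp del]

lemma PT_dedup:
 fixes xs :: "'a::repr => 'b::repr list"
 assumes "PT (%z :: 'b * 'b. fst z = snd z)" "PT xs"
 shows "PT (%e. dedup (xs e))"
proof -
 let ?f = "%a y. if EX z:set a. z = y then a else y # a"
 have s: "sz (foldl ?f b ys) <= sz b + sz ys" for ys b :: "'b list"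
 proof (induction ys arbitrary: b)
  case (Cons y ys)
  from Cons[of "?f b y"] show ?case by (cases "EX z:set b. z = y") auto
 qed simp
 have "PT (%w :: ('a * 'b list * 'b) * 'b. (snd w, snd (snd (fst w))))"
  by (intro PT_Pair PT_fst PT_snd PT_id)
 from PT_comp[OF assms(1) this]
 have e: "PT (%w :: ('a * 'b list * 'b) * 'b. snd w = snd (snd (fst w)))" by simp
 show ?thesis
  unfolding dedup.simps
 proof (rule PT_foldl[where B = "%e. 1 + sz (xs e)"])
  show "PT (%w :: 'a * 'b list * 'b. if EX z:set (fst (snd w)). z = snd (snd w) then fst (snd w)
   else snd (snd w) # fst (snd w))"
   by (intro PT_if PT_Bex PT_Cons PT_fst PT_snd PT_id e)
  show "PB (%e. 1 + sz (xs e))" by (intro PB_add PB_const PT_size assms)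
  fix e i
  show "sz (foldl ?f [] (take i (xs e))) <= 1 + sz (xs e)"
   using s[of "[]" "take i (xs e)"] sz_take[of i "xs e"] by simp
 qed (intro PT_const assms)+
qed

section \<open>Bit arrays, rationals and oracle queries\<close>

text \<open>A query has to occupy consecutive cells, so the linked list of bits is copied to the top
  of the heap. Cell 12 receives its address and cell 13 its length.\<close>

definition p_arr :: prog where
 "p_arr = Seq (seqs (mov 12 5))
  (Seq (WhileNZ 3 (seqs [Load 7 3, Store 5 7, Const 6 1, Add 5 5 6, Add 3 3 6, Load 3 3]))
   (seqs [Sub 13 5 12]))"

lemma arr_loop:
 fixes bs :: "bool list"
 assumes "heap_ok s" "rep s (s 3) (val_of bs)"
 shows "EX s'. runs P x (WhileNZ 3 (seqs [Load 7 3, Store 5 7, Const 6 1, Add 5 5 6, Add 3 3 6, Load 3 3]))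
   s (1 + 8 * length bs) s' & heap_ok s' & heap_le s s' & s' 4 = s 4 & s' 12 = s 12 &
   s' 5 = s 5 + length bs & (\<forall>i<length bs. s' (s 5 + i) = of_bool (bs ! i))"
 using assms
proof (induction bs arbitrary: s)
 case Nil
 hence "s 3 = 0" by simp
 thus ?case using Nil runs_While_0[of s 3] by (intro exI[of _ s]) auto
next
 case (Cons b bs)
 let ?is = "[Load 7 3, Store 5 7, Const 6 1, Add 5 5 6, Add 3 3 6, Load 3 3]"
 obtain h where h: "s 5 = h + 16" using Cons.prems(1) by (metis heap_ok_def add.commute le_Suc_ex)
 have r: "16 <= s 3" "s 3 + 1 < s 5" "s (s 3) = of_bool b" "rep s (s (s 3 + 1)) (val_of bs)"
  using Cons.prems(2) by (auto simp: val_of_bool_def)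
 define s1 where "s1 = s(7 := of_bool b, h + 16 := of_bool b, 6 := 1, 5 := h + 17, 3 := s (s 3 + 1))"
 have e: "fold eff ?is s = s1"
 proof -
  obtain g where g: "s 3 = g + 16" using r(1) by (metis add.commute le_Suc_ex)
  have gh: "g + 17 < h + 16" using r(2) g h by simp
  hence "g + 17 ~= h + 16" "g + 16 ~= h + 16" by auto
  thus ?thesis using h g r(3) by (auto simp: fun_eq_iff s1_def)
 qed
 have ok: "heap_ok s1" using Cons.prems(1) h by (auto simp: heap_ok_def s1_def)
 have le: "heap_le s s1" using h by (auto simp: heap_le_def s1_def)
 have s1: "s1 3 = s (s 3 + 1)" "s1 5 = s 5 + 1" "s1 4 = s 4" "s1 12 = s 12" "s1 (s 5) = of_bool b"
  by (simp_all add: s1_def h)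
 obtain s2 where 2: "runs P x (WhileNZ 3 (seqs ?is)) s1 (1 + 8 * length bs) s2" "heap_ok s2" "heap_le s1 s2"
  "s2 4 = s1 4" "s2 12 = s1 12" "s2 5 = s1 5 + length bs" "\<forall>i<length bs. s2 (s1 5 + i) = of_bool (bs ! i)"
  using Cons.IH[OF ok] rep_mono[OF le r(4)] s1(1) by auto
 have "runs P x (seqs ?is) s 7 s1" by (rule runs_seqsI[OF _ e]) simp_all
 hence "runs P x (WhileNZ 3 (seqs ?is)) s (1 + 7 + (1 + 8 * length bs)) s2"
  using r(1) by (intro runs_While_step[OF _ _ 2(1)]) auto
 hence run: "runs P x (WhileNZ 3 (seqs ?is)) s (1 + 8 * length (b # bs)) s2" by (rule runs_mono) simp
 have b0: "s2 (s 5) = of_bool b"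
  using 2(3) s1(2,5) h unfolding heap_le_def by simp
 have "\<forall>i<length (b # bs). s2 (s 5 + i) = of_bool ((b # bs) ! i)"
 proof (intro allI impI)
  fix i assume "i < length (b # bs)"
  thus "s2 (s 5 + i) = of_bool ((b # bs) ! i)"
   using b0 2(7) s1(2) by (cases i) auto
 qed
 thus ?case
  using run 2 s1 heap_le_trans[OF le 2(3)] by (intro exI[of _ s2]) auto
qed

lemma arr_correct:
 fixes bs :: "bool list"
 assumes "heap_ok s" "rep s (s 3) (val_of bs)"
 obtains s' where "runs P x p_arr s (8 * length bs + 6) s'" "heap_ok s'" "heap_le s s'" "s' 4 = s 4"
  "s' 12 = s 5" "s' 13 = length bs" "s' 5 = s 5 + length bs"
  "!!i. i < length bs ==> s' (s 5 + i) = of_bool (bs ! i)"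
proof -
 define s1 where "s1 = s(6 := 0, 12 := s 5)"
 have s1: "heap_ok s1" "rep s1 (s1 3) (val_of bs)" "heap_le s s1" "s1 4 = s 4" "s1 5 = s 5" "s1 12 = s 5"
  using assms by (simp_all add: s1_def heap_upd rep_upd)
 have R1: "runs P x (seqs (mov 12 5)) s 3 s1"
  by (rule runs_seqsI) (auto simp: mov_def s1_def)
 obtain s2 where 2: "runs P x (WhileNZ 3 (seqs [Load 7 3, Store 5 7, Const 6 1, Add 5 5 6, Add 3 3 6, Load 3 3]))
   s1 (1 + 8 * length bs) s2" "heap_ok s2" "heap_le s1 s2" "s2 4 = s1 4" "s2 12 = s1 12"
   "s2 5 = s1 5 + length bs" "\<forall>i<length bs. s2 (s1 5 + i) = of_bool (bs ! i)"
  using arr_loop[OF s1(1,2)] by blast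
 define s3 where "s3 = s2(13 := length bs)"
 have R3: "runs P x (seqs [Sub 13 5 12]) s2 2 s3"
  by (rule runs_seqsI) (auto simp: s3_def 2 s1)
 have "runs P x p_arr s (3 + (1 + 8 * length bs + 2)) s3"
  unfolding p_arr_def by (intro runs_Seq[OF R1] runs_Seq[OF 2(1) R3])
 moreover have "16 <= s 5" using assms(1) by (simp add: heap_ok_def)
 ultimately show thesis
  using 2 s1 heap_le_trans[OF s1(3) 2(3)] by (intro that[of s3]) (auto simp: s3_def heap_upd elim: runs_mono)
qed

definition p_triple :: prog where
 "p_triple = seqs (mov 7 9 @ mov 3 10 @ alloc @ mov 7 8 @ alloc)"

lemma triple_correct:
 assumes "heap_ok s"
 obtains s' where "runs P x p_triple s 20 s'" "heap_ok s'" "heap_le s s'" "s' 4 = s 4"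
  "rep s' (s' 3) (val_of (Big (s 8), Big (s 9), Big (s 10)))"
proof -
 define s1 where "s1 = s(6 := 0, 7 := s 9, 3 := s 10)"
 have e1: "fold eff (mov 7 9 @ mov 3 10) s = s1" by (auto simp: mov_correct s1_def)
 have ok1: "heap_ok s1" "heap_le s s1" using assms by (simp_all add: s1_def heap_upd)
 define s2 where "s2 = fold eff alloc s1"
 note A2 = alloc_correct[OF ok1(1), folded s2_def]
 have r2: "rep s2 (s2 3) (VPair (VNat (s 9)) (VNat (s 10)))"
  unfolding s2_def by (rule alloc_rep[OF ok1(1)]) (simp_all add: s1_def)
 have k8: "s2 8 = s 8"
 proof -
  obtain h where "s1 5 = h + 16" using ok1(1) by (metis heap_ok_def add.commute le_Suc_ex)
  thus ?thesis by (simp add: s2_def alloc_def s1_def)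
 qed
 define s3 where "s3 = s2(6 := 0, 7 := s 8)"
 have e3: "fold eff (mov 7 8) s2 = s3" by (auto simp: mov_correct s3_def k8)
 have ok3: "heap_ok s3" "heap_le s2 s3" using A2(1) by (simp_all add: s3_def heap_upd)
 have r3: "rep s3 (s3 3) (VPair (VNat (s 9)) (VNat (s 10)))"
  using rep_mono[OF ok3(2) r2] by (simp only: s3_def fun_upd_other num.distinct numeral_eq_iff num.inject not_False_eq_True simp_thms)
 define s4 where "s4 = fold eff alloc s3"
 note A4 = alloc_correct[OF ok3(1), folded s4_def]
 have r4: "rep s4 (s4 3) (VPair (VNat (s 8)) (VPair (VNat (s 9)) (VNat (s 10))))"
  unfolding s4_def by (rule alloc_rep[OF ok3(1) _ r3]) (simp add: s3_def)
 have e: "fold eff (mov 7 9 @ mov 3 10 @ alloc @ mov 7 8 @ alloc) s = s4"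
  using e1 e3 by (simp add: s2_def s4_def)
 have "runs P x p_triple s 20 s4"
  unfolding p_triple_def by (rule runs_seqsI[OF _ e]) (simp_all add: mov_def alloc_def)
 moreover have "heap_le s s4"
  using heap_le_trans[OF ok1(2) heap_le_trans[OF A2(2) heap_le_trans[OF ok3(2) A4(2)]]] .
 moreover have "s4 4 = s 4" using A4(4) A2(4) by (simp add: s3_def s1_def)
 ultimately show thesis using that A4(1) r4 by (simp add: val_of_prod_def val_of_big_def)
qed

type_synonym big3 = "big * big * big"

definition rep3 :: "big3 => rat => bool" where
 "rep3 t v \<longleftrightarrow> nob (snd (snd t)) > 0 &
  v = (of_nat (nob (fst t)) - of_nat (nob (fst (snd t)))) / of_nat (nob (snd (snd t)))"

definition rat3 :: "rat => big3" where
 "rat3 v = (let (p, q) = quotient_of v in (Big (nat p), Big (nat (- p)), Big (nat q)))"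

lemma rep3_rat3: "rep3 (rat3 v) v"
proof -
 obtain p q where pq: "quotient_of v = (p, q)" by (cases "quotient_of v")
 hence q: "q > 0" and v: "v = of_int p / of_int q" by (auto simp: quotient_of_denom_pos quotient_of_div)
 have "of_nat (nat p) - of_nat (nat (- p)) = (of_int p :: rat)" by (cases "p >= 0") auto
 hence "rep3 (Big (nat p), Big (nat (- p)), Big (nat q)) v" using q v by (simp add: rep3_def)
 thus ?thesis by (simp add: rat3_def pq)
qed

definition answer :: "problem => bool list => rat" where
 "answer P y = (THE v. EX k. (y, k, v) : P)"

lemma answer_eq: "functional P ==> (y, k, v) : P ==> answer P y = v"
 unfolding answer_def functional_def by (rule the_equality) blast+

definition p_query :: prog where
 "p_query = Seq p_arr (Seq (Query 8 12 13) p_triple)"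

text \<open>The domain consists of the encoded instances, because any other query makes the
  computation fail.\<close>

lemma impl_query:
 assumes "functional P"
 shows "impl P x p_query {y. EX k v. (y, k, v) : P} (%y. rat3 (answer P y))
  (%y. 9 * length y + rat_length (answer P y) + 30)"
proof (rule implI)
 fix s and y :: "bool list"
 assume 0: "heap_ok s" "y : {y. EX k v. (y, k, v) : P}" "rep s (s 3) (val_of y)"
 then obtain k v where kv: "(y, k, v) : P" by blast
 have an: "answer P y = v" by (rule answer_eq[OF assms kv])
 obtain s1 where 1: "runs P x p_arr s (8 * length y + 6) s1" "heap_ok s1" "heap_le s s1" "s1 4 = s 4"
  "s1 12 = s 5" "s1 13 = length y" "s1 5 = s 5 + length y"
  "!!i. i < length y ==> s1 (s 5 + i) = of_bool (y ! i)"
  using arr_correct[OF 0(1,3)] by blast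
 have "map (%i. s1 (s1 12 + i) ~= 0) [0..<s1 13] = y"
  by (rule nth_equalityI) (auto simp: 1)
 hence "exec P x (Query 8 12 13) s1 (1 + length y + rat_length v) {} {k} (put_rat s1 8 v)"
  using exec.intros(8)[OF _ kv, of s1 12 13 x 8] by simp
 hence 2: "runs P x (Query 8 12 13) s1 (1 + length y + rat_length v) (put_rat s1 8 v)"
  unfolding runs_def by blast
 obtain p q where pq: "quotient_of v = (p, q)" by (cases "quotient_of v")
 define s2 where "s2 = put_rat s1 8 v"
 have s2: "s2 = s1(8 := nat p, 9 := nat (- p), 10 := nat q)" by (simp add: s2_def put_rat_def pq)
 have ok2: "heap_ok s2" "heap_le s1 s2" using 1(2) by (simp_all add: s2 heap_upd)
 obtain s3 where 3: "runs P x p_triple s2 20 s3" "heap_ok s3" "heap_le s2 s3" "s3 4 = s2 4"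
  "rep s3 (s3 3) (val_of (Big (s2 8), Big (s2 9), Big (s2 10)))"
  using triple_correct[OF ok2(1)] by blast
 have "runs P x p_query s ((8 * length y + 6) + ((1 + length y + rat_length v) + 20)) s3"
  unfolding p_query_def by (intro runs_Seq[OF 1(1)] runs_Seq[OF 2[folded s2_def] 3(1)])
 hence "runs P x p_query s (9 * length y + rat_length (answer P y) + 30) s3"
  by (rule runs_mono) (simp add: an)
 moreover have "s3 4 = s 4" using 3(4) 1(4) by (simp add: s2)
 moreover have "rep s3 (s3 3) (val_of (rat3 (answer P y)))"
  using 3(5) by (simp add: an rat3_def pq s2)
 ultimately show "EX s'. runs P x p_query s (9 * length y + rat_length (answer P y) + 30) s' &
   heap_ok s' & heap_le s s' & s' 4 = s 4 & rep s' (s' 3) (val_of (rat3 (answer P y)))"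
  using 3(2) heap_le_trans[OF 1(3) heap_le_trans[OF ok2(2) 3(3)]] by blast
qed

section \<open>Simulation of oracle-free programs\<close>

definition s_ld :: "nat => nat => prog list" where
 "s_ld t r = [Const 6 r, Add 6 11 6, Load t 6]"

definition s_ad :: "nat => prog list" where
 "s_ad r = [Const 6 r, Add 7 11 6]"

text \<open>A simulated write may hit a cell beyond the heap. By the truncated subtraction the heap
  pointer becomes the maximum of its old value and the successor of the written address, so the
  cells from the pointer on remain zero.\<close>

definition s_st :: "prog list" where
 "s_st = [Store 7 8, Const 6 1, Add 9 7 6, Sub 10 9 5, Add 5 5 10]"

text \<open>Cell 11 holds the base of the simulated memory, cells 12 and 13 the address and length
  of the simulated input. Stored bits are 0 and 1 but input symbols are 1 and 2, hence the increment
  in the case of \<open>Read\<close>. Only runs with the empty oracle are simulated, so any image of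
  \<open>Query\<close> will do.\<close>

fun simp_prog :: "prog => prog" where
 "simp_prog Skip = Skip"
| "simp_prog (Const r n) = seqs (s_ad r @ [Const 8 n] @ s_st)"
| "simp_prog (Add r a b) = seqs (s_ld 8 a @ s_ld 9 b @ [Add 8 8 9] @ s_ad r @ s_st)"
| "simp_prog (Sub r a b) = seqs (s_ld 8 a @ s_ld 9 b @ [Sub 8 8 9] @ s_ad r @ s_st)"
| "simp_prog (Load r a) = seqs (s_ld 8 a @ [Add 8 11 8, Load 8 8] @ s_ad r @ s_st)"
| "simp_prog (Store a r) = seqs (s_ld 8 r @ s_ld 7 a @ [Add 7 11 7] @ s_st)"
| "simp_prog (Read r a) = Seq (seqs (s_ld 8 a @ [Sub 9 13 8]))
  (Seq (IfNZ 9 (seqs [Add 8 12 8, Load 8 8, Const 6 1, Add 8 8 6]) (seqs [Const 8 0]))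
   (seqs (s_ad r @ s_st)))"
| "simp_prog (Query r a l) = Skip"
| "simp_prog (Seq p q) = Seq (simp_prog p) (simp_prog q)"
| "simp_prog (IfNZ r p q) = Seq (seqs (s_ld 8 r)) (IfNZ 8 (simp_prog p) (simp_prog q))"
| "simp_prog (WhileNZ r p) = Seq (seqs (s_ld 8 r)) (WhileNZ 8 (Seq (simp_prog p) (seqs (s_ld 8 r))))"

text \<open>The simulated memory starts at address \<open>B\<close>; \<open>m\<close> is the memory before the simulation.\<close>

definition sim :: "mem => nat => mem => mem => bool" where
 "sim m B s0 s \<longleftrightarrow> 16 <= B & B <= s 5 & heap_ok s & s 11 = B & s 12 = m 12 & s 13 = m 13 & s 4 = m 4 &
  (ALL a. 16 <= a & a < B --> s a = m a) & (ALL a. s (B + a) = s0 a)"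

lemma sim_upd:
 assumes "r < 11" "r ~= 4" "r ~= 5"
 shows "sim m B s0 (s(r := n)) \<longleftrightarrow> sim m B s0 s"
proof (cases "16 <= B")
 case True
 have "heap_ok (s(r := n)) = heap_ok s" using heap_upd(1)[of r] assms by simp
 moreover have "(s(r := n)) a = s a" if "16 <= a" for a using that assms by simp
 moreover have "(s(r := n)) 5 = s 5" "(s(r := n)) 11 = s 11" "(s(r := n)) 12 = s 12"
  "(s(r := n)) 13 = s 13" "(s(r := n)) 4 = s 4" using assms by auto
 ultimately show ?thesis unfolding sim_def using True by (metis trans_le_add1)
qed (simp add: sim_def)

lemma sim_st:
 assumes "sim m B s0 s" "s 7 = B + a" "s 8 = v"
 shows "sim m B (s0(a := v)) (fold eff s_st s)"
proof -
 obtain h where h: "s 5 = h + 16" using assms(1) by (metis sim_def heap_ok_def add.commute le_Suc_ex)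
 obtain b where b: "B = b + 16" using assms(1) by (metis sim_def add.commute le_Suc_ex)
 define s' where "s' = s(B + a := v, 6 := 1, 9 := B + a + 1, 10 := (B + a + 1) - s 5,
  5 := s 5 + ((B + a + 1) - s 5))"
 have e: "fold eff s_st s = s'"
  using assms(2,3) by (auto simp: s_st_def s'_def fun_eq_iff b)
 have hp: "s' 5 = max (s 5) (B + a + 1)" by (simp add: s'_def)
 have hi: "s' c = (if c = B + a then v else s c)" if "16 <= c" for c
  using that by (simp add: s'_def)
 have z: "!!c. s 5 <= c ==> s c = 0" and h16: "16 <= s 5" using assms(1) by (auto simp: sim_def heap_ok_def)
 have "heap_ok s'"
  unfolding heap_ok_def hp using h16 z hi by (auto simp: le_max_iff_disj)
 moreover have "s' 11 = s 11" "s' 12 = s 12" "s' 13 = s 13" "s' 4 = s 4"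
  by (simp_all add: s'_def b)
 moreover have "s' c = m c" if "16 <= c" "c < B" for c using that hi assms(1) by (simp add: sim_def)
 moreover have "s' (B + c) = (s0(a := v)) c" for c using hi[of "B + c"] assms(1) b by (simp add: sim_def)
 ultimately show ?thesis unfolding e using assms(1) hp by (auto simp: sim_def)
qed

lemma sim_cell: "sim m B s0 s ==> s (B + r) = s0 r" "sim m B s0 s ==> s 11 = B" "sim m B s0 s ==> 16 <= B"
 by (auto simp: sim_def)

lemma sim_ld:
 assumes "sim m B s0 s" "t ~= 6"
 shows "fold eff (s_ld t r) s = s(6 := B + r, t := s0 r)"
proof -
 have "B + r ~= 6" using sim_cell(3)[OF assms(1)] by simp
 thus ?thesis using sim_cell[OF assms(1)] by (simp add: s_ld_def)
qed

lemma sim_ad: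
 assumes "sim m B s0 s"
 shows "fold eff (s_ad r) s = s(6 := r, 7 := B + r)"
 using sim_cell[OF assms] by (simp add: s_ad_def)

lemma sim_store_reg:
 assumes "sim m B s0 s" "s 8 = v"
 shows "sim m B (s0(r := v)) (fold eff (s_ad r @ s_st) s)"
proof -
 have "fold eff (s_ad r @ s_st) s = fold eff s_st (s(6 := r, 7 := B + r))"
  by (simp add: sim_ad[OF assms(1)])
 note e = this
 have "sim m B (s0(r := v)) ..."
  by (rule sim_st) (use assms in "simp_all add: sim_upd")
 thus ?thesis by (simp only: e)
qed

lemma sim_exI:
 "runs P x p s T s' ==> T <= T' ==> sim m B z s' ==> EX s'. runs P x p s T' s' & sim m B z s'"
 using runs_mono by blast

lemma no_loop:
 fixes p :: prog
 assumes "!!s. A s ==> B s" "!!r q. p ~= WhileNZ r q"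
 shows "(ALL s. A s --> B s) & (ALL r q s. p = WhileNZ r q --> C r q s)"
 using assms by blast

text \<open>The second conjunct is about a loop whose guard has already been loaded into cell 8, the
  situation after each round. The 5 steps saved there pay for loading the guard when the loop is
  entered.\<close>

lemma sim_exec:
 assumes arr: "m 13 = length y" "16 <= m 12" "m 12 + length y <= B"
  "!!i. i < length y ==> m (m 12 + i) = of_bool (y ! i)"
 shows "exec {} y p s0 t R K s0' ==>
  (ALL s. sim m B s0 s --> (EX s'. runs P x (simp_prog p) s (20 * t) s' & sim m B s0' s')) &
  (ALL r q s. p = WhileNZ r q --> sim m B s0 s --> s 8 = s0 r -->
   (EX s'. runs P x (WhileNZ 8 (Seq (simp_prog q) (seqs (s_ld 8 r)))) s (20 * t - 5) s' & sim m B s0' s'))"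
proof (induction rule: exec.induct)
 case (1 s0)
 have "EX s'. runs P x (simp_prog Skip) s (20 * 1) s' & sim m B s0 s'" if "sim m B s0 s" for s
 proof -
  have "runs P x (simp_prog Skip) s 1 s" unfolding runs_def simp_prog.simps using exec.intros(1) by blast
  thus ?thesis by (rule sim_exI[OF _ _ that]) simp
 qed
 thus ?case by (rule no_loop) simp_all
next
 case (2 r n s0)
 have "EX s'. runs P x (simp_prog (Const r n)) s (20 * 1) s' & sim m B (s0(r := n)) s'" if "sim m B s0 s" for s
 proof -
  have "fold eff (s_ad r @ [Const 8 n] @ s_st) s = fold eff s_st (s(6 := r, 7 := B + r, 8 := n))"
   by (simp add: sim_ad[OF that])
  note e = this
  have "sim m B (s0(r := n)) ..."
   by (rule sim_st) (use that in "simp_all add: sim_upd")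
  hence "sim m B (s0(r := n)) (fold eff (s_ad r @ [Const 8 n] @ s_st) s)" by (simp only: e)
  moreover have "runs P x (simp_prog (Const r n)) s (20 * 1) (fold eff (s_ad r @ [Const 8 n] @ s_st) s)"
   unfolding simp_prog.simps by (rule runs_seqsI[OF _ refl]) (simp_all add: s_ad_def s_st_def)
  ultimately show ?thesis by blast
 qed
 thus ?case by (rule no_loop) simp_all
next
 case (3 r a b s0)
 have "EX s'. runs P x (simp_prog (Add r a b)) s (20 * 1) s' & sim m B (s0(r := s0 a + s0 b)) s'"
  if "sim m B s0 s" for s
 proof -
  let ?is = "s_ld 8 a @ s_ld 9 b @ [Add 8 8 9] @ s_ad r @ s_st"
  have q: "sim m B s0 (s(6 := B + a, 8 := s0 a))" using that by (simp add: sim_upd)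
  have "fold eff ?is s = fold eff (s_ad r @ s_st) (s(6 := B + a, 8 := s0 a, 6 := B + b, 9 := s0 b, 8 := s0 a + s0 b))"
   using sim_ld[OF that, of 8 a] sim_ld[OF q, of 9 b] by simp
  note e = this
  have "sim m B (s0(r := s0 a + s0 b)) ..."
   by (rule sim_store_reg) (use that in "simp_all add: sim_upd")
  hence "sim m B (s0(r := s0 a + s0 b)) (fold eff ?is s)" by (simp only: e)
  moreover have "runs P x (simp_prog (Add r a b)) s (20 * 1) (fold eff ?is s)"
   unfolding simp_prog.simps by (rule runs_seqsI[OF _ refl]) (simp_all add: s_ad_def s_st_def s_ld_def)
  ultimately show ?thesis by blast
 qed
 thus ?case by (rule no_loop) simp_all
next
 case (4 r a b s0)
 have "EX s'. runs P x (simp_prog (Sub r a b)) s (20 * 1) s' & sim m B (s0(r := s0 a - s0 b)) s'"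
  if "sim m B s0 s" for s
 proof -
  let ?is = "s_ld 8 a @ s_ld 9 b @ [Sub 8 8 9] @ s_ad r @ s_st"
  have q: "sim m B s0 (s(6 := B + a, 8 := s0 a))" using that by (simp add: sim_upd)
  have "fold eff ?is s = fold eff (s_ad r @ s_st) (s(6 := B + a, 8 := s0 a, 6 := B + b, 9 := s0 b, 8 := s0 a - s0 b))"
   using sim_ld[OF that, of 8 a] sim_ld[OF q, of 9 b] by simp
  note e = this
  have "sim m B (s0(r := s0 a - s0 b)) ..."
   by (rule sim_store_reg) (use that in "simp_all add: sim_upd")
  hence "sim m B (s0(r := s0 a - s0 b)) (fold eff ?is s)" by (simp only: e)
  moreover have "runs P x (simp_prog (Sub r a b)) s (20 * 1) (fold eff ?is s)"
   unfolding simp_prog.simps by (rule runs_seqsI[OF _ refl]) (simp_all add: s_ad_def s_st_def s_ld_def)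
  ultimately show ?thesis by blast
 qed
 thus ?case by (rule no_loop) simp_all
next
 case (5 r a s0)
 have "EX s'. runs P x (simp_prog (Load r a)) s (20 * 1) s' & sim m B (s0(r := s0 (s0 a))) s'"
  if "sim m B s0 s" for s
 proof -
  let ?is = "s_ld 8 a @ [Add 8 11 8, Load 8 8] @ s_ad r @ s_st"
  have "B + s0 a ~= 6" "B + s0 a ~= 8" using sim_cell(3)[OF that] by auto
  hence "fold eff ?is s = fold eff (s_ad r @ s_st) (s(6 := B + a, 8 := s0 (s0 a)))"
   using sim_ld[OF that, of 8 a] sim_cell[OF that] by simp
  note e = this
  have "sim m B (s0(r := s0 (s0 a))) ..."
   by (rule sim_store_reg) (use that in "simp_all add: sim_upd")
  hence "sim m B (s0(r := s0 (s0 a))) (fold eff ?is s)" by (simp only: e)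
  moreover have "runs P x (simp_prog (Load r a)) s (20 * 1) (fold eff ?is s)"
   unfolding simp_prog.simps by (rule runs_seqsI[OF _ refl]) (simp_all add: s_ad_def s_st_def s_ld_def)
  ultimately show ?thesis by blast
 qed
 thus ?case by (rule no_loop) simp_all
next
 case (6 a r s0)
 have "EX s'. runs P x (simp_prog (Store a r)) s (20 * 1) s' & sim m B (s0(s0 a := s0 r)) s'"
  if "sim m B s0 s" for s
 proof -
  let ?is = "s_ld 8 r @ s_ld 7 a @ [Add 7 11 7] @ s_st"
  have q: "sim m B s0 (s(6 := B + r, 8 := s0 r))" using that by (simp add: sim_upd)
  have "fold eff ?is s = fold eff s_st (s(6 := B + r, 8 := s0 r, 6 := B + a, 7 := B + s0 a))"
   using sim_ld[OF that, of 8 r] sim_ld[OF q, of 7 a] sim_cell[OF that] by simp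
  note e = this
  have "sim m B (s0(s0 a := s0 r)) ..."
   by (rule sim_st) (use that in "simp_all add: sim_upd")
  hence "sim m B (s0(s0 a := s0 r)) (fold eff ?is s)" by (simp only: e)
  moreover have "runs P x (simp_prog (Store a r)) s (20 * 1) (fold eff ?is s)"
   unfolding simp_prog.simps by (rule runs_seqsI[OF _ refl]) (simp_all add: s_st_def s_ld_def)
  ultimately show ?thesis by blast
 qed
 thus ?case by (rule no_loop) simp_all
next
 case (7 r a s0)
 have "EX s'. runs P x (simp_prog (Read r a)) s (20 * 1) s' & sim m B (s0(r := input_symbol y (s0 a))) s'"
  if "sim m B s0 s" for s
 proof -
  define s1 where "s1 = s(6 := B + a, 8 := s0 a, 9 := length y - s0 a)"
  have q1: "sim m B s0 s1" using that by (simp add: sim_upd s1_def)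
  have s13: "s 13 = length y" "s 12 = m 12" using that arr(1) by (auto simp: sim_def)
  have R1: "runs P x (seqs (s_ld 8 a @ [Sub 9 13 8])) s 5 s1"
   by (rule runs_seqsI) (use sim_ld[OF that, of 8 a] s13 in "auto simp: s1_def s_ld_def")
  define s2 where "s2 = (if s0 a < length y then s1(6 := 1, 8 := Suc (of_bool (y ! s0 a))) else s1(8 := 0))"
  have q2: "sim m B s0 s2" using q1 by (simp add: s2_def sim_upd)
  have v2: "s2 8 = input_symbol y (s0 a)" by (auto simp: s2_def input_symbol_def)
  have R2: "runs P x (IfNZ 9 (seqs [Add 8 12 8, Load 8 8, Const 6 1, Add 8 8 6]) (seqs [Const 8 0])) s1 (1 + 5) s2"
  proof (rule runs_IfNZ)
   assume "s1 9 ~= 0"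
   hence lt: "s0 a < length y" by (simp add: s1_def)
   have "s (m 12 + s0 a) = of_bool (y ! s0 a)"
    using arr(2,3) lt that arr(4)[OF lt] unfolding sim_def by simp
   moreover have "m 12 + s0 a ~= 6" "m 12 + s0 a ~= 8" "m 12 + s0 a ~= 9" using arr(2) by auto
   ultimately have "fold eff [Add 8 12 8, Load 8 8, Const 6 1, Add 8 8 6] s1 = s2"
    using lt s13 by (auto simp: s1_def s2_def fun_eq_iff)
   thus "runs P x (seqs [Add 8 12 8, Load 8 8, Const 6 1, Add 8 8 6]) s1 5 s2"
    by (intro runs_seqsI) auto
  next
   assume "s1 9 = 0"
   hence "fold eff [Const 8 0] s1 = s2" by (simp add: s1_def s2_def)
   thus "runs P x (seqs [Const 8 0]) s1 5 s2" by (intro runs_seqsI) auto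
  qed
  have R3: "runs P x (seqs (s_ad r @ s_st)) s2 9 (fold eff (s_ad r @ s_st) s2)"
   by (rule runs_seqsI[OF _ refl]) (simp_all add: s_ad_def s_st_def)
  have "runs P x (simp_prog (Read r a)) s (5 + (1 + 5 + 9)) (fold eff (s_ad r @ s_st) s2)"
   unfolding simp_prog.simps by (rule runs_Seq[OF R1 runs_Seq[OF R2 R3]])
  thus ?thesis by (rule sim_exI[OF _ _ sim_store_reg[OF q2 v2]]) simp
 qed
 thus ?case by (rule no_loop) simp_all
next
 case (8 ya s a l k v r)
 thus ?case by (simp only: empty_iff)
next
 case (9 p s0 t R K s1 q t' R' K' s2)
 have "EX s'. runs P x (simp_prog (Seq p q)) s (20 * (t + t')) s' & sim m B s2 s'" if "sim m B s0 s" for s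
 proof -
  note H = that
  obtain sa where a: "runs P x (simp_prog p) s (20 * t) sa" "sim m B s1 sa"
   using 9(3)[THEN conjunct1, rule_format, OF H] by blast
  obtain sb where b: "runs P x (simp_prog q) sa (20 * t') sb" "sim m B s2 sb" using 9(4)[THEN conjunct1, rule_format, OF a(2)] by blast
  show ?thesis unfolding simp_prog.simps by (rule sim_exI[OF runs_Seq[OF a(1) b(1)] _ b(2)]) simp
 qed
 thus ?case by (rule no_loop) simp_all
next
 case (10 s0 r p t R K s1 q)
 have "EX s'. runs P x (simp_prog (IfNZ r p q)) s (20 * (1 + t)) s' & sim m B s1 s'" if "sim m B s0 s" for s
 proof -
  define sa where "sa = s(6 := B + r, 8 := s0 r)"
  have qa: "sim m B s0 sa" using that by (simp add: sa_def sim_upd)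
  have Ra: "runs P x (seqs (s_ld 8 r)) s 4 sa"
   by (rule runs_seqsI) (use sim_ld[OF that, of 8 r] in "auto simp: sa_def s_ld_def")
  obtain sb where b: "runs P x (simp_prog p) sa (20 * t) sb" "sim m B s1 sb" using 10(3)[THEN conjunct1, rule_format, OF qa] by blast
  have "runs P x (IfNZ 8 (simp_prog p) (simp_prog q)) sa (1 + 20 * t) sb"
   by (rule runs_IfNZ) (use b 10(1) in "auto simp: sa_def")
  from runs_Seq[OF Ra this] show ?thesis unfolding simp_prog.simps by (rule sim_exI[OF _ _ b(2)]) simp
 qed
 thus ?case by (rule no_loop) simp_all
next
 case (11 s0 r q t R K s1 p)
 have "EX s'. runs P x (simp_prog (IfNZ r p q)) s (20 * (1 + t)) s' & sim m B s1 s'" if "sim m B s0 s" for s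
 proof -
  define sa where "sa = s(6 := B + r, 8 := s0 r)"
  have qa: "sim m B s0 sa" using that by (simp add: sa_def sim_upd)
  have Ra: "runs P x (seqs (s_ld 8 r)) s 4 sa"
   by (rule runs_seqsI) (use sim_ld[OF that, of 8 r] in "auto simp: sa_def s_ld_def")
  obtain sb where b: "runs P x (simp_prog q) sa (20 * t) sb" "sim m B s1 sb" using 11(3)[THEN conjunct1, rule_format, OF qa] by blast
  have "runs P x (IfNZ 8 (simp_prog p) (simp_prog q)) sa (1 + 20 * t) sb"
   by (rule runs_IfNZ) (use b 11(1) in "auto simp: sa_def")
  from runs_Seq[OF Ra this] show ?thesis unfolding simp_prog.simps by (rule sim_exI[OF _ _ b(2)]) simp
 qed
 thus ?case by (rule no_loop) simp_all
next
 case (12 s0 r p)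
 have w: "runs P x (WhileNZ 8 (Seq (simp_prog p) (seqs (s_ld 8 r)))) s 15 s" if "s 8 = s0 r" for s
  by (rule runs_mono[OF runs_While_0]) (use that 12 in simp_all)
 have "EX s'. runs P x (simp_prog (WhileNZ r p)) s (20 * 1) s' & sim m B s0 s'" if "sim m B s0 s" for s
 proof -
  define sa where "sa = s(6 := B + r, 8 := s0 r)"
  have qa: "sim m B s0 sa" using that by (simp add: sa_def sim_upd)
  have Ra: "runs P x (seqs (s_ld 8 r)) s 4 sa"
   by (rule runs_seqsI) (use sim_ld[OF that, of 8 r] in "auto simp: sa_def s_ld_def")
  have "sa 8 = s0 r" by (simp add: sa_def)
  from runs_Seq[OF Ra w[of sa, OF this]] show ?thesis unfolding simp_prog.simps by (rule sim_exI[OF _ _ qa]) simp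
 qed
 thus ?case using sim_exI[OF w, of _ "20 * 1 - 5"] by (intro conjI allI impI) (blast, auto simp only: prog.inject)
next
 case (13 s0 r p t R K s1 t' R' K' s2)
 have t': "1 <= t'" using 13(3) by (cases rule: exec.cases) auto
 let ?W = "WhileNZ 8 (Seq (simp_prog p) (seqs (s_ld 8 r)))"
 have w: "EX s'. runs P x ?W s (20 * (1 + t + t') - 5) s' & sim m B s2 s'" if "sim m B s0 s" "s 8 = s0 r" for s
 proof -
  note H = that
  obtain sa where a: "runs P x (simp_prog p) s (20 * t) sa" "sim m B s1 sa"
   using 13(4)[THEN conjunct1, rule_format, OF H(1)] by blast
  define sb where "sb = sa(6 := B + r, 8 := s1 r)"
  have qb: "sim m B s1 sb" "sb 8 = s1 r" using a by (simp_all add: sb_def sim_upd)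
  have Rb: "runs P x (seqs (s_ld 8 r)) sa 4 sb"
   by (rule runs_seqsI) (use sim_ld[OF a(2), of 8 r] in "auto simp: sb_def s_ld_def")
  obtain sc where c: "runs P x ?W sb (20 * t' - 5) sc" "sim m B s2 sc" using 13(5)[THEN conjunct2, rule_format, OF refl qb] by blast
  have "s 8 ~= 0" using that 13(1) by simp
  from runs_While_step[OF this runs_Seq[OF a(1) Rb] c(1)] show ?thesis
   by (rule sim_exI[OF _ _ c(2)]) (use t' in simp)
 qed
 have "EX s'. runs P x (simp_prog (WhileNZ r p)) s (20 * (1 + t + t')) s' & sim m B s2 s'" if "sim m B s0 s" for s
 proof -
  define sa where "sa = s(6 := B + r, 8 := s0 r)"
  have qa: "sim m B s0 sa" "sa 8 = s0 r" using that by (simp_all add: sa_def sim_upd)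
  have Ra: "runs P x (seqs (s_ld 8 r)) s 4 sa"
   by (rule runs_seqsI) (use sim_ld[OF that, of 8 r] in "auto simp: sa_def s_ld_def")
  obtain sb where b: "runs P x ?W sa (20 * (1 + t + t') - 5) sb" "sim m B s2 sb" using w[OF qa] by blast
  from runs_Seq[OF Ra b(1)] show ?thesis unfolding simp_prog.simps by (rule sim_exI[OF _ _ b(2)]) simp
 qed
 thus ?case using w by (intro conjI allI impI) (blast, auto simp only: prog.inject)
qed

definition p_sim :: "prog => prog" where
 "p_sim p = Seq p_arr (Seq (seqs (mov 11 5)) (Seq (simp_prog p)
  (Seq (seqs (s_ld 8 0 @ s_ld 9 1 @ s_ld 10 2)) p_triple)))"

text \<open>Determinism of the machine makes the final memory, and likewise the running time,
  unique.\<close>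

definition sim_val :: "prog => bool list => big3" where
 "sim_val p y = (let s = (THE s. EX t R. exec {} y p (%_. 0) t R {} s) in (Big (s 0), Big (s 1), Big (s 2)))"

definition sim_time :: "prog => bool list => nat" where
 "sim_time p y = (THE t. EX s R. exec {} y p (%_. 0) t R {} s)"

lemma functional_empty: "functional {}"
 by (simp add: functional_def)

lemma sim_val_time:
 assumes "exec {} y p (%_. 0) t R {} s"
 shows "sim_val p y = (Big (s 0), Big (s 1), Big (s 2))" "sim_time p y = t"
proof -
 note det = exec_deterministic[OF functional_empty assms]
 have "(THE s. EX t R. exec {} y p (%_. 0) t R {} s) = s"
  by (rule the_equality) (use assms det in blast)+
 thus "sim_val p y = (Big (s 0), Big (s 1), Big (s 2))" by (simp add: sim_val_def Let_def)
 show "sim_time p y = t"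
  unfolding sim_time_def by (rule the_equality) (use assms det in blast)+
qed

lemma outputs_sim:
 assumes "outputs p y v t"
 shows "rep3 (sim_val p y) v" "sim_time p y = t"
 using assms unfolding outputs_def oracle_run_def
 by (auto simp: rep3_def holds_rat_def sim_val_time numeral_2_eq_2)

lemma impl_sim:
 "impl P x (p_sim p) {y. EX v t. outputs p y v t} (sim_val p) (%y. 20 * sim_time p y + 8 * length y + 50)"
proof (rule implI)
 fix s and y :: "bool list"
 assume 0: "heap_ok s" "y : {y. EX v t. outputs p y v t}" "rep s (s 3) (val_of y)"
 then obtain t R z where ex: "exec {} y p (%_. 0) t R {} z"
  unfolding outputs_def oracle_run_def by blast
 obtain s1 where 1: "runs P x p_arr s (8 * length y + 6) s1" "heap_ok s1" "heap_le s s1" "s1 4 = s 4"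
  "s1 12 = s 5" "s1 13 = length y" "s1 5 = s 5 + length y"
  "!!i. i < length y ==> s1 (s 5 + i) = of_bool (y ! i)"
  using arr_correct[OF 0(1,3)] by blast
 define B where "B = s1 5"
 define s2 where "s2 = s1(6 := 0, 11 := B)"
 have R2: "runs P x (seqs (mov 11 5)) s1 3 s2"
  by (rule runs_seqsI) (auto simp: mov_def s2_def B_def)
 have h: "16 <= s 5" using 0(1) by (simp add: heap_ok_def)
 have ok2: "heap_ok s2" "heap_le s1 s2" using 1(2) by (simp_all add: s2_def heap_upd)
 have B16: "16 <= B" using 1(7) h by (simp add: B_def)
 have sim0: "sim s2 B (%_. 0) s2"
  using ok2 B16 by (auto simp: sim_def heap_ok_def) (auto simp: s2_def B_def)
 obtain s3 where 3: "runs P x (simp_prog p) s2 (20 * t) s3" "sim s2 B z s3"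
  using sim_exec[OF _ _ _ _ ex, of s2 B P x] sim0 1 h by (auto simp: s2_def B_def)
 define s4 where "s4 = s3(6 := B + 2, 8 := z 0, 9 := z 1, 10 := z 2)"
 have e4: "fold eff (s_ld 8 0 @ s_ld 9 1 @ s_ld 10 2) s3 = s4"
 proof -
  have q1: "sim s2 B z (s3(6 := B + 0, 8 := z 0))" using 3(2) by (simp add: sim_upd)
  hence q2: "sim s2 B z (s3(6 := B + 0, 8 := z 0, 6 := B + 1, 9 := z 1))" by (simp add: sim_upd)
  show ?thesis
   using sim_ld[OF 3(2), of 8 0] sim_ld[OF q1, of 9 1] sim_ld[OF q2, of 10 2]
   by (auto simp: s4_def)
 qed
 have R4: "runs P x (seqs (s_ld 8 0 @ s_ld 9 1 @ s_ld 10 2)) s3 10 s4"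
  by (rule runs_seqsI[OF _ e4]) (simp_all add: s_ld_def)
 have ok4: "heap_ok s4" using 3(2) by (simp add: s4_def heap_upd sim_def)
 have le24: "heap_le s2 s4"
 proof -
  have "s2 5 = B" by (simp add: s2_def B_def)
  hence "heap_le s2 s3" using 3(2) unfolding sim_def heap_le_def by simp
  thus ?thesis by (simp add: s4_def heap_upd)
 qed
 obtain s5 where 5: "runs P x p_triple s4 20 s5" "heap_ok s5" "heap_le s4 s5" "s5 4 = s4 4"
  "rep s5 (s5 3) (val_of (Big (s4 8), Big (s4 9), Big (s4 10)))"
  using triple_correct[OF ok4] by blast
 have "runs P x (p_sim p) s (8 * length y + 6 + (3 + (20 * t + (10 + 20)))) s5"
  unfolding p_sim_def by (intro runs_Seq[OF 1(1)] runs_Seq[OF R2] runs_Seq[OF 3(1)] runs_Seq[OF R4 5(1)])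
 hence "runs P x (p_sim p) s (20 * sim_time p y + 8 * length y + 50) s5"
  by (rule runs_mono) (simp add: sim_val_time[OF ex])
 moreover have "heap_le s s5"
  using heap_le_trans[OF 1(3) heap_le_trans[OF ok2(2) heap_le_trans[OF le24 5(3)]]] .
 moreover have "s5 4 = s 4" using 5(4) 3(2) 1(4) by (simp add: s4_def sim_def s2_def)
 moreover have "rep s5 (s5 3) (val_of (sim_val p y))"
  using 5(5) by (simp add: sim_val_time[OF ex] s4_def)
 ultimately show "EX s'. runs P x (p_sim p) s (20 * sim_time p y + 8 * length y + 50) s' & heap_ok s' &
   heap_le s s' & s' 4 = s 4 & rep s' (s' 3) (val_of (sim_val p y))"
  using 5(2) by blast
qed

section \<open>Whole programs\<close>

text \<open>Consing the symbols as they arrive yields the input in reverse order; for this reason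
  whole programs are specified on \<open>rev x\<close>.\<close>

definition p_read :: prog where
 "p_read = Seq (seqs [Const 5 16, Const 3 0, Const 12 0]) (Seq (Read 8 12)
  (WhileNZ 8 (Seq (seqs ([Const 6 1, Sub 7 8 6] @ alloc @ [Const 6 1, Add 12 12 6])) (Read 8 12))))"

lemma runs_Read: "runs P x (Read r a) s 1 (s(r := input_symbol x (s a)))"
 unfolding runs_def using exec.intros(7) by blast

lemma read_loop:
 assumes "heap_ok s" "i <= length x" "s 12 = i" "s 8 = input_symbol x i"
  "rep s (s 3) (val_of (rev (take i x)))"
 shows "EX s'. runs P x (WhileNZ 8 (Seq (seqs ([Const 6 1, Sub 7 8 6] @ alloc @ [Const 6 1, Add 12 12 6])) (Read 8 12)))
  s (1 + 20 * (length x - i)) s' & heap_ok s' & rep s' (s' 3) (val_of (rev x))"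
 using assms
proof (induction "length x - i" arbitrary: i s)
 case 0
 hence "s 8 = 0" by (simp add: input_symbol_def)
 thus ?case using 0 runs_While_0[of s 8] by (intro exI[of _ s]) auto
next
 case (Suc n)
 hence i: "i < length x" by simp
 let ?is = "[Const 6 1, Sub 7 8 6] @ alloc @ [Const 6 1, Add 12 12 6]"
 define s1 where "s1 = s(6 := 1, 7 := of_bool (x ! i))"
 have s8: "s 8 = of_bool (x ! i) + 1" using Suc.prems(4) i by (simp add: input_symbol_def)
 have e1: "fold eff [Const 6 1, Sub 7 8 6] s = s1" by (simp add: s1_def s8)
 have ok1: "heap_ok s1" "heap_le s s1" using Suc.prems(1) by (simp_all add: s1_def heap_upd)
 define s2 where "s2 = fold eff alloc s1"
 note A = alloc_correct[OF ok1(1), folded s2_def]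
 have r2: "rep s2 (s2 3) (VPair (val_of (x ! i)) (val_of (rev (take i x))))"
  unfolding s2_def
  by (rule alloc_rep[OF ok1(1)]) (use Suc.prems(5) in "auto simp: s1_def rep_upd val_of_bool_def")
 hence r2': "rep s2 (s2 3) (val_of (rev (take (Suc i) x)))"
  using i by (simp add: take_Suc_conv_app_nth)
 have s2_12: "s2 12 = i"
 proof -
  obtain h where "s1 5 = h + 16" using ok1(1) by (metis heap_ok_def add.commute le_Suc_ex)
  thus ?thesis using Suc.prems(3) by (simp add: s2_def alloc_def s1_def)
 qed
 define s3 where "s3 = s2(6 := 1, 12 := Suc i)"
 have e3: "fold eff ?is s = s3"
  using e1 s2_12 by (simp add: s3_def s2_def)
 have R3: "runs P x (seqs ?is) s 11 s3"
  by (rule runs_seqsI[OF _ e3]) (simp_all add: alloc_def)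
 define s4 where "s4 = s3(8 := input_symbol x (Suc i))"
 have R4: "runs P x (Read 8 12) s3 1 s4" using runs_Read[of P x 8 12 s3] by (simp add: s4_def s3_def)
 have "heap_ok s4" "rep s4 (s4 3) (val_of (rev (take (Suc i) x)))" "s4 12 = Suc i" "s4 8 = input_symbol x (Suc i)"
  using A(1) r2' by (simp_all add: s4_def s3_def heap_upd rep_upd)
 note q = this
 have n: "n = length x - Suc i" using Suc.hyps(2) i by simp
 obtain s5 where 5: "runs P x (WhileNZ 8 (Seq (seqs ?is) (Read 8 12))) s4 (1 + 20 * (length x - Suc i)) s5"
  "heap_ok s5" "rep s5 (s5 3) (val_of (rev x))"
  using Suc.hyps(1)[OF n q(1) Suc_leI[OF i] q(3,4,2)] by blast
 have "runs P x (WhileNZ 8 (Seq (seqs ?is) (Read 8 12))) s (1 + (11 + 1) + (1 + 20 * (length x - Suc i))) s5"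
  by (rule runs_While_step[OF _ runs_Seq[OF R3 R4] 5(1)]) (simp add: s8)
 hence "runs P x (WhileNZ 8 (Seq (seqs ?is) (Read 8 12))) s (1 + 20 * (length x - i)) s5"
  by (rule runs_mono) (use i in simp)
 thus ?case using 5 by blast
qed

lemma read_correct:
 obtains s where "runs P x p_read (%_. 0) (20 * length x + 10) s" "heap_ok s" "rep s (s 3) (val_of (rev x))"
proof -
 define s1 :: mem where "s1 = (%_. 0)(5 := 16)"
 have R1: "runs P x (seqs [Const 5 16, Const 3 0, Const 12 0]) (%_. 0) 4 s1"
  by (rule runs_seqsI) (auto simp: s1_def)
 define s2 where "s2 = s1(8 := input_symbol x 0)"
 have R2: "runs P x (Read 8 12) s1 1 s2" using runs_Read[of P x 8 12 s1] by (simp add: s2_def s1_def)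
 have "heap_ok s2" by (auto simp: s2_def s1_def heap_ok_def)
 moreover have "s2 12 = 0" "s2 8 = input_symbol x 0" "rep s2 (s2 3) (val_of (rev (take 0 x)))"
  by (auto simp: s2_def s1_def)
 ultimately obtain s3 where 3: "runs P x (WhileNZ 8 (Seq (seqs ([Const 6 1, Sub 7 8 6] @ alloc @ [Const 6 1, Add 12 12 6])) (Read 8 12)))
  s2 (1 + 20 * (length x - 0)) s3" "heap_ok s3" "rep s3 (s3 3) (val_of (rev x))"
  using read_loop[of s2 0 x P] by blast
 have "runs P x p_read (%_. 0) (4 + (1 + (1 + 20 * (length x - 0)))) s3"
  unfolding p_read_def by (rule runs_Seq[OF R1 runs_Seq[OF R2 3(1)]])
 hence "runs P x p_read (%_. 0) (20 * length x + 10) s3" by (rule runs_mono) simp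
 thus thesis using that 3 by blast
qed

definition p_main :: "prog => prog" where
 "p_main p = Seq p_read (Seq p (seqs [Const 6 1, Add 7 3 6, Load 7 7, Load 0 3, Load 1 7, Add 7 7 6, Load 2 7]))"

lemma main_correct:
 assumes "impl P x p {rev x} f T" "rep3 (f (rev x)) v"
 shows "EX t R K. oracle_run P (p_main p) x v t R K & t <= T (rev x) + 20 * length x + 20"
proof -
 obtain s1 where 1: "runs P x p_read (%_. 0) (20 * length x + 10) s1" "heap_ok s1" "rep s1 (s1 3) (val_of (rev x))"
  using read_correct by blast
 obtain s2 where 2: "runs P x p s1 (T (rev x)) s2" "heap_ok s2" "rep s2 (s2 3) (val_of (f (rev x)))"
  using implE[OF assms(1) 1(2) _ 1(3)] by blast
 obtain a b d where f: "f (rev x) = (Big a, Big b, Big d)"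
  by (metis big.exhaust prod.exhaust)
 define w where "w = s2 (s2 3 + 1)"
 have r: "16 <= s2 3" "s2 (s2 3) = a" "16 <= w" "s2 w = b" "s2 (w + 1) = d"
  using 2(3) by (auto simp: f w_def val_of_prod_def val_of_big_def)
 define s3 where "s3 = s2(6 := 1, 0 := a, 1 := b, 7 := w + 1, 2 := d)"
 have e3: "fold eff [Const 6 1, Add 7 3 6, Load 7 7, Load 0 3, Load 1 7, Add 7 7 6, Load 2 7] s2 = s3"
 proof -
  have "s2 3 + 1 ~= 6" "s2 3 + 1 ~= 7" "s2 3 ~= 6" "s2 3 ~= 7" "w ~= 0" "w ~= 6" "w ~= 7" "w + 1 ~= 0" "w + 1 ~= 1"
   "w + 1 ~= 6" "w + 1 ~= 7" using r by auto
  thus ?thesis using r by (auto simp: s3_def fun_eq_iff w_def)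
 qed
 have R3: "runs P x (seqs [Const 6 1, Add 7 3 6, Load 7 7, Load 0 3, Load 1 7, Add 7 7 6, Load 2 7]) s2 8 s3"
  by (rule runs_seqsI[OF _ e3]) simp_all
 have "holds_rat s3 0 v"
  using assms(2) by (simp add: holds_rat_def s3_def f rep3_def)
 moreover have "runs P x (p_main p) (%_. 0) (20 * length x + 10 + (T (rev x) + 8)) s3"
  unfolding p_main_def by (rule runs_Seq[OF 1(1) runs_Seq[OF 2(1) R3]])
 ultimately show ?thesis unfolding runs_def oracle_run_def by fastforce
qed

lemma exec_empty_oracle: "exec {} x p s t R K s' ==> K = {}"
 by (induction rule: exec.induct) auto

lemma main_outputs:
 assumes "impl {} x p {rev x} f T" "rep3 (f (rev x)) v"
 shows "EX t. outputs (p_main p) x v t & t <= T (rev x) + 20 * length x + 20"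
 using main_correct[OF assms] exec_empty_oracle unfolding outputs_def oracle_run_def by blast

lemma exec_restrict:
 "exec {(y, k, v) : P. k <= b} x p s t R K s' ==> exec P x p s t R K s' & K <= {..b}"
proof (induction rule: exec.induct)
 case (8 y s a l k v r)
 thus ?case using exec.intros(8)[of y s a l k v P x r] by auto
qed (auto simp del: One_nat_def fun_upd_apply intro: exec.intros[simplified One_nat_def[symmetric]] exec.intros)

definition p_rmap :: "prog => prog" where
 "p_rmap p = Seq (p_pair (seqs [Const 3 0]) (seqs []))
  (p_fold (p_pair (Seq (seqs [Const 6 1, Add 3 3 6, Load 3 3]) p) (seqs [Load 3 3])))"

lemma impl_rmap:
 fixes f :: "'a::repr => 'b::repr"
 assumes "impl P x p D f T"
 shows "impl P x (p_rmap p) {xs. set xs <= D} (%xs. rev (map f xs)) (%xs. 300 + (\<Sum>y\<leftarrow>xs. T y + 300))"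
proof -
 let ?snd = "seqs [Const 6 1, Add 3 3 6, Load 3 3]"
 have g: "impl P x (p_pair (Seq ?snd p) (seqs [Load 3 3])) {z :: 'b list * 'a. snd z : D}
  (%z. f (snd z) # fst z) (%z. (4 + T (snd z)) + 2 + 40)"
  by (rule impl_cong[OF impl_pair[OF impl_comp[OF impl_sub[OF impl_snd] assms] impl_sub[OF impl_fst]]])
   (auto simp: val_of_prod_def)
 note fl = impl_foldl[OF g]
 have i: "impl P x (p_pair (seqs [Const 3 0]) (seqs [])) UNIV (%xs :: 'a list. ([] :: 'b list, xs)) (%_. 2 + 1 + 40)"
  by (rule impl_pair[OF impl_const impl_id]) simp
 have t: "fold_time 200 (%z. (4 + T (snd z)) + 2 + 40) (%a y. f y # a) a xs <= 200 + (\<Sum>y\<leftarrow>xs. T y + 300)" for a xs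
 proof (induction xs arbitrary: a)
  case (Cons y ys)
  from Cons[of "f y # a"] show ?case by simp
 qed simp
 have c: "impl P x (p_rmap p) {xs. set xs <= D} (%xs. foldl (%a y. f y # a) (fst ([], xs)) (snd ([] :: 'b list, xs)))
  (%xs. 2 + 1 + 40 + fold_time 200 (%z. (4 + T (snd z)) + 2 + 40) (%a y. f y # a) (fst ([], xs)) (snd ([] :: 'b list, xs)))"
  unfolding p_rmap_def by (rule impl_comp[OF impl_sub[OF i] fl]) auto
 show ?thesis
 proof (rule impl_mono[OF c], goal_cases)
  case (3 v)
  thus ?case using t[of "[]" v] by simp
 qed (auto simp: foldl_Cons_rev)
qed

section \<open>Counting modulo a prime\<close>

text \<open>Each orbit of the iterates of \<open>si\<close> has 1 or \<open>p\<close> elements. The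
  induction removes one orbit of \<open>p\<close> elements at a time.\<close>

lemma prime_order_orbits:
 fixes si :: "'a => 'a"
 assumes p: "prime p" and X: "finite X" and si: "!!x. x : X ==> si x : X"
  and per: "!!x. x : X ==> (si ^^ p) x = x"
 shows "[card X = card {x : X. si x = x}] (mod p)"
 using X si per
proof (induction "card X" arbitrary: X rule: less_induct)
 case less
 note X = less.prems(1) and si = less.prems(2) and per = less.prems(3)
 have p0: "p > 0" using p by (simp add: prime_gt_0_nat)
 let ?Y = "{x : X. si x ~= x}"
 let ?O = "%x. (%i. (si ^^ i) x) ` {..<p}"
 have inX: "(si ^^ i) x : X" if "x : X" for i x using that si by (induction i) auto
 have perm: "(si ^^ (p * k)) x = x" if "x : X" for k x
 proof (induction k)
  case (Suc k)
  have "(si ^^ (p * Suc k)) x = (si ^^ (p * k)) ((si ^^ p) x)"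
   by (simp add: funpow_add[symmetric] add.commute del: funpow.simps flip: funpow_add[unfolded comp_def, THEN fun_cong])
  thus ?case using per[OF that] Suc by simp
 qed simp
 have modp: "(si ^^ i) x = (si ^^ (i mod p)) x" if "x : X" for i x
 proof -
  have "(si ^^ i) x = (si ^^ (i mod p + p * (i div p))) x" by simp
  also have "... = (si ^^ (i mod p)) ((si ^^ (p * (i div p))) x)" by (simp only: funpow_add o_apply)
  finally show ?thesis using perm[OF that] by simp
 qed
 have O_all: "?O x = range (%i. (si ^^ i) x)" if "x : X" for x
 proof
  show "range (%i. (si ^^ i) x) <= ?O x"
  proof
   fix y assume "y : range (%i. (si ^^ i) x)"
   hence "EX i. y = (si ^^ (i mod p)) x" using modp[OF that] by auto
   thus "y : ?O x" using p0 by auto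
  qed
 qed auto
 have inj: "inj_on (%i. (si ^^ i) x) {..<p}" if x: "x : ?Y" for x
 proof (rule ccontr)
  assume "~ ?thesis"
  then obtain i j where ij: "i < j" "j < p" "(si ^^ i) x = (si ^^ j) x"
   unfolding inj_on_def by (metis lessThan_iff nat_neq_iff)
  have xX: "x : X" using x by simp
  have "(si ^^ (p - i)) ((si ^^ i) x) = (si ^^ (p - i)) ((si ^^ j) x)" using ij by simp
  hence "(si ^^ (p - i + i)) x = (si ^^ (p - i + j)) x" by (simp only: funpow_add o_apply)
  moreover have "p - i + i = p" "p - i + j = p + (j - i)" using ij by auto
  ultimately have "(si ^^ p) x = (si ^^ (p + (j - i))) x" by (simp only:)
  hence "x = (si ^^ (p + (j - i))) x" by (simp only: per[OF xX])
  also have "... = (si ^^ ((p + (j - i)) mod p)) x" by (rule modp[OF xX])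
  also have "(p + (j - i)) mod p = j - i" using ij by (subst mod_add_self1) simp
  finally have d: "(si ^^ (j - i)) x = x" by simp
  define d where "d = j - i"
  have dmul: "(si ^^ (d * k)) x = x" for k
  proof (induction k)
   case (Suc k)
   have "(si ^^ (d * k + d)) x = (si ^^ (d * k)) ((si ^^ d) x)" by (simp only: funpow_add o_apply)
   thus ?case using d Suc by (simp add: d_def add.commute)
  qed simp
  have "0 < d" "d < p" using ij by (auto simp: d_def)
  hence "coprime d p" using p by (metis coprime_commute dvd_imp_le not_le prime_imp_coprime_nat)
  \<comment> \<open>If two of the \<open>p\<close> iterates coincided, \<open>si ^^ d\<close> would
    fix \<open>x\<close> for some \<open>0 < d < p\<close>. As \<open>d\<close> is invertible modulo
    \<open>p\<close>, already \<open>si\<close> itself would fix \<open>x\<close>.\<close>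
  then obtain k where "[d * k = Suc 0] (mod p)" using cong_solve_coprime_nat by blast
  hence "(d * k) mod p = 1 mod p" by (simp add: cong_def)
  moreover have "1 mod p = 1" using prime_gt_1_nat[OF p] by simp
  ultimately have "(si ^^ (d * k)) x = si x" using modp[OF xX, of "d * k"] by simp
  thus False using dmul x by simp
 qed
 show ?case
 proof (cases "?Y = {}")
  case True
  hence "{x : X. si x = x} = X" by auto
  thus ?thesis by simp
 next
  case False
  then obtain x where x: "x : ?Y" by blast
  hence xX: "x : X" by simp
  have bk: "z = (si ^^ (p - 1)) (si z)" if "z : X" for z
   using per[OF that] p0 by (cases p) (simp_all add: funpow_swap1)
  have OX: "?O x <= X" using inX[OF xX] by auto
  have nofix: "si y ~= y" if y: "y : ?O x" for y
  proof
   assume fy: "si y = y"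
   obtain i where i: "i < p" "y = (si ^^ i) x" using y by auto
   have "(si ^^ k) y = y" for k using fy by (induction k) auto
   hence "(si ^^ (p - i)) ((si ^^ i) x) = y" using i by simp
   hence "(si ^^ (p - i + i)) x = y" by (simp only: funpow_add o_apply)
   thus False using i per[OF xX] x fy by simp
  qed
  have stay: "si z : X - ?O x" if z: "z : X - ?O x" for z
  proof -
   have "si z ~= (si ^^ i) x" for i
   proof
    assume "si z = (si ^^ i) x"
    hence "z = (si ^^ (p - 1 + i)) x" using bk[of z] z by (simp add: funpow_add)
    thus False using O_all[OF xX] z by blast
   qed
   thus ?thesis using si[of z] z by blast
  qed
  have cO: "card (?O x) = p" using card_image[OF inj[OF x]] by simp
  have cX: "card X = card (X - ?O x) + p"
   using card_Diff_subset[of "?O x" X] card_mono[OF X OX] OX cO by simp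
  have "[card (X - ?O x) = card {z : X - ?O x. si z = z}] (mod p)"
   by (rule less.hyps) (use cX p0 X stay per in auto)
  moreover have "{z : X - ?O x. si z = z} = {z : X. si z = z}" using nofix by blast
  ultimately show ?thesis unfolding cX by (simp add: cong_def)
 qed
qed

text \<open>Induction on \<open>a\<close>: the iterate \<open>si ^^ p\<close> has period
  \<open>p ^ a\<close>, and on its fixed points \<open>si\<close> has period
  \<open>p\<close>.\<close>

lemma prime_power_orbits:
 fixes si :: "'a => 'a"
 assumes p: "prime p" and "finite X" and "!!x. x : X ==> si x : X"
  and "!!x. x : X ==> (si ^^ (p ^ a)) x = x"
 shows "[card X = card {x : X. si x = x}] (mod p)"
 using assms(2-4)
proof (induction a arbitrary: X si)
 case 0
 hence "{x : X. si x = x} = X" by auto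
 thus ?case by simp
next
 case (Suc a)
 let ?F = "{x : X. (si ^^ p) x = x}"
 have inX: "(si ^^ i) x : X" if "x : X" for i x using that Suc.prems(2) by (induction i) auto
 have 1: "[card X = card ?F] (mod p)"
  by (rule Suc.IH) (use Suc.prems inX in "auto simp: funpow_mult")
 have "[card ?F = card {x : ?F. si x = x}] (mod p)"
 proof (rule prime_order_orbits[OF p])
  fix x assume "x : ?F"
  thus "si x : ?F" using Suc.prems(2) by (auto simp: funpow_swap1[symmetric])
 qed (use Suc.prems in auto)
 moreover have "{x : ?F. si x = x} = {x : X. si x = x}"
 proof -
  have "(si ^^ i) x = x" if "si x = x" for x i using that by (induction i) auto
  thus ?thesis by auto
 qed
 ultimately show ?case using 1 by (auto intro: cong_trans)
qed

text \<open>Since \<open>g\<close> is invariant, \<open>si\<close> acts on each level set of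
  \<open>g\<close>, and the counting lemma applies to each of them.\<close>

lemma sum_fixpoints:
 fixes si :: "'a => 'a" and g :: "'a => int"
 assumes p: "prime p" and X: "finite X" and si: "!!x. x : X ==> si x : X"
  and per: "!!x. x : X ==> (si ^^ (p ^ a)) x = x" and g: "!!x. x : X ==> g (si x) = g x"
 shows "[(SUM x:X. g x) = (SUM x:{x : X. si x = x}. g x)] (mod int p)"
proof -
 have s: "(SUM x:Y. g x) = (SUM c:g ` X. c * int (card {x : Y. g x = c}))" if "Y <= X" for Y
 proof -
  have "(SUM x:Y. g x) = (SUM c:g ` X. SUM x:{x : Y. g x = c}. g x)"
   using that X by (intro sum.group[symmetric]) (auto intro: finite_subset)
  also have "... = (SUM c:g ` X. c * int (card {x : Y. g x = c}))"
   by (intro sum.cong refl) (auto simp: mult.commute)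
  finally show ?thesis .
 qed
 have "[(SUM c:g ` X. c * int (card {x : X. g x = c})) =
  (SUM c:g ` X. c * int (card {x : {x : X. si x = x}. g x = c}))] (mod int p)"
 proof (intro cong_sum cong_mult cong_refl)
  fix c
  have "[card {x : X. g x = c} = card {x : {x : X. g x = c}. si x = x}] (mod p)"
   by (rule prime_power_orbits[OF p, of _ _ a]) (use X si per g in auto)
  moreover have "{x : {x : X. g x = c}. si x = x} = {x : {x : X. si x = x}. g x = c}" by auto
  ultimately show "[int (card {x : X. g x = c}) = int (card {x : {x : X. si x = x}. g x = c})] (mod int p)"
   by (simp add: cong_int_iff)
 qed
 thus ?thesis using s[of X] s[of "{x : X. si x = x}"] by auto
qed

section \<open>Edge sets\<close>

definition pairs :: "nat set => nat set set" where
 "pairs V = {e. e <= V & card e = 2}"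

text \<open>\<open>R\<close> need not be symmetric: an edge is present if either orientation is
  related, so asymmetric descriptions such as \<open>i < j\<close> can be used directly.\<close>

definition ES :: "nat set => (nat => nat => bool) => nat set set" where
 "ES V R = {{u, v} | u v. u : V & v : V & u ~= v & R u v}"

lemma ES_iff: "{u, v} : ES V R \<longleftrightarrow> u : V & v : V & u ~= v & (R u v | R v u)"
 by (auto simp: ES_def doubleton_eq_iff)

lemma ESE:
 assumes "e : ES V R"
 obtains u v where "e = {u, v}" "u : V" "v : V" "u ~= v" "R u v"
 using assms unfolding ES_def by blast

lemma ES_sub: "ES V R <= pairs V"
 by (auto simp: ES_def pairs_def card_2_iff)

lemma ES_mono: "(!!u v. u : V ==> v : V ==> u ~= v ==> R u v ==> R' u v) ==> ES V R <= ES V R'"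
 unfolding ES_def by blast

lemma ES_cong: "(!!u v. u : V ==> v : V ==> u ~= v ==> R u v \<longleftrightarrow> R' u v) ==> ES V R = ES V R'"
 by (intro equalityI ES_mono) auto

lemma ES_image:
 assumes "\<pi> permutes V"
 shows "(`) \<pi> ` ES V R = ES V (%u v. R (inv \<pi> u) (inv \<pi> v))"
proof -
 have i: "inv \<pi> (\<pi> u) = u" "\<pi> (inv \<pi> u) = u" for u using permutes_inverses[OF assms] by auto
 show ?thesis
 proof (intro equalityI subsetI)
  fix e assume "e : (`) \<pi> ` ES V R"
  then obtain u v where e: "e = {\<pi> u, \<pi> v}" "u : V" "v : V" "u ~= v" "R u v" by (auto elim!: ESE)
  have "\<pi> u ~= \<pi> v" using e(4) i by metis
  thus "e : ES V (%u v. R (inv \<pi> u) (inv \<pi> v))"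
   unfolding e(1) ES_iff using i e permutes_in_image[OF assms] by simp
 next
  fix e assume "e : ES V (%u v. R (inv \<pi> u) (inv \<pi> v))"
  then obtain u v where e: "e = {u, v}" "u : V" "v : V" "u ~= v" "R (inv \<pi> u) (inv \<pi> v)" by (auto simp: ES_def)
  have "inv \<pi> u ~= inv \<pi> v" using e i by metis
  moreover have "inv \<pi> u : V" "inv \<pi> v : V" using e permutes_in_image[OF permutes_inv[OF assms]] by auto
  ultimately have "{inv \<pi> u, inv \<pi> v} : ES V R" using e(5) unfolding ES_def by blast
  moreover have "e = \<pi> ` {inv \<pi> u, inv \<pi> v}" using e i by simp
  ultimately show "e : (`) \<pi> ` ES V R" by blast
 qed
qed

lemma pairs_ES: "pairs V = ES V (%_ _. True)"
 by (auto simp: pairs_def ES_def card_2_iff)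

lemma ES_minus:
 assumes "!!u v. R u v \<longleftrightarrow> R v u"
 shows "pairs V - ES V R = ES V (%u v. ~ R u v)"
proof (intro equalityI subsetI)
 fix e assume "e : pairs V - ES V R"
 then obtain u v where "e = {u, v}" "u : V" "v : V" "u ~= v" "e ~: ES V R" unfolding pairs_ES by (auto elim!: ESE)
 thus "e : ES V (%u v. ~ R u v)" by (auto simp: ES_iff)
next
 fix e assume "e : ES V (%u v. ~ R u v)"
 then obtain u v where "e = {u, v}" "u : V" "v : V" "u ~= v" "~ R u v" by (auto elim!: ESE)
 thus "e : pairs V - ES V R" using assms[of u v] by (auto simp: ES_iff pairs_ES)
qed

lemma ES_Un: "ES V R Un ES V R' = ES V (%u v. R u v | R' u v)"
 by (auto simp: ES_def)

lemma ES_Int_empty: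
 assumes "!!u v. u : V ==> v : V ==> R u v ==> R' u v | R' v u ==> False"
 shows "ES V R Int ES V R' = {}"
 using assms by (fastforce simp: ES_def doubleton_eq_iff)

text \<open>Edge sets of graphs on \<open>{..<k}\<close>; the vertices below \<open>m * q\<close> form \<open>m\<close> blocks of \<open>q = p ^ a\<close>
 consecutive vertices each.\<close>

definition block :: "nat => nat => nat => nat => bool" where
 "block q b v w \<longleftrightarrow> v div q = b & w div q ~= b"

definition between :: "nat => nat => nat => nat => nat => bool" where
 "between q b b' v w \<longleftrightarrow> (v div q = b & w div q = b') | (v div q = b' & w div q = b)"

definition rot :: "nat => nat => nat => nat" where
 "rot q b v = (if v div q = b then b * q + (v mod q + 1) mod q else v)"

text \<open>The situation to be refuted for a nontrivial parameter. \<open>F\<close> is its integral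
  form on \<open>k\<close> vertices, \<open>modp\<close> expresses that its values differ by less
  than \<open>p\<close>, and \<open>zero\<close> is the assumption that all alternating sums vanish.
  The conclusion is \<open>trivial\<close>.\<close>

locale edge_fun =
 fixes k p a m q :: nat and F :: "nat set set => int"
 assumes p: "prime p" "3 <= p" and q: "q = p ^ a" and m: "m = k div q" "p <= m"
  and inv: "!!\<pi> E. \<pi> permutes {..<k} ==> E <= pairs {..<k} ==> F ((`) \<pi> ` E) = F E"
  and mono: "!!E E'. E <= E' ==> E' <= pairs {..<k} ==> F E' <= F E"
  and modp: "!!E E'. E <= pairs {..<k} ==> E' <= pairs {..<k} ==> [F E = F E'] (mod int p) ==> F E = F E'"
  and zero: "!!b b' H. b < m ==> b' < m ==> b ~= b' ==> H <= pairs {..<k} ==>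
   H Int ES {..<k} (between q b b') = {} ==>
   (SUM S:Pow (ES {..<k} (between q b b')). (-1) ^ card S * F (H Un S)) = 0"
begin

lemma q_pos: "0 < q" using p q by (simp add: prime_gt_0_nat)

lemma mq: "m * q <= k" using m by simp

lemma rot_permutes: assumes "b < m" shows "rot q b permutes {..<k}"
proof (rule bij_imp_permutes)
 have qb: "b * q + r < k" if "r < q" for r
 proof -
  have "b * q + r < (b + 1) * q" using that by simp
  also have "... <= m * q" using assms by (intro mult_le_mono1) simp
  finally show ?thesis using mq by simp
 qed
 show "bij_betw (rot q b) {..<k} {..<k}"
 proof -
  have "inj_on (rot q b) {..<k}"
  proof (rule inj_onI)
   fix u v assume h: "rot q b u = rot q b v"
   have d: "(b * q + (u mod q + 1) mod q) div q = b" for u using q_pos by simp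
   have "u div q = b \<longleftrightarrow> v div q = b" using h d by (metis rot_def)
   moreover have "u = v" if uv: "u div q = b" "v div q = b"
   proof -
    have "(u mod q + 1) mod q = (v mod q + 1) mod q" using h uv by (simp add: rot_def)
    hence "u mod q mod q = v mod q mod q" using cong_add_rcancel_nat[of "u mod q" 1 "v mod q" q] by (simp add: cong_def)
    thus ?thesis using uv by (metis mod_mod_trivial div_mult_mod_eq)
   qed
   ultimately show "u = v" using h by (auto simp: rot_def)
  qed
  moreover have "rot q b ` {..<k} <= {..<k}" using qb q_pos by (auto simp: rot_def)
  ultimately show ?thesis using endo_inj_surj[of "{..<k}" "rot q b"] by (simp add: bij_betw_def)
 qed
 show "rot q b v = v" if "v ~: {..<k}" for v
  using qb[of "v mod q"] that q_pos by (auto simp: rot_def)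
qed

lemma rot_div: "rot q b v div q = v div q"
 using q_pos by (simp add: rot_def)

lemma rot_mod: "v div q = b ==> rot q b v mod q = (v mod q + 1) mod q"
 using q_pos by (simp add: rot_def)

lemma rot_pow: "(rot q b ^^ i) v = (if v div q = b then b * q + (v mod q + i) mod q else v)"
proof (induction i)
 case 0
 thus ?case using div_mult_mod_eq[of v q] by auto
next
 case (Suc i)
 have "(b * q + (v mod q + i) mod q) div q = b" using q_pos by simp
 thus ?case using Suc by (simp add: rot_def mod_Suc_eq)
qed

text \<open>A step of the chain: joining two blocks that can be rotated independently does not change the
 value, since the only sets of edges between them invariant under both rotations are trivial.\<close>

lemma join_blocks:
 assumes b: "b < m" "b' < m" "b ~= b'"
  and sym: "!!u v. R u v \<longleftrightarrow> R v u"
  and rotb: "!!u v. u < k ==> v < k ==> u ~= v ==> R u v ==> R (rot q b u) (rot q b v)"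
  and rotb': "!!u v. u < k ==> v < k ==> u ~= v ==> R u v ==> R (rot q b' u) (rot q b' v)"
  and disj: "!!u v. R u v ==> ~ between q b b' u v"
 shows "F (ES {..<k} R) = F (ES {..<k} (%u v. R u v | between q b b' u v))"
proof -
 define D where "D = ES {..<k} (between q b b')"
 define H where "H = ES {..<k} R"
 define g where "g S = (-1) ^ card S * F (H Un S)" for S
 have fin: "finite D" "finite H"
  using ES_sub[of "{..<k}"] finite_subset[of _ "Pow {..<k}"] unfolding D_def H_def pairs_def by blast+
 have sub: "D <= pairs {..<k}" "H <= pairs {..<k}" by (auto simp: D_def H_def ES_sub[THEN subsetD])
 have HD: "H Int D = {}"
  unfolding H_def D_def by (rule ES_Int_empty) (use disj in "auto simp: between_def")
 have z: "(SUM S:Pow D. g S) = 0"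
  using zero[OF b sub(2)] HD by (simp add: D_def g_def)
 define \<rho> where "\<rho> c S = (`) (rot q c) ` S" for c and S :: "nat set set"
 have perm: "rot q b permutes {..<k}" "rot q b' permutes {..<k}" using rot_permutes b by auto
 have \<rho>_pow: "(\<rho> c ^^ i) S = (`) (rot q c ^^ i) ` S" for c i S
 proof (induction i)
  case (Suc i)
  thus ?case by (simp add: \<rho>_def image_image image_comp)
 qed simp
 have \<rho>_per: "(\<rho> c ^^ (p ^ a)) S = S" for c S
 proof -
  have "(rot q c ^^ q) v = v" for v using div_mult_mod_eq[of v q] by (auto simp: rot_pow)
  hence "(rot q c ^^ q) = id" by auto
  thus ?thesis by (simp add: \<rho>_pow q[symmetric])
 qed
 have \<rho>_ES: "\<rho> c (ES {..<k} Q) <= ES {..<k} Q"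
  if "c : {b, b'}" "!!u v. u < k ==> v < k ==> u ~= v ==> Q u v ==> Q (rot q c u) (rot q c v)" for c Q
 proof
  fix e assume "e : \<rho> c (ES {..<k} Q)"
  then obtain u v where e: "e = {rot q c u, rot q c v}" "u < k" "v < k" "u ~= v" "Q u v"
   by (auto simp: ES_def \<rho>_def)
  have pc: "rot q c permutes {..<k}" using that(1) perm by auto
  have "rot q c u ~= rot q c v" using e(4) permutes_inj[OF pc] by (auto dest: injD)
  moreover have "rot q c u : {..<k}" "rot q c v : {..<k}" using permutes_in_image[OF pc] e by auto
  ultimately show "e : ES {..<k} Q" unfolding ES_def using e that(2) by blast
 qed
 have \<rho>_eq: "\<rho> c (ES {..<k} Q) = ES {..<k} Q"
  if "c : {b, b'}" "!!u v. u < k ==> v < k ==> u ~= v ==> Q u v ==> Q (rot q c u) (rot q c v)" for c Q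
 proof (rule card_subset_eq)
  show "finite (ES {..<k} Q)"
   using ES_sub[of "{..<k}" Q] finite_subset[of _ "Pow {..<k}"] unfolding pairs_def by blast
  have "inj (rot q c)" using that(1) perm permutes_inj by auto
  thus "card (\<rho> c (ES {..<k} Q)) = card (ES {..<k} Q)"
   unfolding \<rho>_def by (intro card_image) (simp add: inj_on_def inj_image_eq_iff)
  show "\<rho> c (ES {..<k} Q) <= ES {..<k} Q" by (rule \<rho>_ES[of c Q]) (use that in auto)
 qed
 have \<rho>D: "\<rho> c D = D" if "c : {b, b'}" for c
  unfolding D_def by (rule \<rho>_eq[of c "between q b b'", OF that]) (auto simp: between_def rot_div)
 have \<rho>H: "\<rho> c H = H" if "c : {b, b'}" for c
  unfolding H_def by (rule \<rho>_eq[of c R, OF that]) (use that rotb rotb' in auto)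
 have g_inv: "g (\<rho> c S) = g S" if c: "c : {b, b'}" and S: "S <= D" for c S
 proof -
  have pc: "rot q c permutes {..<k}" using c perm by auto
  have "H Un \<rho> c S = \<rho> c (H Un S)" using \<rho>H[OF c] by (simp add: \<rho>_def image_Un)
  hence "F (H Un \<rho> c S) = F (H Un S)"
   using inv[OF pc, of "H Un S"] sub S by (simp add: \<rho>_def)
  moreover have "card (\<rho> c S) = card S"
   unfolding \<rho>_def using permutes_inj[OF pc] by (intro card_image) (simp add: inj_on_def inj_image_eq_iff)
  ultimately show ?thesis by (simp add: g_def)
 qed
 have \<rho>_sub: "\<rho> c S <= D" if "c : {b, b'}" "S <= D" for c S
  using \<rho>D[OF that(1)] that(2) by (metis \<rho>_def image_mono)
 have comm: "\<rho> b' (\<rho> b S) = \<rho> b (\<rho> b' S)" for S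
 proof -
  have "rot q b' (rot q b v) = rot q b (rot q b' v)" for v
   using b(3) rot_div by (auto simp: rot_def[of q b] rot_def[of q b'] q_pos)
  thus ?thesis by (simp add: \<rho>_def image_image)
 qed
 \<comment> \<open>The two rotations are treated one after the other. They commute, so the second
   acts on the fixed points of the first.\<close>
 let ?X = "{S : Pow D. \<rho> b S = S}"
 have 1: "[(SUM S:Pow D. g S) = (SUM S:?X. g S)] (mod int p)"
  by (rule sum_fixpoints[OF p(1), where a = a]) (use fin \<rho>_sub g_inv \<rho>_per in auto)
 have 2: "[(SUM S:?X. g S) = (SUM S:{S : ?X. \<rho> b' S = S}. g S)] (mod int p)"
 proof (rule sum_fixpoints[OF p(1), where a = a])
  fix S assume S: "S : ?X"
  hence "\<rho> b (\<rho> b' S) = \<rho> b' S" using comm[of S] by simp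
  thus "\<rho> b' S : ?X" using \<rho>_sub[of b' S] S by simp
 qed (use fin g_inv \<rho>_per in auto)
 have bq: "b * q + r < k" if "r < q" "b < m" for r b
 proof -
  have "b * q + r < (b + 1) * q" using that by simp
  also have "... <= m * q" using that by (intro mult_le_mono1) simp
  finally show ?thesis using mq by simp
 qed
 have "{S : ?X. \<rho> b' S = S} = {{}, D}"
 proof (intro equalityI subsetI)
  fix S assume "S : {S : ?X. \<rho> b' S = S}"
  hence S: "S <= D" "\<rho> b S = S" "\<rho> b' S = S" by auto
  have pw: "(\<rho> c ^^ i) S = S" if "c : {b, b'}" for c i
   using S that by (induction i) auto
  show "S : {{}, D}"
  proof (cases "S = {}")
   case False
   then obtain e where "e : S" by blast
   moreover from this obtain u v where uv0: "e = {u, v}" "between q b b' u v"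
    using S(1) unfolding D_def by (elim ESE[OF subsetD]) auto
   ultimately have "(u div q = b & v div q = b' & {u, v} : S) | (v div q = b & u div q = b' & {v, u} : S)"
    by (auto simp: between_def insert_commute)
   then obtain u v where uv: "{u, v} : S" "u div q = b" "v div q = b'" by blast
   have "D <= S"
   proof
    fix e assume "e : D"
    then obtain w z where "e = {w, z}" "between q b b' w z" unfolding D_def by (rule ESE)
    hence "(w div q = b & z div q = b' & e = {w, z}) | (z div q = b & w div q = b' & e = {z, w})"
     by (auto simp: between_def insert_commute)
    then obtain u' v' where e: "e = {u', v'}" "u' div q = b" "v' div q = b'" by blast
    \<comment> \<open>Rotating the two blocks independently moves the edge \<open>{u, v}\<close> to
      any other edge between them. The summand \<open>q - u mod q\<close> realizes a subtraction
      modulo \<open>q\<close> in natural numbers.\<close>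
    define i where "i = u' mod q + (q - u mod q)"
    define j where "j = v' mod q + (q - v mod q)"
    have "u mod q + i = u' mod q + q" "v mod q + j = v' mod q + q"
     unfolding i_def j_def using mod_less_divisor[OF q_pos, of u] mod_less_divisor[OF q_pos, of v] by linarith+
    hence "(u mod q + i) mod q = u' mod q" "(v mod q + j) mod q = v' mod q" by simp_all
    hence "(rot q b ^^ i) u = u'" "(rot q b' ^^ j) v = v'" "(rot q b ^^ i) v = v" "(rot q b' ^^ j) u' = u'"
     using uv e b(3) div_mult_mod_eq[of u' q] div_mult_mod_eq[of v' q] by (auto simp: rot_pow)
    hence "(rot q b' ^^ j) ` ((rot q b ^^ i) ` {u, v}) = e" using e by simp
    moreover have "(rot q b ^^ i) ` {u, v} : (\<rho> b ^^ i) S" unfolding \<rho>_pow using uv(1) by (rule imageI)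
    hence "(rot q b ^^ i) ` {u, v} : S" using pw[of b i] by simp
    hence "(rot q b' ^^ j) ` ((rot q b ^^ i) ` {u, v}) : (\<rho> b' ^^ j) S" unfolding \<rho>_pow by (rule imageI)
    ultimately show "e : S" using pw[of b' j] by simp
   qed
   thus ?thesis using S(1) by auto
  qed simp
 next
  fix S assume "S : {{}, D}"
  thus "S : {S : ?X. \<rho> b' S = S}" using \<rho>D by (auto simp: \<rho>_def)
 qed
 moreover have "{} ~= D"
 proof -
  have "{b * q + 0, b' * q + 0} : D"
   unfolding D_def ES_iff using bq[of 0 b] bq[of 0 b'] b q_pos by (auto simp: between_def)
  thus ?thesis by auto
 qed
 ultimately have s: "(SUM S:{S : ?X. \<rho> b' S = S}. g S) = g {} + g D" by simp
 \<comment> \<open>This is odd because \<open>p\<close> is, so the two surviving terms enter with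
   opposite signs and form a difference.\<close>
 have "card D = q * q"
 proof -
  let ?A = "{v. v < k & v div q = b}" and ?B = "{v. v < k & v div q = b'}"
  have cA: "card {v. v < k & v div q = c} = q" if "c < m" for c
  proof -
   have "{v. v < k & v div q = c} = (%r. c * q + r) ` {..<q}"
   proof (intro equalityI subsetI)
    fix v assume v: "v : {v. v < k & v div q = c}"
    hence "v = c * q + v mod q" using div_mult_mod_eq[of v q] by auto
    thus "v : (%r. c * q + r) ` {..<q}" using q_pos by auto
   qed (use bq that in auto)
   thus ?thesis by (simp add: card_image)
  qed
  have "D = (%(u, v). {u, v}) ` (?A \<times> ?B)"
   using b(3) by (auto simp: D_def ES_def between_def image_def insert_commute)
  moreover have "inj_on (%(u, v). {u, v}) (?A \<times> ?B)"
   using b(3) by (auto simp: inj_on_def doubleton_eq_iff)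
  ultimately show ?thesis using cA b by (simp add: card_image card_cartesian_product)
 qed
 moreover have "odd p" using p prime_odd_nat by auto
 ultimately have "odd (card D)" using q by simp
 hence "g {} + g D = F H - F (H Un D)" by (simp add: g_def)
 hence "[0 = F H - F (H Un D)] (mod int p)" using cong_trans[OF 1 2] z s by simp
 hence "[F H = F (H Un D)] (mod int p)" by (simp add: cong_iff_dvd_diff dvd_diff_commute)
 hence "F H = F (H Un D)" using modp[of H "H Un D"] sub by blast
 thus "F (ES {..<k} R) = F (ES {..<k} (%u v. R u v | between q b b' u v))"
  unfolding H_def D_def ES_Un .
qed


text \<open>The permutation carries the first graph onto a subgraph of the second, and
  \<open>F\<close> decreases when edges are added.\<close>

lemma F_iso:
 assumes \<pi>: "\<pi> permutes {..<k}"
  and R: "!!u v. u < k ==> v < k ==> u ~= v ==> R u v ==> R' (\<pi> u) (\<pi> v)"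
 shows "F (ES {..<k} R') <= F (ES {..<k} R)"
proof -
 have "(`) \<pi> ` ES {..<k} R <= ES {..<k} R'"
  unfolding ES_image[OF \<pi>]
 proof (rule ES_mono)
  fix u v assume h: "u : {..<k}" "v : {..<k}" "u ~= v" "R (inv \<pi> u) (inv \<pi> v)"
  have "\<pi> (inv \<pi> u) = u" "\<pi> (inv \<pi> v) = v" using permutes_inverses[OF \<pi>] by auto
  moreover have "inv \<pi> u < k" "inv \<pi> v < k" using permutes_in_image[OF permutes_inv[OF \<pi>]] h by auto
  ultimately show "R' u v" using R[of "inv \<pi> u" "inv \<pi> v"] h by metis
 qed
 hence "F (ES {..<k} R') <= F ((`) \<pi> ` ES {..<k} R)" by (rule mono[OF _ ES_sub])
 thus ?thesis using inv[OF \<pi> ES_sub] by simp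
qed

lemma F_empty_max: "E <= pairs {..<k} ==> F E <= F {}"
 using mono[of "{}" E] by simp

definition T0 :: "nat set set" where "T0 = {{b, b'} | b b'. b < m & b' < m & b ~= b'}"

lemma finite_T0: "finite T0"
proof -
 have "T0 <= Pow {..<m}" by (auto simp: T0_def)
 thus ?thesis by (rule finite_subset) simp
qed

text \<open>The pairs in \<open>T\<close> are joined one by one. All edges between two blocks form a
  set that is invariant under every rotation, so the requirement of \<open>join_blocks\<close>
  persists.\<close>

lemma join_all:
 assumes sym: "!!u v. R u v \<longleftrightarrow> R v u"
  and rot: "!!b u v. b < m ==> u < k ==> v < k ==> u ~= v ==> R u v ==> R (rot q b u) (rot q b v)"
  and T: "T <= T0"
  and disj: "!!u v. R u v ==> {u div q, v div q} ~: T"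
 shows "F (ES {..<k} R) = F (ES {..<k} (%u v. R u v | {u div q, v div q} : T))"
proof -
 have "finite T" using T finite_T0 by (rule finite_subset)
 thus ?thesis using T disj
 proof (induction T rule: finite_induct)
  case (insert t T)
  obtain b b' where t: "t = {b, b'}" "b < m" "b' < m" "b ~= b'" using insert.prems by (auto simp: T0_def)
  let ?R = "%u v. R u v | {u div q, v div q} : T"
  have "F (ES {..<k} ?R) = F (ES {..<k} (%u v. ?R u v | between q b b' u v))"
  proof (rule join_blocks[OF t(2-4)])
   show "?R u v \<longleftrightarrow> ?R v u" for u v using sym by (simp add: insert_commute)
   show "~ between q b b' u v" if h: "?R u v" for u v
   proof
    assume "between q b b' u v"
    hence "{u div q, v div q} = t" using t by (auto simp: between_def)
    thus False using h insert.prems(2)[of u v] insert.hyps by auto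
   qed
  qed (use rot t in "auto simp: rot_div")
  moreover have "between q b b' u v \<longleftrightarrow> {u div q, v div q} = t" for u v
   using t by (auto simp: between_def doubleton_eq_iff)
  ultimately show ?case using insert.IH insert.prems by (simp add: disj_commute disj_left_commute)
 qed simp
qed

text \<open>Residue classes modulo \<open>r\<close> inside a block are cliques of size \<open>q div r\<close>.\<close>

definition cliques :: "nat => nat => nat => bool" where
 "cliques r u v \<longleftrightarrow> u < m * q & v < m * q & u div q = v div q & u mod q mod r = v mod q mod r"

definition joined :: "nat => nat => nat => bool" where
 "joined r u v \<longleftrightarrow> cliques r u v | (u < m * q & v < m * q & u div q ~= v div q)"

lemma lt_mq: "u < m * q \<longleftrightarrow> u div q < m"
 by (simp add: div_less_iff_less_mult q_pos)

text \<open>Rotating a block respects the residue classes modulo \<open>r\<close> because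
  \<open>r\<close> divides \<open>q\<close>.\<close>

lemma join_cliques:
 assumes "r dvd q"
 shows "F (ES {..<k} (cliques r)) = F (ES {..<k} (joined r))"
proof -
 have "F (ES {..<k} (cliques r)) = F (ES {..<k} (%u v. cliques r u v | {u div q, v div q} : T0))"
 proof (rule join_all)
  fix b u v assume cl: "cliques r u v"
  have st: "(x + 1) mod q mod r = (y + 1) mod q mod r" if "x mod r = y mod r" for x y
   using that assms by (simp add: mod_mod_cancel) (metis mod_Suc_eq)
  have c0: "u div q < m" "v div q < m" "u div q = v div q" "u mod q mod r = v mod q mod r"
   using cl unfolding cliques_def lt_mq by blast+
  note c = c0 st[OF c0(4)]
  have "rot q b u mod q mod r = rot q b v mod q mod r"
  proof (cases "u div q = b")
   case True
   thus ?thesis using c rot_mod[of u b] rot_mod[of v b] by (simp only:)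
  next
   case False
   thus ?thesis using c by (simp add: rot_def)
  qed
  thus "cliques r (rot q b u) (rot q b v)"
   using c(1-3) by (simp add: cliques_def lt_mq rot_div)
 qed (auto simp: cliques_def T0_def)
 moreover have "{u div q, v div q} : T0 \<longleftrightarrow> u < m * q & v < m * q & u div q ~= v div q" for u v
  by (auto simp: T0_def lt_mq doubleton_eq_iff)
 ultimately show ?thesis by (simp add: joined_def[abs_def])
qed

text \<open>A residue class modulo \<open>r\<close> splits into \<open>p\<close> classes modulo
  \<open>r * p\<close>. Moving the part with index \<open>s\<close> cyclically by \<open>s\<close>
  blocks puts different parts of a class into different blocks, as there are at least
  \<open>p\<close> blocks. Between blocks all edges are present, and each part stays a class modulo
  \<open>r * p\<close>.\<close>

lemma cliques_in_joined:
 assumes r: "r * p dvd q"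
 shows "F (ES {..<k} (joined (r * p))) <= F (ES {..<k} (cliques r))"
proof -
 have r0: "0 < r" using r q_pos by (metis dvd_0_left_iff gr0I mult_is_0 not_less0)
 define s where "s u = (u mod q div r) mod p" for u
 define \<pi> where "\<pi> u = (if u < m * q then ((u div q + s u) mod m) * q + u mod q else u)" for u
 have m0: "0 < m" using m p by simp
 have \<pi>_div: "\<pi> u div q = (u div q + s u) mod m" "\<pi> u mod q = u mod q" if "u < m * q" for u
  using that q_pos by (simp_all add: \<pi>_def)
 have \<pi>_lt: "\<pi> u < m * q" if "u < m * q" for u
  using \<pi>_div(1)[OF that] m0 by (simp add: lt_mq)
 have perm: "\<pi> permutes {..<k}"
 proof (rule bij_imp_permutes)
  have "inj_on \<pi> {..<m * q}"
  proof (rule inj_onI)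
   fix u v assume h: "u : {..<m * q}" "v : {..<m * q}" "\<pi> u = \<pi> v"
   hence uv: "u mod q = v mod q" using \<pi>_div(2) by (metis lessThan_iff)
   hence "s u = s v" by (simp add: s_def)
   moreover have "(u div q + s u) mod m = (v div q + s v) mod m" using h \<pi>_div(1) by (metis lessThan_iff)
   ultimately have "u div q mod m = v div q mod m"
    using cong_add_rcancel_nat[of "u div q" "s u" "v div q" m] by (simp add: cong_def)
   hence "u div q = v div q" using h by (simp add: lt_mq)
   thus "u = v" using uv by (metis div_mult_mod_eq)
  qed
  moreover have hi: "\<pi> u = u" if "~ u < m * q" for u using that by (simp add: \<pi>_def)
  ultimately have "inj_on \<pi> {..<k}"
  proof -
   have "u = v" if "\<pi> u = \<pi> v" for u v
   proof (cases "u < m * q & v < m * q")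
    case True
    thus ?thesis using \<open>inj_on \<pi> {..<m * q}\<close> that by (auto dest: inj_onD)
   next
    case False
    thus ?thesis using \<pi>_lt[of u] \<pi>_lt[of v] hi[of u] hi[of v] that by metis
   qed
   thus ?thesis by (rule inj_onI)
  qed
  moreover have "\<pi> u < k" if "u < k" for u
   using \<pi>_lt[of u] hi[of u] mq that by (cases "u < m * q") auto
  hence "\<pi> ` {..<k} <= {..<k}" by auto
  ultimately show "bij_betw \<pi> {..<k} {..<k}" using endo_inj_surj[of "{..<k}" \<pi>] by (simp add: bij_betw_def)
  show "\<pi> u = u" if "u ~: {..<k}" for u using that mq by (simp add: \<pi>_def)
 qed
 show ?thesis
 proof (rule F_iso[OF perm])
  fix u v assume h: "u ~= v" "cliques r u v"
  hence lt: "u < m * q" "v < m * q" and d: "u div q = v div q" and c: "u mod q mod r = v mod q mod r"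
   by (auto simp: cliques_def)
  show "joined (r * p) (\<pi> u) (\<pi> v)"
  proof (cases "s u = s v")
   case True
   have "u mod q mod (r * p) = r * (u mod q div r mod p) + u mod q mod r" for u by (rule mod_mult2_eq)
   hence "u mod q mod (r * p) = v mod q mod (r * p)" using True c by (simp add: s_def)
   hence "cliques (r * p) (\<pi> u) (\<pi> v)" using \<pi>_lt \<pi>_div lt d True by (simp add: cliques_def)
   thus ?thesis by (simp add: joined_def)
  next
   case False
   have sp: "s w < m" for w using m p by (simp add: s_def less_le_trans[OF mod_less_divisor])
   have "(u div q + s u) mod m ~= (v div q + s v) mod m"
   proof
    assume "(u div q + s u) mod m = (v div q + s v) mod m"
    hence "s u mod m = s v mod m"
     using d cong_add_lcancel_nat[of "v div q" "s u" "s v" m] by (simp add: cong_def)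
    thus False using False sp by simp
   qed
   thus ?thesis using \<pi>_lt \<pi>_div lt by (simp add: joined_def)
  qed
 qed
qed

text \<open>The chain starts with single vertices (\<open>r = q\<close>) and multiplies the clique
  size by \<open>p\<close> in each round, by joining blocks and then finding larger cliques inside.
  Monotonicity makes \<open>F {}\<close> the maximum, so each comparison is an equality.\<close>

lemma joined_const: "j <= a ==> F (ES {..<k} (joined (p ^ (a - j)))) = F {}"
proof (induction j)
 case 0
 have "ES {..<k} (cliques q) = {}"
 proof -
  have "u = v" if "cliques q u v" for u v using that by (metis cliques_def div_mult_mod_eq mod_mod_trivial)
  thus ?thesis by (auto simp: ES_def)
 qed
 thus ?case using join_cliques[of q] q by simp
next
 case (Suc j)
 have e: "p ^ (a - Suc j) * p = p ^ (a - j)" using Suc.prems by (metis Suc_diff_Suc Suc_le_lessD power_Suc2)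
 have "p ^ (a - Suc j) * p dvd q" unfolding e q by (rule le_imp_power_dvd) simp
 from cliques_in_joined[OF this] have "F {} <= F (ES {..<k} (cliques (p ^ (a - Suc j))))"
  using Suc unfolding e by simp
 also have "... = F (ES {..<k} (joined (p ^ (a - Suc j))))"
  by (rule join_cliques) (simp add: q le_imp_power_dvd)
 finally show ?case using F_empty_max[OF ES_sub] by (simp add: antisym)
qed

lemma complete_const: "F (ES {..<k} (%u v. u < m * q & v < m * q)) = F {}"
proof -
 have "joined 1 = (%u v. u < m * q & v < m * q)"
  by (auto simp: joined_def cliques_def fun_eq_iff)
 thus ?thesis using joined_const[of a] by simp
qed

lemma shift_permutes: "c <= k ==> (%u. if u < k then (u + c) mod k else u) permutes {..<k}"
proof (rule bij_imp_permutes)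
 assume c: "c <= k"
 have "inj_on (%u. if u < k then (u + c) mod k else u) {..<k}"
 proof (rule inj_onI)
  fix u v assume h: "u : {..<k}" "v : {..<k}"
   "(if u < k then (u + c) mod k else u) = (if v < k then (v + c) mod k else v)"
  thus "u = v" using cong_add_rcancel_nat[of u c v k] by (simp add: cong_def)
 qed
 thus "bij_betw (%u. if u < k then (u + c) mod k else u) {..<k} {..<k}"
  unfolding bij_betw_def by (intro conjI endo_inj_surj) auto
qed simp

text \<open>Embedding of sets of at most \<open>m * q\<close> vertices of the form \<open>{c..<c + m * q}\<close>, cyclically.\<close>

lemma small_const:
 assumes c: "c <= k" and R: "!!u v. u < k ==> v < k ==> u ~= v ==> R u v ==> (u + c) mod k < m * q & (v + c) mod k < m * q"
 shows "F (ES {..<k} R) = F {}"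
proof -
 have "F {} <= F (ES {..<k} R)"
  unfolding complete_const[symmetric] by (rule F_iso[OF shift_permutes[OF c]]) (use R in auto)
 thus ?thesis using F_empty_max[OF ES_sub] by (simp add: antisym)
qed

text \<open>The vertices from \<open>q\<close> on number at most \<open>m * q\<close>, so a complete
  graph on them is covered by \<open>small_const\<close>. It contains all blocks but the first,
  which is then joined to the \<open>m - 1\<close> others.\<close>

lemma final_const:
 shows "F (ES {..<k} (%u v. (q <= u & q <= v) | (u < q & q <= v & v < m * q) | (v < q & q <= u & u < m * q))) = F {}"
proof -
 have m3: "3 <= m" using m p by simp
 have kk: "k - q <= m * q"
 proof -
  have "k = m * q + k mod q" using m by simp
  thus ?thesis using mod_less_divisor[OF q_pos, of k] by linarith
 qed
 have qk: "q <= k" using mq m3 by (metis le_trans mult_le_mono1 nat_mult_1 numeral_3_eq_3 Suc_leD le_SucI one_le_numeral)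
 let ?R = "%u v. q <= u & q <= v"
 let ?T = "{{0, b} | b. 0 < b & b < m}"
 have "F {} = F (ES {..<k} ?R)"
 proof (rule small_const[of "k - q", symmetric])
  fix u v assume "u < k" "v < k" "q <= u & q <= v"
  moreover have "(w + (k - q)) mod k = w - q" if "w < k" "q <= w" for w
  proof -
   have "w + (k - q) = (w - q) + k" using that qk by simp
   hence "(w + (k - q)) mod k = (w - q) mod k" by (simp only: mod_add_self2)
   thus ?thesis using that by simp
  qed
  ultimately show "(u + (k - q)) mod k < m * q & (v + (k - q)) mod k < m * q"
   using kk by auto
 qed simp
 also have "... = F (ES {..<k} (%u v. ?R u v | {u div q, v div q} : ?T))"
 proof (rule join_all)
  have qd: "q <= u \<longleftrightarrow> 1 <= u div q" for u using less_eq_div_iff_mult_less_eq[OF q_pos, of 1 u] by simp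
  show "?R (rot q b u) (rot q b v)" if "?R u v" for b u v using that by (simp add: qd rot_div)
  show "{u div q, v div q} ~: ?T" if "?R u v" for u v using that by (auto simp: qd doubleton_eq_iff)
  show "?T <= T0" using m3 unfolding T0_def by force
 qed auto
 also have "ES {..<k} (%u v. ?R u v | {u div q, v div q} : ?T) =
  ES {..<k} (%u v. (q <= u & q <= v) | (u < q & q <= v & v < m * q) | (v < q & q <= u & u < m * q))"
 proof (rule ES_cong)
  fix u v
  have d0: "w div q = 0 \<longleftrightarrow> w < q" for w using q_pos by (simp add: div_eq_0_iff)
  have "{u div q, v div q} : ?T \<longleftrightarrow> (u div q = 0 & 0 < v div q & v div q < m) | (v div q = 0 & 0 < u div q & u div q < m)"
   by (auto simp: doubleton_eq_iff)
  also have "... \<longleftrightarrow> (u < q & q <= v & v < m * q) | (v < q & q <= u & u < m * q)"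
  proof -
   have "0 < w div q \<longleftrightarrow> q <= w" for w using d0[of w] by linarith
   thus ?thesis unfolding lt_mq using d0 by auto
  qed
  finally show "(?R u v | {u div q, v div q} : ?T) \<longleftrightarrow> (q <= u & q <= v) | (u < q & q <= v & v < m * q) | (v < q & q <= u & u < m * q)"
   by simp
 qed
 finally show ?thesis by simp
qed

text \<open>Applying the chain to complements as well yields a graph sandwiched between both ends.\<close>

lemma dual: "edge_fun k p a m q (%E. - F (pairs {..<k} - E))"
proof (unfold_locales, goal_cases)
 case (6 \<pi> E)
 have "(`) \<pi> ` pairs {..<k} = pairs {..<k}"
  using ES_image[OF 6(1), of "%_ _. True"] by (simp add: pairs_ES)
 hence "pairs {..<k} - (`) \<pi> ` E = (`) \<pi> ` (pairs {..<k} - E)"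
  using permutes_inj[OF 6(1)] by (subst image_set_diff) (auto simp: inj_on_def inj_image_eq_iff)
 thus ?case using inv[OF 6(1), of "pairs {..<k} - E"] by simp
next
 case (7 E E')
 thus ?case using mono[of "pairs {..<k} - E'" "pairs {..<k} - E"] by auto
next
 case (8 E E')
 have "[F (pairs {..<k} - E) = F (pairs {..<k} - E')] (mod int p)"
  using 8(3) by (simp add: cong_minus_minus_iff)
 thus ?case using modp[of "pairs {..<k} - E" "pairs {..<k} - E'"] by auto
next
 case (9 b b' H)
 let ?D = "ES {..<k} (between q b b')" and ?P = "pairs {..<k}"
 have fin: "finite ?D" using ES_sub[of "{..<k}"] finite_subset[of _ "Pow {..<k}"] unfolding pairs_def by blast
 have D: "?D <= ?P" by (rule ES_sub)
 \<comment> \<open>Complementation turns \<open>S\<close> into \<open>?D - S\<close> and so changes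
   all signs by the common factor \<open>(-1) ^ card ?D\<close>.\<close>
 have "(SUM S:Pow ?D. (-1) ^ card S * - F (?P - (H Un S))) =
  (SUM S:Pow ?D. - ((-1) ^ card ?D) * ((-1) ^ card S * F ((?P - H - ?D) Un S)))"
 proof (rule sum.reindex_bij_witness[where i = "%S. ?D - S" and j = "%S. ?D - S"])
  fix S assume S: "S : Pow ?D"
  hence c: "card ?D = card S + card (?D - S)"
   using fin by (metis Pow_iff card_Diff_subset card_mono finite_subset le_add_diff_inverse)
  have "?P - H - ?D Un (?D - S) = ?P - (H Un S)" using D 9(5) S by blast
  moreover have "(-1::int) ^ card ?D * (-1) ^ card (?D - S) = (-1) ^ card S"
   unfolding c by (simp add: power_add mult.assoc flip: power_mult_distrib)
  ultimately show "- ((-1) ^ card ?D) * ((-1) ^ card (?D - S) * F (?P - H - ?D Un (?D - S))) =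
   (-1) ^ card S * - F (?P - (H Un S))" by (simp add: mult.assoc[symmetric])
 qed auto
 also have "... = - ((-1) ^ card ?D) * (SUM S:Pow ?D. (-1) ^ card S * F ((?P - H - ?D) Un S))"
  by (simp add: sum_distrib_left)
 also have "(SUM S:Pow ?D. (-1) ^ card S * F ((?P - H - ?D) Un S)) = 0"
  by (rule zero[OF 9(1-3)]) auto
 finally show ?case by simp
qed (use p q m in auto)

text \<open>The graph of \<open>final_const\<close> has the value of the edgeless graph. Its
  complement has edges only among the first block and the fewer than \<open>q\<close> vertices
  behind the last block. These are fewer than \<open>2 * q <= m * q\<close> vertices, so by duality
  the same graph also has the value of the complete graph.\<close>

lemma trivial: "F {} = F (pairs {..<k})"
proof -
 interpret d: edge_fun k p a m q "%E. - F (pairs {..<k} - E)" by (rule dual)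
 let ?X = "%u v. (q <= u & q <= v) | (u < q & q <= v & v < m * q) | (v < q & q <= u & u < m * q)"
 \<comment> \<open>The cyclic shift by \<open>?c\<close> places the vertices behind the blocks first
   and the first block right after them.\<close>
 let ?c = "k - m * q"
 have kq: "k - m * q < q" using m mod_less_divisor[OF q_pos, of k] by (simp add: minus_div_mult_eq_mod[symmetric])
 have m3: "3 * q <= m * q" using m p by (intro mult_le_mono1) simp
 have "- F (pairs {..<k} - ES {..<k} (%u v. ~ ?X u v)) = - F (pairs {..<k} - {})"
 proof (rule d.small_const[of ?c])
  fix u v assume uv: "u < k" "v < k" "u ~= v" "~ ?X u v"
  have "(w + ?c) mod k < m * q" if "w < k" "w < q | m * q <= w" for w
  proof (cases "w < q")
   case True
   hence "w + ?c < 2 * q" using kq by simp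
   moreover have "2 * q <= m * q" using m3 by linarith
   moreover from this have "2 * q <= k" using mq by linarith
   ultimately show ?thesis by (metis less_le_trans mod_less)
  next
   case False
   hence "w + ?c = (w - m * q) + k" using that mq by simp
   hence "(w + ?c) mod k = (w - m * q) mod k" by (simp only: mod_add_self2)
   hence "(w + ?c) mod k = w - m * q" using that by simp
   thus ?thesis using that kq m3 q_pos by linarith
  qed
  moreover have "u < q | m * q <= u" "v < q | m * q <= v" using uv by auto
  ultimately show "(u + ?c) mod k < m * q & (v + ?c) mod k < m * q" using uv by blast
 qed simp
 moreover have "pairs {..<k} - ES {..<k} (%u v. ~ ?X u v) = ES {..<k} ?X"
  by (subst ES_minus) (auto intro!: ES_cong)
 ultimately show ?thesis using final_const by simp
qed

end

definition mkgraph :: "nat set => nat set set => graph" where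
 "mkgraph V E = \<lparr>verts = V, edges = E\<rparr>"

lemma mkgraph_simps [simp]: "verts (mkgraph V E) = V" "edges (mkgraph V E) = E"
 by (simp_all add: mkgraph_def)

lemma mkgraph_graphs: "finite V ==> E <= pairs V ==> mkgraph V E : graphs"
 by (auto simp: graphs_def pairs_def)

lemma graph_eq_mkgraph: "G = mkgraph (verts G) (edges G)"
 by (simp add: mkgraph_def)

lemma iso_ES:
 assumes "iso_invariant \<Phi>" "finite V" "bij_betw f V V'"
  and "!!u v. u : V ==> v : V ==> u ~= v ==> (R u v | R v u) \<longleftrightarrow> (R' (f u) (f v) | R' (f v) (f u))"
 shows "\<Phi> (mkgraph V (ES V R)) = \<Phi> (mkgraph V' (ES V' R'))"
proof -
 have "finite V'" using assms(2,3) bij_betw_finite by blast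
 moreover have "graph_iso (mkgraph V (ES V R)) (mkgraph V' (ES V' R'))"
  unfolding graph_iso_def
 proof (intro exI[of _ f] conjI ballI)
  fix u v assume uv: "u : verts (mkgraph V (ES V R))" "v : verts (mkgraph V (ES V R))"
  have "u = v \<longleftrightarrow> f u = f v" "f u : V'" "f v : V'"
   using uv assms(3) by (auto simp: bij_betw_def inj_on_eq_iff)
  thus "{u, v} : edges (mkgraph V (ES V R)) \<longleftrightarrow> {f u, f v} : edges (mkgraph V' (ES V' R'))"
   using uv assms(4)[of u v] by (auto simp: ES_iff)
 qed (use assms(3) in simp)
 ultimately show ?thesis
  using assms(1,2) mkgraph_graphs ES_sub unfolding iso_invariant_def by blast
qed

lemma edges_ES:
 assumes "E <= pairs V"
 shows "E = ES V (%u v. {u, v} : E)"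
proof (intro equalityI subsetI)
 fix e assume e: "e : E"
 then obtain u v where "e = {u, v}" "u ~= v" using assms by (auto simp: pairs_def card_2_iff)
 thus "e : ES V (%u v. {u, v} : E)" using e assms by (auto simp: ES_iff pairs_def)
qed (auto elim!: ESE)

section \<open>A base graph with nonvanishing alternating sum\<close>

definition biedges :: "nat => nat set set" where
 "biedges q = {{i, q + j} | i j. i < q & j < q}"

text \<open>Here \<open>S\<close> consists of the omitted edges. Counting the edges that are kept
  instead changes the sum only by a sign.\<close>

definition altsum :: "(graph => rat) => nat => nat => nat set set => rat" where
 "altsum \<Phi> k q H = (SUM S:Pow (biedges q). (-1) ^ card S * \<Phi> (mkgraph {..<k} (H Un (biedges q - S))))"

lemma biedges_ES: "2 * q <= k ==> 0 < q ==> biedges q = ES {..<k} (between q 0 1)"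
proof (intro equalityI subsetI)
 fix e assume h: "2 * q <= k" "0 < q" "e : ES {..<k} (between q 0 1)"
 obtain u v where uv: "e = {u, v}" "u ~= v" "between q 0 1 u v" using h(3) by (rule ESE)
 have *: "w div q = 0 \<longleftrightarrow> w < q" "w div q = 1 \<longleftrightarrow> q <= w & w < 2 * q" for w
  using h(2) div_less_iff_less_mult[OF h(2), of w 1] div_less_iff_less_mult[OF h(2), of w 2] by auto
 have "(u < q & q <= v & v < 2 * q) | (v < q & q <= u & u < 2 * q)"
  using uv(3) unfolding between_def * by blast
 then consider "u < q" "q <= v" "v < 2 * q" | "v < q" "q <= u" "u < 2 * q" by blast
 thus "e : biedges q"
 proof cases
  case 1
  hence "e = {u, q + (v - q)}" "v - q < q" using uv by auto
  thus ?thesis unfolding biedges_def using 1 by blast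
 next
  case 2
  hence "e = {v, q + (u - q)}" "u - q < q" using uv by auto
  thus ?thesis unfolding biedges_def using 2 by blast
 qed
next
 fix e assume h: "2 * q <= k" "0 < q" "e : biedges q"
 then obtain i j where "e = {i, q + j}" "i < q" "j < q" by (auto simp: biedges_def)
 thus "e : ES {..<k} (between q 0 1)"
  using h(1,2) by (auto simp: ES_iff between_def div_add_self1)
qed

lemma pairs_finite: "finite (pairs {..<k})"
 unfolding pairs_def by (rule finite_subset[of _ "Pow {..<k}"]) auto

text \<open>By symmetry, vanishing for the first two blocks carries over to any two blocks.\<close>

lemma block_move:
 fixes b b' q m k :: nat
 assumes "0 < q" "m * q <= k" "b < m" "b' < m" "b ~= b'" "2 <= m"
 obtains \<pi> where "\<pi> permutes {..<k}" "!!v. \<pi> v div q = 0 \<longleftrightarrow> v div q = b" "!!v. \<pi> v div q = 1 \<longleftrightarrow> v div q = b'"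
proof -
 \<comment> \<open>The inner transposition sends \<open>b\<close> to 0; the outer one sends the
   resulting position of \<open>b'\<close> to 1 and leaves 0 alone, as \<open>b'\<close> is not at
   0.\<close>
 define t where "t = Transposition.transpose (1::nat) (Transposition.transpose 0 b b') \<circ> Transposition.transpose 0 b"
 have tb: "t b = 0" "t b' = 1" using assms(5) by (auto simp: t_def Transposition.transpose_def split: if_splits)
 have tm: "t permutes {..<m}"
  unfolding t_def
  by (rule permutes_compose; rule permutes_swap_id) (use assms in "auto simp: Transposition.transpose_def")
 define \<pi> where "\<pi> v = t (v div q) * q + v mod q" for v
 have d: "\<pi> v div q = t (v div q)" "\<pi> v mod q = v mod q" for v using assms(1) by (auto simp: \<pi>_def)
 have inj: "inj t" using tm permutes_inj by blast
 have "\<pi> permutes {..<k}"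
 proof (rule bij_imp_permutes)
  have fix': "\<pi> v = v" if "~ v div q < m" for v
   using that permutes_not_in[OF tm, of "v div q"] div_mult_mod_eq[of v q] by (simp add: \<pi>_def)
  have lt: "\<pi> v < k" if "v < k" for v
  proof (cases "v div q < m")
   case True
   hence "\<pi> v div q < m" using permutes_in_image[OF tm] d by auto
   hence "\<pi> v < m * q" using assms(1) by (simp add: div_less_iff_less_mult)
   thus ?thesis using assms(2) by simp
  qed (use fix' that in auto)
  have "inj \<pi>"
  proof (rule injI)
   fix u v assume "\<pi> u = \<pi> v"
   hence "t (u div q) = t (v div q)" "u mod q = v mod q" using d by metis+
   thus "u = v" using inj by (metis div_mult_mod_eq injD)
  qed
  hence "inj_on \<pi> {..<k}" by (rule inj_on_subset) simp
  thus "bij_betw \<pi> {..<k} {..<k}"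
   unfolding bij_betw_def using lt by (intro conjI endo_inj_surj) (auto simp del: finite_lessThan intro: finite_lessThan)
  show "\<pi> v = v" if "v ~: {..<k}" for v
  proof (rule fix')
   have "m * q <= v" using that assms(2) by (meson le_trans lessThan_iff not_le)
   thus "~ v div q < m" using assms(1) by (simp add: div_less_iff_less_mult)
  qed
 qed
 moreover have "\<pi> v div q = 0 \<longleftrightarrow> v div q = b" "\<pi> v div q = 1 \<longleftrightarrow> v div q = b'" for v
  using d(1)[of v] tb inj by (metis injD)+
 ultimately show thesis using that by blast
qed

text \<open>If all alternating sums vanished, \<open>edge_fun.trivial\<close> would give the
  edgeless and the complete graph the same value, and by monotonicity every graph on
  \<open>k\<close> vertices lies between the two.\<close>

lemma exists_base:
 fixes \<Phi> :: "graph => rat" and N :: nat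
 assumes iso: "iso_invariant \<Phi>" and mono: "edge_monotone \<Phi>" and nt: "nontrivial_on \<Phi> k"
  and N: "0 < N" "!!G. G : graphs ==> of_nat N * \<Phi> G : \<int>"
  and p: "prime p" "3 <= p"
   "!!G G'. G : graphs ==> G' : graphs ==> \<bar>of_nat N * \<Phi> G - of_nat N * \<Phi> G'\<bar> < of_nat p"
  and q: "q = p ^ a" "p <= k div q"
 shows "EX H. H <= pairs {..<k} & H Int biedges q = {} & altsum \<Phi> k q H ~= 0"
proof (rule ccontr)
 assume "~ ?thesis"
 hence z0: "!!H. H <= pairs {..<k} ==> H Int biedges q = {} ==> altsum \<Phi> k q H = 0" by blast
 \<comment> \<open>\<open>N\<close> clears the denominators; the floor only converts the result to
   an integer.\<close>
 define F where "F E = \<lfloor>of_nat N * \<Phi> (mkgraph {..<k} E)\<rfloor>" for E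
 have gr: "mkgraph {..<k} E : graphs" if "E <= pairs {..<k}" for E using that by (rule mkgraph_graphs[rotated]) simp
 have F: "of_int (F E) = of_nat N * \<Phi> (mkgraph {..<k} E)" if "E <= pairs {..<k}" for E
  unfolding F_def using N(2)[OF gr[OF that]] by (rule of_int_floor)
 have q0: "0 < q" using p q by (simp add: prime_gt_0_nat)
 have mq: "(k div q) * q <= k" by simp
 have q2: "2 * q <= k"
 proof -
  have "2 * q <= (k div q) * q" using p q by (intro mult_le_mono1) simp
  thus ?thesis using mq by linarith
 qed
 have permF: "F ((`) \<pi> ` E) = F E" if \<pi>: "\<pi> permutes {..<k}" and E: "E <= pairs {..<k}" for \<pi> E
 proof -
  let ?R = "%u v. {u, v} : E"
  have "(`) \<pi> ` E = (`) \<pi> ` ES {..<k} ?R" using edges_ES[OF E] by simp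
  also have "... = ES {..<k} (%u v. ?R (inv \<pi> u) (inv \<pi> v))" by (rule ES_image[OF \<pi>])
  finally have e: "(`) \<pi> ` E = ES {..<k} (%u v. ?R (inv \<pi> u) (inv \<pi> v))" .
  have "\<Phi> (mkgraph {..<k} (ES {..<k} ?R)) = \<Phi> (mkgraph {..<k} (ES {..<k} (%u v. ?R (inv \<pi> u) (inv \<pi> v))))"
   by (rule iso_ES[OF iso, of _ \<pi>]) (use \<pi> permutes_imp_bij permutes_inverses[OF \<pi>] in auto)
  thus ?thesis using edges_ES[OF E] e by (simp add: F_def)
 qed
 have zero0: "(SUM S:Pow (biedges q). (-1) ^ card S * F (H Un S)) = 0"
  if H: "H <= pairs {..<k}" "H Int biedges q = {}" for H
 proof -
  have D: "biedges q <= pairs {..<k}" using biedges_ES[OF q2 q0] ES_sub by metis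
  have fin: "finite (biedges q)" using D pairs_finite by (rule finite_subset)
  have "of_int (SUM S:Pow (biedges q). (-1) ^ card S * F (H Un S)) =
   (SUM S:Pow (biedges q). (-1) ^ card S * (of_nat N * \<Phi> (mkgraph {..<k} (H Un S))))"
   using D H by (auto intro!: sum.cong F simp: subset_iff)
  also have "... = (SUM S:Pow (biedges q). (-1) ^ card (biedges q) * of_nat N *
    ((-1) ^ card S * \<Phi> (mkgraph {..<k} (H Un (biedges q - S)))))"
  proof (rule sum.reindex_bij_witness[where i = "%S. biedges q - S" and j = "%S. biedges q - S"])
   fix S assume S: "S : Pow (biedges q)"
   hence c: "card (biedges q) = card S + card (biedges q - S)"
    using fin by (metis Pow_iff card_Diff_subset card_mono finite_subset le_add_diff_inverse)
   have "(-1::rat) ^ card (biedges q) * (-1) ^ card (biedges q - S) = (-1) ^ card S"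
    unfolding c by (simp add: power_add mult.assoc flip: power_mult_distrib)
   moreover have "biedges q - (biedges q - S) = S" using S by auto
   ultimately show "(-1) ^ card (biedges q) * of_nat N * ((-1) ^ card (biedges q - S) *
    \<Phi> (mkgraph {..<k} (H Un (biedges q - (biedges q - S))))) =
    (-1) ^ card S * (of_nat N * \<Phi> (mkgraph {..<k} (H Un S)))"
    by (simp add: mult_ac)
  qed auto
  also have "... = (-1) ^ card (biedges q) * of_nat N * altsum \<Phi> k q H"
   by (simp add: altsum_def sum_distrib_left)
  finally have "of_int (SUM S:Pow (biedges q). (-1) ^ card S * F (H Un S)) = (0 :: rat)"
   unfolding z0[OF H] by (simp only: mult_zero_right)
  thus ?thesis by (simp only: of_int_eq_0_iff)
 qed
 have "edge_fun k p a (k div q) q F"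
 proof
  show "F E' <= F E" if "E <= E'" "E' <= pairs {..<k}" for E E'
  proof -
   have "\<Phi> (mkgraph {..<k} E') <= \<Phi> (mkgraph {..<k} E)"
    using mono gr that unfolding edge_monotone_def edge_subgraph_def by auto
   thus ?thesis unfolding F_def by (intro floor_mono mult_left_mono) auto
  qed
  show "F E = F E'" if "E <= pairs {..<k}" "E' <= pairs {..<k}" "[F E = F E'] (mod int p)" for E E'
  proof (rule ccontr)
   assume "F E ~= F E'"
   moreover have "int p dvd F E - F E'" using that(3) by (simp add: cong_iff_dvd_diff)
   ultimately have "int p <= \<bar>F E - F E'\<bar>" using dvd_imp_le_int[of "F E - F E'" "int p"] by simp
   hence "of_int (int p) <= (of_int \<bar>F E - F E'\<bar> :: rat)" by (simp only: of_int_le_iff)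
   moreover have "(of_int \<bar>F E - F E'\<bar> :: rat) < of_nat p"
    using p(3)[OF gr[OF that(1)] gr[OF that(2)]] F that by simp
   ultimately show False by simp
  qed
  show "(SUM S:Pow (ES {..<k} (between q b b')). (-1) ^ card S * F (H Un S)) = 0"
   if b: "b < k div q" "b' < k div q" "b ~= b'" and H: "H <= pairs {..<k}"
    "H Int ES {..<k} (between q b b') = {}" for b b' H
  proof -
   obtain \<pi> where \<pi>: "\<pi> permutes {..<k}" "!!v. \<pi> v div q = 0 \<longleftrightarrow> v div q = b" "!!v. \<pi> v div q = 1 \<longleftrightarrow> v div q = b'"
    using block_move[OF q0 mq b] p q by auto
   let ?D = "ES {..<k} (between q b b')"
   let ?h = "%S. (`) \<pi> ` S"
   have inj: "inj ((`) \<pi>)" using permutes_inj[OF \<pi>(1)] by (simp add: inj_on_def inj_image_eq_iff)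
   have i: "\<pi> (inv \<pi> v) = v" for v using permutes_inverses[OF \<pi>(1)] by simp
   have hD: "?h ?D = biedges q"
    unfolding ES_image[OF \<pi>(1)] biedges_ES[OF q2 q0]
    using \<pi>(2)[of "inv \<pi> _"] \<pi>(3)[of "inv \<pi> _"] by (intro ES_cong) (simp add: between_def i)
   have hP: "?h E <= pairs {..<k}" if "E <= pairs {..<k}" for E
   proof -
    have "?h E <= ?h (pairs {..<k})" using that by (rule image_mono)
    also have "... = pairs {..<k}" using ES_image[OF \<pi>(1), of "%_ _. True"] by (simp add: pairs_ES)
    finally show ?thesis .
   qed
   have "(SUM S:Pow ?D. (-1) ^ card S * F (H Un S)) = (SUM S:?h ` Pow ?D. (-1) ^ card S * F (?h H Un S))"
   proof (subst sum.reindex)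
    show "inj_on (image ((`) \<pi>)) (Pow ?D)"
     using inj by (intro inj_onI) (simp add: inj_image_eq_iff)
    show "(SUM S:Pow ?D. (-1) ^ card S * F (H Un S)) =
     sum ((%S. (-1) ^ card S * F (?h H Un S)) \<circ> image ((`) \<pi>)) (Pow ?D)"
    proof (intro sum.cong refl)
     fix S assume "S : Pow ?D"
     hence "S <= pairs {..<k}" using ES_sub[of "{..<k}" "between q b b'"] by auto
     hence "F (?h (H Un S)) = F (H Un S)" using permF[OF \<pi>(1)] H(1) by simp
     moreover have "card (?h S) = card S" using inj by (intro card_image) (rule inj_on_subset, auto)
     ultimately show "(-1) ^ card S * F (H Un S) = ((%S. (-1) ^ card S * F (?h H Un S)) \<circ> image ((`) \<pi>)) S"
      by (simp add: image_Un)
    qed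
   qed
   also have "?h ` Pow ?D = Pow (biedges q)" using hD by (simp add: image_Pow_surj)
   also have "(SUM S:Pow (biedges q). (-1) ^ card S * F (?h H Un S)) = 0"
   proof (rule zero0[OF hP[OF H(1)]])
    show "?h H Int biedges q = {}" unfolding hD[symmetric] using H(2) inj by (simp add: image_Int[symmetric])
   qed
   finally show ?thesis .
  qed
 qed (use p q permF in auto)
 hence triv: "F {} = F (pairs {..<k})" by (rule edge_fun.trivial)
 have all: "\<Phi> G = \<Phi> (mkgraph {..<k} {})" if G: "G : graphs" "card (verts G) = k" for G
 proof -
  have fin: "finite (verts G)" using G(1) by (simp add: graphs_def)
  then obtain f where f: "bij_betw f (verts G) {..<k}" using G(2) finite_same_card_bij[of "verts G" "{..<k}"] by auto
  define E where "E = ES {..<k} (%u v. {inv_into (verts G) f u, inv_into (verts G) f v} : edges G)"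
  have eG: "edges G <= pairs (verts G)" using G(1) by (auto simp: graphs_def pairs_def)
  have "\<Phi> G = \<Phi> (mkgraph (verts G) (ES (verts G) (%u v. {u, v} : edges G)))"
   unfolding edges_ES[OF eG, symmetric] by (rule arg_cong[where f = \<Phi>, OF graph_eq_mkgraph])
  also have "... = \<Phi> (mkgraph {..<k} E)"
   unfolding E_def by (rule iso_ES[OF iso fin f]) (use f in "simp add: bij_betw_inv_into_left")
  finally have GE: "\<Phi> G = \<Phi> (mkgraph {..<k} E)" .
  have E: "E <= pairs {..<k}" unfolding E_def by (rule ES_sub)
  have "\<Phi> (mkgraph {..<k} E) <= \<Phi> (mkgraph {..<k} {})" "\<Phi> (mkgraph {..<k} (pairs {..<k})) <= \<Phi> (mkgraph {..<k} E)"
   using mono gr E unfolding edge_monotone_def edge_subgraph_def by auto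
  moreover have "of_nat N * \<Phi> (mkgraph {..<k} {}) = of_nat N * \<Phi> (mkgraph {..<k} (pairs {..<k}))"
   using F[of "{}"] F[of "pairs {..<k}"] unfolding triv by (metis empty_subsetI order_refl)
  hence "\<Phi> (mkgraph {..<k} {}) = \<Phi> (mkgraph {..<k} (pairs {..<k}))" using N(1) by simp
  ultimately show ?thesis using GE by simp
 qed
 thus False using nt unfolding nontrivial_on_def by metis
qed

section \<open>Colourful subgraphs\<close>

definition graph_of :: "'v list => ('v => 'v => bool) => graph" where
 "graph_of L adj = mkgraph {..<length L} (ES {..<length L} (%i j. adj (L ! i) (L ! j)))"

lemma graph_of_input: "graph_of L adj : input_graphs"
 by (auto simp: input_graphs_def graph_of_def intro!: mkgraph_graphs ES_sub)

lemma verts_graph_of: "verts (graph_of L adj) = {..<length L}"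
 by (simp add: graph_of_def)

lemma induced_ES: "A <= V ==> induced (mkgraph V (ES V R)) A = mkgraph A (ES A R)"
 unfolding induced_def mkgraph_def by (auto simp: ES_def)

text \<open>The value of the graph induced on a vertex set of arbitrary type, transported to
  \<open>{..<k}\<close> by some bijection; by invariance the choice is immaterial.\<close>

definition on_set :: "(graph => rat) => nat => ('v => 'v => bool) => 'v set => rat" where
 "on_set \<Phi> k adj B = (let h = (SOME h. bij_betw h {..<k} B)
  in \<Phi> (mkgraph {..<k} (ES {..<k} (%i j. adj (h i) (h j)))))"

lemma on_set_eq:
 assumes iso: "iso_invariant \<Phi>" and g: "bij_betw g {..<k} B"
 shows "on_set \<Phi> k adj B = \<Phi> (mkgraph {..<k} (ES {..<k} (%i j. adj (g i) (g j))))"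
proof -
 define h where "h = (SOME h. bij_betw h {..<k} B)"
 have h: "bij_betw h {..<k} B" unfolding h_def by (rule someI[of _ g]) (rule g)
 let ?f = "%i. inv_into {..<k} g (h i)"
 have f: "bij_betw ?f {..<k} {..<k}"
  using bij_betw_trans[OF h bij_betw_inv_into[OF g]] by (simp add: comp_def)
 have "g (?f i) = h i" if "i < k" for i
  using g h that by (metis bij_betw_apply bij_betw_inv_into_right lessThan_iff)
 thus ?thesis
  unfolding on_set_def Let_def h_def[symmetric] by (intro iso_ES[OF iso _ f]) auto
qed

lemma on_set_induced:
 assumes iso: "iso_invariant \<Phi>" and L: "distinct L" and A: "A <= {..<length L}" "card A = k"
 shows "\<Phi> (induced (graph_of L adj) A) = on_set \<Phi> k adj ((!) L ` A)"
proof -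
 have fin: "finite A" using A(1) finite_subset by blast
 obtain g where g: "bij_betw g {..<k} A" using finite_same_card_bij[of "{..<k}" A] fin A(2) by auto
 have inj: "inj_on ((!) L) A" using A(1) by (intro inj_on_nth[OF L]) auto
 have "bij_betw ((!) L \<circ> g) {..<k} ((!) L ` A)"
  by (rule bij_betw_trans[OF g]) (simp add: bij_betw_def inj)
 hence "on_set \<Phi> k adj ((!) L ` A) = \<Phi> (mkgraph {..<k} (ES {..<k} (%i j. adj (L ! g i) (L ! g j))))"
  by (subst on_set_eq[OF iso]) (auto simp: comp_def)
 also have "... = \<Phi> (mkgraph A (ES A (%i j. adj (L ! i) (L ! j))))"
  by (rule iso_ES[OF iso _ g]) auto
 finally show ?thesis using A(1) by (simp add: graph_of_def induced_ES)
qed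

lemma bij_nth_subsets:
 assumes "distinct L"
 shows "bij_betw (%A. (!) L ` A) {A. A <= {..<length L} & card A = k} {B. B <= set L & card B = k}"
proof -
 have b: "bij_betw ((!) L) {..<length L} (set L)" using assms by (simp add: bij_betw_nth)
 have inj: "inj_on ((!) L) A" if "A <= {..<length L}" for A using b that by (meson bij_betw_def inj_on_subset)
 show ?thesis
  unfolding bij_betw_def
 proof
  show "inj_on (%A. (!) L ` A) {A. A <= {..<length L} & card A = k}"
  proof (rule inj_onI)
   fix A B assume "A : {A. A <= {..<length L} & card A = k}" "B : {A. A <= {..<length L} & card A = k}"
    "(!) L ` A = (!) L ` B"
   moreover have "inj_on ((!) L) {..<length L}" using b by (simp add: bij_betw_def)
   ultimately show "A = B" using inj_on_image_eq_iff by blast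
  qed
  show "(%A. (!) L ` A) ` {A. A <= {..<length L} & card A = k} = {B. B <= set L & card B = k}"
  proof (intro equalityI subsetI)
   fix B assume B: "B : {B. B <= set L & card B = k}"
   let ?A = "{i. i < length L & L ! i : B}"
   have "(!) L ` ?A = B" using B by (auto simp: in_set_conv_nth subset_iff)
   moreover have "card ((!) L ` ?A) = card ?A" by (intro card_image inj) auto
   ultimately have "?A <= {..<length L} & card ?A = k" "B = (!) L ` ?A" using B by auto
   thus "B : (%A. (!) L ` A) ` {A. A <= {..<length L} & card A = k}" by blast
  qed (auto simp: card_image[OF inj])
 qed
qed

lemma indsub_on_set:
 assumes "iso_invariant \<Phi>" "distinct L"
 shows "indsub \<Phi> k (graph_of L adj) = (\<Sum>B | B <= set L & card B = k. on_set \<Phi> k adj B)"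
 unfolding indsub_def verts_graph_of
 by (subst sum.reindex_bij_betw[OF bij_nth_subsets[OF assms(2)], symmetric])
  (auto intro!: sum.cong on_set_induced assms)

lemma cp_indsub_on_set:
 assumes "iso_invariant \<Phi>" "distinct L"
 shows "cp_indsub \<Phi> (mkgraph {..<k} E) (graph_of L adj) (%v. col (L ! v)) =
  (\<Sum>B | B <= set L & card B = k & col ` B = {..<k}. on_set \<Phi> k adj B)"
proof -
 note bij = bij_nth_subsets[OF assms(2), of k]
 have "cp_indsub \<Phi> (mkgraph {..<k} E) (graph_of L adj) (%v. col (L ! v)) =
  (\<Sum>A | A <= {..<length L} & card A = k & col ` (!) L ` A = {..<k}. on_set \<Phi> k adj ((!) L ` A))"
  unfolding cp_indsub_def colorful_def verts_graph_of
  by (rule sum.cong) (auto intro!: on_set_induced assms simp: image_image)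
 also have "... = (\<Sum>A | A <= {..<length L} & card A = k.
   if col ` (!) L ` A = {..<k} then on_set \<Phi> k adj ((!) L ` A) else 0)"
  by (subst sum.inter_filter[symmetric]) (auto intro: finite_subset[of _ "Pow {..<length L}"] sum.cong)
 also have "... = (\<Sum>B | B <= set L & card B = k. if col ` B = {..<k} then on_set \<Phi> k adj B else 0)"
  by (rule sum.reindex_bij_betw[OF bij])
 also have "... = (\<Sum>B | B <= set L & card B = k & col ` B = {..<k}. on_set \<Phi> k adj B)"
  by (subst sum.inter_filter[symmetric]) (auto intro: finite_subset[of _ "Pow (set L)"] sum.cong)
 finally show ?thesis .
qed

text \<open>Toggling an element of \<open>A - B\<close> pairs terms of opposite sign.\<close>

lemma alternating_supersets:
 assumes "finite A" "B <= A"
 shows "(\<Sum>C | B <= C & C <= A. (-1 :: rat) ^ (card A - card C)) = of_bool (B = A)"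
proof -
 have fin: "finite {C. B <= C & C <= A}" using assms(1) by (auto intro: finite_subset[of _ "Pow A"])
 show ?thesis
 proof (cases "B = A")
  case True
  hence "{C. B <= C & C <= A} = {A}" by auto
  thus ?thesis using True by simp
 next
  case False
  then obtain e where e: "e : A" "e ~: B" using assms(2) by blast
  let ?f = "%C. if e : C then C - {e} else insert e C"
  have "(\<Sum>C | B <= C & C <= A. (-1 :: rat) ^ (card A - card C)) =
   (\<Sum>C | B <= C & C <= A. - ((-1 :: rat) ^ (card A - card C)))"
  proof (rule sum.reindex_bij_witness[where i = ?f and j = ?f])
   fix C assume "C : {C. B <= C & C <= A}"
   hence C: "B <= C" "C <= A" by auto
   hence fC: "finite C" using assms(1) finite_subset by blast
   have le: "card C <= card A" "card (insert e C) <= card A" using C e assms(1) by (auto intro: card_mono)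
   show "- ((-1 :: rat) ^ (card A - card (?f C))) = (-1) ^ (card A - card C)"
   proof (cases "e : C")
    case True
    hence "card C = Suc (card (C - {e}))" using fC by (metis card_Suc_Diff1)
    hence "card A - card (C - {e}) = Suc (card A - card C)" using le by simp
    thus ?thesis using True by simp
   next
    case False
    hence "card A - card C = Suc (card A - card (insert e C))" using le fC by simp
    thus ?thesis using False by simp
   qed
  qed (use e in auto)
  thus ?thesis using False by (simp add: sum_negf)
 qed
qed

lemma indsub_colorful:
 assumes iso: "iso_invariant \<Phi>" and L: "distinct L" "col ` set L <= {..<k}"
 shows "(SUM C:Pow {..<k}. (-1) ^ (k - card C) * indsub \<Phi> k (graph_of (filter (%x. col x : C) L) adj)) =
  (\<Sum>B | B <= set L & card B = k & col ` B = {..<k}. on_set \<Phi> k adj B)"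
proof -
 let ?X = "{B. B <= set L & card B = k}"
 have fin: "finite ?X" by (rule finite_subset[of _ "Pow (set L)"]) auto
 have "(SUM C:Pow {..<k}. (-1) ^ (k - card C) * indsub \<Phi> k (graph_of (filter (%x. col x : C) L) adj)) =
  (SUM C:Pow {..<k}. SUM B:?X. if col ` B <= C then (-1) ^ (k - card C) * on_set \<Phi> k adj B else 0)"
 proof (intro sum.cong refl)
  fix C
  have "indsub \<Phi> k (graph_of (filter (%x. col x : C) L) adj) =
   (\<Sum>B | B <= set L & card B = k & col ` B <= C. on_set \<Phi> k adj B)"
   by (subst indsub_on_set[OF iso]) (use L in "auto intro!: sum.cong")
  also have "... = (SUM B:?X. if col ` B <= C then on_set \<Phi> k adj B else 0)"
   using fin by (subst sum.inter_filter[symmetric]) (auto intro: sum.cong)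
  finally show "(-1) ^ (k - card C) * indsub \<Phi> k (graph_of (filter (%x. col x : C) L) adj) =
   (SUM B:?X. if col ` B <= C then (-1) ^ (k - card C) * on_set \<Phi> k adj B else 0)"
   by (simp add: sum_distrib_left if_distrib cong: if_cong)
 qed
 also have "... = (SUM B:?X. SUM C:Pow {..<k}. if col ` B <= C then (-1) ^ (k - card C) * on_set \<Phi> k adj B else 0)"
  by (rule sum.swap)
 also have "... = (SUM B:?X. if col ` B = {..<k} then on_set \<Phi> k adj B else 0)"
 proof (intro sum.cong refl)
  fix B assume B: "B : ?X"
  have "(SUM C:Pow {..<k}. if col ` B <= C then (-1) ^ (k - card C) * on_set \<Phi> k adj B else 0) =
   (\<Sum>C | col ` B <= C & C <= {..<k}. (-1) ^ (card {..<k} - card C)) * on_set \<Phi> k adj B"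
   by (subst sum.inter_filter[symmetric]) (auto simp: sum_distrib_right intro: sum.cong)
  also have "... = of_bool (col ` B = {..<k}) * on_set \<Phi> k adj B"
   by (subst alternating_supersets) (use B L in auto)
  finally show "(SUM C:Pow {..<k}. if col ` B <= C then (-1) ^ (k - card C) * on_set \<Phi> k adj B else 0) =
   (if col ` B = {..<k} then on_set \<Phi> k adj B else 0)" by simp
 qed
 also have "... = (\<Sum>B | B <= set L & card B = k & col ` B = {..<k}. on_set \<Phi> k adj B)"
  using fin by (subst sum.inter_filter[symmetric]) (auto intro: sum.cong)
 finally show ?thesis .
qed

text \<open>A set of \<open>k\<close> vertices that has all \<open>k\<close> colours has each of
  them exactly once, so it is a choice of one vertex per colour.\<close>

lemma colorful_choice:
 assumes iso: "iso_invariant \<Phi>" and W: "finite W"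
 shows "(\<Sum>B | B <= W & card B = k & col ` B = {..<k}. on_set \<Phi> k adj B) =
  (SUM tu:PiE {..<k} (%i. {x : W. col x = i}). \<Phi> (mkgraph {..<k} (ES {..<k} (%i j. adj (tu i) (tu j)))))"
proof -
 let ?P = "PiE {..<k} (%i. {x : W. col x = i})"
 let ?Q = "{B. B <= W & card B = k & col ` B = {..<k}}"
 have inj: "inj_on tu {..<k}" if "tu : ?P" for tu
 proof (rule inj_onI)
  fix i j assume ij: "i : {..<k}" "j : {..<k}" "tu i = tu j"
  have "col (tu i) = i" "col (tu j) = j" using PiE_mem[OF that ij(1)] PiE_mem[OF that ij(2)] by simp_all
  thus "i = j" using ij(3) by metis
 qed
 have bij: "bij_betw (%tu. tu ` {..<k}) ?P ?Q"
 proof (rule bij_betw_byWitness[where f' = "%B. \<lambda>i\<in>{..<k}. inv_into B col i"])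
  show "ALL tu:?P. (\<lambda>i\<in>{..<k}. inv_into (tu ` {..<k}) col i) = tu"
  proof
   fix tu assume tu: "tu : ?P"
   show "(\<lambda>i\<in>{..<k}. inv_into (tu ` {..<k}) col i) = tu"
   proof (rule extensionalityI[of _ "{..<k}"])
    show "(\<lambda>i\<in>{..<k}. inv_into (tu ` {..<k}) col i) i = tu i" if "i : {..<k}" for i
    proof -
     have c: "col (tu j) = j" if "j : {..<k}" for j using PiE_mem[OF tu that] by simp
     have "inj_on col (tu ` {..<k})" using c by (auto simp: inj_on_def)
     hence "inv_into (tu ` {..<k}) col (col (tu i)) = tu i" using that by (intro inv_into_f_f) auto
     thus ?thesis using c[OF that] that by simp
    qed
   qed (use tu in "auto simp: PiE_def")
  qed
  have wit: "inv_into B col i : B & col (inv_into B col i) = i" if "B : ?Q" "i < k" for B i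
  proof -
   have "i : col ` B" using that by auto
   thus ?thesis by (simp add: inv_into_into f_inv_into_f)
  qed
  show "ALL B:?Q. (\<lambda>i\<in>{..<k}. inv_into B col i) ` {..<k} = B"
  proof
   fix B assume B: "B : ?Q"
   hence "finite B" using W finite_subset by blast
   hence i: "inj_on col B" using B by (intro eq_card_imp_inj_on) auto
   show "(\<lambda>i\<in>{..<k}. inv_into B col i) ` {..<k} = B"
   proof (intro equalityI subsetI)
    fix x assume x: "x : B"
    hence "inv_into B col (col x) = x" using i by simp
    moreover have "col x : {..<k}" using x B by blast
    ultimately show "x : (\<lambda>i\<in>{..<k}. inv_into B col i) ` {..<k}" by (intro image_eqI[of _ _ "col x"]) auto
   qed (use wit[OF B] in auto)
  qed
  show "(%tu. tu ` {..<k}) ` ?P <= ?Q"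
  proof (intro image_subsetI)
   fix tu assume tu: "tu : ?P"
   have c: "col (tu j) = j" "tu j : W" if "j : {..<k}" for j using PiE_mem[OF tu that] by simp_all
   have "col ` tu ` {..<k} = {..<k}" unfolding image_image using c(1) by force
   thus "tu ` {..<k} : ?Q" using c(2) card_image[OF inj[OF tu]] by auto
  qed
  show "(%B. \<lambda>i\<in>{..<k}. inv_into B col i) ` ?Q <= ?P"
  proof (intro image_subsetI PiE_I)
   fix B i assume B: "B : ?Q" and i: "i : {..<k}"
   show "(\<lambda>i\<in>{..<k}. inv_into B col i) i : {x : W. col x = i}" using wit[OF B, of i] i B by auto
  qed auto
 qed
 have "(SUM B:?Q. on_set \<Phi> k adj B) = (SUM tu:?P. on_set \<Phi> k adj (tu ` {..<k}))"
  by (rule sum.reindex_bij_betw[OF bij, symmetric])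
 also have "... = (SUM tu:?P. \<Phi> (mkgraph {..<k} (ES {..<k} (%i j. adj (tu i) (tu j)))))"
  by (intro sum.cong refl on_set_eq[OF iso]) (simp add: bij_betw_def inj)
 finally show ?thesis .
qed

section \<open>Bicliques\<close>

text \<open>Colours below \<open>q\<close> and in \<open>{q..<2 * q}\<close> form the two sides of a biclique; its compatibility
 relation is \<open>Cp\<close>. The edges of \<open>H\<close> are realized completely and those in \<open>S\<close> are left out.\<close>

definition bi_adj :: "nat => (nat * nat) list => (nat => 'x => nat => 'x => bool) => (nat * nat) list =>
  nat * 'x => nat * 'x => bool" where
 "bi_adj q hl Cp S u v \<longleftrightarrow> (fst u, fst v) : set hl |
  (fst u < q & q <= fst v & fst v < 2 * q & (fst u, fst v - q) ~: set S & Cp (fst u) (snd u) (fst v - q) (snd v))"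

text \<open>Only the \<open>2 * q\<close> colours of the biclique carry labels. For every other
  colour the choice is forced.\<close>

definition bi_verts :: "nat => nat => 'x list => 'x => (nat * 'x) list" where
 "bi_verts k q xs x0 = concat (map (%i. map (%x. (i, x)) (if i < 2 * q then xs else [x0])) [0..<k])"

definition bicliques :: "nat => nat => 'x list => 'x => (nat => 'x => nat => 'x => bool) => (nat => nat * 'x) set" where
 "bicliques k q xs x0 Cp = {tu : PiE {..<k} (%i. {x : set (bi_verts k q xs x0). fst x = i}).
  \<forall>i<q. \<forall>j<q. Cp i (snd (tu i)) j (snd (tu (q + j)))}"

lemma set_bi_verts: "set (bi_verts k q xs x0) = {(i, x). i < k & x : (if i < 2 * q then set xs else {x0})}"
 by (auto simp: bi_verts_def split: if_splits)

lemma distinct_bi_verts: "distinct xs ==> distinct (bi_verts k q xs x0)"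
 unfolding bi_verts_def
proof (induction k)
 case (Suc k)
 thus ?case by (auto simp: distinct_map inj_on_def)
qed simp

text \<open>An element of \<open>D - T\<close> can be toggled in \<open>S\<close> without changing
  \<open>T - S\<close>, so the terms cancel in pairs unless \<open>T = D\<close>.\<close>

lemma toggle_sum:
 fixes f :: "'a set => rat"
 assumes "finite D" "T <= D"
 shows "(SUM S:Pow D. (-1) ^ card S * f (T - S)) = (if T = D then (SUM S:Pow D. (-1) ^ card S * f (D - S)) else 0)"
proof (cases "T = D")
 case False
 then obtain e where e: "e : D" "e ~: T" using assms(2) by blast
 let ?g = "%S. if e : S then S - {e} else insert e S"
 have "(SUM S:Pow D. (-1) ^ card S * f (T - S)) = (SUM S:Pow D. - ((-1) ^ card S * f (T - S)))"
 proof (rule sum.reindex_bij_witness[where i = ?g and j = ?g])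
  fix S assume "S : Pow D"
  hence fS: "finite S" using assms(1) finite_subset by blast
  have "T - ?g S = T - S" using e by auto
  moreover have "(-1::rat) ^ card S = - ((-1) ^ card (?g S))"
  proof (cases "e : S")
   case True
   hence "card S = Suc (card (S - {e}))" using fS by (metis card_Suc_Diff1)
   hence "(-1::rat) ^ card S = - ((-1) ^ card (S - {e}))" by (simp only: power_Suc mult_minus1)
   thus ?thesis using True by simp
  qed (use fS in simp)
  ultimately show "- ((-1) ^ card (?g S) * f (T - ?g S)) = (-1) ^ card S * f (T - S)" by simp
 qed (use e in auto)
 thus ?thesis using False by (simp add: sum_negf)
qed simp

definition sgn_of :: "'a list => rat" where "sgn_of S = (-1) ^ length S"

text \<open>Fix a choice of labels and let \<open>T\<close> be the set of compatible pairs. Omitting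
  \<open>S\<close> leaves the graph \<open>H\<close> with the edges of \<open>T - S\<close>. By
  \<open>toggle_sum\<close> the signed sum over \<open>S\<close> is zero unless every pair is
  compatible, and then it is \<open>altsum\<close>, independently of the choice.\<close>

lemma biclique_identity:
 fixes \<Phi> :: "graph => rat" and Cp :: "nat => 'x => nat => 'x => bool"
 assumes iso: "iso_invariant \<Phi>" and k: "2 * q <= k"
  and H: "H = (%(i, j). {i, j}) ` set hl" "!!i j. (i, j) : set hl ==> i < k & j < k & i ~= j" "H Int biedges q = {}"
  and S: "distinct SS" "!!S. S : set SS ==> distinct S" "inj_on set (set SS)"
   "set ` set SS = Pow ({..<q} \<times> {..<q})"
 shows "(\<Sum>S\<leftarrow>SS. sgn_of S *
   (\<Sum>B | B <= set (bi_verts k q xs x0) & card B = k & fst ` B = {..<k}. on_set \<Phi> k (bi_adj q hl Cp S) B)) =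
  altsum \<Phi> k q H * of_nat (card (bicliques k q xs x0 Cp))"
proof -
 let ?W = "set (bi_verts k q xs x0)"
 let ?P = "PiE {..<k} (%i. {x : ?W. fst x = i})"
 let ?D = "{..<q} \<times> {..<q} :: (nat * nat) set"
 define e where "e = (%(i, j). {i, q + j})"
 have inje: "inj_on e ?D"
 proof (rule inj_onI)
  fix z w assume "z : ?D" "w : ?D" "e z = e w"
  thus "z = w" by (cases z; cases w) (auto simp: e_def doubleton_eq_iff)
 qed
 have eD: "e ` ?D = biedges q" by (auto simp: e_def biedges_def image_def)
 have finP: "finite ?P" by (intro finite_PiE) auto
 define T where "T tu = {(i, j) : ?D. Cp i (snd (tu i)) j (snd (tu (q + j)))}" for tu :: "nat => nat * 'x"
 have ed: "ES {..<k} (%i j. bi_adj q hl Cp S (tu i) (tu j)) = H Un e ` (T tu - set S)"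
  if tu: "tu : ?P" for tu S
 proof -
  have f: "fst (tu i) = i" if "i < k" for i using PiE_mem[OF tu, of i] that by simp
  show ?thesis
  proof (intro equalityI subsetI)
   fix d assume "d : ES {..<k} (%i j. bi_adj q hl Cp S (tu i) (tu j))"
   then obtain i j where d: "d = {i, j}" "i < k" "j < k" "i ~= j" "bi_adj q hl Cp S (tu i) (tu j)"
    by (auto elim!: ESE)
   have "(i, j) : set hl | (i < q & q <= j & j < 2 * q & (i, j - q) ~: set S & Cp i (snd (tu i)) (j - q) (snd (tu j)))"
    using d f by (simp add: bi_adj_def)
   thus "d : H Un e ` (T tu - set S)"
   proof
    assume "(i, j) : set hl"
    thus ?thesis using H(1) d by auto
   next
    assume h: "i < q & q <= j & j < 2 * q & (i, j - q) ~: set S & Cp i (snd (tu i)) (j - q) (snd (tu j))"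
    hence "(i, j - q) : T tu - set S" by (auto simp: T_def)
    moreover have "d = e (i, j - q)" using h d by (simp add: e_def)
    ultimately show ?thesis by blast
   qed
  next
   fix d assume "d : H Un e ` (T tu - set S)"
   thus "d : ES {..<k} (%i j. bi_adj q hl Cp S (tu i) (tu j))"
   proof
    assume "d : H"
    then obtain i j where "(i, j) : set hl" "d = {i, j}" using H(1) by auto
    thus ?thesis using H(2) f by (simp add: ES_iff bi_adj_def)
   next
    assume "d : e ` (T tu - set S)"
    then obtain i j where "(i, j) : T tu - set S" "d = {i, q + j}" by (auto simp: e_def)
    thus ?thesis using f k by (auto simp: ES_iff bi_adj_def T_def)
   qed
  qed
 qed
 define f where "f U = \<Phi> (mkgraph {..<k} (H Un e ` U))" for U
 have Sfin: "finite ?D" by simp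
 have "(\<Sum>S\<leftarrow>SS. sgn_of S * (\<Sum>B | B <= ?W & card B = k & fst ` B = {..<k}. on_set \<Phi> k (bi_adj q hl Cp S) B)) =
  (SUM S:set SS. sgn_of S * (SUM tu:?P. f (T tu - set S)))"
  unfolding sum_list_distinct_conv_sum_set[OF S(1)]
  by (intro sum.cong refl) (simp add: colorful_choice[OF iso] ed f_def)
 also have "... = (SUM S:set SS. (%S. (-1) ^ card S * (SUM tu:?P. f (T tu - S))) (set S))"
  by (intro sum.cong refl) (simp add: sgn_of_def distinct_card S(2))
 also have "... = (SUM S:Pow ?D. (-1) ^ card S * (SUM tu:?P. f (T tu - S)))"
  unfolding S(4)[symmetric] sum.reindex[OF S(3)] by simp
 also have "... = (SUM tu:?P. SUM S:Pow ?D. (-1) ^ card S * f (T tu - S))"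
  unfolding sum_distrib_left by (rule sum.swap)
 also have "... = (SUM tu:?P. if T tu = ?D then (SUM S:Pow ?D. (-1) ^ card S * f (?D - S)) else 0)"
  by (intro sum.cong refl toggle_sum) (auto simp: T_def)
 also have "(SUM S:Pow ?D. (-1) ^ card S * f (?D - S)) = altsum \<Phi> k q H"
 proof -
  have "(SUM S:Pow ?D. (-1) ^ card S * f (?D - S)) =
   (SUM S:Pow ?D. (%S. (-1) ^ card S * \<Phi> (mkgraph {..<k} (H Un (biedges q - S)))) (e ` S))"
  proof (intro sum.cong refl)
   fix S assume SD: "S : Pow ?D"
   have "e ` (?D - S) = biedges q - e ` S"
    unfolding eD[symmetric] using SD by (intro inj_on_image_set_diff[OF inje]) auto
   moreover have "card (e ` S) = card S" using SD by (intro card_image inj_on_subset[OF inje]) auto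
   ultimately show "(-1) ^ card S * f (?D - S) = (%S. (-1) ^ card S * \<Phi> (mkgraph {..<k} (H Un (biedges q - S)))) (e ` S)"
    by (simp add: f_def)
  qed
  also have "... = (SUM S:(`) e ` Pow ?D. (-1) ^ card S * \<Phi> (mkgraph {..<k} (H Un (biedges q - S))))"
   by (subst sum.reindex[OF inj_on_image_Pow[OF inje]]) simp
  also have "(`) e ` Pow ?D = Pow (biedges q)" using eD by (simp add: image_Pow_surj)
  finally show ?thesis by (simp add: altsum_def)
 qed
 also have "(SUM tu:?P. if T tu = ?D then altsum \<Phi> k q H else 0) = (SUM tu:{tu : ?P. T tu = ?D}. altsum \<Phi> k q H)"
  by (rule sum.inter_filter[OF finP, symmetric])
 also have "{tu : ?P. T tu = ?D} = bicliques k q xs x0 Cp"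
  unfolding bicliques_def T_def by auto
 finally show ?thesis by (simp add: mult.commute)
qed

section \<open>Further polynomial-time list functions and enumeration of subsets\<close>

lemmas PTs = PT_const PT_id PT_fst PT_snd PT_Pair PT_if PT_add PT_diff PT_mult PT_div PT_not PT_conj PT_disj PT_imp PT_le PT_less PT_eq_nat PT_eq_bool PT_Cons PT_append PT_rev PT_map PT_concat PT_filter PT_length PT_Ball PT_Bex PT_upt PT_nthd PT_drop PT_take

lemma PT_member:
 fixes f :: "'a::repr => 'b::repr"
 assumes "PT (%z :: 'b * 'b. fst z = snd z)" "PT f" "PT g"
 shows "PT (%e. f e : set (g e))"
proof -
 have "PT (%z :: 'a * 'b. (snd z, f (fst z)))"
  by (intro PTs PT_comp[OF assms(2)])
 from PT_comp[OF assms(1) this] have "PT (%z :: 'a * 'b. snd z = f (fst z))" by simp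
 hence "PT (%e. EX y:set (g e). y = f e)" by (intro PT_Bex assms)
 moreover have "(EX y:set (g e). y = f e) \<longleftrightarrow> f e : set (g e)" for e by auto
 ultimately show ?thesis by simp
qed

lemma PT_member_nat: "PT f ==> PT g ==> PT (%e. (f e :: nat) : set (g e))"
 by (rule PT_member) (intro PTs)

lemma PT_member_nat2: "PT f ==> PT g ==> PT (%e. (f e :: nat * nat) : set (g e))"
 by (rule PT_member) (intro PTs PT_eq_prod)

lemma PT_even: "PT f ==> PT (%e. even (f e :: nat))"
proof -
 assume "PT f"
 hence "PT (%e. f e div 2 * 2 = f e)" by (intro PTs)
 moreover have "n div 2 * 2 = n \<longleftrightarrow> even n" for n :: nat by presburger
 ultimately show ?thesis by simp
qed

lemma PT_replicate: assumes "PT f" "PT g" shows "PT (%e. replicate (f e) (g e))"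
proof -
 have "PT (%e. map (%i. g e) [0..<f e])"
  by (intro PTs assms assms[THEN PT_comp])
 thus ?thesis by (simp add: map_replicate_const)
qed

lemma PT_product: assumes "PT f" "PT g" shows "PT (%e. List.product (f e) (g e))"
 unfolding product_concat_map
 by (intro PTs assms assms[THEN PT_comp])

text \<open>The enumeration of all subsets is cut off at \<open>M\<close> entries. This makes it
  polynomial in \<open>M\<close> on all inputs, and nothing is lost when \<open>M\<close> is at
  least \<open>2 ^ length xs\<close>.\<close>

definition psubs :: "nat => 'a list => 'a list list" where
 "psubs M xs = foldl (%a x. take M (map (%y. x # y) a @ a)) [[]] xs"

lemma sz_list_bound:
 assumes "length a <= M" "!!y. y : set a ==> sz y <= B"
 shows "sz a <= 1 + M * B"
proof -
 have "sz (map (%y. y) a) <= 1 + length a * B" using assms(2) by (intro sz_map_le) auto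
 also have "... <= 1 + M * B" using assms(1) by (intro add_left_mono mult_le_mono1)
 finally show ?thesis by simp
qed

lemma PT_psubs:
 fixes xs :: "'a::repr => 'b::repr list"
 assumes "PT M" "PT xs"
 shows "PT (%e. psubs (M e) (xs e))"
proof -
 let ?f = "%M a x. take M (map (%y. x # y) a @ a)"
 have inv: "length (foldl (?f M) a ys) <= max M (length a) &
   (ALL y:set (foldl (?f M) a ys). sz y <= s + sz ys)" if "ALL y:set a. sz y <= s" for a and ys :: "'b list" and M s
  using that
 proof (induction ys arbitrary: a s)
  case (Cons x ys)
  have "ALL y:set (?f M a x). sz y <= s + sz x" using Cons.prems by (fastforce dest: in_set_takeD)
  from Cons.IH[OF this] show ?case by auto
 qed (auto intro: le_SucI)
 show ?thesis
  unfolding psubs_def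
 proof (rule PT_foldl[OF assms(2) PT_const, where B = "%e. 1 + (M e + 1) * (1 + sz (xs e))"])
  show "PT (%w :: 'a * 'b list list * 'b. take (M (fst w)) (map (%y. snd (snd w) # y) (fst (snd w)) @ fst (snd w)))"
   by (intro PTs PT_comp[OF assms(1)])
  have "PB (%e. M e)" by (rule PB_mono[OF PT_size[OF assms(1)]]) simp
  thus "PB (%e. 1 + (M e + 1) * (1 + sz (xs e)))"
   by (intro PB_add PB_mult PB_const PT_size assms)
  fix e i
  have *: "length (foldl (?f (M e)) [[]] (take i (xs e))) <= max (M e) 1 &
   (ALL y:set (foldl (?f (M e)) [[]] (take i (xs e))). sz y <= 1 + sz (take i (xs e)))"
   using inv[of "[[]]" 1 "M e" "take i (xs e)"] by simp
  show "sz (foldl (?f (M e)) [[]] (take i (xs e))) <= 1 + (M e + 1) * (1 + sz (xs e))"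
  proof (rule sz_list_bound)
   fix y assume "y : set (foldl (?f (M e)) [[]] (take i (xs e)))"
   hence "sz y <= 1 + sz (take i (xs e))" using * by blast
   thus "sz y <= 1 + sz (xs e)" using sz_take[of i "xs e"] by simp
  qed (use * in auto)
 qed
qed

lemma psubs_props:
 assumes "distinct xs" "2 ^ length xs <= M"
 shows "distinct (psubs M xs)" "!!S. S : set (psubs M xs) ==> distinct S" "inj_on set (set (psubs M xs))"
  "set ` set (psubs M xs) = Pow (set xs)"
proof -
 have "distinct (psubs M xs) & (ALL S:set (psubs M xs). distinct S) & inj_on set (set (psubs M xs)) &
  set ` set (psubs M xs) = Pow (set xs) & length (psubs M xs) = 2 ^ length xs"
  using assms
 proof (induction xs rule: rev_induct)
  case (snoc x xs)
  let ?a = "psubs M xs"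
  have IH: "distinct ?a" "ALL S:set ?a. distinct S" "inj_on set (set ?a)" "set ` set ?a = Pow (set xs)"
   "length ?a = 2 ^ length xs" and x: "x ~: set xs"
   using snoc by auto
  have e: "psubs M (xs @ [x]) = map (%y. x # y) ?a @ ?a"
   using snoc.prems(2) IH(5) by (simp add: psubs_def)
  have xa: "x ~: set S" if "S : set ?a" for S using that IH(4) x by auto
  have "inj_on set (set (map (%y. x # y) ?a @ ?a))"
  proof (rule inj_onI)
   fix S T assume S: "S : set (map (%y. x # y) ?a @ ?a)" "T : set (map (%y. x # y) ?a @ ?a)" "set S = set T"
   have "insert x (set S') = insert x (set T') --> S' = T'" if "S' : set ?a" "T' : set ?a" for S' T'
    using that xa IH(3) by (metis inj_onD insert_ident)
   moreover have "x : set U \<longleftrightarrow> U : (%y. x # y) ` set ?a" if "U : set (map (%y. x # y) ?a @ ?a)" for U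
    using that xa by auto
   hence "S : (%y. x # y) ` set ?a \<longleftrightarrow> T : (%y. x # y) ` set ?a" using S by metis
   ultimately show "S = T" using S IH(3) by (auto dest: inj_onD)
  qed
  moreover have "set ` set (map (%y. x # y) ?a @ ?a) = Pow (set (xs @ [x]))"
  proof -
   have "set ` set (map (%y. x # y) ?a @ ?a) = (insert x ` (set ` set ?a)) Un set ` set ?a"
    by (auto simp: image_Un image_image)
   thus ?thesis unfolding IH(4) by (simp add: Pow_insert Un_commute)
  qed
  moreover have "distinct (map (%y. x # y) ?a @ ?a)" using IH(1) xa
   by (auto simp: distinct_map inj_on_def) (metis list.set_intros(1))
  ultimately show ?case unfolding e using IH xa by auto
 qed (auto simp: psubs_def)
 thus "distinct (psubs M xs)" "!!S. S : set (psubs M xs) ==> distinct S" "inj_on set (set (psubs M xs))"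
  "set ` set (psubs M xs) = Pow (set xs)" by auto
qed

section \<open>Query strings\<close>

text \<open>The encoding of \<open>graph_of L adj\<close> for irreflexive \<open>adj\<close>,
  written over the entries of \<open>L\<close> so that the rules for \<open>PT\<close> apply to
  it.\<close>

definition bits_graph :: "'v list => ('v => 'v => bool) => bool list" where
 "bits_graph L adj = replicate (length L) True @ [False] @ concat (map (%u. map (%v. adj u v | adj v u) L) L)"

lemma enc_graph_of:
 assumes "!!u. u : set L ==> ~ adj u u"
 shows "enc_graph (graph_of L adj) = bits_graph L adj"
proof -
 have 1: "{i, j} : edges (graph_of L adj) \<longleftrightarrow> adj (L ! i) (L ! j) | adj (L ! j) (L ! i)"
  if "i < length L" "j < length L" for i j
  using that assms[OF nth_mem[OF that(1)]] by (auto simp: graph_of_def ES_iff)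
 have 2: "map f [0..<length L] = map (%v. g v) L" if "!!i. i < length L ==> f i = g (L ! i)" for f :: "nat => 'b" and g
  using that by (intro nth_equalityI) auto
 have "map (%(i, j). {i, j} : edges (graph_of L adj)) (List.product [0..<length L] [0..<length L]) =
  concat (map (%u. map (%v. adj u v | adj v u) L) L)"
  unfolding product_concat_map map_concat map_map comp_def
  by (rule arg_cong[where f = concat], rule 2) (simp add: 1 2)
 thus ?thesis
  by (simp add: enc_graph_def Let_def verts_graph_of enc_nat_def bits_graph_def)
qed

definition squares :: "nat => (nat * nat) list" where
 "squares q = List.product [0..<q] [0..<q]"

definition ind_graphs :: "nat => nat => nat => (nat * nat) list => (nat => 'x => nat => 'x => bool) => 'x list => 'x =>
  (bool * (nat * 'x) list * (nat * nat) list) list" where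
 "ind_graphs M k q hl Cp xs x0 = concat (map (%S. map (%C. (even (length S + (k - length C)),
  filter (%u. fst u : set C) (bi_verts k q xs x0), S)) (psubs M [0..<k])) (psubs M (squares q)))"

definition ind_queries where
 "ind_queries pre M k q hl Cp xs x0 = map (%z. (fst z, pre @ bits_graph (fst (snd z)) (bi_adj q hl Cp (snd (snd z)))))
  (ind_graphs M k q hl Cp xs x0)"

definition good_hl :: "nat => nat => (nat * nat) list => bool" where
 "good_hl k q hl \<longleftrightarrow> (\<forall>(i, j)\<in>set hl. i < j & j < k & ~ (i < q & q <= j & j < 2 * q))"

definition hl_edges :: "(nat * nat) list => nat set set" where
 "hl_edges hl = (%(i, j). {i, j}) ` set hl"

lemma good_hl_biedges: "good_hl k q hl ==> hl_edges hl Int biedges q = {}"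
 by (fastforce simp: good_hl_def hl_edges_def biedges_def doubleton_eq_iff)

lemma good_hl_irrefl: "good_hl k q hl ==> ~ bi_adj q hl Cp S u u"
 by (auto simp: good_hl_def bi_adj_def)

lemma exists_hl:
 assumes "H <= pairs {..<k}" "H Int biedges q = {}"
 obtains C where "C <= {(i, j). i < j & j < k & ~ (i < q & q <= j & j < 2 * q)}" "(%(i, j). {i, j}) ` C = H"
proof
 let ?C = "{(i, j). i < j & {i, j} : H}"
 show "?C <= {(i, j). i < j & j < k & ~ (i < q & q <= j & j < 2 * q)}"
 proof (clarify, intro conjI notI)
  fix i j assume h: "i < j" "{i, j} : H"
  thus "j < k" using assms(1) by (auto simp: pairs_def)
  assume "i < q & q <= j & j < 2 * q"
  hence "{i, j} = {i, q + (j - q)} & i < q & j - q < q" by auto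
  hence "{i, j} : biedges q" unfolding biedges_def by blast
  thus False using h assms(2) by blast
 qed
 show "(%(i, j). {i, j}) ` ?C = H"
 proof (intro equalityI subsetI)
  fix e assume e: "e : H"
  then obtain u v where uv: "e = {u, v}" "u ~= v" using assms(1) by (auto simp: pairs_def card_2_iff)
  hence "(min u v, max u v) : ?C" "e = {min u v, max u v}" using e by (auto simp: min_def max_def insert_commute)
  thus "e : (%(i, j). {i, j}) ` ?C" by (intro image_eqI[of _ _ "(min u v, max u v)"]) auto
 qed auto
qed

definition sg :: "bool => rat" where "sg b = (if b then 1 else -1)"

lemma sg_even: "sg (even n) = (-1) ^ n"
 by (simp add: sg_def)

lemma ind_graphs_sum:
 assumes iso: "iso_invariant \<Phi>" and k: "2 * q <= k" and hl: "good_hl k q hl"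
  and M: "2 ^ (q * q) <= M" "2 ^ k <= M" and xs: "distinct xs"
 shows "(\<Sum>z\<leftarrow>ind_graphs M k q hl Cp xs x0. sg (fst z) *
   indsub \<Phi> k (graph_of (fst (snd z)) (bi_adj q hl Cp (snd (snd z))))) =
  altsum \<Phi> k q (hl_edges hl) * of_nat (card (bicliques k q xs x0 Cp))"
proof -
 let ?L = "bi_verts k q xs x0"
 note SS = psubs_props[of "squares q" M]
 note CC = psubs_props[of "[0..<k]" M]
 have s: "distinct (squares q)" "2 ^ length (squares q) <= M" "set (squares q) = {..<q} \<times> {..<q}"
  using M by (auto simp: squares_def distinct_product)
 have c: "distinct [0..<k]" "2 ^ length [0..<k] <= M" using M by auto
 have kL: "fst ` set ?L <= {..<k}" by (auto simp: set_bi_verts)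
 have "(\<Sum>z\<leftarrow>ind_graphs M k q hl Cp xs x0. sg (fst z) * indsub \<Phi> k (graph_of (fst (snd z)) (bi_adj q hl Cp (snd (snd z))))) =
  (\<Sum>S\<leftarrow>psubs M (squares q). \<Sum>C\<leftarrow>psubs M [0..<k]. sg (even (length S + (k - length C))) *
   indsub \<Phi> k (graph_of (filter (%u. fst u : set C) ?L) (bi_adj q hl Cp S)))"
 proof -
  have *: "(\<Sum>z\<leftarrow>concat (map h ys). g z) = (\<Sum>y\<leftarrow>ys. \<Sum>z\<leftarrow>h y. (g z :: rat))" for g and h :: "(nat * nat) list => 'c list" and ys
   by (induction ys) auto
  show ?thesis unfolding ind_graphs_def * map_map comp_def by simp
 qed
 also have "... = (\<Sum>S\<leftarrow>psubs M (squares q). sgn_of S *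
   (\<Sum>B | B <= set ?L & card B = k & fst ` B = {..<k}. on_set \<Phi> k (bi_adj q hl Cp S) B))"
 proof (intro arg_cong[where f = sum_list] map_cong refl)
  fix S
  have "(\<Sum>C\<leftarrow>psubs M [0..<k]. sg (even (length S + (k - length C))) *
   indsub \<Phi> k (graph_of (filter (%u. fst u : set C) ?L) (bi_adj q hl Cp S))) =
   (SUM C:set (psubs M [0..<k]). (%C. sgn_of S * ((-1) ^ (k - card C) *
   indsub \<Phi> k (graph_of (filter (%u. fst u : C) ?L) (bi_adj q hl Cp S)))) (set C))"
   unfolding sum_list_distinct_conv_sum_set[OF CC(1)[OF c]]
   by (intro sum.cong refl) (simp only: sg_even sgn_of_def power_add distinct_card[OF CC(2)[OF c]] mult.assoc)
  also have "... = (SUM C:Pow {..<k}. sgn_of S * ((-1) ^ (k - card C) *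
   indsub \<Phi> k (graph_of (filter (%u. fst u : C) ?L) (bi_adj q hl Cp S))))"
  proof -
   have "Pow {..<k} = set ` set (psubs M [0..<k])" using CC(4)[OF c] by (simp add: atLeast0LessThan)
   thus ?thesis by (simp add: sum.reindex[OF CC(3)[OF c]])
  qed
  also have "... = sgn_of S * (\<Sum>B | B <= set ?L & card B = k & fst ` B = {..<k}. on_set \<Phi> k (bi_adj q hl Cp S) B)"
   unfolding sum_distrib_left[symmetric]
   by (subst indsub_colorful[OF iso distinct_bi_verts[OF xs] kL]) simp
  finally show "(\<Sum>C\<leftarrow>psubs M [0..<k]. sg (even (length S + (k - length C))) *
   indsub \<Phi> k (graph_of (filter (%u. fst u : set C) ?L) (bi_adj q hl Cp S))) = ..." .
 qed
 also have "... = altsum \<Phi> k q (hl_edges hl) * of_nat (card (bicliques k q xs x0 Cp))"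
  by (rule biclique_identity[OF iso k]) (use hl SS[OF s(1,2)] s(3) good_hl_biedges[OF hl] in "auto simp: hl_edges_def good_hl_def")
 finally show ?thesis .
qed

text \<open>The pattern contains the whole biclique. Hence the colouring is a homomorphism for every
  omitted set \<open>S\<close>, and one pattern serves all queries.\<close>

definition cp_target :: "nat => nat => (nat * nat) list => nat => nat => bool" where
 "cp_target k q hl i j \<longleftrightarrow> (i, j) : set hl | (i < q & q <= j & j < 2 * q)"

definition cp_queries where
 "cp_queries M k q hl Cp xs x0 = (let L = bi_verts k q xs x0 in map (%S. (even (length S),
  bits_graph [0..<k] (cp_target k q hl) @ bits_graph L (bi_adj q hl Cp S) @
  concat (map (%u. replicate (fst u) True @ [False]) L))) (psubs M (squares q)))"

abbreviation cp_H :: "nat => nat => (nat * nat) list => graph" where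
 "cp_H k q hl \<equiv> graph_of [0..<k] (cp_target k q hl)"

lemma cp_queries_enc:
 assumes "good_hl k q hl"
 shows "cp_queries M k q hl Cp xs x0 = (let L = bi_verts k q xs x0 in map (%S. (even (length S),
  enc_colored (cp_H k q hl) (graph_of L (bi_adj q hl Cp S)) (%v. fst (L ! v)))) (psubs M (squares q)))"
proof -
 have 1: "~ cp_target k q hl i i" for i using assms by (auto simp: cp_target_def good_hl_def)
 have "enc_coloring (graph_of L adj) (%v. fst (L ! v)) = concat (map (%u. replicate (fst u) True @ [False]) L)"
  for L :: "(nat * 'a) list" and adj
 proof -
  have "map (%v. enc_nat (fst (L ! v))) [0..<length L] = map (%u. replicate (fst u) True @ [False]) L"
   by (intro nth_equalityI) (auto simp: enc_nat_def)
  thus ?thesis by (simp add: enc_coloring_def verts_graph_of)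
 qed
 thus ?thesis
  unfolding cp_queries_def Let_def enc_colored_def
  by (simp add: enc_graph_of 1 good_hl_irrefl[OF assms])
qed

lemma cp_hom:
 assumes "2 * q <= k" "good_hl k q hl" "L = bi_verts k q xs x0"
 shows "graph_hom (%v. fst (L ! v)) (graph_of L (bi_adj q hl Cp S)) (cp_H k q hl)"
proof -
 have f: "fst (L ! v) < k" if "v < length L" for v using nth_mem[OF that] by (auto simp: assms(3) set_bi_verts)
 show ?thesis
  unfolding graph_hom_def
 proof (intro conjI ballI)
  show "(%v. fst (L ! v)) ` verts (graph_of L (bi_adj q hl Cp S)) <= verts (cp_H k q hl)"
   using f by (auto simp: verts_graph_of)
  fix e assume "e : edges (graph_of L (bi_adj q hl Cp S))"
  then obtain u v where e: "e = {u, v}" "u < length L" "v < length L" "bi_adj q hl Cp S (L ! u) (L ! v)"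
   by (auto simp: graph_of_def elim!: ESE)
  hence "cp_target k q hl (fst (L ! u)) (fst (L ! v))" by (auto simp: bi_adj_def cp_target_def)
  moreover from this have "fst (L ! u) ~= fst (L ! v)" using assms(2) by (auto simp: cp_target_def good_hl_def)
  ultimately show "(%v. fst (L ! v)) ` e : edges (cp_H k q hl)"
   using f[OF e(2)] f[OF e(3)] by (simp add: e(1) graph_of_def ES_iff)
 qed
qed

lemma cp_queries_sum:
 assumes iso: "iso_invariant \<Phi>" and k: "2 * q <= k" and hl: "good_hl k q hl"
  and M: "2 ^ (q * q) <= M" and xs: "distinct xs" and L: "L = bi_verts k q xs x0"
 shows "(\<Sum>S\<leftarrow>psubs M (squares q). sg (even (length S)) *
   cp_indsub \<Phi> (cp_H k q hl) (graph_of L (bi_adj q hl Cp S)) (%v. fst (L ! v))) =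
  altsum \<Phi> k q (hl_edges hl) * of_nat (card (bicliques k q xs x0 Cp))"
proof -
 note SS = psubs_props[of "squares q" M]
 have s: "distinct (squares q)" "2 ^ length (squares q) <= M" "set (squares q) = {..<q} \<times> {..<q}"
  using M by (auto simp: squares_def distinct_product)
 have "cp_indsub \<Phi> (cp_H k q hl) (graph_of L (bi_adj q hl Cp S)) (%v. fst (L ! v)) =
  (\<Sum>B | B <= set L & card B = k & fst ` B = {..<k}. on_set \<Phi> k (bi_adj q hl Cp S) B)" for S
 proof -
  have "cp_H k q hl = mkgraph {..<k} (ES {..<k} (cp_target k q hl))"
   unfolding graph_of_def by (auto intro!: arg_cong[where f = "mkgraph {..<k}"] ES_cong)
  show ?thesis unfolding \<open>cp_H k q hl = _\<close> L by (rule cp_indsub_on_set[OF iso distinct_bi_verts[OF xs]])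
 qed
 hence "(\<Sum>S\<leftarrow>psubs M (squares q). sg (even (length S)) *
   cp_indsub \<Phi> (cp_H k q hl) (graph_of L (bi_adj q hl Cp S)) (%v. fst (L ! v))) =
  (\<Sum>S\<leftarrow>psubs M (squares q). sgn_of S *
   (\<Sum>B | B <= set (bi_verts k q xs x0) & card B = k & fst ` B = {..<k}. on_set \<Phi> k (bi_adj q hl Cp S) B))"
  by (simp add: sg_even sgn_of_def L)
 also have "... = altsum \<Phi> k q (hl_edges hl) * of_nat (card (bicliques k q xs x0 Cp))"
  by (rule biclique_identity[OF iso k]) (use hl SS[OF s(1,2)] s(3) good_hl_biedges[OF hl] in "auto simp: hl_edges_def good_hl_def")
 finally show ?thesis .
qed

section \<open>Query strings are computable in polynomial time\<close>

context
 fixes Cp :: "'c::repr => nat => 'x::repr => nat => 'x => bool"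
 assumes Cp: "PT (%z. Cp (fst z) (fst (snd z)) (fst (snd (snd z))) (fst (snd (snd (snd z)))) (snd (snd (snd (snd z)))))"
begin

lemma PT_Cp:
 assumes "PT c" "PT i" "PT x" "PT j" "PT y"
 shows "PT (%e. Cp (c e) (i e) (x e) (j e) (y e))"
 using PT_comp[OF Cp PT_Pair[OF assms(1) PT_Pair[OF assms(2) PT_Pair[OF assms(3) PT_Pair[OF assms(4,5)]]]]] by simp

lemma PT_bi_adj:
 assumes "PT c" "PT q" "PT hl" "PT S" "PT u" "PT v"
 shows "PT (%e. bi_adj (q e) (hl e) (Cp (c e)) (S e) (u e) (v e))"
 unfolding bi_adj_def
 by (intro PTs PT_member_nat2 PT_Cp assms)

lemma PT_bi_verts:
 assumes "PT k" "PT q" "PT xs" "PT (x0 :: 'e::repr => 'x)"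
 shows "PT (%e. bi_verts (k e) (q e) (xs e) (x0 e))"
 unfolding bi_verts_def
 by (intro PTs assms assms[THEN PT_comp])

lemma PT_bits_bi:
 assumes "PT c" "PT q" "PT hl" "PT S" "PT L"
 shows "PT (%e. bits_graph (L e) (bi_adj (q e) (hl e) (Cp (c e)) (S e)))"
 unfolding bits_graph_def
 by (intro PTs PT_replicate PT_bi_adj assms assms[THEN PT_comp])

lemma PT_squares: "PT q ==> PT (%e. squares (q e))"
 unfolding squares_def by (intro PT_product PT_upt)

lemma PT_ind_queries:
 assumes "PT pre" "PT M" "PT k" "PT q" "PT hl" "PT c" "PT xs" "PT x0"
 shows "PT (%e. ind_queries (pre e) (M e) (k e) (q e) (hl e) (Cp (c e)) (xs e) (x0 e))"
 unfolding ind_queries_def ind_graphs_def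
 by (intro PTs PT_bits_bi PT_even PT_member_nat PT_psubs PT_squares PT_bi_verts assms assms[THEN PT_comp])

lemma PT_cp_queries:
 assumes "PT M" "PT k" "PT q" "PT hl" "PT c" "PT xs" "PT x0"
 shows "PT (%e. cp_queries (M e) (k e) (q e) (hl e) (Cp (c e)) (xs e) (x0 e))"
proof -
 have t: "PT (%e. bits_graph [0..<k e] (cp_target (k e) (q e) (hl e)))"
  unfolding bits_graph_def cp_target_def
  by (intro PTs PT_replicate PT_member_nat2 assms assms[THEN PT_comp])
 show ?thesis
  unfolding cp_queries_def Let_def
  by (intro PTs PT_bits_bi PT_even PT_psubs PT_squares PT_bi_verts PT_replicate PT_comp[OF t] assms assms[THEN PT_comp])
qed

end

section \<open>Evaluating signed sums of answers\<close>

definition dbl :: "big * big list => big * big list" where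
 "dbl z = (badd (fst z) (fst z), badd (fst z) (fst z) # snd z)"

definition div_step :: "big * big => big => big * big" where
 "div_step z t = (if nob t <= nob (fst z) then (bsub (fst z) t, badd (badd (snd z) (snd z)) (Big 1))
  else (fst z, badd (snd z) (snd z)))"

text \<open>Binary long division with \<open>l + 1\<close> digits. The values may be exponentially
  large, so neither unary counting nor repeated subtraction would be polynomial.\<close>

definition bdiv :: "nat => big => big => big" where
 "bdiv l a d = snd (foldl div_step (a, Big 0) (snd ((dbl ^^ l) (d, [d]))))"

lemma bdiv_correct:
 assumes "0 < nob d" "nob a < 2 ^ (l + 1) * nob d"
 shows "nob (bdiv l a d) = nob a div nob d"
proof -
 have fst_dbl: "nob (fst ((dbl ^^ l) (d, [d]))) = 2 ^ l * nob d" for l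
  by (induction l) (auto simp: dbl_def)
 have "nob (snd (foldl div_step (a, Q) (snd ((dbl ^^ l) (d, [d]))))) = nob Q * 2 ^ (l + 1) + nob a div nob d"
  if "nob a < 2 ^ (l + 1) * nob d" for a Q l
  using that
 proof (induction l arbitrary: a Q)
  case 0
  have "nob a div nob d = (if nob d <= nob a then 1 else 0)"
   using 0 assms(1) by (auto intro: div_nat_eqI)
  thus ?case by (simp add: div_step_def)
 next
  case (Suc l)
  let ?t = "badd (fst ((dbl ^^ l) (d, [d]))) (fst ((dbl ^^ l) (d, [d])))"
  have t: "nob ?t = 2 ^ (l + 1) * nob d" by (simp add: fst_dbl)
  have e: "snd ((dbl ^^ Suc l) (d, [d])) = ?t # snd ((dbl ^^ l) (d, [d]))" by (simp add: dbl_def)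
  show ?case
  proof (cases "nob ?t <= nob a")
   case True
   have "nob (bsub a ?t) < 2 ^ (l + 1) * nob d" using Suc.prems True unfolding nob_simps(2) t by simp
   have st: "div_step (a, Q) ?t = (bsub a ?t, badd (badd Q Q) (Big 1))" using True by (simp add: div_step_def del: nob_simps)
   have "nob (snd (foldl div_step (a, Q) (snd ((dbl ^^ Suc l) (d, [d]))))) =
    nob (badd (badd Q Q) (Big 1)) * 2 ^ (l + 1) + nob (bsub a ?t) div nob d"
    unfolding e foldl.simps st by (rule Suc.IH) fact
   hence "nob (snd (foldl div_step (a, Q) (snd ((dbl ^^ Suc l) (d, [d]))))) =
    (2 * nob Q + 1) * 2 ^ (l + 1) + (nob a - 2 ^ (l + 1) * nob d) div nob d"
    unfolding nob_simps(2) t by (simp del: power_Suc)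
   moreover have "nob a div nob d = 2 ^ (l + 1) + (nob a - 2 ^ (l + 1) * nob d) div nob d"
   proof -
    have "nob a = (nob a - 2 ^ (l + 1) * nob d) + 2 ^ (l + 1) * nob d" using True t by simp
    hence "nob a div nob d = ((nob a - 2 ^ (l + 1) * nob d) + 2 ^ (l + 1) * nob d) div nob d" by simp
    also have "... = 2 ^ (l + 1) + (nob a - 2 ^ (l + 1) * nob d) div nob d"
     using assms(1) by (simp only: div_mult_self1)
    finally show ?thesis .
   qed
   ultimately show ?thesis by (simp add: algebra_simps)
  next
   case False
   hence "nob a < 2 ^ (l + 1) * nob d" using t by simp
   from Suc.IH[OF this, of "badd Q Q"] False show ?thesis
    unfolding e by (simp add: div_step_def)
  qed
 qed
 from this[OF assms(2), of "Big 0"] show ?thesis by (simp add: bdiv_def)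
qed

definition scale :: "nat => big => big" where
 "scale n a = ((%s. badd s a) ^^ n) (Big 0)"

lemma nob_scale: "nob (scale n a) = n * nob a"
proof -
 have "nob (((%s. badd s a) ^^ n) (Big 0)) = n * nob a" by (induction n) auto
 thus ?thesis by (simp add: scale_def)
qed

text \<open>An answer is \<open>(a - b) / d\<close>. One of the truncated differences vanishes, so
  \<open>u\<close> and \<open>w\<close> are the positive and the negative part of the integer
  \<open>n * (a - b) / d\<close>. They are added to separate counters, crosswise if the sign is
  negative.\<close>

definition add_ans :: "nat => nat => big * big => bool * big3 => big * big" where
 "add_ans n l z r = (let a = fst (snd r); b = fst (snd (snd r)); d = snd (snd (snd r));
  u = bdiv l (scale n (bsub a b)) d; w = bdiv l (scale n (bsub b a)) d
  in if fst r then (badd (fst z) u, badd (snd z) w) else (badd (fst z) w, badd (snd z) u))"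

definition sum_ans :: "nat => nat => (bool * big3) list => big * big" where
 "sum_ans n l rs = foldl (add_ans n l) (Big 0, Big 0) rs"

definition ival :: "big * big => rat" where
 "ival z = of_nat (nob (fst z)) - of_nat (nob (snd z))"

lemma add_ans_correct:
 assumes "rep3 (snd r) v" "of_nat n * v : \<int>" "\<bar>of_nat n * v\<bar> < 2 ^ (l + 1)"
 shows "ival (add_ans n l z r) = ival z + sg (fst r) * (of_nat n * v)"
proof -
 obtain a b d where t: "snd r = (a, b, d)" by (cases "snd r") auto
 have d: "0 < nob d" and v: "v = (of_nat (nob a) - of_nat (nob b)) / of_nat (nob d)"
  using assms(1) by (auto simp: rep3_def t)
 obtain w where w: "of_nat n * v = of_int w" using assms(2) by (auto elim: Ints_cases)
 have key: "of_nat (nob (bdiv l (scale n (bsub a b)) d)) = (of_nat (nat w) :: rat)"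
  if "of_nat n * ((of_nat (nob a) - of_nat (nob b)) / of_nat (nob d)) = (of_int w :: rat)" "\<bar>of_int w :: rat\<bar> < 2 ^ (l + 1)" for a b w
 proof -
  have "of_int (int n * (int (nob a) - int (nob b))) = (of_int (w * int (nob d)) :: rat)"
   using that(1) d by (simp add: field_simps)
  hence e: "int n * (int (nob a) - int (nob b)) = w * int (nob d)" by (simp only: of_int_eq_iff)
  have s: "nob (scale n (bsub a b)) = nat w * nob d"
  proof (cases "nob b <= nob a")
   case True
   hence i: "int (n * (nob a - nob b)) = w * int (nob d)" using e by (simp add: of_nat_diff)
   hence "0 <= w" using d by (metis of_nat_0_le_iff of_nat_0_less_iff zero_le_mult_iff not_le)
   hence "int (n * (nob a - nob b)) = int (nat w * nob d)" using i by simp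
   thus ?thesis by (simp only: nob_scale nob_simps of_nat_eq_iff)
  next
   case False
   hence "w * int (nob d) <= 0" unfolding e[symmetric] by (simp add: mult_le_0_iff)
   hence "w <= 0" using d by (simp add: mult_le_0_iff)
   thus ?thesis using False by (simp add: nob_scale)
  qed
  have "of_nat (nat w) < (of_nat (2 ^ (l + 1)) :: rat)"
   using that(2) by (cases "0 <= w") (auto simp: abs_if split: if_splits)
  hence "nat w < 2 ^ (l + 1)" by (simp only: of_nat_less_iff)
  hence "nob (scale n (bsub a b)) < 2 ^ (l + 1) * nob d" unfolding s using d by simp
  from bdiv_correct[OF d this] show ?thesis using s d by simp
 qed
 have 1: "of_nat (nob (bdiv l (scale n (bsub a b)) d)) = (of_nat (nat w) :: rat)"
  by (rule key) (use w v assms(3) in auto)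
 have 2: "of_nat (nob (bdiv l (scale n (bsub b a)) d)) = (of_nat (nat (- w)) :: rat)"
 proof (rule key)
  have "(of_nat (nob b) - of_nat (nob a)) / of_nat (nob d) = - v" unfolding v by (simp add: minus_divide_left)
  thus "of_nat n * ((of_nat (nob b) - of_nat (nob a)) / of_nat (nob d)) = (of_int (- w) :: rat)"
   using w by simp
 qed (use assms(3) w in simp)
 have 3: "of_nat (nat w) - of_nat (nat (- w)) = (of_int w :: rat)" by (cases "0 <= w") auto
 show ?thesis
  unfolding w 3[symmetric] 1[symmetric] 2[symmetric]
  by (simp add: add_ans_def Let_def t ival_def sg_def)
qed

lemma sum_ans_correct:
 assumes "!!r. r : set rs ==> rep3 (snd r) (f r) & of_nat n * f r : \<int> & \<bar>of_nat n * f r\<bar> < 2 ^ (l + 1)"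
 shows "ival (sum_ans n l rs) = of_nat n * (\<Sum>r\<leftarrow>rs. sg (fst r) * f r)"
proof -
 have "ival (foldl (add_ans n l) z rs) = ival z + of_nat n * (\<Sum>r\<leftarrow>rs. sg (fst r) * f r)" for z
  using assms
 proof (induction rs arbitrary: z)
  case (Cons r rs)
  have "ival (add_ans n l z r) = ival z + sg (fst r) * (of_nat n * f r)"
   using Cons.prems by (intro add_ans_correct) auto
  thus ?case using Cons.IH[of "add_ans n l z r"] Cons.prems by (simp add: algebra_simps)
 qed simp
 from this[of "(Big 0, Big 0)"] show ?thesis by (simp add: sum_ans_def ival_def)
qed

lemma PT_sum_ans:
 assumes "PT n" "PT l" "PT rs"
 shows "PT (%e. sum_ans (n e) (l e) (rs e))"
proof -
 have pow: "PT (%e :: nat * big. snd ((dbl ^^ fst e) (snd e, [snd e])))"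
 proof (intro PT_snd PT_funpow[where B = "%e. sz e + 5"] PT_fst PT_Pair PT_Cons PT_const PT_id)
  show "PT (%z :: (nat * big) * big * big list. dbl (snd z))"
   unfolding dbl_def by (intro PTs PT_badd)
  show "PB (%e :: nat * big. sz e + 5)" by (intro PB_add PB_sz PB_const)
  fix e :: "nat * big" and i assume "i <= fst e"
  moreover have "sz ((dbl ^^ i) (snd e, [snd e])) = i + 3" by (induction i) (auto simp: dbl_def sz_prod_def)
  ultimately show "sz ((dbl ^^ i) (snd e, [snd e])) <= sz e + 5" by (simp add: sz_prod_def)
 qed
 have div: "PT (%e :: nat * big * big. bdiv (fst e) (fst (snd e)) (snd (snd e)))"
  unfolding bdiv_def
 proof (rule PT_snd, rule PT_foldl[where B = "%e. 2"])
  show "PT (%e :: nat * big * big. snd ((dbl ^^ fst e) (snd (snd e), [snd (snd e)])))"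
   using PT_comp[OF pow PT_Pair[OF PT_fst[OF PT_id] PT_snd[OF PT_snd[OF PT_id]]]] by simp
  show "PT (%w :: (nat * big * big) * (big * big) * big. div_step (fst (snd w)) (snd (snd w)))"
   unfolding div_step_def
   by (intro PTs PT_ble PT_badd PT_bsub)
 qed (auto intro!: PT_Pair PT_fst PT_snd PT_id PT_const PB_const simp: sz_prod_def)
 have sc: "PT (%e :: nat * big. scale (fst e) (snd e))"
  unfolding scale_def
  by (rule PT_funpow[where B = "%e. 1"]) (auto intro!: PT_badd PT_fst PT_snd PT_id PT_const PB_const)
 have div': "PT (%e. bdiv (a e) (b e) (c e))" if "PT a" "PT b" "PT c" for a b and c :: "'x::repr => big"
  using PT_comp[OF div PT_Pair[OF that(1) PT_Pair[OF that(2,3)]]] by simp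
 have sc': "PT (%e. scale (a e) (b e))" if "PT a" "PT b" for a and b :: "'x::repr => big"
  using PT_comp[OF sc PT_Pair[OF that]] by simp
 show ?thesis
  unfolding sum_ans_def
 proof (rule PT_foldl[OF assms(3), where B = "%e. 2"])
  show "PT (%w. add_ans (n (fst w)) (l (fst w)) (fst (snd w)) (snd (snd w)))"
   unfolding add_ans_def Let_def
   by (intro PTs PT_badd PT_bsub div' sc' assms[THEN PT_comp])
 qed (auto intro!: PT_const PB_const simp: sz_prod_def)
qed

section \<open>Sparsification of 3-CNF formulas\<close>

type_synonym lit = "bool * nat"
text \<open>A node of the branching tree: the unit clauses and the two-literal clauses added so far,
  the latter in both orders.\<close>

type_synonym 'l state = "'l list * ('l * 'l) list"

definition holds :: "(nat => bool) => lit => bool" where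
 "holds al l \<longleftrightarrow> al (snd l) = fst l"

definition lits :: "('l * 'l * 'l) list => 'l list" where
 "lits T = dedup (concat (map (%t. [fst t, fst (snd t), snd (snd t)]) T))"

definition act2 :: "'l state => ('l * 'l) list" where
 "act2 s = filter (%p. ~ fst p : set (fst s) & ~ snd p : set (fst s)) (snd s)"

definition act3 :: "('l * 'l * 'l) list => 'l state => ('l * 'l * 'l) list" where
 "act3 T s = filter (%t. ~ fst t : set (fst s) & ~ fst (snd t) : set (fst s) & ~ snd (snd t) : set (fst s) &
  ~ (fst t, fst (snd t)) : set (snd s) & ~ (fst t, snd (snd t)) : set (snd s) &
  ~ (fst (snd t), snd (snd t)) : set (snd s)) T"

text \<open>\<open>nb1\<close>, \<open>nb2\<close> and \<open>nb3\<close> list the petals of the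
  three kinds of flowers: two-literal clauses through a literal, three-literal clauses through a
  pair, and three-literal clauses through a literal, whose petals are pairs. Only clauses not yet
  implied by a shorter one count.\<close>

definition nb1 :: "'l state => 'l => 'l list" where
 "nb1 s l = dedup (map snd (filter (%p. fst p = l) (act2 s)))"

definition nb2 :: "('l * 'l * 'l) list => 'l state => 'l * 'l => 'l list" where
 "nb2 T s p = dedup (map (%t. snd (snd t)) (filter (%t. fst t = fst p & fst (snd t) = snd p) (act3 T s)))"

definition nb3 :: "('l * 'l * 'l) list => 'l state => 'l => ('l * 'l) list" where
 "nb3 T s l = dedup (map snd (filter (%t. fst t = l) (act3 T s)))"

text \<open>Branching on a flower: either its heart or all of its petals are added as clauses.\<close>

definition branch :: "nat => nat => nat => ('l * 'l * 'l) list => 'l state => 'l state list" where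
 "branch a b c T s =
  (case filter (%l. a <= length (nb1 s l)) (lits T) of
   l # _ => [(dedup (l # fst s), snd s), (dedup (nb1 s l @ fst s), snd s)]
  | [] => (case filter (%p. b <= length (nb2 T s p)) (List.product (lits T) (lits T)) of
    p # _ => [(fst s, dedup (p # (snd p, fst p) # snd s)), (dedup (nb2 T s p @ fst s), snd s)]
   | [] => (case filter (%l. c <= length (nb3 T s l)) (lits T) of
     l # _ => [(dedup (l # fst s), snd s), (fst s, dedup (nb3 T s l @ snd s))]
    | [] => [s])))"

text \<open>Every round branches once at each state. The cut at \<open>M\<close> keeps the procedure
  polynomial in \<open>M\<close> on all inputs; \<open>spars_inv\<close> shows that it never takes
  effect when \<open>M\<close> is large enough.\<close>

definition spars :: "nat => nat => nat => nat => nat => ('l * 'l * 'l) list => 'l state list" where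
 "spars M i a b c T = ((%Ls. take M (concat (map (branch a b c T) Ls))) ^^ i) [([], [])]"

definition leaf_clauses :: "('l * 'l * 'l) list => 'l state => 'l list list" where
 "leaf_clauses T s = map (%l. [l]) (dedup (fst s)) @ map (%p. [fst p, snd p]) (dedup (act2 s)) @
  map (%t. [fst t, fst (snd t), snd (snd t)]) (dedup (act3 T s))"

definition sat_T :: "('l => bool) => ('l * 'l * 'l) list => bool" where
 "sat_T al T \<longleftrightarrow> (\<forall>(x, y, z)\<in>set T. al x | al y | al z)"

definition sat_s :: "('l => bool) => 'l state => bool" where
 "sat_s al s \<longleftrightarrow> (ALL l:set (fst s). al l) & (\<forall>(x, y)\<in>set (snd s). al x | al y)"

definition sat_cl :: "('l => bool) => 'l list list => bool" where
 "sat_cl al cs \<longleftrightarrow> (ALL C:set cs. EX l:set C. al l)"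

lemma length_dedup: "length (dedup xs) = card (set xs)"
 by (metis dedup distinct_card)

lemma set_act2: "set (act2 s) = {(x, y) : set (snd s). x ~: set (fst s) & y ~: set (fst s)}"
 by (auto simp: act2_def)

lemma set_nb1: "set (nb1 s l) = {y. (l, y) : set (act2 s)}"
 unfolding nb1_def dedup by force

lemma set_nb2: "set (nb2 T s p) = {y. (fst p, snd p, y) : set (act3 T s)}"
 unfolding nb2_def dedup by force

lemma set_nb3: "set (nb3 T s l) = {(y, z). (l, y, z) : set (act3 T s)}"
 unfolding nb3_def dedup by force

lemma length_nb: "length (nb1 s l) = card (set (nb1 s l))" "length (nb2 T s p) = card (set (nb2 T s p))"
 "length (nb3 T s l) = card (set (nb3 T s l))"
 unfolding nb1_def nb2_def nb3_def by (simp_all add: length_dedup dedup)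

text \<open>\<open>a\<close>, \<open>b\<close>, \<open>c\<close> are the sizes from which flowers of
  the three kinds are branched on, and \<open>y\<close> is the base of a potential. The exponents
  are the drops of \<open>mu\<close> in the two successors; the inequalities say that their
  potentials add up to at most that of the state.\<close>

locale sparsify =
 fixes a b c :: nat and T :: "('a * 'a * 'a) list" and y :: real
 assumes pos: "0 < a" "0 < b" "0 < c"
  and y: "1 < y" "1 / y ^ (2 * (a + b)) + 1 / y ^ (2 * (a + b) * a) <= 1"
   "1 / y ^ 2 + 1 / y ^ (2 * (a + b) * b) <= 1"
   "1 / y ^ (2 * (a + b)) + 1 / y ^ c <= 1"
  and sym: "!!x u v. (x, u, v) : set T ==> (x, v, u) : set T & (u, x, v) : set T & x ~= u"
begin

abbreviation "L \<equiv> set (lits T)"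
abbreviation "D \<equiv> a + b"

lemma L_T: "(x, u, v) : set T ==> x : L & u : L & v : L"
 unfolding lits_def dedup by force

text \<open>The degree bound is what keeps \<open>mu\<close> nonnegative: a literal that becomes a
  unit deactivates only boundedly many pairs.\<close>

definition inv :: "'a state => bool" where
 "inv s \<longleftrightarrow> set (fst s) <= L & set (snd s) <= L \<times> L &
  (ALL x y. (x, y) : set (snd s) --> (y, x) : set (snd s)) & (ALL l. card (set (nb1 s l)) <= D)"

text \<open>Each literal that is not yet a unit is worth \<open>4 * D\<close>. Making it a unit
  loses this amount and deactivates at most \<open>2 * D\<close> ordered pairs, so the net drop is
  at least \<open>2 * D\<close>. Every new active ordered pair lowers \<open>mu\<close> by
  1.\<close>

definition mu :: "'a state => int" where
 "mu s = 4 * int D * int (card (L - set (fst s))) - int (card (set (act2 s)))"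

lemma act3_T: "set (act3 T s) <= set T" by (auto simp: act3_def)

lemma act3_iff: "(x, u, v) : set (act3 T s) \<longleftrightarrow> (x, u, v) : set T & x ~: set (fst s) & u ~: set (fst s) & v ~: set (fst s) &
 (x, u) ~: set (snd s) & (x, v) ~: set (snd s) & (u, v) ~: set (snd s)"
 by (auto simp: act3_def)

lemma act3_sym: "inv s ==> (x, u, v) : set (act3 T s) ==> (x, v, u) : set (act3 T s)"
 unfolding act3_iff inv_def using sym by blast

lemma act2_count:
 assumes "inv s"
 shows "card (set (act2 s)) <= D * card (L - set (fst s))"
proof -
 have "set (act2 s) <= (SIGMA x:L - set (fst s). set (nb1 s x))"
  using assms by (auto simp: set_nb1 set_act2 inv_def)
 hence "card (set (act2 s)) <= card (SIGMA x:L - set (fst s). set (nb1 s x))"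
  by (intro card_mono) auto
 also have "... = (SUM x:L - set (fst s). card (set (nb1 s x)))" by (subst card_SigmaI) auto
 also have "... <= (SUM x:L - set (fst s). D)" using assms by (intro sum_mono) (auto simp: inv_def)
 finally show ?thesis by (simp add: mult.commute)
qed

lemma mu_nonneg: assumes "inv s" shows "0 <= mu s"
proof -
 have "int (card (set (act2 s))) <= int (D * card (L - set (fst s)))"
  using act2_count[OF assms] by (simp only: of_nat_le_iff)
 also have "... <= int (4 * D * card (L - set (fst s)))" by (intro of_nat_mono mult_le_mono1) simp
 finally show ?thesis by (simp add: mu_def)
qed

lemma add_units:
 assumes s: "inv s" and W: "set W <= L - set (fst s)" and U: "set U = set W Un set (fst s)"
 shows "inv (U, snd s)" "mu (U, snd s) <= mu s - 2 * int D * int (card (set W))"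
proof -
 let ?s = "(U, snd s)"
 have sub: "set (act2 ?s) <= set (act2 s)" using U by (auto simp: set_act2)
 have nb: "set (nb1 ?s l) <= set (nb1 s l)" for l using sub by (auto simp: set_nb1)
 have "card (set (nb1 ?s l)) <= D" for l
  using card_mono[OF _ nb] s unfolding inv_def by (meson List.finite_set le_trans)
 thus "inv ?s" using s W U by (auto simp: inv_def)
 have "set (act2 s) <= set (act2 ?s) Un (SIGMA x:set W. set (nb1 s x)) Un (%(x, y). (y, x)) ` (SIGMA x:set W. set (nb1 s x))"
 proof
  fix p assume p: "p : set (act2 s)"
  obtain x z where xz: "p = (x, z)" by (cases p)
  have zx: "(z, x) : set (act2 s)" using p s xz by (auto simp: set_act2 inv_def)
  show "p : set (act2 ?s) Un (SIGMA x:set W. set (nb1 s x)) Un (%(x, y). (y, x)) ` (SIGMA x:set W. set (nb1 s x))"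
  proof (cases "x : set W \<or> z : set W")
   case True
   thus ?thesis using p zx xz by (auto simp: set_nb1 image_iff)
  next
   case False
   thus ?thesis using p xz U by (auto simp: set_act2)
  qed
 qed
 hence "card (set (act2 s)) <= card (set (act2 ?s) Un (SIGMA x:set W. set (nb1 s x)) Un (%(x, y). (y, x)) ` (SIGMA x:set W. set (nb1 s x)))"
  by (intro card_mono) auto
 also have "... <= card (set (act2 ?s)) + card (SIGMA x:set W. set (nb1 s x)) + card ((%(x, y). (y, x)) ` (SIGMA x:set W. set (nb1 s x)))"
  using card_Un_le[of "set (act2 ?s) Un (SIGMA x:set W. set (nb1 s x))"] card_Un_le[of "set (act2 ?s)" "SIGMA x:set W. set (nb1 s x)"]
  by (meson add_le_mono1 le_trans)
 also have "card ((%(x, y). (y, x)) ` (SIGMA x:set W. set (nb1 s x))) <= card (SIGMA x:set W. set (nb1 s x))"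
  by (rule card_image_le) auto
 also have "card (SIGMA x:set W. set (nb1 s x)) <= D * card (set W)"
 proof -
  have "card (SIGMA x:set W. set (nb1 s x)) = (SUM x:set W. card (set (nb1 s x)))" by (subst card_SigmaI) auto
  also have "... <= (SUM x:set W. D)" using s by (intro sum_mono) (auto simp: inv_def)
  finally show ?thesis by (simp add: mult.commute)
 qed
 finally have 1: "card (set (act2 s)) <= card (set (act2 ?s)) + 2 * (D * card (set W))" by simp
 have "card (L - set (fst s)) = card (L - set U) + card (set W)"
  using W U by (subst card_Un_disjoint[symmetric]) (auto intro: arg_cong[where f = card])
 hence "mu ?s = mu s - 4 * int D * int (card (set W)) + (int (card (set (act2 s))) - int (card (set (act2 ?s))))"
  by (simp add: mu_def algebra_simps)
 also have "int (card (set (act2 s))) - int (card (set (act2 ?s))) <= int (2 * (D * card (set W)))" using 1 by linarith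
 finally show "mu ?s <= mu s - 2 * int D * int (card (set W))" by (simp add: algebra_simps)
qed

definition phi :: "'a state => real" where "phi s = y powr (of_int (mu s))"

lemma phi_drop: assumes "mu s' <= mu s - int n" shows "phi s' <= phi s * (1 / y ^ n)"
proof -
 have "phi s' <= y powr (of_int (mu s) - real n)"
  unfolding phi_def using assms y(1) by (intro powr_mono) linarith+
 also have "... = phi s * (1 / y ^ n)" using y(1) by (simp add: phi_def powr_diff powr_realpow)
 finally show ?thesis .
qed

lemma phi_two:
 assumes "mu s1 <= mu s - int n" "mu s2 <= mu s - int m" "1 / y ^ n + 1 / y ^ m <= 1"
 shows "phi s1 + phi s2 <= phi s"
proof -
 have "phi s1 + phi s2 <= phi s * (1 / y ^ n) + phi s * (1 / y ^ m)"
  using phi_drop assms(1,2) by (intro add_mono) auto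
 also have "... = phi s * (1 / y ^ n + 1 / y ^ m)" by (simp add: distrib_left)
 also have "... <= phi s * 1" using assms(3) by (intro mult_left_mono) (auto simp: phi_def)
 finally show ?thesis by simp
qed

definition good_branch :: "'a state => 'a state list => bool" where
 "good_branch s B \<longleftrightarrow> (ALL s':set B. inv s' & mu s' < mu s) & (\<Sum>s'\<leftarrow>B. phi s') <= phi s &
  (ALL al. sat_T al T --> (sat_s al s \<longleftrightarrow> (EX s':set B. sat_s al s')))"

definition leaf :: "'a state => bool" where
 "leaf s \<longleftrightarrow> (ALL l:L. card (set (nb1 s l)) < a) & (ALL l:L. card (set (nb3 T s l)) < c)"

lemma good_two:
 assumes "inv s1" "mu s1 <= mu s - int n" "inv s2" "mu s2 <= mu s - int m" "1 / y ^ n + 1 / y ^ m <= 1" "0 < n" "0 < m"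
  "!!al. sat_T al T ==> sat_s al s \<longleftrightarrow> sat_s al s1 | sat_s al s2"
 shows "good_branch s [s1, s2]"
 using assms phi_two[OF assms(2,4,5)] by (auto simp: good_branch_def)

lemma mu_weaken: "mu s' <= mu s - 2 * int D * int n ==> m <= n ==> mu s' <= mu s - int (2 * D * m)"
proof -
 assume h: "mu s' <= mu s - 2 * int D * int n" "m <= n"
 have "int (2 * D * m) <= int (2 * D * n)" using h(2) by (intro of_nat_mono mult_le_mono2)
 thus ?thesis using h(1) by simp
qed

text \<open>The order of the tests matters: pairs are added only when every literal has fewer than
  \<open>a\<close> active partners, which leaves room for the new ones within the degree bound
  \<open>D\<close>.\<close>

lemma branch_cases:
 assumes s: "inv s"
 shows "branch a b c T s = [s] & leaf s | good_branch s (branch a b c T s)"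
proof (cases "filter (%l. a <= length (nb1 s l)) (lits T)")
 case (Cons l ls)
 hence "l : set (filter (%l. a <= length (nb1 s l)) (lits T))" by simp
 hence l: "l : L" "a <= card (set (nb1 s l))" by (auto simp: length_nb)
 hence "set (nb1 s l) ~= {}" using pos by auto
 hence lU: "l ~: set (fst s)" by (auto simp: set_nb1 set_act2)
 have nbL: "set (nb1 s l) <= L - set (fst s)" using s by (auto simp: set_nb1 set_act2 inv_def)
 have B: "branch a b c T s = [(dedup (l # fst s), snd s), (dedup (nb1 s l @ fst s), snd s)]"
  using Cons by (simp add: branch_def)
 have u1: "inv (dedup (l # fst s), snd s)" "mu (dedup (l # fst s), snd s) <= mu s - 2 * int D * int (card (set [l]))"
  by (rule add_units[OF s, of "[l]"]; use l lU in "simp add: dedup")+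
 have u2: "inv (dedup (nb1 s l @ fst s), snd s)"
  "mu (dedup (nb1 s l @ fst s), snd s) <= mu s - 2 * int D * int (card (set (nb1 s l)))"
  by (rule add_units[OF s nbL]; simp add: dedup)+
 have "good_branch s (branch a b c T s)"
  unfolding B
 proof (rule good_two[OF u1(1) _ u2(1) _ y(2)])
  show "mu (dedup (l # fst s), snd s) <= mu s - int (2 * D)" using u1(2) by simp
  show "mu (dedup (nb1 s l @ fst s), snd s) <= mu s - int (2 * D * a)" by (rule mu_weaken[OF u2(2) l(2)])
  show "sat_s al s \<longleftrightarrow> sat_s al (dedup (l # fst s), snd s) | sat_s al (dedup (nb1 s l @ fst s), snd s)" for al
   by (auto simp: sat_s_def dedup set_nb1 set_act2)
 qed (use pos in auto)
 thus ?thesis by blast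
next
 case Nil
 hence n1: "card (set (nb1 s l)) < a" if "l : L" for l
  using that by (auto simp: filter_empty_conv length_nb)
 have n1': "card (set (nb1 s l)) < a" for l
 proof (cases "l : L")
  case False
  hence "set (nb1 s l) = {}" using s by (auto simp: set_nb1 set_act2 inv_def)
  thus ?thesis using pos by simp
 qed (rule n1)
 note N1 = Nil
 show ?thesis
 proof (cases "filter (%p. b <= length (nb2 T s p)) (List.product (lits T) (lits T))")
  case (Cons p ps)
  hence "p : set (filter (%p. b <= length (nb2 T s p)) (List.product (lits T) (lits T)))" by simp
  hence p: "p : L \<times> L" "b <= card (set (nb2 T s p))" by (auto simp: length_nb)
  obtain u v where uv: "p = (u, v)" by (cases p)
  have "set (nb2 T s p) ~= {}" using pos p(2) by auto
  then obtain w where w: "(u, v, w) : set (act3 T s)" by (auto simp: set_nb2 uv)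
  hence act: "u ~: set (fst s)" "v ~: set (fst s)" "(u, v) ~: set (snd s)" "u ~= v"
   using sym[of u v w] unfolding act3_iff by blast+
  hence act': "(v, u) ~: set (snd s)" using s by (auto simp: inv_def)
  have nbL: "set (nb2 T s p) <= L - set (fst s)" using L_T by (auto simp: set_nb2 act3_iff)
  let ?s1 = "(fst s, dedup (p # (snd p, fst p) # snd s))" and ?s2 = "(dedup (nb2 T s p @ fst s), snd s)"
  have B: "branch a b c T s = [?s1, ?s2]" using N1 Cons by (simp add: branch_def)
  have a2: "set (act2 ?s1) = set (act2 s) Un {(u, v), (v, u)}" using act by (auto simp: set_act2 dedup uv)
  have c2: "card (set (act2 ?s1)) = card (set (act2 s)) + 2"
  proof -
   have "(u, v) ~: set (act2 s)" "(v, u) ~: set (act2 s)" using act act' by (auto simp: set_act2)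
   thus ?thesis unfolding a2 using act(4) by (simp add: card_insert_if)
  qed
  have u1: "inv ?s1"
  proof -
   have "card (set (nb1 ?s1 l)) <= D" for l
   proof -
    have "set (nb1 ?s1 l) <= set (nb1 s l) Un (if l = u then {v} else if l = v then {u} else {})"
     using a2 by (auto simp: set_nb1)
    hence "card (set (nb1 ?s1 l)) <= card (set (nb1 s l) Un (if l = u then {v} else if l = v then {u} else {}))"
     by (intro card_mono) auto
    also have "... <= card (set (nb1 s l)) + card (if l = u then {v} else if l = v then {u} else {})"
     by (rule card_Un_le)
    also have "... <= card (set (nb1 s l)) + 1" by simp
    also have "... <= D" using n1'[of l] by simp
    finally show ?thesis .
   qed
   moreover have "(x, z) : set (snd ?s1) ==> (z, x) : set (snd ?s1)" for x z
    using s by (auto simp: dedup uv inv_def)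
   ultimately show ?thesis using s p(1) unfolding inv_def by (auto simp: dedup uv)
  qed
  \<comment> \<open>The new clause counts twice, once in each order.\<close>
  have m1: "mu ?s1 <= mu s - int 2" using c2 by (simp add: mu_def)
  have u2: "inv ?s2" "mu ?s2 <= mu s - 2 * int D * int (card (set (nb2 T s p)))"
   by (rule add_units[OF s nbL]; simp add: dedup)+
  have "good_branch s (branch a b c T s)"
   unfolding B
  proof (rule good_two[OF u1 m1 u2(1) mu_weaken[OF u2(2) p(2)] y(3)])
   show "sat_s al s \<longleftrightarrow> sat_s al ?s1 | sat_s al ?s2" if "sat_T al T" for al
    using that by (auto simp: sat_s_def dedup set_nb2 uv act3_iff sat_T_def)
  qed (use pos in auto)
  thus ?thesis by blast
 next
  case Nil
  hence n2: "card (set (nb2 T s p)) < b" if "p : L \<times> L" for p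
   using that by (cases p) (auto simp: filter_empty_conv length_nb not_le)
  note N2 = Nil
  show ?thesis
  proof (cases "filter (%l. c <= length (nb3 T s l)) (lits T)")
   case (Cons l ls)
   hence "l : set (filter (%l. c <= length (nb3 T s l)) (lits T))" by simp
   hence l: "l : L" "c <= card (set (nb3 T s l))" by (auto simp: length_nb)
   hence "set (nb3 T s l) ~= {}" using pos by auto
   hence lU: "l ~: set (fst s)" by (auto simp: set_nb3 act3_iff)
   let ?s1 = "(dedup (l # fst s), snd s)" and ?s2 = "(fst s, dedup (nb3 T s l @ snd s))"
   have B: "branch a b c T s = [?s1, ?s2]" using N1 N2 Cons by (simp add: branch_def)
   have u1: "inv ?s1" "mu ?s1 <= mu s - 2 * int D * int (card (set [l]))"
    by (rule add_units[OF s, of "[l]"]; use l lU in "simp add: dedup")+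
   have a2: "set (act2 ?s2) = set (act2 s) Un set (nb3 T s l)"
    by (auto simp: set_act2 dedup set_nb3 act3_iff)
   have dis: "set (act2 s) Int set (nb3 T s l) = {}" by (auto simp: set_act2 set_nb3 act3_iff)
   \<comment> \<open>The new partners of \<open>x\<close> are the completions of the pair
     \<open>(l, x)\<close>. As the second test failed, their number is within \<open>b\<close>, and
     there are fewer than \<open>a\<close> old partners.\<close>
   have u2: "inv ?s2"
   proof -
    have "card (set (nb1 ?s2 x)) <= D" for x
    proof -
     have "set (nb1 ?s2 x) = set (nb1 s x) Un set (nb2 T s (l, x))"
      using a2 by (auto simp: set_nb1 set_nb2 set_nb3)
     hence "card (set (nb1 ?s2 x)) <= card (set (nb1 s x)) + card (set (nb2 T s (l, x)))"
      by (simp add: card_Un_le)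
     moreover have "card (set (nb2 T s (l, x))) <= b"
     proof (cases "x : L")
      case True
      thus ?thesis using n2[of "(l, x)"] l(1) by simp
     next
      case False
      hence "set (nb2 T s (l, x)) = {}" using L_T by (auto simp: set_nb2 act3_iff)
      thus ?thesis by simp
     qed
     ultimately show ?thesis using n1'[of x] by simp
    qed
    moreover have "(x, z) : set (snd ?s2) ==> (z, x) : set (snd ?s2)" for x z
     using s act3_sym[OF s] by (auto simp: dedup inv_def set_nb3)
    moreover have "set (snd ?s2) <= L \<times> L" using s L_T by (auto simp: dedup inv_def set_nb3 act3_iff)
    ultimately show ?thesis using s unfolding inv_def by auto
   qed
   have m2: "mu ?s2 <= mu s - int c"
    using l(2) by (simp add: mu_def a2 card_Un_disjoint[OF _ _ dis])
   have "good_branch s (branch a b c T s)"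
    unfolding B
   proof (rule good_two[OF u1(1) _ u2 m2 y(4)])
    show "mu ?s1 <= mu s - int (2 * D)" using u1(2) by simp
    show "sat_s al s \<longleftrightarrow> sat_s al ?s1 | sat_s al ?s2" if "sat_T al T" for al
     using that by (auto simp: sat_s_def dedup set_nb3 act3_iff sat_T_def)
   qed (use pos in auto)
   thus ?thesis by blast
  next
   case Nil
   hence "branch a b c T s = [s]" using N1 N2 by (simp add: branch_def)
   moreover have "leaf s" using n1 Nil by (auto simp: leaf_def filter_empty_conv length_nb)
   ultimately show ?thesis by blast
  qed
 qed
qed

lemma phi_ge_1: "inv s ==> 1 <= phi s"
 unfolding phi_def using mu_nonneg[of s] y(1) by (intro ge_one_powr_ge_zero) auto

text \<open>Every state has potential at least 1 and the total potential never grows, so there are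
  at most \<open>y ^ (4 * D * card L) <= M\<close> states and the cut removes none. A state that is
  not a leaf loses at least 1 of \<open>mu\<close> in each round.\<close>

lemma spars_inv:
 assumes M: "y ^ (4 * D * card L) <= real M"
 defines "Ls i \<equiv> spars M i a b c T"
 shows "(ALL s:set (Ls i). inv s & (branch a b c T s = [s] & leaf s | mu s <= 4 * int D * int (card L) - int i)) &
  (\<Sum>s\<leftarrow>Ls i. phi s) <= y ^ (4 * D * card L) &
  (ALL al. sat_T al T --> (EX s:set (Ls i). sat_s al s))"
proof (induction i)
 case 0
 have "inv ([], [])" by (auto simp: inv_def set_nb1 set_act2)
 moreover have "mu ([], []) = 4 * int D * int (card L)" by (simp add: mu_def act2_def)
 moreover from this have "phi ([], []) = y ^ (4 * D * card L)"
  unfolding phi_def using y(1) by (simp flip: powr_realpow)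
 ultimately show ?case by (auto simp: Ls_def spars_def sat_s_def)
next
 case (Suc i)
 let ?C = "concat (map (branch a b c T) (Ls i))"
 have IH: "!!s. s : set (Ls i) ==> inv s"
  "!!s. s : set (Ls i) ==> branch a b c T s = [s] & leaf s | mu s <= 4 * int D * int (card L) - int i"
  "(\<Sum>s\<leftarrow>Ls i. phi s) <= y ^ (4 * D * card L)"
  "!!al. sat_T al T ==> EX s:set (Ls i). sat_s al s"
  using Suc by auto
 have bi: "inv s'" if "s : set (Ls i)" "s' : set (branch a b c T s)" for s s'
  using branch_cases[OF IH(1)[OF that(1)]]
 proof
  assume "branch a b c T s = [s] & leaf s"
  thus ?thesis using that IH(1) by simp
 next
  assume "good_branch s (branch a b c T s)"
  thus ?thesis using that(2) unfolding good_branch_def by blast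
 qed
 have invC: "inv s" if "s : set ?C" for s using that bi unfolding set_concat set_map by blast
 have "(\<Sum>s\<leftarrow>concat (map f xs). g s) = (\<Sum>x\<leftarrow>xs. \<Sum>s\<leftarrow>f x. (g s :: real))" for f :: "'a state => 'a state list" and g xs
  by (induction xs) auto
 hence "(\<Sum>s\<leftarrow>?C. phi s) = (\<Sum>s\<leftarrow>Ls i. \<Sum>s'\<leftarrow>branch a b c T s. phi s')" .
 also have "... <= (\<Sum>s\<leftarrow>Ls i. phi s)"
 proof (rule sum_list_mono)
  fix s assume "s : set (Ls i)"
  from branch_cases[OF IH(1)[OF this]] show "(\<Sum>s'\<leftarrow>branch a b c T s. phi s') <= phi s"
   by (elim disjE) (simp, simp add: good_branch_def)
 qed
 finally have ph: "(\<Sum>s\<leftarrow>?C. phi s) <= y ^ (4 * D * card L)" using IH(3) by simp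
 have "real (length ?C) = (\<Sum>s\<leftarrow>?C. 1)" by (simp add: sum_list_triv)
 also have "... <= (\<Sum>s\<leftarrow>?C. phi s)" by (rule sum_list_mono) (use invC phi_ge_1 in auto)
 finally have "length ?C <= M" using ph M by linarith
 hence e: "Ls (Suc i) = ?C" by (simp add: Ls_def spars_def)
 show ?case
 proof (intro conjI ballI allI impI)
  fix s' assume "s' : set (Ls (Suc i))"
  then obtain s where s: "s : set (Ls i)" "s' : set (branch a b c T s)" unfolding e by auto
  show "inv s'" by (rule bi[OF s])
  show "branch a b c T s' = [s'] & leaf s' | mu s' <= 4 * int D * int (card L) - int (Suc i)"
   using branch_cases[OF IH(1)[OF s(1)]]
  proof
   assume "branch a b c T s = [s] & leaf s"
   thus ?thesis using s(2) by simp
  next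
   assume g: "good_branch s (branch a b c T s)"
   hence "branch a b c T s ~= [s]" by (auto simp: good_branch_def)
   hence "mu s <= 4 * int D * int (card L) - int i" using IH(2)[OF s(1)] by blast
   moreover have "mu s' < mu s" using g s(2) by (auto simp: good_branch_def)
   ultimately show ?thesis by simp
  qed
 next
  show "(\<Sum>s\<leftarrow>Ls (Suc i). phi s) <= y ^ (4 * D * card L)" using ph e by simp
 next
  fix al assume al: "sat_T al T"
  then obtain s where s: "s : set (Ls i)" "sat_s al s" using IH(4) by blast
  have "EX s':set (branch a b c T s). sat_s al s'"
   using branch_cases[OF IH(1)[OF s(1)]] s(2) al by (auto simp: good_branch_def)
  thus "EX s:set (Ls (Suc i)). sat_s al s" unfolding e using s(1) by auto
 qed
qed

text \<open>After more than \<open>4 * D * card L\<close> rounds a state that is not a leaf would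
  have negative \<open>mu\<close>. At a leaf every literal lies in fewer than \<open>a\<close>
  active pairs and heads fewer than \<open>c\<close> active triples, so the number of clauses is
  linear.\<close>

lemma spars_correct:
 assumes M: "y ^ (4 * D * card L) <= real M" and i: "4 * D * card L < i"
 shows "length (spars M i a b c T) <= M"
  "!!s. s : set (spars M i a b c T) ==> length (leaf_clauses T s) <= (1 + a + c) * card L"
  "!!al. (EX s:set (spars M i a b c T). sat_cl al (leaf_clauses T s)) \<longleftrightarrow> sat_T al T"
  "!!s. s : set (spars M i a b c T) ==> set (concat (leaf_clauses T s)) <= L"
  "!!s C. s : set (spars M i a b c T) ==> C : set (leaf_clauses T s) ==> length C <= 3"
proof -
 note S = spars_inv[OF M, of i]
 have inv: "inv s" if "s : set (spars M i a b c T)" for s using S that by blast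
 have leaf: "leaf s" if "s : set (spars M i a b c T)" for s
 proof -
  have "~ mu s <= 4 * int D * int (card L) - int i"
  proof -
   have "int (4 * D * card L) < int i" using i by (simp only: of_nat_less_iff)
   thus ?thesis using mu_nonneg[OF inv[OF that]] by simp
  qed
  thus ?thesis using S that by blast
 qed
 have lc: "sat_cl al (leaf_clauses T s) \<longleftrightarrow> sat_T al T & sat_s al s" for s al
 proof
  assume h: "sat_cl al (leaf_clauses T s)"
  have cl: "EX l:set C. al l" if "C : set (leaf_clauses T s)" for C using h that by (auto simp: sat_cl_def)
  have 1: "ALL l:set (fst s). al l"
  proof
   fix l assume "l : set (fst s)"
   hence "[l] : set (leaf_clauses T s)" by (auto simp: leaf_clauses_def dedup)
   from cl[OF this] show "al l" by simp
  qed
  have 2: "al x | al z" if "(x, z) : set (snd s)" for x z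
  proof (cases "(x, z) : set (act2 s)")
   case True
   hence "[x, z] : set (leaf_clauses T s)" by (force simp: leaf_clauses_def dedup)
   from cl[OF this] show ?thesis by simp
  qed (use that 1 in "auto simp: set_act2")
  have 3: "al x | al z | al w" if "(x, z, w) : set T" for x z w
  proof (cases "(x, z, w) : set (act3 T s)")
   case True
   hence "[x, z, w] : set (leaf_clauses T s)" by (force simp: leaf_clauses_def dedup)
   from cl[OF this] show ?thesis by simp
  qed (use that 1 2 act3_iff in blast)
  show "sat_T al T & sat_s al s" unfolding sat_T_def sat_s_def using 1 2 3 by blast
 next
  assume "sat_T al T & sat_s al s"
  thus "sat_cl al (leaf_clauses T s)"
   by (auto simp: sat_cl_def leaf_clauses_def dedup sat_T_def sat_s_def set_act2 act3_iff)
 qed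
 show "(EX s:set (spars M i a b c T). sat_cl al (leaf_clauses T s)) \<longleftrightarrow> sat_T al T" for al
  using lc S by blast
 show "length (spars M i a b c T) <= M"
 proof -
  have "real (length (spars M i a b c T)) = (\<Sum>s\<leftarrow>spars M i a b c T. 1)" by (simp add: sum_list_triv)
  also have "... <= (\<Sum>s\<leftarrow>spars M i a b c T. phi s)" by (rule sum_list_mono) (use inv phi_ge_1 in auto)
  finally show ?thesis using S M by linarith
 qed
 fix s assume s: "s : set (spars M i a b c T)"
 have "card (set (fst s)) <= card L" using inv[OF s] by (intro card_mono) (auto simp: inv_def)
 moreover have "card (set (act2 s)) <= card L * a"
 proof -
  have "set (act2 s) <= (SIGMA x:L. set (nb1 s x))" using inv[OF s] by (auto simp: set_nb1 set_act2 inv_def)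
  hence "card (set (act2 s)) <= card (SIGMA x:L. set (nb1 s x))" by (intro card_mono) auto
  also have "... = (SUM x:L. card (set (nb1 s x)))" by (subst card_SigmaI) auto
  also have "... <= (SUM x:L. a)" using leaf[OF s] by (intro sum_mono) (auto simp: leaf_def less_imp_le)
  finally show ?thesis by simp
 qed
 moreover have "card (set (act3 T s)) <= card L * c"
 proof -
  have "set (act3 T s) <= (SIGMA x:L. set (nb3 T s x))" using L_T by (auto simp: set_nb3 act3_iff)
  hence "card (set (act3 T s)) <= card (SIGMA x:L. set (nb3 T s x))" by (intro card_mono) auto
  also have "... = (SUM x:L. card (set (nb3 T s x)))" by (subst card_SigmaI) auto
  also have "... <= (SUM x:L. c)" using leaf[OF s] by (intro sum_mono) (auto simp: leaf_def less_imp_le)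
  finally show ?thesis by simp
 qed
 ultimately show "length (leaf_clauses T s) <= (1 + a + c) * card L"
  by (simp add: leaf_clauses_def length_dedup algebra_simps)
 show "set (concat (leaf_clauses T s)) <= L"
 proof -
  have "x : L & z : L" if "(x, z) : set (act2 s)" for x z
   using that inv[OF s] by (auto simp: inv_def set_act2)
  moreover have "x : L & z : L & w : L" if "(x, z, w) : set (act3 T s)" for x z w
   using that L_T act3_T by blast
  ultimately show ?thesis using inv[OF s] by (auto simp: leaf_clauses_def dedup inv_def)
 qed
 show "length C <= 3" if "C : set (leaf_clauses T s)" for C
  using that by (auto simp: leaf_clauses_def)
qed

end

text \<open>With \<open>y ^ (2 * (a + b)) = exp r\<close>, the three conditions become inequalities
  between exponentials that are met by choosing \<open>a\<close> and then \<open>b\<close> large. At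
  most \<open>exp (2 * r)\<close> leaves arise per literal, and \<open>r\<close> is
  arbitrary.\<close>

lemma exists_thresholds:
 fixes r :: real
 assumes "0 < r"
 obtains a b c :: nat and y where "0 < a" "0 < b" "0 < c" "1 < y"
  "1 / y ^ (2 * (a + b)) + 1 / y ^ (2 * (a + b) * a) <= 1"
  "1 / y ^ 2 + 1 / y ^ (2 * (a + b) * b) <= 1" "1 / y ^ (2 * (a + b)) + 1 / y ^ c <= 1"
  "y ^ (4 * (a + b)) = exp (2 * r)"
proof -
 have "((%x. exp (- r * real x)) \<longlongrightarrow> 0) at_top" using assms by real_asymp
 moreover have "0 < 1 - exp (- r)" using assms by simp
 ultimately have "eventually (%x. exp (- r * real x) < 1 - exp (- r)) at_top"
  by (rule order_tendstoD)
 then obtain a where a: "0 < a" "exp (- r * real a) < 1 - exp (- r)"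
  using eventually_conj[OF _ eventually_gt_at_top[of 0]] by (metis (mono_tags, lifting) eventually_sequentially order_refl)
 \<comment> \<open>\<open>1 - exp (- r / (a + x))\<close> decays only like \<open>r / x\<close>, so
   the exponentially small second term fits in.\<close>
 have "eventually (%x. exp (- r / (real a + real x)) + exp (- r * real x) < 1) at_top"
  using assms by real_asymp
 then obtain b where b: "0 < b" "exp (- r / (real a + real b)) + exp (- r * real b) < 1"
  using eventually_conj[OF _ eventually_gt_at_top[of 0]] by (metis (mono_tags, lifting) eventually_sequentially order_refl)
 define y where "y = exp (r / (2 * (real a + real b)))"
 have ab: "0 < real a + real b" using a(1) by simp
 have pw: "1 / y ^ n = exp (- (r * real n / (2 * (real a + real b))))" for n
  by (simp add: y_def exp_of_nat_mult[symmetric] exp_minus inverse_eq_divide mult.commute)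
 \<comment> \<open>This choice makes the third inequality coincide with the first.\<close>
 define c where "c = 2 * (a + b) * a"
 have e1: "1 / y ^ (2 * (a + b)) = exp (- r)" unfolding pw using ab by simp
 have e2: "1 / y ^ (2 * (a + b) * a) = exp (- r * real a)" unfolding pw using ab by (simp add: field_simps)
 have e3: "1 / y ^ 2 = exp (- r / (real a + real b))" unfolding pw using ab by (simp add: field_simps)
 have e4: "1 / y ^ (2 * (a + b) * b) = exp (- r * real b)" unfolding pw using ab by (simp add: field_simps)
 have e5: "y ^ (4 * (a + b)) = exp (2 * r)"
  unfolding y_def exp_of_nat_mult[symmetric] using ab by (simp add: field_simps)
 show thesis
 proof (rule that[of a b c y])
  show "1 < y" using assms ab by (simp add: y_def)
 qed (use a b e1 e2 e3 e4 e5 in "auto simp: c_def")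
qed

section \<open>Reduction of a CNF to symmetric triples\<close>

text \<open>Variables are shifted by three; clauses with fewer than three literals are padded with the
 variables 0, 1, 2 in all possible ways.\<close>

definition six :: "lit list => (lit * lit * lit) list" where
 "six l = (let x = nthd (True, 0) l 0; y = nthd (True, 0) l 1; z = nthd (True, 0) l 2
  in [(x, y, z), (x, z, y), (y, x, z), (y, z, x), (z, x, y), (z, y, x)])"

definition pad :: "lit list => bool * bool * bool => lit list" where
 "pad C w = dedup (map (%l. (fst l, snd l + 3)) C) @ [(fst w, 0), (fst (snd w), 1), (snd (snd w), 2)]"

definition triples :: "cnf => (lit * lit * lit) list" where
 "triples F = concat (map (%C. concat (map (%w. six (pad C w))
  (List.product [True, False] (List.product [True, False] [True, False])))) F)"

lemma set_triples: "set (triples F) = (UN C:set F. \<Union>w. set (six (pad C w)))"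
proof -
 have "set (List.product [True, False] (List.product [True, False] [True, False])) = UNIV"
  by (auto simp: UNIV_bool)
 thus ?thesis unfolding triples_def by (simp only: set_concat set_map image_image UN_simps)
qed

lemma nthd_pad: "j < 3 ==> nthd (True, 0) (pad C w) j = pad C w ! j" "3 <= length (pad C w)" "distinct (pad C w)"
 by (auto simp: nthd_eq pad_def dedup)

lemma set_six_pad:
 "set (six (pad C w)) = (let x = pad C w ! 0; y = pad C w ! 1; z = pad C w ! 2
  in {(x, y, z), (x, z, y), (y, x, z), (y, z, x), (z, x, y), (z, y, x)})"
 by (simp add: six_def Let_def nthd_pad)

lemma triples_sym:
 assumes "(x, u, v) : set (triples F)"
 shows "(x, v, u) : set (triples F) & (u, x, v) : set (triples F) & x ~= u"
proof -
 obtain C w where C: "C : set F" "(x, u, v) : set (six (pad C w))" using assms by (auto simp: set_triples)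
 have ne: "pad C w ! i ~= pad C w ! j" if "i ~= j" "i < 3" "j < 3" for i j
  using nthd_pad(2,3)[of C w] that by (simp add: nth_eq_iff_index_eq)
 have "(x, v, u) : set (six (pad C w)) & (u, x, v) : set (six (pad C w)) & x ~= u"
  using C(2) ne[of 0 1] ne[of 0 2] ne[of 1 2] unfolding set_six_pad Let_def by auto
 thus ?thesis using C(1) unfolding set_triples by blast
qed

lemma pad_mem: "j < 3 ==> (!!x u v. (x, u, v) : set (six (pad C w)) ==> pad C w ! j : {x, u, v})"
proof -
 fix x u v assume j: "j < 3" and t: "(x, u, v) : set (six (pad C w))"
 have "j = 0 | j = 1 | j = 2" using j by auto
 thus "pad C w ! j : {x, u, v}" using t unfolding set_six_pad Let_def by auto
qed

text \<open>Without repetitions a clause has at most three literals, which are the first three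
  entries of every padded version. Conversely, for a given assignment one of the eight paddings
  consists of false literals only, so the truth of its triple comes from the clause.\<close>

lemma triples_sat:
 assumes "three_cnf F"
 shows "satisfiable F \<longleftrightarrow> (EX al. sat_T (holds al) (triples F))"
proof
 assume "satisfiable F"
 then obtain al where al: "!!C. C : set F ==> \<exists>(b, i)\<in>set C. al i = b" unfolding satisfiable_def by blast
 define \<beta> where "\<beta> i = al (i - 3)" for i
 have "holds \<beta> x | holds \<beta> u | holds \<beta> v" if t: "(x, u, v) : set (triples F)" for x u v
 proof -
  obtain C w where C: "C : set F" "(x, u, v) : set (six (pad C w))" using t by (auto simp: set_triples)
  define ds where "ds = dedup (map (%l. (fst l, snd l + 3)) C)"
  obtain b i where bi: "(b, i) : set C" "al i = b" using al[OF C(1)] by blast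
  have "(b, i + 3) : set ds" using bi by (force simp: ds_def dedup)
  then obtain j where j: "j < length ds" "ds ! j = (b, i + 3)" by (auto simp: in_set_conv_nth)
  have "length ds <= length C"
   unfolding ds_def length_dedup using card_length[of "map (%l. (fst l, snd l + 3)) C"] by simp
  also have "... <= 3" using assms C by (auto simp: three_cnf_def)
  finally have j3: "j < 3" using j by simp
  have "pad C w ! j = (b, i + 3)" using j by (simp add: pad_def ds_def[symmetric] nth_append)
  hence "(b, i + 3) : {x, u, v}" using pad_mem[OF j3 C(2)] by simp
  moreover have "holds \<beta> (b, i + 3)" using bi by (simp add: holds_def \<beta>_def)
  ultimately show ?thesis by auto
 qed
 thus "EX al. sat_T (holds al) (triples F)" unfolding sat_T_def by blast
next
 assume "EX al. sat_T (holds al) (triples F)"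
 then obtain \<beta> where \<beta>: "sat_T (holds \<beta>) (triples F)" by blast
 have "\<exists>(b, i)\<in>set C. \<beta> (i + 3) = b" if C: "C : set F" for C
 proof (rule ccontr)
  assume no: "~ ?thesis"
  \<comment> \<open>The padding whose three literals are all false under \<beta>.\<close>
  define w where "w = (~ \<beta> 0, ~ \<beta> 1, ~ \<beta> 2)"
  let ?l = "pad C w"
  have "(?l ! 0, ?l ! 1, ?l ! 2) : set (six (pad C w))" unfolding set_six_pad Let_def by simp
  hence "(?l ! 0, ?l ! 1, ?l ! 2) : set (triples F)" using C unfolding set_triples by blast
  hence "holds \<beta> (?l ! 0) | holds \<beta> (?l ! 1) | holds \<beta> (?l ! 2)" using \<beta> unfolding sat_T_def by blast
  moreover have nh: "~ holds \<beta> z" if z: "z : set ?l" for z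
  proof (cases "z : {(fst w, 0), (fst (snd w), 1), (snd (snd w), 2)}")
   case True
   thus ?thesis by (elim insertE) (simp_all add: holds_def w_def)
  next
   case False
   then obtain m where m: "m : set C" "z = (fst m, snd m + 3)" using z by (auto simp: pad_def dedup)
   hence "~ \<beta> (snd m + 3) = fst m" using no by (auto simp: case_prod_beta)
   thus ?thesis using m(2) by (simp add: holds_def)
  qed
  have "~ holds \<beta> (?l ! j)" if "j < 3" for j
   using that nthd_pad(2)[of C w] by (intro nh nth_mem) simp
  ultimately show False by simp
 qed
 thus "satisfiable F" unfolding satisfiable_def by (intro exI[of _ "%i. \<beta> (i + 3)"]) blast
qed

lemma lits_triples: "set (lits (triples F)) <= {(b, i). i < 3 | i - 3 : cnf_vars F}"
proof
 fix l assume "l : set (lits (triples F))"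
 then obtain x u v where t: "(x, u, v) : set (triples F)" "l : {x, u, v}"
  unfolding lits_def dedup by auto
 obtain C w where C: "C : set F" "(x, u, v) : set (six (pad C w))" using t by (auto simp: set_triples)
 have "l : {pad C w ! 0, pad C w ! 1, pad C w ! 2}"
  using C(2) t(2) unfolding set_six_pad Let_def by auto
 moreover have "pad C w ! j : set (pad C w)" if "j < 3" for j using that nthd_pad(2)[of C w] by simp
 ultimately have "l : set (pad C w)" by auto
 thus "l : {(b, i). i < 3 | i - 3 : cnf_vars F}"
 proof -
  assume l: "l : set (pad C w)"
  show ?thesis
  proof (cases "l : {(fst w, 0), (fst (snd w), 1), (snd (snd w), 2)}")
   case False
   then obtain m where m: "m : set C" "l = (fst m, snd m + 3)" using l by (auto simp: pad_def dedup)
   hence "snd m : cnf_vars F" using C(1) unfolding cnf_vars_def by blast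
   thus ?thesis using m(2) by simp
  qed auto
 qed
qed

lemma finite_cnf_vars: "finite (cnf_vars F)"
 by (auto simp: cnf_vars_def)

lemma card_lits: "card (set (lits (triples F))) <= 2 * (card (cnf_vars F) + 3)"
 and card_lit_vars: "card (snd ` set (lits (triples F))) <= card (cnf_vars F) + 3"
proof -
 let ?V = "{..<3} Un (%i. i + 3) ` cnf_vars F"
 have V: "finite ?V" "card ?V <= card (cnf_vars F) + 3"
  using finite_cnf_vars card_Un_le[of "{..<3}" "(%i. i + 3) ` cnf_vars F"] card_image_le[OF finite_cnf_vars, of "%i. i + 3" F]
  by auto
 have s: "set (lits (triples F)) <= UNIV \<times> ?V"
  using lits_triples by (force simp: image_iff)
 hence "card (set (lits (triples F))) <= card ((UNIV :: bool set) \<times> ?V)"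
  using V(1) by (intro card_mono) auto
 also have "... = 2 * card ?V" by (simp add: card_cartesian_product)
 finally show "card (set (lits (triples F))) <= 2 * (card (cnf_vars F) + 3)"
  using mult_le_mono2[OF V(2), of 2] by (rule order_trans)
 have "snd ` set (lits (triples F)) <= ?V" using s by auto
 thus "card (snd ` set (lits (triples F))) <= card (cnf_vars F) + 3"
  using card_mono[OF V(1)] V(2) le_trans by blast
qed

section \<open>Sparsification is computable in polynomial time\<close>

lemma PT_eq_lit: "PT f ==> PT g ==> PT (%e. f e = (g e :: lit))"
 by (intro PTs PT_eq_prod)

lemma PT_member_lit: "PT f ==> PT g ==> PT (%e. (f e :: lit) : set (g e))"
 by (rule PT_member) (intro PTs PT_eq_lit)

lemma PT_member_lit2: "PT f ==> PT g ==> PT (%e. (f e :: lit * lit) : set (g e))"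
 by (rule PT_member) (intro PTs PT_eq_prod)

lemma PT_dedup_lit: "PT f ==> PT (%e. dedup (f e :: lit list))"
 by (rule PT_dedup) (intro PTs PT_eq_lit)

lemma PT_dedup_lit2: "PT f ==> PT (%e. dedup (f e :: (lit * lit) list))"
 by (rule PT_dedup) (intro PTs PT_eq_prod)

lemma PT_dedup_lit3: "PT f ==> PT (%e. dedup (f e :: (lit * lit * lit) list))"
 by (rule PT_dedup) (intro PTs PT_eq_prod)

lemma PT_lits: fixes T :: "'e::repr => (lit * lit * lit) list" assumes "PT T" shows "PT (%e. lits (T e))"
 unfolding lits_def by (intro PTs PT_dedup_lit assms)

lemma PT_act2: fixes s :: "'e::repr => lit state" assumes "PT s" shows "PT (%e. act2 (s e))"
 unfolding act2_def by (intro PTs PT_member_lit PT_comp[OF assms] assms)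

lemma PT_act3: fixes T :: "'e::repr => (lit * lit * lit) list" assumes "PT T" "PT s" shows "PT (%e. act3 (T e) (s e))"
 unfolding act3_def
 by (intro PTs PT_member_lit PT_member_lit2 assms assms[THEN PT_comp])

lemma PT_nb1: fixes s :: "'e::repr => lit state" assumes "PT s" "PT l" shows "PT (%e. nb1 (s e) (l e))"
 unfolding nb1_def by (intro PTs PT_dedup_lit PT_eq_lit PT_act2 assms assms[THEN PT_comp])

lemma PT_nb2: fixes T :: "'e::repr => (lit * lit * lit) list" assumes "PT T" "PT s" "PT l" shows "PT (%e. nb2 (T e) (s e) (l e))"
 unfolding nb2_def
 by (intro PTs PT_dedup_lit PT_eq_lit PT_act3 assms assms[THEN PT_comp])

lemma PT_nb3: fixes T :: "'e::repr => (lit * lit * lit) list" assumes "PT T" "PT s" "PT l" shows "PT (%e. nb3 (T e) (s e) (l e))"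
 unfolding nb3_def
 by (intro PTs PT_dedup_lit2 PT_eq_lit PT_act3 assms assms[THEN PT_comp])

lemma PT_branch:
 fixes T :: "'e::repr => (lit * lit * lit) list"
 assumes "PT a" "PT b" "PT c" "PT T" "PT s"
 shows "PT (%e. branch (a e) (b e) (c e) (T e) (s e))"
 unfolding branch_def
 by (intro PTs PT_case_list PT_nb1 PT_nb2 PT_nb3 PT_lits PT_product PT_dedup_lit PT_dedup_lit2 assms assms[THEN PT_comp])

lemma PT_leaf_clauses: fixes T :: "'e::repr => (lit * lit * lit) list" assumes "PT T" "PT s" shows "PT (%e. leaf_clauses (T e) (s e))"
 unfolding leaf_clauses_def
 by (intro PTs PT_dedup_lit PT_dedup_lit2 PT_dedup_lit3 PT_act2 PT_act3 assms)

lemma PT_triples: assumes "PT F" shows "PT (%e. triples (F e))"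
 unfolding triples_def six_def pad_def Let_def
 by (intro PTs PT_dedup_lit assms)

text \<open>A size invariant that holds for arbitrary thresholds: without repetitions, a state has
  at most \<open>card K\<close> units and \<open>card K ^ 2\<close> pairs. It yields the polynomial
  bound in \<open>PT_spars\<close>.\<close>

definition small :: "'l set => 'l state => bool" where
 "small K s \<longleftrightarrow> set (fst s) <= K & distinct (fst s) & set (snd s) <= K \<times> K & distinct (snd s)"

lemma small_branch:
 assumes "small (set (lits T)) s" "s' : set (branch a b c T s)"
 shows "small (set (lits T)) s'"
proof -
 let ?K = "set (lits T)"
 have T: "x : ?K & u : ?K & v : ?K" if "(x, u, v) : set T" for x u v
  using that unfolding lits_def dedup by force
 have nb: "set (nb1 s l) <= ?K" "set (nb2 T s p) <= ?K" "set (nb3 T s l) <= ?K \<times> ?K" for l p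
  using assms(1) T by (auto simp: set_nb1 set_act2 small_def set_nb2 set_nb3 act3_def)
 have f: "x : set xs" if "filter Q xs = x # ys" for x Q and xs ys :: "'z list"
  using that by (metis filter_is_subset list.set_intros(1) subsetD)
 have s: "small ?K s" by (rule assms(1))
 have u: "small ?K (dedup (A @ fst s), snd s)" if "set A <= ?K" for A
  using s that by (auto simp: small_def dedup)
 have w: "small ?K (fst s, dedup (A @ snd s))" if "set A <= ?K \<times> ?K" for A
  using s that by (auto simp: small_def dedup)
 consider l ls where "filter (%l. a <= length (nb1 s l)) (lits T) = l # ls"
   "s' = (dedup ([l] @ fst s), snd s) | s' = (dedup (nb1 s l @ fst s), snd s)"
  | p ps where "filter (%p. b <= length (nb2 T s p)) (List.product (lits T) (lits T)) = p # ps"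
   "s' = (fst s, dedup ([p, (snd p, fst p)] @ snd s)) | s' = (dedup (nb2 T s p @ fst s), snd s)"
  | l ls where "filter (%l. c <= length (nb3 T s l)) (lits T) = l # ls"
   "s' = (dedup ([l] @ fst s), snd s) | s' = (fst s, dedup (nb3 T s l @ snd s))"
  | "s' = s"
  using assms(2) unfolding branch_def by (auto split: list.splits)
 thus ?thesis
 proof cases
  case (1 l ls)
  hence "set [l] <= ?K" using f[OF 1(1)] by simp
  thus ?thesis using 1(2) u nb(1) by blast
 next
  case (2 p ps)
  hence "set [p, (snd p, fst p)] <= ?K \<times> ?K" using f[OF 2(1)] by auto
  thus ?thesis using 2(2) w u nb(2) by blast
 next
  case (3 l ls)
  hence "set [l] <= ?K" using f[OF 3(1)] by simp
  thus ?thesis using 3(2) u w nb(3) by blast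
 qed (use s in simp)
qed

lemma PT_spars:
 fixes T :: "'e::repr => (lit * lit * lit) list"
 assumes "PT M" "PT i" "PT a" "PT b" "PT c" "PT T"
 shows "PT (%e. spars (M e) (i e) (a e) (b e) (c e) (T e))"
 unfolding spars_def
proof -
 let ?f = "%e Ls. take (M e) (concat (map (branch (a e) (b e) (c e) (T e)) Ls))"
 have f: "PT (%z. ?f (fst z) (snd z))"
  by (intro PTs PT_branch assms[THEN PT_comp])
 let ?K = "%e. set (lits (T e))"
 let ?s = "%e. sz (lits (T e))"
 let ?B = "%e. 1 + (M e + 1) * (2 + ?s e * ?s e + ?s e * ?s e * (2 * ?s e))"
 have sm: "small (?K e) s ==> sz s <= 2 + ?s e * ?s e + ?s e * ?s e * (2 * ?s e)" for e s
 proof -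
  assume s: "small (?K e) s"
  have cK: "card (?K e) <= ?s e" using card_length[of "lits (T e)"] length_le_sz[of "lits (T e)"] by linarith
  have "length (fst s) <= ?s e"
  proof -
   have "length (fst s) = card (set (fst s))" using s by (simp add: small_def distinct_card)
   also have "... <= card (?K e)" using s by (intro card_mono) (auto simp: small_def)
   finally show ?thesis using cK by simp
  qed
  hence 1: "sz (fst s) <= 1 + ?s e * ?s e"
   by (rule sz_list_bound) (use s in "auto simp: small_def intro: sz_mem")
  have "length (snd s) <= ?s e * ?s e"
  proof -
   have "length (snd s) = card (set (snd s))" using s by (simp add: small_def distinct_card)
   also have "... <= card (?K e \<times> ?K e)" using s by (intro card_mono) (auto simp: small_def)
   also have "... <= ?s e * ?s e" using cK by (simp add: card_cartesian_product mult_le_mono)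
   finally show ?thesis .
  qed
  hence 2: "sz (snd s) <= 1 + ?s e * ?s e * (2 * ?s e)"
  proof (rule sz_list_bound)
   fix p assume "p : set (snd s)"
   hence "fst p : ?K e" "snd p : ?K e" using s by (auto simp: small_def)
   thus "sz p <= 2 * ?s e" using sz_mem[of "fst p" "lits (T e)"] sz_mem[of "snd p" "lits (T e)"] by (simp add: sz_prod_def)
  qed
  show ?thesis using 1 2 by (simp add: sz_prod_def[of s])
 qed
 show "PT (%e. (?f e ^^ i e) [([], [])])"
 proof (rule PT_funpow[OF assms(2) PT_const f, where B = ?B])
  have "PB (%e. M e)" by (rule PB_mono[OF PT_size[OF assms(1)]]) simp
  thus "PB ?B" by (intro PB_add PB_mult PB_const PT_size PT_lits assms)
  fix e j assume "j <= i e"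
  have "length ((?f e ^^ j) [([], [])]) <= M e + 1 & (ALL s:set ((?f e ^^ j) [([], [])]). small (?K e) s)"
  proof (induction j)
   case (Suc j)
   thus ?case using small_branch by (fastforce dest!: in_set_takeD)
  qed (simp add: small_def)
  thus "sz ((?f e ^^ j) [([], [])]) <= ?B e" by (intro sz_list_bound) (use sm in auto)
 qed
qed

section \<open>Satisfiability as a compatibility problem\<close>

text \<open>Labels are sets of numbers, given as lists. In a label of the second block the members
  \<open>2 * t\<close> and \<open>2 * t + 1\<close> encode in unary which of the at most three
  literals is picked in clause \<open>t\<close> of the group.\<close>

definition dg :: "nat list => nat => nat" where
 "dg y t = of_bool (2 * t : set y) + of_bool (2 * t + 1 : set y)"

type_synonym sat_env = "(nat list * lit list list) * nat * nat"

definition lit_ok :: "nat list => nat => nat => nat list => lit => bool" where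
 "lit_ok vs g i x l \<longleftrightarrow> (ALL u:set [0..<g]. i * g + u < length vs --> nthd 0 vs (i * g + u) = snd l --> (u : set x) = fst l)"

text \<open>The environment is \<open>((variables, clauses), g, h)\<close> with groups of
  \<open>g\<close> variables and \<open>h\<close> clauses. A pair of labels only checks those picked
  literals of clause group \<open>j\<close> whose variables belong to variable group
  \<open>i\<close>.\<close>

definition satCp :: "sat_env => nat => nat list => nat => nat list => bool" where
 "satCp c i x j y \<longleftrightarrow> (ALL t:set [0..<snd (snd c)].
  j * snd (snd c) + t < length (snd (fst c)) -->
  dg y t < length (nthd [] (snd (fst c)) (j * snd (snd c) + t)) &
  lit_ok (fst (fst c)) (fst (snd c)) i x (nthd (True, 0) (nthd [] (snd (fst c)) (j * snd (snd c) + t)) (dg y t)))"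

lemma PT_dg: "PT y ==> PT t ==> PT (%e. dg (y e) (t e))"
 unfolding dg_def by (intro PTs PT_of_bool PT_member_nat)

lemma PT_lit_ok:
 assumes "PT vs" "PT g" "PT i" "PT x" "PT l"
 shows "PT (%e. lit_ok (vs e) (g e) (i e) (x e) (l e))"
 unfolding lit_ok_def
 by (intro PTs PT_member_nat assms assms[THEN PT_comp])

lemma PT_satCp:
 "PT (%z. satCp (fst z) (fst (snd z)) (fst (snd (snd z))) (fst (snd (snd (snd z)))) (snd (snd (snd (snd z)))))"
 unfolding satCp_def
 by (intro PTs PT_lit_ok PT_dg)

lemma finite_bicliques: "finite (bicliques k q xs x0 Cp)"
proof -
 have "finite (PiE {..<k} (%i. {x : set (bi_verts k q xs x0). fst x = i}))" by (intro finite_PiE) auto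
 thus ?thesis unfolding bicliques_def by (rule finite_subset[rotated]) blast
qed

lemma block_index:
 fixes m :: nat
 assumes "m < q * h"
 obtains j t where "j < q" "t < h" "m = j * h + t"
proof
 have "0 < h" using assms by (cases h) auto
 thus "m mod h < h" by simp
 show "m div h < q" using assms by (simp add: less_mult_imp_div_less)
 show "m = m div h * h + m mod h" by simp
qed

text \<open>The labels of the first block form an assignment. Each picked literal is checked against
  the one group that contains its variable, so compatibility of all pairs means that every clause
  has a true picked literal.\<close>

lemma sat_bicliques:
 assumes vs: "distinct vs" "snd ` set (concat cls) <= set vs" "length vs <= q * g"
  and cls: "length cls <= q * h" "!!C. C : set cls ==> length C <= 3"
  and k: "2 * q <= k" and l: "g <= l" "2 * h <= l" and xs: "set ` set xs = Pow (set [0..<l])"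
 shows "card (bicliques k q xs x0 (satCp ((vs, cls), (g, h)))) ~= 0 \<longleftrightarrow> (EX al. sat_cl (holds al) cls)"
proof
 assume "card (bicliques k q xs x0 (satCp ((vs, cls), (g, h)))) ~= 0"
 then obtain tu where "tu : bicliques k q xs x0 (satCp ((vs, cls), (g, h)))" by (metis card.empty ex_in_conv)
 hence tu: "!!i j. i < q ==> j < q ==> satCp ((vs, cls), (g, h)) i (snd (tu i)) j (snd (tu (q + j)))"
  by (auto simp: bicliques_def)
 define pos where "pos v = (THE m. m < length vs & vs ! m = v)" for v
 have pos: "pos (vs ! m) = m" if "m < length vs" for m
  unfolding pos_def using that vs(1) by (intro the_equality) (auto simp: nth_eq_iff_index_eq)
 define al where "al v = (pos v mod g : set (snd (tu (pos v div g))))" for v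
 have "EX l:set C. holds al l" if C: "C : set cls" for C
 proof -
  obtain m where m: "m < length cls" "cls ! m = C" using C by (auto simp: in_set_conv_nth)
  hence "m < q * h" using cls by simp
  then obtain j t where jt: "j < q" "t < h" "m = j * h + t" by (rule block_index)
  define d where "d = dg (snd (tu (q + j))) t"
  have ok: "d < length C & lit_ok vs g i (snd (tu i)) (C ! d)" if "i < q" for i
   using tu[OF that jt(1)] jt m unfolding satCp_def d_def by (auto simp: nthd_eq)
  have d: "d < length C" using ok[OF jt(1)] by simp
  hence "snd (C ! d) : set vs" using vs(2) C by force
  then obtain w where w: "w < length vs" "vs ! w = snd (C ! d)" by (auto simp: in_set_conv_nth)
  hence "w < q * g" using vs by simp
  then obtain i u where iu: "i < q" "u < g" "w = i * g + u" by (rule block_index)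
  have "w div g = i" "w mod g = u" using iu by auto
  moreover have "(u : set (snd (tu i))) = fst (C ! d)"
   using ok[OF iu(1)] iu w unfolding lit_ok_def by (auto simp: nthd_eq)
  ultimately have "holds al (C ! d)" using pos[OF w(1)] w(2) by (simp add: holds_def al_def)
  thus ?thesis using d by auto
 qed
 thus "EX al. sat_cl (holds al) cls" by (auto simp: sat_cl_def)
next
 assume "EX al. sat_cl (holds al) cls"
 then obtain al where al: "!!C. C : set cls ==> EX l:set C. holds al l" by (auto simp: sat_cl_def)
 define ch where "ch m = (SOME d. d < length (cls ! m) & holds al (cls ! m ! d))" for m
 have ch: "ch m < length (cls ! m)" "holds al (cls ! m ! ch m)" if "m < length cls" for m
 proof -
  have "EX d. d < length (cls ! m) & holds al (cls ! m ! d)"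
   using al[of "cls ! m"] that by (metis in_set_conv_nth nth_mem)
  from someI_ex[OF this] show "ch m < length (cls ! m)" "holds al (cls ! m ! ch m)" unfolding ch_def by auto
 qed
 have ch2: "ch m <= 2" if "m < length cls" for m using ch(1)[OF that] cls(2)[of "cls ! m"] that by simp
 define X where "X i = {u. u < g & i * g + u < length vs & al (vs ! (i * g + u))}" for i
 \<comment> \<open>The inverse of \<open>dg\<close>: position 1 is encoded by one member and
   position 2 by both.\<close>
 define Y where "Y j = {2 * t | t. t < h & j * h + t < length cls & 1 <= ch (j * h + t)} Un
  {2 * t + 1 | t. t < h & j * h + t < length cls & 2 <= ch (j * h + t)}" for j
 have "X i : set ` set xs" for i using l by (auto simp: xs X_def)
 hence "ALL i. EX x. x : set xs & set x = X i" by (metis imageE)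
 then obtain x where x: "!!i. x i : set xs & set (x i) = X i" by metis
 have "Y j : set ` set xs" for j using l by (auto simp: xs Y_def)
 hence "ALL j. EX y. y : set xs & set y = Y j" by (metis imageE)
 then obtain y where y: "!!i. y i : set xs & set (y i) = Y i" by metis
 define tu where "tu = (\<lambda>i\<in>{..<k}. (i, if i < q then x i else if i < 2 * q then y (i - q) else x0))"
 have t1: "tu i = (i, x i)" "tu (q + i) = (q + i, y i)" if "i < q" for i
  using that k by (auto simp: tu_def)
 have "tu : bicliques k q xs x0 (satCp ((vs, cls), (g, h)))"
  unfolding bicliques_def
 proof (intro CollectI conjI allI impI)
  show "tu : PiE {..<k} (%i. {x : set (bi_verts k q xs x0). fst x = i})"
   using x y unfolding tu_def by (intro restrict_PiE_iff[THEN iffD2]) (auto simp: set_bi_verts)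
  fix i j assume ij: "i < q" "j < q"
  show "satCp ((vs, cls), (g, h)) i (snd (tu i)) j (snd (tu (q + j)))"
   unfolding satCp_def
  proof (intro ballI impI)
   fix t assume t: "t : set [0..<snd (snd ((vs, cls), (g, h)))]"
    "j * snd (snd ((vs, cls), (g, h))) + t < length (snd (fst ((vs, cls), (g, h))))"
   define m where "m = j * h + t"
   have m: "m < length cls" "t < h" using t by (auto simp: m_def)
   have a: "2 * t : Y j \<longleftrightarrow> 1 <= ch m" "2 * t + 1 : Y j \<longleftrightarrow> 2 <= ch m"
    using m unfolding Y_def m_def by (auto, presburger+)
   have "dg (y j) t = ch m"
    unfolding dg_def using y[of j] a ch2[OF m(1)] by (cases "ch m = 0"; cases "ch m = 1") auto
   moreover have "lit_ok vs g i (x i) (cls ! m ! ch m)"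
    using ch(2)[OF m(1)] x[of i] by (auto simp: lit_ok_def nthd_eq holds_def X_def)
   ultimately show "dg (snd (tu (q + j))) t < length (nthd [] (snd (fst ((vs, cls), (g, h)))) (j * snd (snd ((vs, cls), (g, h))) + t)) &
     lit_ok (fst (fst ((vs, cls), (g, h)))) (fst (snd ((vs, cls), (g, h)))) i (snd (tu i))
      (nthd (True, 0) (nthd [] (snd (fst ((vs, cls), (g, h)))) (j * snd (snd ((vs, cls), (g, h))) + t)) (dg (snd (tu (q + j))) t))"
    using ch(1)[OF m(1)] m ij by (simp add: t1 nthd_eq m_def[symmetric])
  qed
 qed
 thus "card (bicliques k q xs x0 (satCp ((vs, cls), (g, h)))) ~= 0"
  using finite_bicliques by (metis card_0_eq empty_iff)
qed

section \<open>Parsing\<close>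

text \<open>Decodes a number at the front of a string; the flag records that the terminating
  \<open>False\<close> has been seen.\<close>

definition lead :: "bool list => nat" where
 "lead y = fst (foldl (%c z. if snd c then c else if z then (fst c + (1::nat), False) else (fst c, True)) (0, False) y)"

lemma lead_enc_nat: "lead (enc_nat n @ y) = n"
proof -
 let ?f = "%c z. if snd c then c else if z then (fst c + (1::nat), False) else (fst c, True)"
 have 1: "foldl ?f (c, True) y = (c, True)" for c :: nat and y by (induction y) auto
 have "foldl ?f (m, False) (enc_nat n @ y) = (m + n, True)" for m
 proof (induction n arbitrary: m)
  case 0
  thus ?case using 1 by (simp add: enc_nat_def)
 next
  case (Suc n)
  thus ?case using Suc[of "m + 1"] by (simp add: enc_nat_def)
 qed
 from this[of 0] show ?thesis by (simp add: lead_def)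
qed

lemma length_enc_nat [simp]: "length (enc_nat n) = n + 1" by (simp add: enc_nat_def)

lemma PT_lead: assumes "PT y" shows "PT (%e. lead (y e))"
 unfolding lead_def
proof (rule PT_fst, rule PT_foldl[OF assms PT_const, where B = "%e. sz (y e) + 3"])
 show "PT (%w. if snd (fst (snd w)) then fst (snd w) else if snd (snd w) then (fst (fst (snd w)) + (1::nat), False) else (fst (fst (snd w)), True))"
  by (intro PTs)
 show "PB (%e. sz (y e) + 3)" by (intro PB_add PB_const PT_size assms)
 fix e i
 let ?f = "%c z. if snd c then c else if z then (fst c + (1::nat), False) else (fst c, True)"
 have "fst (foldl ?f c ys) <= fst c + length ys" for c :: "nat * bool" and ys
 proof (induction ys arbitrary: c)
  case (Cons a ys)
  have "fst (foldl ?f (?f c a) ys) <= fst (?f c a) + length ys" by (rule Cons)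
  also have "... <= fst c + length (a # ys)" by auto
  finally show ?case by simp
 qed simp
 from this[of "(0, False)" "take i (y e)"]
 have "fst (foldl ?f (0, False) (take i (y e))) <= length (y e)" by simp
 thus "sz (foldl ?f (0, False) (take i (y e))) <= sz (y e) + 3"
  using length_le_sz[of "y e"] by (simp add: sz_prod_def)
qed

text \<open>The first number is the mode of the parser: 0 before a clause, 1 before a literal, 2
  before its sign, 3 while counting its variable, 4 after the end. Then come the sign and the count,
  the current clause and the finished clauses.\<close>

type_synonym pstate = "(nat * bool * nat) * lit list * cnf"

definition pstep :: "pstate => bool => pstate" where
 "pstep s z = (let m = fst (fst s); b = fst (snd (fst s)); c = snd (snd (fst s)); C = fst (snd s); F = snd (snd s) in
  if m = 0 then (if z then ((1, False, 0), [], F) else ((4, False, 0), [], F))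
  else if m = 1 then (if z then ((2, False, 0), C, F) else ((0, False, 0), [], F @ [C]))
  else if m = 2 then ((3, z, 0), C, F)
  else if m = 3 then (if z then ((3, b, c + 1), C, F) else ((1, False, 0), C @ [(b, c)], F))
  else s)"

definition parse :: "bool list => cnf" where
 "parse y = snd (snd (foldl pstep ((0, False, 0), [], []) y))"

lemma pstep_simps:
 "pstep ((0, v), C, F) True = ((1, False, 0), [], F)" "pstep ((0, v), C, F) False = ((4, False, 0), [], F)"
 "pstep ((1, v), C, F) True = ((2, False, 0), C, F)" "pstep ((1, v), C, F) False = ((0, False, 0), [], F @ [C])"
 "pstep ((2, v), C, F) z = ((3, z, 0), C, F)"
 "pstep ((3, b, c), C, F) True = ((3, b, c + 1), C, F)" "pstep ((3, b, c), C, F) False = ((1, False, 0), C @ [(b, c)], F)"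
 by (simp_all add: pstep_def)

lemma parse_nat: "foldl pstep ((3, b, c), C, F) (enc_nat i) = ((1, False, 0), C @ [(b, c + i)], F)"
 by (induction i arbitrary: c) (simp_all add: enc_nat_def pstep_simps)

lemma parse_clause: "foldl pstep ((1, False, 0), C, F) (enc_list (%(b, i). b # enc_nat i) D) = ((0, False, 0), [], F @ [C @ D])"
proof (induction D arbitrary: C)
 case (Cons l D)
 obtain b i where l: "l = (b, i)" by (cases l)
 have "foldl pstep ((1, False, 0), C, F) (enc_list (%(b, i). b # enc_nat i) (l # D)) =
  foldl pstep (foldl pstep ((3, b, 0), C, F) (enc_nat i)) (enc_list (%(b, i). b # enc_nat i) D)"
  by (simp only: enc_list_def list.map concat.simps foldl_append foldl_Cons foldl_Nil append_Cons append_assoc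
    pstep_simps l prod.case)
 also have "... = ((0, False, 0), [], F @ [C @ (l # D)])"
  unfolding parse_nat using Cons[of "C @ [(b, i)]"] by (simp only: l add_0 append_assoc append_Cons append_Nil)
 finally show ?case .
qed (simp only: enc_list_def list.map concat.simps foldl_append foldl_Cons foldl_Nil pstep_simps append_Nil append_Nil2)

lemma parse_cnf: "parse (enc_cnf F) = F"
proof -
 have "foldl pstep ((0, False, 0), [], G) (enc_list (enc_list (%(b, i). b # enc_nat i)) F) = ((4, False, 0), [], G @ F)" for G
 proof (induction F arbitrary: G)
  case (Cons D F)
  have "foldl pstep ((0, False, 0), [], G) (enc_list (enc_list (%(b, i). b # enc_nat i)) (D # F)) =
   foldl pstep (foldl pstep ((1, False, 0), [], G) (enc_list (%(b, i). b # enc_nat i) D))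
    (enc_list (enc_list (%(b, i). b # enc_nat i)) F)"
   by (simp only: enc_list_def list.map concat.simps foldl_append foldl_Cons foldl_Nil append_Cons append_assoc pstep_simps)
  also have "... = ((4, False, 0), [], G @ (D # F))"
   unfolding parse_clause using Cons[of "G @ [D]"] by (simp only: append_assoc append_Cons append_Nil)
  finally show ?case .
 qed (simp only: enc_list_def list.map concat.simps foldl_append foldl_Cons foldl_Nil pstep_simps append_Nil append_Nil2)
 from this[of "[]"] show ?thesis by (simp add: parse_def enc_cnf_def)
qed

lemma sz_append': "sz (xs @ ys) = sz xs + sz ys - 1" using sz_append[of xs ys] by simp

lemma PT_parse: assumes "PT y" shows "PT (%e. parse (y e))"
 unfolding parse_def
proof (intro PT_snd, rule PT_foldl[OF assms PT_const, where B = "%e. 10 * sz (y e) + 10"])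
 show "PT (%w. pstep (fst (snd w)) (snd (snd w)))"
  unfolding pstep_def Let_def
  by (intro PTs)
 show "PB (%e. 10 * sz (y e) + 10)" by (intro PB_add PB_mult PB_const PT_size assms)
 fix e i
 have "sz (pstep s z) <= sz s + 10" for s z
  using sz_pos[of "fst (snd s)"] sz_pos[of "snd (snd s)"]
  by (auto simp: pstep_def Let_def sz_prod_def sz_append')
 hence "sz (foldl pstep s ys) <= sz s + 10 * length ys" for s ys
 proof (induction ys arbitrary: s)
  case (Cons z ys)
  have "sz (foldl pstep (pstep s z) ys) <= sz (pstep s z) + 10 * length ys" using Cons by blast
  also have "... <= sz s + 10 + 10 * length ys" using Cons.prems[of s z] by simp
  finally show ?case by simp
 qed simp
 from this[of "((0, False, 0), [], [])" "take i (y e)"]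
 show "sz (foldl pstep ((0, False, 0), [], []) (take i (y e))) <= 10 * sz (y e) + 10"
  using length_le_sz[of "y e"] by (simp add: min_def split: if_splits)
qed

section \<open>Families of queries and the size of their answers\<close>

text \<open>The property of answers on \<open>V\<close>-vertex graphs from which both their
  denominators and their magnitude are controlled.\<close>

definition sum_form :: "(graph => rat) => nat => rat => bool" where
 "sum_form \<Phi> V v \<longleftrightarrow> (\<exists>(S :: nat set set) h. finite S & card S <= 2 ^ V & h ` S <= graphs & v = (SUM s:S. \<Phi> (h s)))"

text \<open>\<open>V\<close> bounds the number of vertices of the queried graph. The prefix is
  \<open>enc_nat k\<close> for the parameterized problem and empty for an algorithm for one fixed
  \<open>k\<close>.\<close>

definition imem :: "bool list => (graph => rat) => nat => nat => bool list => rat => bool" where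
 "imem pre \<Phi> k V y v \<longleftrightarrow> (EX G:input_graphs. y = pre @ enc_graph G & card (verts G) <= V & v = indsub \<Phi> k G)"

definition cmem :: "(graph => rat) => nat => nat => bool list => rat => bool" where
 "cmem \<Phi> k V y v \<longleftrightarrow> (EX H G c. H : input_graphs & G : input_graphs & graph_hom c G H & card (verts H) = k &
  y = enc_colored H G c & card (verts G) <= V & v = cp_indsub \<Phi> H G c)"

lemma imem_unique: "imem pre \<Phi> k V y v ==> imem pre \<Phi> k V' y v' ==> v' = v"
 unfolding imem_def using enc_graph_inj by (metis same_append_eq)

lemma cmem_unique: "cmem \<Phi> k V y v ==> cmem \<Phi> k V' y v' ==> v' = v"
proof -
 have "cmem \<Phi> k V y v ==> (y, k, v) : cp_indsub_problem \<Phi>" for V v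
  unfolding cmem_def cp_indsub_problem_def by blast
 thus "cmem \<Phi> k V y v ==> cmem \<Phi> k V' y v' ==> v' = v"
  using functional_cp_indsub_problem[of \<Phi>] unfolding functional_def by blast
qed

lemma sum_form_subsets:
 assumes G: "G : graphs" "card (verts G) <= V" and S: "S <= Pow (verts G)"
 shows "sum_form \<Phi> V (SUM A:S. \<Phi> (induced G A))"
proof -
 have f: "finite (verts G)" using G by (simp add: graphs_def)
 have "card S <= card (Pow (verts G))" using S f by (intro card_mono) auto
 also have "... <= 2 ^ V" using f G(2) by (simp add: card_Pow)
 finally have "card S <= 2 ^ V" .
 moreover have "finite S" using S f by (meson finite_Pow_iff finite_subset)
 moreover have "induced G ` S <= graphs"
 proof
  fix H assume "H : induced G ` S"
  then obtain A where A: "A : S" "H = induced G A" by blast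
  hence "finite A" using S finite_subset[OF _ f] by blast
  thus "H : graphs" using A(2) G(1) by (auto simp: graphs_def induced_def)
 qed
 ultimately show ?thesis unfolding sum_form_def by blast
qed

lemma sum_form_imem: "imem pre \<Phi> k V y v ==> sum_form \<Phi> V v"
 unfolding imem_def indsub_def input_graphs_def
 by (auto intro!: sum_form_subsets)

lemma sum_form_cmem: "cmem \<Phi> k V y v ==> sum_form \<Phi> V v"
 unfolding cmem_def cp_indsub_def colorful_def input_graphs_def
 by (auto intro!: sum_form_subsets)

type_synonym ('c, 'x) queries = "nat => nat => nat => (nat * nat) list => 'c => 'x list => 'x => (bool * bool list) list"

definition PTQ :: "('c::repr, 'x::repr) queries => bool" where
 "PTQ Q \<longleftrightarrow> PT (%z. Q (fst z) (fst (snd z)) (fst (snd (snd z))) (fst (snd (snd (snd z)))) (fst (snd (snd (snd (snd z)))))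
   (fst (snd (snd (snd (snd (snd z)))))) (snd (snd (snd (snd (snd (snd z)))))))"

lemma PT_queries:
 assumes "PTQ Q" "PT M" "PT k" "PT q" "PT hl" "PT c" "PT xs" "PT x0"
 shows "PT (%e. Q (M e) (k e) (q e) (hl e) (c e) (xs e) (x0 e))"
 using PT_comp[OF assms(1)[unfolded PTQ_def] PT_Pair[OF assms(2) PT_Pair[OF assms(3) PT_Pair[OF assms(4)
  PT_Pair[OF assms(5) PT_Pair[OF assms(6) PT_Pair[OF assms(7,8)]]]]]]] by simp

text \<open>The common interface of the two problems: a signed sum of answers is the factor of the
  base graph times the number of bicliques. Both hardness proofs use the problems only through
  it.\<close>

definition qspec :: "(nat => nat => bool list => rat => bool) => (graph => rat) =>
  ('c => nat => 'x => nat => 'x => bool) => ('c, 'x) queries => bool" where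
 "qspec mem \<Phi> Cp Q \<longleftrightarrow> (ALL M k q hl c xs x0. 2 * q <= k --> good_hl k q hl --> 2 ^ (q * q) <= M --> 2 ^ k <= M --> distinct xs -->
  (EX f. (ALL z:set (Q M k q hl c xs x0). mem k (k * (length xs + 1)) (snd z) (f z)) &
   (\<Sum>z\<leftarrow>Q M k q hl c xs x0. sg (fst z) * f z) =
    altsum \<Phi> k q (hl_edges hl) * of_nat (card (bicliques k q xs x0 (Cp c)))))"

lemma length_bi_verts: "length (bi_verts k q xs x0) <= k * (length xs + 1)"
proof -
 have "length (bi_verts k q xs x0) = (\<Sum>i\<leftarrow>[0..<k]. if i < 2 * q then length xs else 1)"
  unfolding bi_verts_def by (simp add: length_concat comp_def if_distrib cong: if_cong)
 also have "... <= (\<Sum>i\<leftarrow>[0..<k]. length xs + 1)" by (intro sum_list_mono) auto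
 finally show ?thesis by (simp add: sum_list_triv)
qed

lemma qspec_ind:
 fixes Cp :: "'c => nat => 'x => nat => 'x => bool"
 assumes "iso_invariant \<Phi>"
 shows "qspec (%k. imem (pre k) \<Phi> k) \<Phi> Cp (%M k q hl c xs x0. ind_queries (pre k) M k q hl (Cp c) xs x0)"
 unfolding qspec_def
proof (intro allI impI)
 fix M k q :: nat and hl and c :: 'c and xs :: "'x list" and x0 :: 'x
 assume h: "2 * q <= k" "good_hl k q hl" "2 ^ (q * q) <= M" "2 ^ k <= M" "distinct xs"
 let ?V = "k * (length xs + 1)"
 let ?g = "%z. graph_of (fst (snd z)) (bi_adj q hl (Cp c) (snd (snd z)))"
 define f where "f z = (THE v. imem (pre k) \<Phi> k ?V (snd z) v)" for z :: "bool * bool list"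
 have enc: "pre k @ bits_graph (fst (snd z)) (bi_adj q hl (Cp c) (snd (snd z))) = pre k @ enc_graph (?g z)" for z
  using good_hl_irrefl[OF h(2)] by (subst enc_graph_of) blast+
 have mem: "imem (pre k) \<Phi> k ?V (pre k @ enc_graph (?g z)) (indsub \<Phi> k (?g z))"
  if z: "z : set (ind_graphs M k q hl (Cp c) xs x0)" for z
 proof -
  have "length (fst (snd z)) <= length (bi_verts k q xs x0)"
   using z by (auto simp: ind_graphs_def)
  hence "card (verts (?g z)) <= ?V"
   using length_bi_verts[of k q xs x0] by (simp add: verts_graph_of)
  thus ?thesis unfolding imem_def using graph_of_input by blast
 qed
 have f: "f (b, pre k @ enc_graph (?g z)) = indsub \<Phi> k (?g z)"
  if "z : set (ind_graphs M k q hl (Cp c) xs x0)" for z b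
  unfolding f_def using mem[OF that] imem_unique by (intro the_equality) auto
 show "EX f. (ALL z:set (ind_queries (pre k) M k q hl (Cp c) xs x0). imem (pre k) \<Phi> k ?V (snd z) (f z)) &
   (\<Sum>z\<leftarrow>ind_queries (pre k) M k q hl (Cp c) xs x0. sg (fst z) * f z) =
    altsum \<Phi> k q (hl_edges hl) * of_nat (card (bicliques k q xs x0 (Cp c)))"
 proof (intro exI[of _ f] conjI ballI)
  show "imem (pre k) \<Phi> k ?V (snd z) (f z)" if z: "z : set (ind_queries (pre k) M k q hl (Cp c) xs x0)" for z
  proof -
   obtain w where w: "w : set (ind_graphs M k q hl (Cp c) xs x0)" "z = (fst w, pre k @ enc_graph (?g w))"
    using z unfolding ind_queries_def enc by auto
   thus ?thesis using mem[OF w(1)] f[OF w(1)] by simp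
  qed
  have "(\<Sum>z\<leftarrow>ind_queries (pre k) M k q hl (Cp c) xs x0. sg (fst z) * f z) =
   (\<Sum>w\<leftarrow>ind_graphs M k q hl (Cp c) xs x0. sg (fst w) * indsub \<Phi> k (?g w))"
   unfolding ind_queries_def enc using f by (auto simp: comp_def intro!: arg_cong[where f = sum_list] map_cong)
  also have "... = altsum \<Phi> k q (hl_edges hl) * of_nat (card (bicliques k q xs x0 (Cp c)))"
   by (rule ind_graphs_sum[OF assms h])
  finally show "(\<Sum>z\<leftarrow>ind_queries (pre k) M k q hl (Cp c) xs x0. sg (fst z) * f z) = ..." .
 qed
qed

lemma qspec_cp:
 fixes Cp :: "'c => nat => 'x => nat => 'x => bool"
 assumes "iso_invariant \<Phi>"
 shows "qspec (cmem \<Phi>) \<Phi> Cp (%M k q hl c xs x0. cp_queries M k q hl (Cp c) xs x0)"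
 unfolding qspec_def
proof (intro allI impI)
 fix M k q :: nat and hl and c :: 'c and xs :: "'x list" and x0 :: 'x
 assume h: "2 * q <= k" "good_hl k q hl" "2 ^ (q * q) <= M" "2 ^ k <= M" "distinct xs"
 let ?V = "k * (length xs + 1)"
 let ?L = "bi_verts k q xs x0"
 let ?g = "%S. graph_of ?L (bi_adj q hl (Cp c) S)" and ?c = "%v. fst (?L ! v)"
 let ?Q = "map (%S. (even (length S), enc_colored (cp_H k q hl) (?g S) ?c)) (psubs M (squares q))"
 define f where "f z = (THE v. cmem \<Phi> k ?V (snd z) v)" for z :: "bool * bool list"
 have Q: "cp_queries M k q hl (Cp c) xs x0 = ?Q"
  using cp_queries_enc[OF h(2), of M "Cp c" xs x0] by (simp only: Let_def)
 have mem: "cmem \<Phi> k ?V (enc_colored (cp_H k q hl) (?g S) ?c) (cp_indsub \<Phi> (cp_H k q hl) (?g S) ?c)" for S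
  unfolding cmem_def
  using graph_of_input cp_hom[OF h(1,2) refl, of xs x0 "Cp c" S] length_bi_verts[of k q xs x0]
  by (rule_tac exI[of _ "cp_H k q hl"], rule_tac exI[of _ "?g S"], rule_tac exI[of _ ?c]) (auto simp: verts_graph_of)
 have f: "f (b, enc_colored (cp_H k q hl) (?g S) ?c) = cp_indsub \<Phi> (cp_H k q hl) (?g S) ?c" for S b
  unfolding f_def using mem[of S] cmem_unique by (intro the_equality) auto
 show "EX f. (ALL z:set (cp_queries M k q hl (Cp c) xs x0). cmem \<Phi> k ?V (snd z) (f z)) &
   (\<Sum>z\<leftarrow>cp_queries M k q hl (Cp c) xs x0. sg (fst z) * f z) =
    altsum \<Phi> k q (hl_edges hl) * of_nat (card (bicliques k q xs x0 (Cp c)))"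
  unfolding Q
 proof (intro exI[of _ f] conjI ballI)
  show "cmem \<Phi> k ?V (snd z) (f z)" if z: "z : set ?Q" for z
   using z mem f by auto
  have "(\<Sum>z\<leftarrow>?Q. sg (fst z) * f z) =
   (\<Sum>S\<leftarrow>psubs M (squares q). sg (even (length S)) * cp_indsub \<Phi> (cp_H k q hl) (?g S) ?c)"
   by (simp add: comp_def f)
  also have "... = altsum \<Phi> k q (hl_edges hl) * of_nat (card (bicliques k q xs x0 (Cp c)))"
   by (rule cp_queries_sum[OF assms h(1-3,5) refl])
  finally show "(\<Sum>z\<leftarrow>?Q. sg (fst z) * f z) = ..." .
 qed
qed

lemma sum_form_int:
 assumes "sum_form \<Phi> V v" "!!G. G : graphs ==> of_nat N * \<Phi> G : \<int>"
 shows "of_nat N * v : \<int>"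
proof -
 obtain S h where S: "finite (S :: nat set set)" "h ` S <= graphs" "v = (SUM s:S. \<Phi> (h s))"
  using assms(1) unfolding sum_form_def by blast
 have "of_nat N * v = (SUM s:S. of_nat N * \<Phi> (h s))" by (simp add: S(3) sum_distrib_left)
 also have "... : \<int>" using assms(2) S(2) by (intro Ints_sum) auto
 finally show ?thesis .
qed

lemma sum_form_abs:
 assumes "sum_form \<Phi> V v" "!!G. G : graphs ==> \<bar>of_nat N * \<Phi> G\<bar> <= of_nat B"
 shows "\<bar>of_nat N * v\<bar> <= of_nat B * 2 ^ V" "\<bar>of_nat N * v\<bar> < 2 ^ (B + V + 1)"
proof -
 obtain S h where S: "finite (S :: nat set set)" "card S <= 2 ^ V" "h ` S <= graphs" "v = (SUM s:S. \<Phi> (h s))"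
  using assms(1) unfolding sum_form_def by blast
 have "\<bar>of_nat N * v\<bar> = \<bar>SUM s:S. of_nat N * \<Phi> (h s)\<bar>" by (simp add: S(4) sum_distrib_left)
 also have "... <= (SUM s:S. \<bar>of_nat N * \<Phi> (h s)\<bar>)" by (rule sum_abs)
 also have "... <= (SUM s:S. of_nat B)" using assms(2) S(3) by (intro sum_mono) auto
 also have "... = of_nat B * of_nat (card S)" by simp
 also have "... <= of_nat B * of_nat (2 ^ V)" using S(2) by (intro mult_left_mono) (simp_all only: of_nat_le_iff of_nat_0_le_iff)
 finally show 1: "\<bar>of_nat N * v\<bar> <= of_nat B * 2 ^ V" by simp
 have "B < 2 ^ B" by (rule less_exp)
 hence "B * 2 ^ V < 2 ^ B * 2 ^ V" by simp
 also have "... <= 2 ^ (B + V + 1)" by (simp add: power_add)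
 finally have "B * 2 ^ V < 2 ^ (B + V + 1)" .
 hence "(of_nat (B * 2 ^ V) :: rat) < of_nat (2 ^ (B + V + 1))" by (simp only: of_nat_less_iff)
 thus "\<bar>of_nat N * v\<bar> < 2 ^ (B + V + 1)" using 1 by simp
qed

lemma floorlog_le: "n < 2 ^ m ==> floorlog 2 n <= m"
 by (simp add: floorlog_le_iff)

text \<open>In lowest terms the denominator of \<open>v\<close> divides \<open>N\<close>, and the
  numerator is at most \<open>N * v\<close> in absolute value. This bounds the charge for an oracle
  answer.\<close>

lemma rat_length_bound:
 assumes "0 < N" "of_nat N * v : \<int>" "\<bar>of_nat N * v\<bar> < 2 ^ m"
 shows "rat_length v <= m + N"
proof -
 obtain a b where ab: "quotient_of v = (a, b)" by (cases "quotient_of v")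
 have b: "0 < b" "coprime a b" "v = of_int a / of_int b"
  using quotient_of_denom_pos[OF ab] quotient_of_coprime[OF ab] quotient_of_div[OF ab] by auto
 obtain w where w: "of_nat N * v = of_int w" using assms(2) by (auto elim: Ints_cases)
 have "(of_int (int N * a) :: rat) = of_int (w * b)" using w b by (simp add: field_simps)
 hence e: "int N * a = w * b" by (simp only: of_int_eq_iff)
 hence "b dvd int N * a" by simp
 hence "b dvd int N" using b(2) by (simp add: coprime_commute coprime_dvd_mult_left_iff)
 hence bN: "b <= int N" using assms(1) by (simp add: zdvd_imp_le)
 have "\<bar>a\<bar> * b <= \<bar>w\<bar> * b"
 proof -
  have "\<bar>w\<bar> * b = int N * \<bar>a\<bar>" using e b(1) by (metis abs_mult abs_of_nat abs_of_pos)
  thus ?thesis using bN mult_right_mono[OF bN, of "\<bar>a\<bar>"] by (simp add: mult.commute)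
 qed
 hence aw: "\<bar>a\<bar> <= \<bar>w\<bar>" using b(1) by simp
 have "(of_int \<bar>w\<bar> :: rat) < of_int (2 ^ m)" using assms(3) w by simp
 hence "\<bar>w\<bar> < 2 ^ m" by (simp only: of_int_less_iff)
 hence "nat \<bar>a\<bar> < 2 ^ m" using aw by (simp add: nat_less_iff)
 hence "floorlog 2 (nat \<bar>a\<bar>) <= m" by (rule floorlog_le)
 moreover have "nat b < 2 ^ N" using bN less_exp[of N] by linarith
 hence "floorlog 2 (nat b) <= N" by (rule floorlog_le)
 ultimately show ?thesis by (simp add: rat_length_def ab)
qed

section \<open>Functions with large values\<close>

text \<open>Polynomial time without a bound on the size of the result, as needed for powers, whose
  size in unary is exponential.\<close>

definition PI :: "('a::repr => 'b::repr) => bool" where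
 "PI f \<longleftrightarrow> (EX p T. (ALL P x. impl P x p UNIV f T) & PB T)"

lemma PIE:
 assumes "PI f"
 obtains p T where "!!P x. impl P x p UNIV f T" "PB T"
 using assms unfolding PI_def by blast

lemma PII:
 assumes "!!P x. impl P x p UNIV f T" "PB T"
 shows "PI f"
 using assms unfolding PI_def by blast

lemma PI_PT: "PT f ==> PI f"
 by (rule PTE, assumption) (rule PII)

lemma PI_comp: assumes "PI g" "PT f" shows "PI (%e. g (f e))"
proof -
 obtain p T where p: "!!P x. impl P x p UNIV g T" "PB T" by (rule PIE[OF assms(1)]) blast
 obtain p' T' where p': "!!P x. impl P x p' UNIV f T'" "PB T'" by (rule PTE[OF assms(2)]) blast
 show ?thesis
 proof (rule PII)
  show "impl P x (Seq p' p) UNIV (%e. g (f e)) (%e. T' e + T (f e))" for P x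
   by (rule impl_comp[OF p'(1) p(1)]) simp
  show "PB (%e. T' e + T (f e))" by (rule PB_add[OF p'(2) PB_comp[OF p(2) PT_size[OF assms(2)]]])
 qed
qed

lemma PI_cast: assumes "PI f" "!!v. val_of (f v) = val_of (f' v)" shows "PI f'"
proof -
 obtain p T where p: "!!P x. impl P x p UNIV f T" "PB T" by (rule PIE[OF assms(1)]) blast
 show ?thesis by (rule PII[OF impl_cong[OF p(1)] p(2)]) (rule assms(2))
qed

lemma PT_scale: assumes "PT n" "PT a" shows "PT (%e. scale (n e) (a e))"
 unfolding scale_def
proof (rule PT_funpow[where B = "%_. 1"])
 show "PT (%z. badd (snd z) (a (fst z)))" by (intro PTs PT_badd PT_comp[OF assms(2)])
qed (auto intro: assms PT_const PB_const)

text \<open>The power is computed with numbers of type \<open>big\<close>, where all intermediate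
  sizes are 1, and only the result is reread as a natural number.\<close>

lemma PI_power: "PI (%n. b ^ n :: nat)"
proof (rule PI_cast)
 show "PI (%n. ((%s. scale b s) ^^ n) (Big 1))"
 proof (rule PI_PT, rule PT_funpow[where B = "%_. 1"])
  show "PT (%z :: nat * big. scale b (snd z))" by (intro PTs PT_scale)
 qed (auto intro: PT_id PT_const PB_const)
 have "nob (((%s. scale b s) ^^ n) (Big 1)) = b ^ n" for n by (induction n) (auto simp: nob_scale)
 thus "val_of (((%s. scale b s) ^^ n) (Big 1)) = val_of (b ^ n)" for n by (simp add: val_of_big_def val_of_nat_def)
qed

text \<open>Programs that keep their input in the output, so that time can be bounded in the size of the output.\<close>

definition AC :: "('a::repr => 'b::repr) => bool" where
 "AC f \<longleftrightarrow> (EX p T. (ALL P x. impl P x p UNIV f (%e. T (f e))) & PB T)"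

lemma ACE:
 assumes "AC f"
 obtains p T where "!!P x. impl P x p UNIV f (%e. T (f e))" "PB T"
 using assms unfolding AC_def by blast

lemma AC_id: "AC (%e. e)"
 unfolding AC_def using impl_id PB_const by blast

lemma PB_fst: "PB T ==> PB (%z. T (fst z))"
 by (rule PB_comp[OF _ PT_size[OF PT_fst[OF PT_id]]])

lemma AC_step: assumes "AC f" "PI g" shows "AC (%e. (f e, g (f e)))"
proof -
 obtain p T where p: "!!P x. impl P x p UNIV f (%e. T (f e))" "PB T" by (rule ACE[OF assms(1)]) blast
 obtain p' T' where p': "!!P x. impl P x p' UNIV g T'" "PB T'" by (rule PIE[OF assms(2)]) blast
 have "impl P x (Seq p (p_pair (seqs []) p')) UNIV (%e. (f e, g (f e))) (%e. T (f e) + (1 + T' (f e) + 40))" for P x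
  by (rule impl_comp[OF p(1) impl_pair[OF impl_id p'(1)]]) simp
 hence "impl P x (Seq p (p_pair (seqs []) p')) UNIV (%e. (f e, g (f e)))
   (%e. (%z. T (fst z) + (1 + T' (fst z) + 40)) (f e, g (f e)))" for P x by simp
 moreover have "PB (%z. T (fst z) + (1 + T' (fst z) + 40))" by (intro PB_add PB_const PB_fst p(2) p'(2))
 ultimately show ?thesis unfolding AC_def
  by (intro exI[of _ "Seq p (p_pair (seqs []) p')"] exI[of _ "%z. T (fst z) + (1 + T' (fst z) + 40)"]) blast
qed

section \<open>Unbounded search\<close>

text \<open>A known stopping point \<open>K\<close> provides termination and limits the time to that
  of the tests up to \<open>K\<close>; the program itself does not contain \<open>K\<close>.\<close>

lemma impl_search:
 fixes K :: nat
 assumes t: "impl P x pt {n. n <= K} tst Tt" and stop: "~ tst K"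
 shows "impl P x (p_while pt (seqs [Const 6 1, Add 3 3 6])) {n. n <= K} (%n. LEAST m. n <= m & ~ tst m)
  (%n. (SUM i:{n..K}. Tt i + 50) + 50)"
proof (rule impl_while[OF t, where f = Suc and Tf = "%_. 3" and \<mu> = "%n. K - n"])
 have "impl P x (seqs [Const 6 1, Add 3 3 6]) UNIV Suc (%_. 3)"
  by (rule impl_basic) (auto simp: val_of_nat_def heap_upd fun_upd_def[symmetric])
 thus "impl P x (seqs [Const 6 1, Add 3 3 6]) {v : {n. n <= K}. tst v} Suc (%_. 3)"
  by (rule impl_sub) simp
 fix v assume v: "v : {n. n <= K}"
 show "(LEAST m. v <= m & ~ tst m) = (if tst v then (LEAST m. Suc v <= m & ~ tst m) else v)"
 proof (cases "tst v")
  case True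
  hence "(v <= m & ~ tst m) = (Suc v <= m & ~ tst m)" for m by (metis Suc_le_eq le_eq_less_or_eq)
  thus ?thesis using True by presburger
 qed (auto intro: Least_equality)
 have "(SUM i:{v..K}. Tt i + 50) = (Tt v + 50) + (SUM i:{Suc v..K}. Tt i + 50)"
  using v by (subst sum.atLeast_Suc_atMost) auto
 thus "Tt v + 22 + (if tst v then 3 + ((SUM i:{Suc v..K}. Tt i + 50) + 50) else 0) <= (SUM i:{v..K}. Tt i + 50) + 50"
  by simp
 assume "tst v"
 hence "v ~= K" using stop by blast
 thus "Suc v : {n. n <= K}" "K - Suc v < K - v" using v by auto
qed

section \<open>Comparing answers\<close>

type_synonym nat3 = "nat * nat * nat"

definition nat3 :: "big3 => nat3" where
 "nat3 t = (nob (fst t), nob (fst (snd t)), nob (snd (snd t)))"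

text \<open>Cross-multiplied and with the subtracted parts moved to the other side, so that only
  sums and products of natural numbers occur.\<close>

definition eq3 :: "nat3 * nat3 => bool" where
 "eq3 z \<longleftrightarrow> fst (fst z) * snd (snd (snd z)) + fst (snd (snd z)) * snd (snd (fst z)) =
  fst (snd z) * snd (snd (fst z)) + fst (snd (fst z)) * snd (snd (snd z))"

lemma PT_eq3: "PT eq3"
proof -
 have "PT (%z. eq3 z)" unfolding eq3_def by (intro PTs)
 thus ?thesis by simp
qed

lemma eq3_correct:
 assumes "rep3 s u" "rep3 t v"
 shows "eq3 (nat3 s, nat3 t) \<longleftrightarrow> u = v"
proof -
 obtain a b d a' b' d' where s: "nat3 s = (a, b, d)" "nat3 t = (a', b', d')" by (cases "nat3 s", cases "nat3 t") auto
 have d: "0 < d" "0 < d'" "u = (of_nat a - of_nat b) / of_nat d" "v = (of_nat a' - of_nat b') / of_nat d'"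
  using assms s by (auto simp: rep3_def nat3_def)
 have "u = v \<longleftrightarrow> (of_nat a - of_nat b) * of_nat d' = ((of_nat a' - of_nat b') * of_nat d :: rat)"
  using d by (simp add: frac_eq_eq)
 also have "... \<longleftrightarrow> (of_nat (a * d' + b' * d) :: rat) = of_nat (a' * d + b * d')" by (auto simp: algebra_simps)
 also have "... \<longleftrightarrow> a * d' + b' * d = a' * d + b * d'" by (simp only: of_nat_eq_iff)
 finally show ?thesis by (simp add: s eq3_def)
qed

text \<open>The test is parametric in the program \<open>p\<close> that supplies the values, so that
  it works both with oracle queries and with the simulation of a program for \<Phi>.\<close>

lemma impl_eqtest:
 fixes yK yE :: "nat => bool list"
 assumes "PT yK" "PT yE"
 shows "EX pt T1 T2. PB T1 & PB T2 & (ALL P x p D f T K. impl P x p D f T --> (\<forall>n\<le>K. yK n : D & yE n : D) -->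
  impl P x (pt p) {n. n <= (K :: nat)} (%n. eq3 (nat3 (f (yK n)), nat3 (f (yE n))))
   (%n. T1 n + T (yK n) + T (yE n) + T2 (nat3 (f (yK n)), nat3 (f (yE n)))))"
proof -
 obtain p1 T1 where p1: "!!P x. impl P x p1 UNIV yK T1" "PB T1" by (rule PTE[OF assms(1)]) blast
 obtain p2 T2 where p2: "!!P x. impl P x p2 UNIV yE T2" "PB T2" by (rule PTE[OF assms(2)]) blast
 obtain p3 T3 where p3: "!!P x. impl P x p3 UNIV eq3 T3" "PB T3" by (rule PTE[OF PT_eq3]) blast
 let ?pt = "%p. Seq (p_pair (Seq p1 p) (Seq p2 p)) p3"
 have "impl P x (?pt p) {n. n <= K} (%n. eq3 (nat3 (f (yK n)), nat3 (f (yE n))))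
   (%n. (T1 n + T2 n + 40) + T (yK n) + T (yE n) + T3 (nat3 (f (yK n)), nat3 (f (yE n))))"
  if p: "impl P x p D f T" and D: "\<forall>n\<le>K. yK n : D & yE n : D" for P x p D f T and K :: nat
 proof -
  have q: "impl P x p D (%y. nat3 (f y)) T"
   by (rule impl_cong[OF p]) (simp add: nat3_def val_of_prod_def val_of_big_def val_of_nat_def)
  have 1: "impl P x (Seq p1 p) {n. n <= K} (%n. nat3 (f (yK n))) (%n. T1 n + T (yK n))"
   by (rule impl_comp[OF impl_sub[OF p1(1)] q]) (use D in auto)
  have 2: "impl P x (Seq p2 p) {n. n <= K} (%n. nat3 (f (yE n))) (%n. T2 n + T (yE n))"
   by (rule impl_comp[OF impl_sub[OF p2(1)] q]) (use D in auto)
  show ?thesis by (rule impl_mono[OF impl_comp[OF impl_pair[OF 1 2] p3(1)]]) auto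
 qed
 moreover have "PB (%n. T1 n + T2 n + 40)" by (intro PB_add PB_const p1 p2)
 ultimately show ?thesis using p3(2) by (intro exI[of _ ?pt] exI[of _ "%n. T1 n + T2 n + 40"] exI[of _ T3]) blast
qed

section \<open>Signed lists of queries\<close>

definition qmap_prog :: "(prog => prog) => bool" where
 "qmap_prog pm \<longleftrightarrow> (\<forall>P x p D (g :: bool list => big3) T. impl P x p D g T -->
  impl P x (pm p) {qs :: (bool * bool list) list. snd ` set qs <= D} (%qs. rev (map (%z. (fst z, g (snd z))) qs))
   (%qs. 300 + (\<Sum>z\<leftarrow>qs. T (snd z) + 400)))"

lemma impl_qmap:
 "EX pm. qmap_prog pm"
proof -
 let ?pm = "%p. p_rmap (p_pair (seqs [Load 3 3]) (Seq (seqs [Const 6 1, Add 3 3 6, Load 3 3]) p))"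
 have "impl P x (?pm p) {qs :: (bool * bool list) list. snd ` set qs <= D} (%qs. rev (map (%z. (fst z, g (snd z))) qs))
   (%qs. 300 + (\<Sum>z\<leftarrow>qs. T (snd z) + 400))"
  if p: "impl P x p D g T" for P x p D and g :: "bool list => big3" and T
 proof -
  have 1: "impl P x (Seq (seqs [Const 6 1, Add 3 3 6, Load 3 3]) p) {z :: bool * bool list. snd z : D} (%z. g (snd z)) (%z. 4 + T (snd z))"
   by (rule impl_comp[OF impl_sub[OF impl_snd] p]) auto
  have "impl P x (p_pair (seqs [Load 3 3]) (Seq (seqs [Const 6 1, Add 3 3 6, Load 3 3]) p)) {z :: bool * bool list. snd z : D}
   (%z. (fst z, g (snd z))) (%z. 2 + (4 + T (snd z)) + 40)"
   by (rule impl_pair[OF impl_sub[OF impl_fst] 1]) auto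
  from impl_rmap[OF this] show ?thesis by (rule impl_mono) (auto intro!: sum_list_mono)
 qed
 thus ?thesis unfolding qmap_prog_def by (intro exI[of _ ?pm]) blast
qed

definition val3 :: "big3 => rat" where
 "val3 t = (of_nat (nob (fst t)) - of_nat (nob (fst (snd t)))) / of_nat (nob (snd (snd t)))"

lemma val3: "rep3 t v ==> val3 t = v"
 by (simp add: rep3_def val3_def)

lemma sum_answers:
 assumes "!!z. z : set qs ==> rep3 (g z) (f z) & of_nat n * f z : \<int> & \<bar>of_nat n * f z\<bar> < 2 ^ (l + 1)"
 shows "ival (sum_ans n l (rev (map (%z. (fst z, g z)) qs))) = of_nat n * (\<Sum>z\<leftarrow>qs. sg (fst z) * f z)"
proof -
 let ?rs = "rev (map (%z. (fst z, g z)) qs)"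
 have "ival (sum_ans n l ?rs) = of_nat n * (\<Sum>r\<leftarrow>?rs. sg (fst r) * val3 (snd r))"
 proof (rule sum_ans_correct)
  fix r assume "r : set ?rs"
  then obtain z where z: "z : set qs" "snd r = g z" by auto
  have "val3 (snd r) = f z" using assms[OF z(1)] val3 z(2) by simp
  thus "rep3 (snd r) (val3 (snd r)) & of_nat n * val3 (snd r) : \<int> & \<bar>of_nat n * val3 (snd r)\<bar> < 2 ^ (l + 1)"
   using assms[OF z(1)] z(2) by (simp only:)
 qed
 also have "(\<Sum>r\<leftarrow>?rs. sg (fst r) * val3 (snd r)) = (\<Sum>z\<leftarrow>qs. sg (fst z) * val3 (g z))"
 proof -
  have "map (%r. sg (fst r) * val3 (snd r)) ?rs = rev (map (%z. sg (fst z) * val3 (g z)) qs)"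
   by (simp add: rev_map comp_def)
  thus ?thesis by (simp only: sum_list_rev)
 qed
 also have "... = (\<Sum>z\<leftarrow>qs. sg (fst z) * f z)"
 proof (intro arg_cong[where f = sum_list] map_cong refl)
  fix z assume "z : set qs"
  hence "val3 (g z) = f z" using assms val3 by blast
  thus "sg (fst z) * val3 (g z) = sg (fst z) * f z" by simp
 qed
 finally show ?thesis .
qed

lemma sz_answers: "sz (rev (map (%z. (fst z :: bool, g z :: big3)) qs)) <= 4 * sz (qs :: (bool * bool list) list)"
proof -
 have "sz (map (%z. (fst z, g z)) qs) <= 4 * sz qs" by (induction qs) (auto simp: sz_prod_def)
 thus ?thesis by (simp add: sz_rev)
qed

lemma sum_list_length_bound:
 fixes f :: "'a => nat"
 assumes "!!z. z : set qs ==> f z <= B" "length qs <= L"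
 shows "(\<Sum>z\<leftarrow>qs. f z) <= L * B"
proof -
 have "(\<Sum>z\<leftarrow>qs. f z) <= (\<Sum>z\<leftarrow>qs. B)" using assms(1) by (intro sum_list_mono) auto
 also have "... = length qs * B" by (simp add: sum_list_triv)
 finally show ?thesis using mult_le_mono1[OF assms(2)] by (rule order_trans)
qed

lemma PT_Big: "PT f ==> PT (%e. Big (f e))"
proof -
 assume f: "PT f"
 obtain p T where p: "!!P x. impl P x p UNIV f T" "PB T" by (rule PTE[OF f]) blast
 show ?thesis
  by (rule PTI[OF impl_cong[OF p(1)] p(2)]) (auto simp: val_of_big_def val_of_nat_def PB_const)
qed

section \<open>Clique counting as a compatibility problem\<close>

type_synonym cenv = "bool * nat * nat * bool list"

text \<open>With the flag set everything is compatible, and a single label gives exactly one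
  biclique: this calibrates the factor of the base graph. Otherwise the first \<open>k\<close>
  positions of a block list the vertices of a clique in increasing order and the others carry 0.
  Compatibility is tested only between the blocks, so the second block repeats the first.\<close>

definition clCp :: "cenv => nat => nat => nat => nat => bool" where
 "clCp c i u j v \<longleftrightarrow> fst c |
  ((if i < fst (snd c) then u < fst (snd (snd c)) else u = 0) & (if j < fst (snd c) then v < fst (snd (snd c)) else v = 0) &
   (i = j --> u = v) &
   (i < j --> j < fst (snd c) --> u < v & nthd False (snd (snd (snd c))) (u * fst (snd (snd c)) + v)))"

lemma PT_clCp:
 "PT (%z. clCp (fst z) (fst (snd z)) (fst (snd (snd z))) (fst (snd (snd (snd z)))) (snd (snd (snd (snd z)))))"
 unfolding clCp_def
 by (intro PTs)

lemma trivial_bicliques: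
 assumes "2 * q <= k'"
 shows "card (bicliques k' q [0] 0 (clCp (True, c))) = 1"
proof -
 let ?f = "\<lambda>i\<in>{..<k'}. (i, 0 :: nat)"
 have "{x : set (bi_verts k' q [0] 0). fst x = i} = {?f i}" if "i : {..<k'}" for i
  using that by (auto simp: set_bi_verts split: if_splits)
 hence "PiE {..<k'} (%i. {x : set (bi_verts k' q [0] 0). fst x = i}) = PiE {..<k'} (%i. {?f i})"
  by (rule PiE_cong)
 also have "... = {?f}" by (rule PiE_singleton) (rule restrict_extensional)
 finally have "bicliques k' q [0] 0 (clCp (True, c)) = {?f}" by (simp add: bicliques_def clCp_def)
 thus ?thesis by simp
qed

definition adj_bits :: "graph => bool list" where
 "adj_bits G = map (%(i, j). {i, j} : edges G) (List.product [0..<card (verts G)] [0..<card (verts G)])"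

lemma adj_bits_nth:
 assumes "u < card (verts G)" "v < card (verts G)"
 shows "nthd False (adj_bits G) (u * card (verts G) + v) \<longleftrightarrow> {u, v} : edges G"
proof -
 let ?n = "card (verts G)"
 have "u * ?n + v < (u + 1) * ?n" using assms by simp
 also have "... <= ?n * ?n" using assms by (intro mult_le_mono1) simp
 finally have l: "u * ?n + v < ?n * ?n" .
 have d: "(u * ?n + v) div ?n = u" "(u * ?n + v) mod ?n = v" using assms by auto
 show ?thesis using l assms by (simp add: nthd_eq adj_bits_def product_nth d)
qed

text \<open>Increasing order makes the list of a clique unique, so cliques and bicliques correspond
  one to one. One label more than there are vertices ensures that the filler 0 exists even for the
  graph without vertices.\<close>

lemma clique_bicliques:
 assumes G: "G : input_graphs" and k: "k <= q" "2 * q <= k'" "0 < q"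
 shows "card (bicliques k' q [0..<card (verts G) + 1] 0 (clCp (False, k, card (verts G), adj_bits G))) = num_cliques k G"
proof -
 let ?n = "card (verts G)"
 let ?B = "bicliques k' q [0..<?n + 1] 0 (clCp (False, k, ?n, adj_bits G))"
 let ?C = "{A. A <= verts G & card A = k & (ALL u:A. ALL v:A. u ~= v --> {u, v} : edges G)}"
 have V: "verts G = {..<?n}" using G by (simp add: input_graphs_def)
 define lab where "lab A i = (if i < k then sorted_list_of_set A ! i
  else if q <= i & i < q + k then sorted_list_of_set A ! (i - q) else 0 :: nat)" for A i
 define F where "F A = (\<lambda>i\<in>{..<k'}. (i, lab A i))" for A
 define I where "I tu = (%i. snd (tu i)) ` {..<k}" for tu :: "nat => nat * nat"
 have B: "(tu : ?B) = (tu : PiE {..<k'} (%i. {x. fst x = i & (if i < 2 * q then snd x <= ?n else snd x = 0)}) &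
   (\<forall>i<q. \<forall>j<q. clCp (False, k, ?n, adj_bits G) i (snd (tu i)) j (snd (tu (q + j)))))" for tu
 proof -
  have "PiE {..<k'} (%i. {x : set (bi_verts k' q [0..<?n + 1] 0). fst x = i}) =
   PiE {..<k'} (%i. {x. fst x = i & (if i < 2 * q then snd x <= ?n else snd x = 0)})"
   by (intro PiE_cong) (auto simp: set_bi_verts less_Suc_eq_le)
  thus ?thesis by (simp add: bicliques_def)
 qed
 have FB: "F A : ?B" if A: "A : ?C" for A
 proof -
  let ?s = "sorted_list_of_set A"
  have f: "finite A" using A V by (auto intro: finite_subset)
  have s: "set ?s = A" "length ?s = k" "sorted_wrt (<) ?s" using A f by auto
  have sn: "?s ! i < ?n" "?s ! i : A" if "i < k" for i
   using that s(1,2) A V nth_mem[of i ?s] by auto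
  have lt: "?s ! i < ?s ! j" if "i < j" "j < k" for i j
   using sorted_wrt_nth_less[OF s(3)] that s(2) by simp
  have ad: "nthd False (adj_bits G) (?s ! i * ?n + ?s ! j)" if "i < j" "j < k" for i j
   using adj_bits_nth[of "?s ! i" G "?s ! j"] sn[of i] sn[of j] that lt[OF that] A by auto
  have l: "lab A i = (if i < k then ?s ! i else 0)" "lab A (q + i) = (if i < k then ?s ! i else 0)" if "i < q" for i
   using that k by (auto simp: lab_def)
  have "F A : PiE {..<k'} (%i. {x. fst x = i & (if i < 2 * q then snd x <= ?n else snd x = 0)})"
   unfolding F_def
  proof (intro restrict_PiE_iff[THEN iffD2] ballI)
   fix i
   have "lab A i <= ?n" using sn(1) by (auto simp: lab_def intro: less_imp_le)
   moreover have "lab A i = 0" if "~ i < 2 * q" using that k by (auto simp: lab_def)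
   ultimately show "(i, lab A i) : {x. fst x = i & (if i < 2 * q then snd x <= ?n else snd x = 0)}" by simp
  qed
  moreover have "clCp (False, k, ?n, adj_bits G) i (snd (F A i)) j (snd (F A (q + j)))" if "i < q" "j < q" for i j
  proof -
   have "snd (F A i) = lab A i" "snd (F A (q + j)) = lab A (q + j)" using that k by (auto simp: F_def)
   thus ?thesis using l(1)[OF that(1)] l(2)[OF that(2)] sn(1) lt ad by (auto simp: clCp_def)
  qed
  ultimately show ?thesis unfolding B by blast
 qed
 have IF: "I (F A) = A" if A: "A : ?C" for A
 proof -
  have f: "finite A" using A V by (auto intro: finite_subset)
  have s: "set (sorted_list_of_set A) = A" "length (sorted_list_of_set A) = k" using A f by auto
  have "I (F A) = (%i. sorted_list_of_set A ! i) ` {..<k}"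
   unfolding I_def using k by (intro image_cong) (auto simp: F_def lab_def)
  also have "... = set (sorted_list_of_set A)" using s(2) by (auto simp: set_conv_nth)
  finally show ?thesis using s by simp
 qed
 have tau: "I tu : ?C & F (I tu) = tu" if tu: "tu : ?B" for tu
 proof -
  let ?a = "%i. snd (tu i)"
  have P: "tu : PiE {..<k'} (%i. {x. fst x = i & (if i < 2 * q then snd x <= ?n else snd x = 0)})"
   and c: "!!i j. i < q ==> j < q ==> clCp (False, k, ?n, adj_bits G) i (?a i) j (?a (q + j))"
   using tu unfolding B by blast+
  have b: "?a (q + i) = ?a i" if "i < q" for i using c[OF that that] by (simp add: clCp_def)
  have r: "?a i < ?n" if "i < k" for i using c[of i i] that k by (simp add: clCp_def)
  have z: "?a i = 0" if "k <= i" "i < q" for i using c[of i i] that by (simp add: clCp_def)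
  have lt: "?a i < ?a j & {?a i, ?a j} : edges G" if "i < j" "j < k" for i j
   using c[of i j] that k b[of j] adj_bits_nth[of "?a i" G "?a j"] r[of i] r[of j] by (simp add: clCp_def)
  have inj: "inj_on ?a {..<k}"
  proof (rule inj_onI)
   fix i j assume "i : {..<k}" "j : {..<k}" "?a i = ?a j"
   thus "i = j" using lt[of i j] lt[of j i] by (cases i j rule: linorder_cases) auto
  qed
  have "sorted_wrt (<) (map ?a [0..<k])" using lt by (auto simp: sorted_wrt_iff_nth_less)
  hence so: "sorted (map ?a [0..<k])" "distinct (map ?a [0..<k])" by (simp_all add: strict_sorted_iff)
  have sl: "sorted_list_of_set (I tu) = map ?a [0..<k]"
   using sorted_list_of_set.idem_if_sorted_distinct[OF so] by (simp add: I_def atLeast0LessThan)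
  have "I tu : ?C"
  proof (intro CollectI conjI ballI impI)
   show "I tu <= verts G" using r V by (auto simp: I_def)
   show "card (I tu) = k" using inj by (simp add: I_def card_image)
   fix u v assume "u : I tu" "v : I tu" "u ~= v"
   then obtain i j where ij: "i < k" "j < k" "u = ?a i" "v = ?a j" "i ~= j" by (auto simp: I_def)
   thus "{u, v} : edges G" using lt[of i j] lt[of j i] by (cases i j rule: linorder_cases) (auto simp: insert_commute)
  qed
  moreover have "F (I tu) = tu"
  proof
   fix i
   show "F (I tu) i = tu i"
   proof (cases "i < k'")
    case True
    hence m: "fst (tu i) = i" "~ i < 2 * q ==> ?a i = 0" using P by (auto simp: PiE_iff split: if_splits)
    have "lab (I tu) i = ?a i"
    proof -
     consider "i < k" | "k <= i" "i < q" | "q <= i" "i < q + k" | "q + k <= i" "i < 2 * q" | "~ i < 2 * q"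
      using k by linarith
     thus ?thesis
     proof cases
      case 3
      thus ?thesis using b[of "i - q"] k by (simp add: lab_def sl)
     next
      case 4
      hence "?a i = ?a (i - q)" using b[of "i - q"] by simp
      thus ?thesis using z[of "i - q"] 4 k by (simp add: lab_def)
     next
      case 5
      thus ?thesis using m(2) k by (simp add: lab_def)
     qed (use z k in "auto simp: lab_def sl")
    qed
    thus ?thesis using True m(1) by (simp add: F_def prod_eq_iff)
   next
    case False
    hence "tu i = undefined" using P by (auto simp: PiE_iff extensional_def)
    thus ?thesis using False by (simp add: F_def)
   qed
  qed
  ultimately show ?thesis by blast
 qed
 have "bij_betw F ?C ?B"
 proof (rule bij_betw_byWitness[where f' = I])
  show "ALL A:?C. I (F A) = A" using IF by blast
  show "ALL tu:?B. F (I tu) = tu" using tau by blast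
  show "F ` ?C <= ?B" using FB by blast
  show "I ` ?B <= ?C" using tau by blast
 qed
 thus ?thesis unfolding num_cliques_def by (rule bij_betw_same_card[symmetric])
qed

definition cgr :: "nat => graph" where "cgr n = graph_of [0..<n] (<)"

definition egr :: "nat => graph" where "egr n = graph_of [0..<n] (%_ _. False)"

lemma cgr_egr:
 "verts (cgr n) = {..<n}" "edges (cgr n) = pairs {..<n}" "verts (egr n) = {..<n}" "edges (egr n) = {}"
proof -
 show "edges (cgr n) = pairs {..<n}"
 proof (intro equalityI subsetI)
  fix e assume "e : pairs {..<n}"
  then obtain u v where e: "e = {u, v}" "u ~= v" "u < n" "v < n" by (auto simp: pairs_def card_2_iff)
  thus "e : edges (cgr n)" by (auto simp: cgr_def graph_of_def ES_iff)
 qed (auto simp: cgr_def graph_of_def ES_def pairs_def)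
qed (auto simp: cgr_def egr_def graph_of_def ES_def)

lemma cgr_in: "cgr n : input_graphs" "egr n : input_graphs"
 by (simp_all add: cgr_def egr_def graph_of_input)

lemma graphs_card_verts:
 assumes "iso_invariant \<Phi>" "G : graphs" "card (verts G) = n"
 obtains G' where "G' : graphs" "verts G' = {..<n}" "\<Phi> G' = \<Phi> G"
proof -
 have f: "finite (verts G)" using assms(2) by (simp add: graphs_def)
 then obtain h where h: "bij_betw h (verts G) {..<n}"
  using assms(3) by (metis card_lessThan finite_lessThan finite_same_card_bij)
 let ?R = "%u v. {u, v} : edges G"
 let ?g = "the_inv_into (verts G) h"
 let ?G = "mkgraph {..<n} (ES {..<n} (%u v. ?R (?g u) (?g v)))"
 have E: "edges G <= pairs (verts G)" using assms(2) by (auto simp: graphs_def pairs_def)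
 have "\<Phi> (mkgraph (verts G) (ES (verts G) ?R)) = \<Phi> ?G"
 proof (rule iso_ES[OF assms(1) f h])
  fix u v assume uv: "u : verts G" "v : verts G" "u ~= v"
  have "?g (h w) = w" if "w : verts G" for w using h that by (simp add: bij_betw_def the_inv_into_f_f)
  thus "(?R u v | ?R v u) = (?R (?g (h u)) (?g (h v)) | ?R (?g (h v)) (?g (h u)))" using uv by simp
 qed
 moreover have "mkgraph (verts G) (ES (verts G) ?R) = G" using edges_ES[OF E] graph_eq_mkgraph[of G] by simp
 ultimately have "\<Phi> ?G = \<Phi> G" by simp
 moreover have "?G : graphs" by (rule mkgraph_graphs) (auto simp: ES_def pairs_def)
 ultimately show ?thesis using that by simp
qed

text \<open>Monotonicity places every graph on \<open>n\<close> vertices between the complete and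
  the edgeless one, so two values decide nontriviality.\<close>

lemma nontrivial_on_iff:
 assumes "iso_invariant \<Phi>" "edge_monotone \<Phi>"
 shows "nontrivial_on \<Phi> n \<longleftrightarrow> \<Phi> (cgr n) ~= \<Phi> (egr n)"
proof
 assume "\<Phi> (cgr n) ~= \<Phi> (egr n)"
 thus "nontrivial_on \<Phi> n"
  unfolding nontrivial_on_def using cgr_in[of n] cgr_egr[of n]
  by (intro bexI[of _ "cgr n"] bexI[of _ "egr n"]) (simp_all add: input_graphs_def)
next
 assume "nontrivial_on \<Phi> n"
 then obtain G H where G: "G : graphs" "H : graphs" "card (verts G) = n" "card (verts H) = n" "\<Phi> G ~= \<Phi> H"
  unfolding nontrivial_on_def by blast
 have c: "cgr n : graphs" "egr n : graphs" using cgr_in[of n] by (auto simp: input_graphs_def)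
 have sw: "\<Phi> (cgr n) <= \<Phi> X & \<Phi> X <= \<Phi> (egr n)" if X: "X : graphs" "card (verts X) = n" for X
 proof -
  obtain X' where X': "X' : graphs" "verts X' = {..<n}" "\<Phi> X' = \<Phi> X"
   by (rule graphs_card_verts[OF assms(1) X])
  have "edges X' <= pairs {..<n}" using X' by (auto simp: graphs_def pairs_def)
  hence "edge_subgraph X' (cgr n)" "edge_subgraph (egr n) X'"
   using X' by (auto simp: edge_subgraph_def cgr_egr)
  thus ?thesis using assms(2) X' c unfolding edge_monotone_def by metis
 qed
 show "\<Phi> (cgr n) ~= \<Phi> (egr n)" using sw[OF G(1,3)] sw[OF G(2,4)] G(5) by linarith
qed

text \<open>With the number of vertices as parameter, the oracle evaluates \<Phi> itself.\<close>

lemma indsub_full: "G : input_graphs ==> indsub \<Phi> (card (verts G)) G = \<Phi> G"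
proof -
 assume G: "G : input_graphs"
 have f: "finite (verts G)" using G by (simp add: input_graphs_def graphs_def)
 have "{A. A <= verts G & card A = card (verts G)} = {verts G}" using card_subset_eq[OF f] by blast
 moreover have "induced G (verts G) = G"
 proof -
  have "{e : edges G. e <= verts G} = edges G" using G by (auto simp: input_graphs_def graphs_def)
  thus ?thesis by (simp add: induced_def)
 qed
 ultimately show ?thesis by (simp add: indsub_def)
qed

lemma cp_indsub_full:
 assumes "G : input_graphs" "verts H = verts G"
 shows "cp_indsub \<Phi> H G (%v. v) = \<Phi> G"
proof -
 have f: "finite (verts G)" using assms by (simp add: input_graphs_def graphs_def)
 have "{A. colorful H G (%v. v) A} = {A. A <= verts G & card A = card (verts G)}"
  unfolding colorful_def using card_subset_eq[OF f] assms(2) by auto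
 thus ?thesis using indsub_full[OF assms(1), of \<Phi>] by (simp add: cp_indsub_def indsub_def)
qed

section \<open>Search for a parameter and evaluation of the answers\<close>

definition qof :: "nat => bool list => nat" where "qof b e = b ^ lead (rev e)"

type_synonym frame = "(((bool list * nat) * nat) * nat) * nat"

text \<open>Collects the input, the block size, the parameter \<open>K\<close> found by the search,
  and the caps for enumerating subsets: of biclique edges and colours by the first power, of edge
  lists of base graphs by the second.\<close>

definition frame :: "nat => bool list => nat => frame" where
 "frame b e K = ((((e, qof b e), K), 2 ^ (qof b e * qof b e + K)), 2 ^ (K * K))"

text \<open>The search starts at \<open>b * qof b e\<close>, which leaves room for \<open>b\<close>
  blocks, and ends at the first \<open>K\<close> on which the two test values differ. The supplier
  \<open>po\<close> of values is a parameter of the program.\<close>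

definition front_prog :: "nat => (nat => bool list) => (nat => bool list) => (prog => prog) => (frame => nat) =>
  (nat => nat) => (nat3 * nat3 => nat) => bool" where
 "front_prog b yK yE pf Tf T1 T2 \<longleftrightarrow> (ALL P x po D f T K e.
  impl P x po D f T --> (\<forall>n\<le>K. yK n : D & yE n : D) --> b * qof b e <= K -->
  ~ eq3 (nat3 (f (yK K)), nat3 (f (yE K))) -->
  (ALL m. b * qof b e <= m --> m < K --> eq3 (nat3 (f (yK m)), nat3 (f (yE m)))) -->
  impl P x (pf po) {e} (%e. frame b e K) (%e. Tf (frame b e K) +
   (SUM i:{..K}. T1 i + T (yK i) + T (yE i) + T2 (nat3 (f (yK i)), nat3 (f (yE i))))))"

lemma front:
 fixes yK yE :: "nat => bool list" and b :: nat
 assumes "PT yK" "PT yE"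
 shows "EX pf Tf T1 T2. PB Tf & PB T1 & PB T2 & front_prog b yK yE pf Tf T1 T2"
proof -
 have "PI (%e. b ^ lead (rev e))" by (rule PI_comp[OF PI_power]) (intro PTs PT_lead)
 hence "AC (%e. (e, qof b e))" unfolding qof_def by (rule AC_step[OF AC_id])
 then obtain pA TA where A: "!!P x. impl P x pA UNIV (%e. (e, qof b e)) (%e. TA (e, qof b e))" "PB TA"
  by (rule ACE) blast
 obtain pM TM where M: "!!P x. impl P x pM UNIV (%z :: bool list * nat. b * snd z) TM" "PB TM"
  by (rule PTE[OF PT_mult[OF PT_const PT_snd[OF PT_id]]]) blast
 let ?m1 = "%z :: (bool list * nat) * nat. 2 ^ (snd (fst z) * snd (fst z) + snd z) :: nat"
 let ?m2 = "%z :: ((bool list * nat) * nat) * nat. 2 ^ (snd (fst z) * snd (fst z)) :: nat"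
 have m1: "PI ?m1" by (rule PI_comp[OF PI_power]) (intro PTs)
 have m2: "PI ?m2" by (rule PI_comp[OF PI_power]) (intro PTs)
 from AC_step[OF AC_step[OF AC_id m1] m2]
 obtain pB TB where B: "!!P x. impl P x pB UNIV (%z. ((z, ?m1 z), ?m2 (z, ?m1 z))) (%z. TB ((z, ?m1 z), ?m2 (z, ?m1 z)))" "PB TB"
  by (rule ACE) blast
 obtain pt T1 T2 where pt: "PB T1" "PB T2" "ALL P x p D f T K. impl P x p D f T --> (\<forall>n\<le>K. yK n : D & yE n : D) -->
  impl P x (pt p) {n. n <= (K :: nat)} (%n. eq3 (nat3 (f (yK n)), nat3 (f (yE n))))
   (%n. T1 n + T (yK n) + T (yE n) + T2 (nat3 (f (yK n)), nat3 (f (yE n))))"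
  using impl_eqtest[OF assms] by (elim exE conjE) (rule that)
 define pf where "pf po = Seq (Seq pA (p_pair (seqs []) (Seq pM (p_while (pt po) (seqs [Const 6 1, Add 3 3 6]))))) pB" for po
 define Tf where "Tf E = TA (fst (fst (fst E))) + TM (fst (fst (fst E))) + TB E + 200" for E :: frame
 have "PB Tf" unfolding Tf_def by (intro PB_add PB_const PB_fst A(2) M(2) B(2))
 moreover have "PB (%n. T1 n + 50)" by (intro PB_add PB_const pt)
 moreover have "impl P x (pf po) {e} (%e. frame b e K) (%e. Tf (frame b e K) +
   (SUM i:{..K}. (T1 i + 50) + T (yK i) + T (yE i) + T2 (nat3 (f (yK i)), nat3 (f (yE i)))))"
  if po: "impl P x po D f T" and D: "\<forall>n\<le>K. yK n : D & yE n : D" and le: "b * qof b e <= K"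
   and stop: "~ eq3 (nat3 (f (yK K)), nat3 (f (yE K)))"
   and go: "ALL m. b * qof b e <= m --> m < K --> eq3 (nat3 (f (yK m)), nat3 (f (yE m)))"
  for P x po D f T K e
 proof -
  let ?tst = "%n. eq3 (nat3 (f (yK n)), nat3 (f (yE n)))"
  let ?Tt = "%n. T1 n + T (yK n) + T (yE n) + T2 (nat3 (f (yK n)), nat3 (f (yE n)))"
  have S: "impl P x (p_while (pt po) (seqs [Const 6 1, Add 3 3 6])) {n. n <= K} (%n. LEAST m. n <= m & ~ ?tst m)
   (%n. (SUM i:{n..K}. ?Tt i + 50) + 50)"
   by (rule impl_search[OF pt(3)[rule_format, OF po] stop]) (use D in blast)
  have L: "(LEAST m. b * qof b e <= m & ~ ?tst m) = K"
   using le stop go by (intro Least_equality) (auto simp: not_less[symmetric])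
  have 1: "impl P x (p_pair (seqs []) (Seq pM (p_while (pt po) (seqs [Const 6 1, Add 3 3 6])))) {(e, qof b e)}
   (%z. (z, LEAST m. b * snd z <= m & ~ ?tst m)) (%z. 1 + (TM z + ((SUM i:{b * snd z..K}. ?Tt i + 50) + 50)) + 40)"
   by (rule impl_pair[OF impl_sub[OF impl_id] impl_comp[OF impl_sub[OF M(1)] S]]) (use le in auto)
  have "(SUM i:{b * qof b e..K}. ?Tt i + 50) <= (SUM i:{..K}. ?Tt i + 50)"
   by (rule sum_mono2) auto
  also have "... = (SUM i:{..K}. (T1 i + 50) + T (yK i) + T (yE i) + T2 (nat3 (f (yK i)), nat3 (f (yE i))))"
   by (intro sum.cong) auto
  finally have s: "(SUM i:{b * qof b e..K}. ?Tt i + 50) <= ..." .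
  have A1: "impl P x pA {e} (%e. (e, qof b e)) (%e. TA (e, qof b e))" by (rule impl_sub[OF A(1)]) simp
  show ?thesis
   unfolding pf_def
   by (rule impl_mono[OF impl_comp[OF impl_comp[OF A1 1] B(1)]])
    (use s in "simp_all add: L frame_def Tf_def")
 qed
 ultimately show ?thesis using pt(2)
  by (intro exI[of _ pf] exI[of _ Tf] exI[of _ "%n. T1 n + 50"] exI[of _ T2]) (unfold front_prog_def, blast)
qed

definition gpairs :: "nat => nat => (nat * nat) list" where
 "gpairs k q = filter (%z. fst z < snd z & ~ (fst z < q & q <= snd z & snd z < 2 * q)) (squares k)"

definition frame_n :: "frame => nat" where
 "frame_n E = (let y = rev (fst (fst (fst (fst E)))) in lead (drop (lead y + 1) y))"

text \<open>No base graph is computed. For every candidate \<open>hl\<close> the first list of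
  queries yields its factor, the second its factor times the number of cliques. The number of
  candidates depends on the parameter only.\<close>

definition frame_items :: "(cenv, nat) queries => frame => ((bool * bool list) list * (bool * bool list) list) list" where
 "frame_items Q E = (let y = rev (fst (fst (fst (fst E)))); q = snd (fst (fst (fst E))); k' = snd (fst (fst E)); M = snd (fst E);
  r = drop (lead y + 1) y; n = lead r in
  map (%hl. (Q M k' q hl (True, 0, 0, []) [0] 0, Q M k' q hl (False, lead y, n, drop (n + 1) r) [0..<n + 1] 0))
   (psubs (snd E) (gpairs k' q)))"

text \<open>The case distinction makes the divisor positive, as the output format demands.\<close>

definition ratio :: "(big * big) * (big * big) => big3" where
 "ratio z = (if nob (snd (fst z)) <= nob (fst (fst z)) then (fst (snd z), snd (snd z), bsub (fst (fst z)) (snd (fst z)))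
  else (snd (snd z), fst (snd z), bsub (snd (fst z)) (fst (fst z))))"

lemma ratio_correct:
 assumes "ival (fst z) = w" "w ~= 0" "ival (snd z) = w * c"
 shows "rep3 (ratio z) c"
proof (cases "nob (snd (fst z)) <= nob (fst (fst z))")
 case True
 have "nob (snd (fst z)) ~= nob (fst (fst z))" using assms by (auto simp: ival_def)
 hence "0 < nob (fst (fst z)) - nob (snd (fst z))" using True by simp
 moreover have "of_nat (nob (fst (fst z)) - nob (snd (fst z))) = w" using True assms by (simp add: ival_def of_nat_diff)
 moreover have "of_nat (nob (fst (snd z))) - of_nat (nob (snd (snd z))) = w * c" using assms by (simp add: ival_def)
 ultimately show ?thesis using True assms(2) by (simp add: rep3_def ratio_def)
next
 case False
 hence "0 < nob (snd (fst z)) - nob (fst (fst z))" by simp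
 moreover have "of_nat (nob (snd (fst z)) - nob (fst (fst z))) = - w" using False assms by (simp add: ival_def of_nat_diff)
 moreover have "of_nat (nob (snd (snd z))) - of_nat (nob (fst (snd z))) = (- w) * c" using assms by (simp add: ival_def)
 ultimately show ?thesis using False assms(2) by (simp add: rep3_def ratio_def)
qed

text \<open>Any candidate with nonzero factor serves, and \<open>base_hl\<close> shows that there is
  one. The second argument of \<open>sum_ans\<close> is the number of binary digits: each value is
  bounded by \<open>B\<close>, and an answer sums up at most 2 to the power
  \<open>K * (n + 2)\<close> of them.\<close>

definition verdict :: "nat => nat => frame * ((bool * big3) list * (bool * big3) list) list => big3" where
 "verdict N B z = (case filter (%z. ~ (nob (fst (fst z)) <= nob (snd (fst z)) & nob (snd (fst z)) <= nob (fst (fst z))))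
   (map (%a. (sum_ans N (B + snd (fst (fst (fst z))) * (frame_n (fst z) + 2)) (fst a),
     sum_ans N (B + snd (fst (fst (fst z))) * (frame_n (fst z) + 2)) (snd a))) (snd z)) of
  [] => (Big 0, Big 0, Big 1) | z # zs => ratio z)"

lemma PT_gpairs: "PT k ==> PT q ==> PT (%e. gpairs (k e) (q e))"
proof -
 assume a: "PT k" "PT q"
 show ?thesis unfolding gpairs_def
  by (intro PTs PT_squares[OF PT_clCp] a PT_comp[OF a(2)])
qed

lemma PT_frame_n: "PT E ==> PT (%e. frame_n (E e))"
 unfolding frame_n_def Let_def by (intro PTs PT_lead)

lemma PT_verdict: "PT (verdict N B)"
proof -
 have r: "PT (%z :: (big * big) * (big * big). ratio z)"
  unfolding ratio_def by (intro PTs PT_ble PT_bsub)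
 have "PT (%z. verdict N B z)"
  unfolding verdict_def
  by (intro PTs PT_case_list PT_ble PT_sum_ans PT_frame_n PT_comp[OF r])
 thus ?thesis by simp
qed

lemma PT_power: "PT f ==> PT (%e. f e ^ d :: nat)"
proof (induction d)
 case (Suc d)
 thus ?case using PT_mult[OF Suc.prems Suc.IH] by simp
qed (simp add: PT_const)

lemma PB_nat_mono:
 assumes "PB (T :: nat => nat)"
 obtains T' where "PB T'" "!!i K. i <= K ==> T i <= T' K"
proof -
 obtain c d where cd: "!!i. T i <= c * sz i ^ d" using assms unfolding PB_def by blast
 show ?thesis
 proof (rule that[of "%K. c * sz K ^ d"])
  show "PB (%K :: nat. c * sz K ^ d)" by (intro PB_mult PB_const PB_power PB_sz)
  fix i K :: nat assume "i <= K"
  hence "sz i ^ d <= sz K ^ d" by (intro power_mono) auto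
  thus "T i <= c * sz K ^ d" using cd[of i] by (meson mult_le_mono2 order_trans)
 qed
qed

definition cgr_bits :: "nat => bool list" where "cgr_bits n = bits_graph [0..<n] (<)"
definition egr_bits :: "nat => bool list" where "egr_bits n = bits_graph [0..<n] (%_ _. False)"

lemma cgr_bits: "enc_graph (cgr n) = cgr_bits n" "enc_graph (egr n) = egr_bits n"
 by (simp_all add: cgr_def egr_def cgr_bits_def egr_bits_def enc_graph_of)

lemma PT_cgr_bits: "PT f ==> PT (%e. cgr_bits (f e))" "PT f ==> PT (%e. egr_bits (f e))"
proof -
 assume f: "PT f"
 show "PT (%e. cgr_bits (f e))"
  unfolding cgr_bits_def bits_graph_def
  by (intro PTs PT_replicate f PT_comp[OF f])
 show "PT (%e. egr_bits (f e))"
  unfolding egr_bits_def bits_graph_def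
  by (intro PTs PT_replicate f PT_comp[OF f])
qed

lemma sum_form_mono: "sum_form \<Phi> V v ==> V <= V' ==> sum_form \<Phi> V' v"
proof -
 assume "sum_form \<Phi> V v" "V <= V'"
 hence p: "(2 :: nat) ^ V <= 2 ^ V'" by (intro power_increasing) simp_all
 obtain S h where S: "finite (S :: nat set set)" "card S <= 2 ^ V" "h ` S <= graphs" "v = (SUM s:S. \<Phi> (h s))"
  using \<open>sum_form \<Phi> V v\<close> unfolding sum_form_def by blast
 have "card S <= 2 ^ V'" using S(2) p by linarith
 thus "sum_form \<Phi> V' v" using S unfolding sum_form_def by blast
qed

section \<open>The parameterized reduction from counting cliques\<close>

text \<open>Covers both problems. \<open>N\<close> clears the denominators of \<Phi>,
  \<open>B\<close> bounds its scaled values, the prime \<open>b\<close> exceeds their differences,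
  and \<open>prg\<close> computes \<Phi>. The strings \<open>sK n\<close> and \<open>sE n\<close>
  query the value of the complete and the edgeless graph.\<close>

locale reduction =
 fixes \<Phi> :: "graph => rat" and Pr :: problem and mem :: "nat => nat => bool list => rat => bool"
  and Q :: "(cenv, nat) queries" and sK sE :: "nat => bool list" and N B b :: nat and prg :: prog
 assumes fn: "functional Pr" and iso: "iso_invariant \<Phi>" and mono: "edge_monotone \<Phi>" and nt: "nontrivial \<Phi>"
  and fin: "finite (\<Phi> ` graphs)"
  and N: "0 < N" "!!G. G : graphs ==> of_nat N * \<Phi> G : \<int>"
  and B: "!!G. G : graphs ==> \<bar>of_nat N * \<Phi> G\<bar> <= of_nat B"
  and b: "prime b" "3 <= b"
   "!!G G'. G : graphs ==> G' : graphs ==> \<bar>of_nat N * \<Phi> G - of_nat N * \<Phi> G'\<bar> < of_nat b"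
  and prg: "!!G. G : input_graphs ==> EX t. outputs prg (enc_graph G) (\<Phi> G) t"
  and PTQ: "PTQ Q"
  and Q: "qspec mem \<Phi> clCp Q" "!!k V y v. mem k V y v ==> (y, k, v) : Pr & sum_form \<Phi> V v"
  and s: "PT sK" "PT sE" "!!n. (sK n, n, \<Phi> (cgr n)) : Pr" "!!n. (sE n, n, \<Phi> (egr n)) : Pr"
begin

lemma PT_items: "PT (frame_items Q)"
proof -
 have "PT (%E. frame_items Q E)"
  unfolding frame_items_def Let_def
  by (intro PTs PT_queries[OF PTQ] PT_psubs PT_gpairs PT_lead)
 thus ?thesis by simp
qed

text \<open>Since \<Phi> is nontrivial infinitely often, such a number exists. Blocks of size
  \<open>b ^ k >= k\<close> offer a position for each vertex of a \<open>k\<close>-clique, and at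
  least \<open>b\<close> blocks fit.\<close>

definition par :: "nat => nat" where
 "par k = (LEAST n. b * b ^ k <= n & nontrivial_on \<Phi> n)"

abbreviation "MM k \<equiv> (2 :: nat) ^ (b ^ k * b ^ k + par k)"
abbreviation "hls k \<equiv> psubs (2 ^ (par k * par k)) (gpairs (par k) (b ^ k))"

lemma par: "b * b ^ k <= par k" "nontrivial_on \<Phi> (par k)"
 "b * b ^ k <= m ==> m < par k ==> ~ nontrivial_on \<Phi> m"
proof -
 have "infinite {n. nontrivial_on \<Phi> n}" using nt by (simp add: nontrivial_def)
 hence "~ {n. nontrivial_on \<Phi> n} <= {..<b * b ^ k}" using finite_subset by blast
 hence "EX n. b * b ^ k <= n & nontrivial_on \<Phi> n" by (auto simp: not_less)
 from LeastI_ex[OF this] show "b * b ^ k <= par k" "nontrivial_on \<Phi> (par k)" by (auto simp: par_def)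
 show "b * b ^ k <= m ==> m < par k ==> ~ nontrivial_on \<Phi> m"
  unfolding par_def using not_less_Least by blast
qed

abbreviation "Pb k \<equiv> {(y, k', v) : Pr. k' <= par k}"

lemma fnb: "functional (Pb k)"
 using fn unfolding functional_def by blast

lemma answer_mem: "(y, k', v) : Pr ==> k' <= par k ==> answer (Pb k) y = v"
 by (rule answer_eq[OF fnb, where k = k']) simp

lemma powers: "0 < b ^ k" "2 * b ^ k <= par k" "k <= b ^ k" "b <= par k div b ^ k"
proof -
 show p: "0 < b ^ k" using b by simp
 have "3 * b ^ k <= b * b ^ k" using b by (intro mult_le_mono1)
 thus "2 * b ^ k <= par k" using par(1)[of k] by linarith
 have "k < b ^ k" using b by (intro power_gt_expt) simp
 thus "k <= b ^ k" by simp
 show "b <= par k div b ^ k" using par(1)[of k] p by (simp add: less_eq_div_iff_mult_less_eq)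
qed

lemma gpairs_good: "set hl <= set (gpairs k' q) ==> good_hl k' q hl"
 unfolding good_hl_def gpairs_def squares_def by force

lemma psubs_gpairs:
 "set ` set (psubs (2 ^ (k' * k')) (gpairs k' q)) = Pow (set (gpairs k' q))"
proof (rule psubs_props(4))
 show "distinct (gpairs k' q)" unfolding gpairs_def squares_def by (intro distinct_filter distinct_product) auto
 have "length (gpairs k' q) <= length (squares k')" unfolding gpairs_def by (rule length_filter_le)
 also have "... = k' * k'" by (simp add: squares_def)
 finally show "2 ^ length (gpairs k' q) <= (2 :: nat) ^ (k' * k')" by (intro power_increasing) simp_all
qed

lemma base_hl:
 "EX hl:set (hls k). altsum \<Phi> (par k) (b ^ k) (hl_edges hl) ~= 0"
proof -
 obtain H where H: "H <= pairs {..<par k}" "H Int biedges (b ^ k) = {}" "altsum \<Phi> (par k) (b ^ k) H ~= 0"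
  using exists_base[OF iso mono par(2) N b refl powers(4)] by blast
 obtain C where C: "C <= {(i, j). i < j & j < par k & ~ (i < b ^ k & b ^ k <= j & j < 2 * b ^ k)}"
  "(%(i, j). {i, j}) ` C = H" by (rule exists_hl[OF H(1,2)])
 have "C <= set (gpairs (par k) (b ^ k))" using C(1) by (auto simp: gpairs_def squares_def)
 hence "C : set ` set (hls k)" unfolding psubs_gpairs by blast
 then obtain hl where "hl : set (hls k)" "set hl = C" by auto
 thus ?thesis using C(2) H(3) by (auto simp: hl_edges_def)
qed

abbreviation "inp k G \<equiv> rev (enc_nat k @ enc_graph G)"
abbreviation "E k G \<equiv> frame b (inp k G) (par k)"
abbreviation "ans k \<equiv> %z. (fst z, rat3 (answer (Pb k) (snd z)))"
abbreviation "pans k its \<equiv> rev (map (%it. (rev (map (ans k) (fst it)), rev (map (ans k) (snd it)))) its)"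
abbreviation "answers k G \<equiv> pans k ((frame_items Q (E k G)))"

lemma parse_input:
 "lead (enc_nat k @ enc_graph G) = k" "drop (k + 1) (enc_nat k @ enc_graph G) = enc_graph G"
 "lead (enc_graph G) = card (verts G)" "drop (card (verts G) + 1) (enc_graph G) = adj_bits G"
 by (simp_all add: lead_enc_nat enc_graph_def Let_def adj_bits_def)

lemma frame_simps: "qof b (inp k G) = b ^ k" "frame_n (E k G) = card (verts G)" "snd (fst (fst (E k G))) = par k"
 by (simp_all add: qof_def frame_n_def frame_def Let_def parse_input[simplified])

lemma items_eq:
 "frame_items Q (E k G) = map (%hl. (Q (MM k) (par k) (b ^ k) hl (True, 0, 0, []) [0] 0,
   Q (MM k) (par k) (b ^ k) hl (False, k, card (verts G), adj_bits G) [0..<card (verts G) + 1] 0))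
  (hls k)"
 by (simp add: frame_items_def frame_def Let_def qof_def parse_input[simplified] del: upt_Suc)

definition W :: "nat => graph => nat" where "W k G = par k * (card (verts G) + 2)"

lemma query_list:
 assumes hl: "hl : set (hls k)"
  and qs: "qs = Q (MM k) (par k) (b ^ k) hl c xs x0"
  and xs: "distinct xs" "length xs <= n + 1" "V = par k * (n + 2)"
 shows "ALL z:set qs. (snd z, par k, answer (Pb k) (snd z)) : Pr & sum_form \<Phi> V (answer (Pb k) (snd z))"
  "(\<Sum>z\<leftarrow>qs. sg (fst z) * answer (Pb k) (snd z)) =
   altsum \<Phi> (par k) (b ^ k) (hl_edges hl) * of_nat (card (bicliques (par k) (b ^ k) xs x0 (clCp c)))"
proof -
 have "set hl : Pow (set (gpairs (par k) (b ^ k)))" using hl unfolding psubs_gpairs[symmetric] by blast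
 hence good: "good_hl (par k) (b ^ k) hl" by (intro gpairs_good) blast
 have M: "2 ^ (b ^ k * b ^ k) <= MM k" "2 ^ par k <= MM k"
  by (intro power_increasing; simp)+
 obtain f where f: "ALL z:set qs. mem (par k) (par k * (length xs + 1)) (snd z) (f z)"
  "(\<Sum>z\<leftarrow>qs. sg (fst z) * f z) = altsum \<Phi> (par k) (b ^ k) (hl_edges hl) * of_nat (card (bicliques (par k) (b ^ k) xs x0 (clCp c)))"
  using Q(1)[unfolded qspec_def, rule_format, OF powers(2) good M xs(1)] unfolding qs by blast
 have a: "answer (Pb k) (snd z) = f z" if "z : set qs" for z
  using answer_mem[of "snd z" "par k" "f z"] Q(2) f(1) that by blast
 have V: "par k * (length xs + 1) <= V" using mult_le_mono2[of "length xs + 1" "n + 2" "par k"] xs by simp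
 have sf: "sum_form \<Phi> V v" if "sum_form \<Phi> (par k * (length xs + 1)) v" for v
  using that V by (rule sum_form_mono)
 show "ALL z:set qs. (snd z, par k, answer (Pb k) (snd z)) : Pr & sum_form \<Phi> V (answer (Pb k) (snd z))"
 proof
  fix z assume z: "z : set qs"
  hence "mem (par k) (par k * (length xs + 1)) (snd z) (f z)" using f(1) by blast
  thus "(snd z, par k, answer (Pb k) (snd z)) : Pr & sum_form \<Phi> V (answer (Pb k) (snd z))"
   unfolding a[OF z] using Q(2) sf by blast
 qed
 have "(\<Sum>z\<leftarrow>qs. sg (fst z) * answer (Pb k) (snd z)) = (\<Sum>z\<leftarrow>qs. sg (fst z) * f z)"
  by (intro arg_cong[where f = sum_list] map_cong refl) (simp add: a)
 thus "(\<Sum>z\<leftarrow>qs. sg (fst z) * answer (Pb k) (snd z)) =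
   altsum \<Phi> (par k) (b ^ k) (hl_edges hl) * of_nat (card (bicliques (par k) (b ^ k) xs x0 (clCp c)))"
  using f(2) by simp
qed

lemma query_sum:
 assumes hl: "hl : set (hls k)"
  and qs: "qs = Q (MM k) (par k) (b ^ k) hl c xs x0"
  and xs: "distinct xs" "length xs <= n + 1" "V = par k * (n + 2)"
 shows "ival (sum_ans N (B + V) (rev (map (ans k) qs))) = of_nat N *
   (altsum \<Phi> (par k) (b ^ k) (hl_edges hl) * of_nat (card (bicliques (par k) (b ^ k) xs x0 (clCp c))))"
proof -
 note q = query_list[OF hl qs xs]
 have "ival (sum_ans N (B + V) (rev (map (%z. (fst z, (%z. rat3 (answer (Pb k) (snd z))) z)) qs))) =
   of_nat N * (\<Sum>z\<leftarrow>qs. sg (fst z) * answer (Pb k) (snd z))"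
 proof (rule sum_answers)
  fix z assume "z : set qs"
  hence "sum_form \<Phi> V (answer (Pb k) (snd z))" using q(1) by blast
  thus "rep3 (rat3 (answer (Pb k) (snd z))) (answer (Pb k) (snd z)) &
   of_nat N * answer (Pb k) (snd z) : \<int> & \<bar>of_nat N * answer (Pb k) (snd z)\<bar> < 2 ^ (B + V + 1)"
   using sum_form_int sum_form_abs(2) rep3_rat3 N(2) B by blast
 qed
 thus ?thesis using q(2) by simp
qed

lemma verdict_correct:
 assumes G: "G : input_graphs"
 shows "rep3 (verdict N B (E k G, answers k G)) (of_nat (num_cliques k G))"
proof -
 let ?n = "card (verts G)" and ?l = "B + W k G"
 let ?hls = "hls k"
 let ?w = "%hl. altsum \<Phi> (par k) (b ^ k) (hl_edges hl)"
 define t where "t hl = Q (MM k) (par k) (b ^ k) hl (True, 0, 0, []) [0] 0" for hl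
 define u where "u hl = Q (MM k) (par k) (b ^ k) hl (False, k, ?n, adj_bits G) [0..<?n + 1] 0" for hl
 define st where "st hl = sum_ans N ?l (rev (map (ans k) (t hl)))" for hl
 define su where "su hl = sum_ans N ?l (rev (map (ans k) (u hl)))" for hl
 have st: "ival (st hl) = of_nat N * ?w hl" if "hl : set ?hls" for hl
  unfolding st_def
  by (subst query_sum[OF that t_def, where n = ?n]) (auto simp: W_def trivial_bicliques[OF powers(2)])
 have su: "ival (su hl) = (of_nat N * ?w hl) * of_nat (num_cliques k G)" if "hl : set ?hls" for hl
 proof -
  have "ival (su hl) = of_nat N * (?w hl * of_nat (card (bicliques (par k) (b ^ k) [0..<?n + 1] 0 (clCp (False, k, ?n, adj_bits G)))))"
   unfolding su_def by (rule query_sum[OF that u_def, where n = ?n]) (auto simp: W_def simp del: upt_Suc)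
  thus ?thesis unfolding clique_bicliques[OF G powers(3,2,1)] by (simp only: mult.assoc)
 qed
 define zs where "zs = rev (map (%hl. (st hl, su hl)) ?hls)"
 have zs: "map (%a. (sum_ans N ?l (fst a), sum_ans N ?l (snd a))) (answers k G) = zs"
  unfolding items_eq zs_def st_def su_def t_def u_def by (simp add: rev_map comp_def del: upt_Suc)
 define fl where "fl = filter (%z :: (big * big) * (big * big). ~ (nob (fst (fst z)) <= nob (snd (fst z)) & nob (snd (fst z)) <= nob (fst (fst z)))) zs"
 have nz: "(~ (nob (fst a) <= nob (snd a) & nob (snd a) <= nob (fst a))) = (ival a ~= 0)" for a
  by (auto simp: ival_def)
 have fl: "fl = filter (%z. ival (fst z) ~= 0) zs" unfolding fl_def nz ..
 have "fl ~= []"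
 proof -
  obtain hl where hl: "hl : set ?hls" "?w hl ~= 0" using base_hl by blast
  hence "(st hl, su hl) : set fl" using st[OF hl(1)] N(1) by (auto simp: fl zs_def)
  thus ?thesis by auto
 qed
 then obtain z zs' where z: "fl = z # zs'" by (cases fl) auto
 hence "z : set fl" by simp
 then obtain hl where hl: "hl : set ?hls" "z = (st hl, su hl)" "ival (st hl) ~= 0" by (auto simp: fl zs_def)
 have "rep3 (ratio z) (of_nat (num_cliques k G))"
  by (rule ratio_correct[where w = "ival (st hl)"]) (use hl su st in auto)
 moreover have "verdict N B (E k G, answers k G) = ratio z"
  unfolding verdict_def fst_conv snd_conv frame_simps(2,3) W_def[symmetric] zs fl_def[symmetric] z by simp
 ultimately show ?thesis by simp
qed

lemma query_cost:
 assumes it: "it : set (frame_items Q (E k G))" and z: "z : set (fst it) Un set (snd it)"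
 shows "(snd z, par k, answer (Pb k) (snd z)) : Pb k"
  "rat_length (answer (Pb k) (snd z)) <= B + W k G + 1 + N"
  "length (snd z) <= sz (frame_items Q (E k G))"
proof -
 have "sz it <= sz (frame_items Q (E k G))" by (rule sz_mem[OF it])
 moreover have "sz z <= sz it"
  using z sz_mem[of z "fst it"] sz_mem[of z "snd it"] by (auto simp: sz_prod_def[of it])
 moreover have "length (snd z) < sz z" using length_le_sz[of "snd z"] by (simp add: sz_prod_def)
 ultimately show "length (snd z) <= sz (frame_items Q (E k G))" by linarith
 have "(snd z, par k, answer (Pb k) (snd z)) : Pr & sum_form \<Phi> (W k G) (answer (Pb k) (snd z))"
 proof -
  obtain hl where hl: "hl : set (hls k)"
   "fst it = Q (MM k) (par k) (b ^ k) hl (True, 0, 0, []) [0] 0"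
   "snd it = Q (MM k) (par k) (b ^ k) hl (False, k, card (verts G), adj_bits G) [0..<card (verts G) + 1] 0"
   using it unfolding items_eq by (auto simp del: upt_Suc)
  have 1: "distinct [0]" "length [0] <= card (verts G) + 1" by auto
  have 2: "distinct [0..<card (verts G) + 1]" "length [0..<card (verts G) + 1] <= card (verts G) + 1" by (auto simp del: upt_Suc)
  show ?thesis
   using z query_list(1)[OF hl(1,2) 1 W_def] query_list(1)[OF hl(1,3) 2 W_def] by blast
 qed
 hence m: "(snd z, par k, answer (Pb k) (snd z)) : Pr" "sum_form \<Phi> (W k G) (answer (Pb k) (snd z))" by auto
 show "(snd z, par k, answer (Pb k) (snd z)) : Pb k" using m(1) by simp
 have "rat_length (answer (Pb k) (snd z)) <= (B + W k G + 1) + N"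
  by (rule rat_length_bound[OF N(1)]) (use sum_form_int[OF m(2) N(2)] sum_form_abs(2)[OF m(2) B] in auto)
 thus "rat_length (answer (Pb k) (snd z)) <= B + W k G + 1 + N" by simp
qed

text \<open>A finite codomain gives a constant bound for every quantity determined by a value of
  \<Phi>, such as the length of an answer or the cost of a comparison.\<close>

lemma finite_bound:
 fixes h :: "rat => nat"
 obtains C where "!!G. G : graphs ==> h (\<Phi> G) <= C"
proof (rule that[of "Max (h ` \<Phi> ` graphs)"])
 show "h (\<Phi> G) <= Max (h ` \<Phi> ` graphs)" if "G : graphs" for G
  using that fin by (intro Max_ge) auto
qed

lemma finite_bound2:
 fixes h :: "rat => rat => nat"
 obtains C where "!!G G'. G : graphs ==> G' : graphs ==> h (\<Phi> G) (\<Phi> G') <= C"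
proof (rule that[of "Max ((%z. h (fst z) (snd z)) ` (\<Phi> ` graphs \<times> \<Phi> ` graphs))"])
 show "h (\<Phi> G) (\<Phi> G') <= Max ((%z. h (fst z) (snd z)) ` (\<Phi> ` graphs \<times> \<Phi> ` graphs))"
  if "G : graphs" "G' : graphs" for G G'
 proof (rule Max_ge)
  show "finite ((%z. h (fst z) (snd z)) ` (\<Phi> ` graphs \<times> \<Phi> ` graphs))" using fin by simp
  show "h (\<Phi> G) (\<Phi> G') : (%z. h (fst z) (snd z)) ` (\<Phi> ` graphs \<times> \<Phi> ` graphs)"
   using that by (intro image_eqI[of _ _ "(\<Phi> G, \<Phi> G')"]) auto
 qed
qed

lemma cgr_graphs: "cgr n : graphs" "egr n : graphs"
 using cgr_in[of n] by (auto simp: input_graphs_def)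

text \<open>Inside the reduction the search takes its values from the oracle. Its cost is then
  polynomial in the frame, whatever the running time of a program for \<Phi> is.\<close>

lemma front_query:
 "EX p R. PB R & (ALL x k G. impl (Pb k) x p {inp k G} (%e. frame b e (par k)) (%e. R (E k G)))"
proof -
 obtain pf Tf T1 T2 where F: "PB Tf" "PB T1" "PB T2" "front_prog b sK sE pf Tf T1 T2"
  using front[OF s(1,2), of b] by blast
 obtain C1 where C1: "!!G. G : graphs ==> rat_length (\<Phi> G) <= C1" by (rule finite_bound[of rat_length]) blast
 obtain C2 where C2: "!!G G'. G : graphs ==> G' : graphs ==> T2 (nat3 (rat3 (\<Phi> G)), nat3 (rat3 (\<Phi> G'))) <= C2"
  by (rule finite_bound2[of "%u v. T2 (nat3 (rat3 u), nat3 (rat3 v))"]) blast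
 let ?U = "%i. T1 i + (9 * sz (sK i) + C1 + 30) + (9 * sz (sE i) + C1 + 30) + C2"
 have U: "PB ?U" by (intro PB_add PB_mult PB_const PT_size s F)
 obtain U' where U': "PB U'" "!!i K. i <= K ==> ?U i <= U' K" by (rule PB_nat_mono[OF U]) blast
 define R where "R E = Tf E + sz (snd (fst (fst E))) * U' (snd (fst (fst E)))" for E :: frame
 have "PB R"
  unfolding R_def by (intro PTs PB_add F PB_mult PT_size PB_comp[OF U'(1)])
 moreover have "impl (Pb k) x (pf p_query) {inp k G} (%e. frame b e (par k)) (%e. R (E k G))" for x k G
 proof -
  let ?f = "%y. rat3 (answer (Pb k) y)" and ?T = "%y. 9 * length y + rat_length (answer (Pb k) y) + 30"
  have a: "answer (Pb k) (sK n) = \<Phi> (cgr n)" "answer (Pb k) (sE n) = \<Phi> (egr n)" if "n <= par k" for n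
   using answer_mem[OF s(3) that] answer_mem[OF s(4) that] by auto
  have eq: "eq3 (nat3 (?f (sK n)), nat3 (?f (sE n))) \<longleftrightarrow> ~ nontrivial_on \<Phi> n" if "n <= par k" for n
   using eq3_correct[OF rep3_rat3 rep3_rat3] nontrivial_on_iff[OF iso mono] by (simp add: a[OF that])
  have D: "\<forall>n\<le>par k. sK n : {y. EX k' v. (y, k', v) : Pb k} & sE n : {y. EX k' v. (y, k', v) : Pb k}"
   using s(3,4) by blast
  have I: "impl (Pb k) x (pf p_query) {inp k G} (%e. frame b e (par k)) (%e. Tf (frame b e (par k)) +
   (SUM i:{..par k}. T1 i + ?T (sK i) + ?T (sE i) + T2 (nat3 (?f (sK i)), nat3 (?f (sE i)))))"
   by (rule F(4)[unfolded front_prog_def, rule_format, OF impl_query[OF fnb]]) (use D eq par frame_simps(1) in "simp_all")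
  have "(SUM i:{..par k}. T1 i + ?T (sK i) + ?T (sE i) + T2 (nat3 (?f (sK i)), nat3 (?f (sE i)))) <= (SUM i:{..par k}. U' (par k))"
  proof (rule sum_mono)
   fix i assume "i : {..par k}"
   hence i: "i <= par k" by simp
   have "T1 i + ?T (sK i) + ?T (sE i) + T2 (nat3 (?f (sK i)), nat3 (?f (sE i))) <= ?U i"
    using a[OF i] C1[OF cgr_graphs(1)[of i]] C1[OF cgr_graphs(2)[of i]] C2[OF cgr_graphs, of i i]
     length_le_sz[of "sK i"] length_le_sz[of "sE i"] by simp
   also have "... <= U' (par k)" by (rule U'(2)[OF i])
   finally show "T1 i + ?T (sK i) + ?T (sE i) + T2 (nat3 (?f (sK i)), nat3 (?f (sE i))) <= U' (par k)" .
  qed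
  also have "... = sz (par k) * U' (par k)" by simp
  finally have "Tf (E k G) + (SUM i:{..par k}. T1 i + ?T (sK i) + ?T (sE i) + T2 (nat3 (?f (sK i)), nat3 (?f (sE i)))) <= R (E k G)"
   unfolding R_def frame_simps by simp
  thus ?thesis by (intro impl_mono[OF I]) auto
 qed
 ultimately show ?thesis by blast
qed

lemma queries_run:
 "EX p R. PB R & (ALL x k G. impl (Pb k) x p {frame_items Q (E k G)}
  (%its. pans k (its)) (%_. R (E k G)))"
proof -
 obtain pm where pm: "qmap_prog pm"
  using impl_qmap by blast
 let ?snd = "seqs [Const 6 1, Add 3 3 6, Load 3 3]"
 let ?p = "p_rmap (p_pair (Seq (seqs [Load 3 3]) (pm p_query)) (Seq ?snd (pm p_query)))"
 let ?Z = "%E. sz (frame_items Q E)"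
 let ?tq = "%E. 9 * ?Z E + (B + snd (fst (fst E)) * (frame_n E + 2) + 1 + N) + 430"
 define R where "R E = 300 + ?Z E * (2 * (300 + ?Z E * ?tq E) + 346)" for E
 have nat: "PB (%E. f E)" if "PT f" for f :: "frame => nat"
  by (rule PB_mono[OF PT_size[OF that]]) simp
 have "PB (%E :: frame. snd (fst (fst E)))" "PB (%E. frame_n E)" "PB ?Z"
  by (rule nat, intro PT_fst PT_snd PT_id) (rule nat, intro PT_frame_n PT_id, intro PT_size PT_items)
 hence "PB R" unfolding R_def by (intro PB_add PB_mult PB_const)
 moreover have "impl (Pb k) x ?p {frame_items Q (E k G)}
  (%its. pans k (its)) (%_. R (E k G))" for x k G
 proof -
  let ?D = "{y. EX k' v. (y, k', v) : Pb k}" and ?T = "%y. 9 * length y + rat_length (answer (Pb k) y) + 30"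
  let ?its = "frame_items Q (E k G)"
  let ?DD = "{qs :: (bool * bool list) list. snd ` set qs <= ?D}"
  let ?TT = "%qs :: (bool * bool list) list. 300 + (\<Sum>z\<leftarrow>qs. ?T (snd z) + 400)"
  have q: "impl (Pb k) x (pm p_query) ?DD (%qs. rev (map (ans k) qs)) ?TT"
   using pm[unfolded qmap_prog_def, rule_format, OF impl_query[OF fnb]] .
  have 1: "impl (Pb k) x (Seq (seqs [Load 3 3]) (pm p_query)) {it. fst it : ?DD & snd it : ?DD} (%it. rev (map (ans k) (fst it))) (%it. 2 + ?TT (fst it))"
   by (rule impl_comp[OF impl_sub[OF impl_fst] q]) auto
  have 2: "impl (Pb k) x (Seq ?snd (pm p_query)) {it. fst it : ?DD & snd it : ?DD} (%it. rev (map (ans k) (snd it))) (%it. 4 + ?TT (snd it))"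
   by (rule impl_comp[OF impl_sub[OF impl_snd] q]) auto
  note I = impl_rmap[OF impl_pair[OF 1 2]]
  have dom: "set ?its <= {it. fst it : ?DD & snd it : ?DD}"
  proof
   fix it assume it: "it : set ?its"
   have "snd z : ?D" if "z : set (fst it) Un set (snd it)" for z
    using query_cost(1)[OF it that] by blast
   thus "it : {it. fst it : ?DD & snd it : ?DD}" by blast
  qed
  have TT: "?TT qs <= 300 + ?Z (E k G) * ?tq (E k G)" if it: "it : set ?its" "qs = fst it | qs = snd it" for it qs
  proof -
   have "sz it <= ?Z (E k G)" by (rule sz_mem[OF it(1)])
   hence "length qs <= ?Z (E k G)" using it(2) length_le_sz[of qs] by (auto simp: sz_prod_def)
   moreover have "?T (snd z) + 400 <= ?tq (E k G)" if "z : set qs" for z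
    using query_cost(2,3)[OF it(1), of z] that it(2) unfolding W_def frame_simps by auto
   ultimately show ?thesis using sum_list_length_bound[of qs "%z. ?T (snd z) + 400"] by simp
  qed
  have "(\<Sum>it\<leftarrow>?its. (2 + ?TT (fst it)) + (4 + ?TT (snd it)) + 40 + 300) <= ?Z (E k G) * (2 * (300 + ?Z (E k G) * ?tq (E k G)) + 346)"
  proof (rule sum_list_length_bound)
   fix it assume it: "it : set ?its"
   have ar: "2 + u + (4 + v) + 40 + 300 <= 2 * w + 346" if "u <= w" "v <= w" for u v w :: nat
    using that by simp
   show "(2 + ?TT (fst it)) + (4 + ?TT (snd it)) + 40 + 300 <= 2 * (300 + ?Z (E k G) * ?tq (E k G)) + 346"
    by (rule ar[OF TT[OF it disjI1[OF refl]] TT[OF it disjI2[OF refl]]])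
  next
   show "length ?its <= ?Z (E k G)" using length_le_sz[of ?its] by simp
  qed
  hence "300 + (\<Sum>it\<leftarrow>?its. (2 + ?TT (fst it)) + (4 + ?TT (snd it)) + 40 + 300) <= R (E k G)"
   unfolding R_def by (rule add_left_mono)
  thus ?thesis by (intro impl_mono[OF I]) (use dom in auto)
 qed
 ultimately show ?thesis by (intro exI[of _ ?p] exI[of _ R]) blast
qed

text \<open>The bounds of a reduction have to be computable without an oracle. The same search is
  therefore run with the simulated program for \<Phi>; its running time is irrelevant here.\<close>

lemma computable_frame:
 assumes "PT h" "!!k. h (frame b (rev (enc_nat k)) (par k)) = F k"
 shows "computable_nat_fun F"
proof -
 have PTc: "PT cgr_bits" "PT egr_bits" using PT_cgr_bits[OF PT_id] by simp_all
 obtain pf Tf T1 T2 where F: "front_prog b cgr_bits egr_bits pf Tf T1 T2"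
  using front[OF PTc, of b] by blast
 let ?D = "{y. EX v t. outputs prg y v t}"
 have out: "EX t. outputs prg (cgr_bits n) (\<Phi> (cgr n)) t" "EX t. outputs prg (egr_bits n) (\<Phi> (egr n)) t" for n
  using prg[OF cgr_in(1)[of n]] prg[OF cgr_in(2)[of n]] by (simp_all add: cgr_bits)
 have eq: "eq3 (nat3 (sim_val prg (cgr_bits n)), nat3 (sim_val prg (egr_bits n))) \<longleftrightarrow> ~ nontrivial_on \<Phi> n" for n
 proof -
  have "rep3 (sim_val prg (cgr_bits n)) (\<Phi> (cgr n))" "rep3 (sim_val prg (egr_bits n)) (\<Phi> (egr n))"
   using out outputs_sim(1) by blast+
  thus ?thesis using eq3_correct nontrivial_on_iff[OF iso mono] by blast
 qed
 have D: "\<forall>n\<le>K. cgr_bits n : ?D & egr_bits n : ?D" for K :: nat using out by blast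
 have q: "qof b (rev (enc_nat k)) = b ^ k" for k using lead_enc_nat[of k "[]"] by (simp add: qof_def)
 have "PT (%z. (Big (h z), Big 0, Big 1))" by (intro PTs PT_Big assms)
 then obtain pH TH where H: "!!P x. impl P x pH UNIV (%z. (Big (h z), Big 0, Big 1)) TH" by (rule PTE) blast
 have "EX t. outputs (p_main (Seq (pf (p_sim prg)) pH)) (enc_nat k) (of_nat (F k)) t" for k
 proof -
  have I: "EX T. impl {} (enc_nat k) (pf (p_sim prg)) {rev (enc_nat k)} (%e. frame b e (par k)) T"
   by (rule exI, rule F[unfolded front_prog_def, rule_format, OF impl_sim]) (use D eq par q in simp_all)
  then obtain T where "impl {} (enc_nat k) (pf (p_sim prg)) {rev (enc_nat k)} (%e. frame b e (par k)) T" by blast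
  from impl_comp[OF this H] have
   "impl {} (enc_nat k) (Seq (pf (p_sim prg)) pH) {rev (enc_nat k)} (%e. (Big (h (frame b e (par k))), Big 0, Big 1))
    (%e. T e + TH (frame b e (par k)))" by simp
  from main_outputs[OF this, of "of_nat (F k)"] show ?thesis using assms(2)[of k] by (auto simp: rep3_def)
 qed
 thus ?thesis unfolding computable_nat_fun_def by blast
qed

theorem hard: "sharp_W1_hard Pr"
proof -
 obtain p1 R1 where 1: "PB R1" "ALL x k G. impl (Pb k) x p1 {inp k G} (%e. frame b e (par k)) (%e. R1 (E k G))"
  using front_query by blast
 obtain p2 R2 where 2: "PB R2" "ALL x k G. impl (Pb k) x p2 {frame_items Q (E k G)}
  (%its. pans k (its)) (%_. R2 (E k G))"
  using queries_run by (elim exE conjE) (rule that)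
 obtain pI TI where I: "!!P x. impl P x pI UNIV (frame_items Q) TI" "PB TI" by (rule PTE[OF PT_items]) blast
 obtain pV TV where V: "!!P x. impl P x pV UNIV (verdict N B) TV" "PB TV" by (rule PTE[OF PT_verdict]) blast
 obtain c d where cd: "!!v. TV v <= c * sz v ^ d" using V(2) unfolding PB_def by blast
 let ?Z = "%E. sz (frame_items Q E)"
 let ?Tot = "%E. R1 E + (1 + (TI E + R2 E) + 40) + c * (sz E + 4 * ?Z E) ^ d + 20 * sz E + 20"
 have "PB ?Tot"
  by (intro PB_add PB_mult PB_const PB_sz PB_power PT_size PT_items 1 2 I)
 then obtain c' d' where cd': "!!E. ?Tot E <= c' * sz E ^ d'" unfolding PB_def by blast
 \<comment> \<open>The frame has size \<open>length ?x + A k\<close>, and both numbers are positive,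
   so this is at most \<open>2 * A k * length ?x\<close>: a product as required of the time
   bound.\<close>
 define A where "A k = b ^ k + par k + MM k + 2 ^ (par k * par k) + 5" for k
 define f where "f k = c' * (2 * A k) ^ d'" for k
 let ?p = "Seq (Seq p1 (p_pair (seqs []) (Seq pI p2))) pV"
 have run: "EX t R K. oracle_run Pr (p_main ?p) (enc_nat k @ enc_graph G) (of_nat (num_cliques k G)) t R K &
   t <= f k * length (enc_nat k @ enc_graph G) ^ d' & (ALL k':K. k' <= par k)" if G: "G : input_graphs" for k G
 proof -
  let ?x = "enc_nat k @ enc_graph G"
  have "impl (Pb k) ?x (Seq pI p2) {E k G} (%e. pans k ((frame_items Q e)))
   (%e. TI e + R2 (E k G))"
   by (rule impl_comp[OF impl_sub[OF I(1)] 2(2)[rule_format]]) auto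
  from impl_pair[OF impl_sub[OF impl_id] this] have "impl (Pb k) ?x (p_pair (seqs []) (Seq pI p2)) {E k G}
   (%e. (e, pans k ((frame_items Q e))))
   (%e. 1 + (TI e + R2 (E k G)) + 40)"
   by simp
  from impl_comp[OF impl_comp[OF 1(2)[rule_format] this] V(1)]
  have im: "impl (Pb k) ?x ?p {inp k G} (%e. verdict N B (frame b e (par k),
    pans k ((frame_items Q (frame b e (par k))))))
   (%e. R1 (E k G) + (1 + (TI (frame b e (par k)) + R2 (E k G)) + 40) +
    TV (frame b e (par k), pans k ((frame_items Q (frame b e (par k))))))"
   by simp
  from main_correct[OF im verdict_correct[OF G]] obtain t R K where
   t: "oracle_run (Pb k) (p_main ?p) ?x (of_nat (num_cliques k G)) t R K"
    "t <= R1 (E k G) + (1 + (TI (E k G) + R2 (E k G)) + 40) + TV (E k G, answers k G) + 20 * length ?x + 20"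
   by blast
  from t(1) obtain s where s: "exec (Pb k) ?x (p_main ?p) (%_. 0) t R K s" "holds_rat s 0 (of_nat (num_cliques k G))"
   unfolding oracle_run_def by blast
  \<comment> \<open>The run used the oracle restricted to parameters up to \<open>par k\<close>. It
    is a run with the full oracle as well, and the restriction bounds the queried
    parameters.\<close>
  from exec_restrict[OF s(1)] have o: "oracle_run Pr (p_main ?p) ?x (of_nat (num_cliques k G)) t R K" "K <= {..par k}"
   unfolding oracle_run_def using s(2) by blast+
  have "sz (answers k G) <= 4 * ?Z (E k G)"
  proof -
   have "sz (map (%it. (rev (map (ans k) (fst it)), rev (map (ans k) (snd it)))) its) <= 4 * sz its"
    for its :: "((bool * bool list) list * (bool * bool list) list) list"
   proof (induction its)
    case (Cons it its)
    have "sz (rev (map (ans k) (fst it))) <= 4 * sz (fst it)" "sz (rev (map (ans k) (snd it))) <= 4 * sz (snd it)"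
     by (rule sz_answers)+
    thus ?case using Cons by (simp add: sz_prod_def[of it])
   qed simp
   thus ?thesis by (simp add: sz_rev)
  qed
  hence "TV (E k G, answers k G) <= c * (sz (E k G) + 4 * ?Z (E k G)) ^ d"
  proof -
   assume "sz (answers k G) <= 4 * ?Z (E k G)"
   hence "sz (E k G, answers k G) <= sz (E k G) + 4 * ?Z (E k G)" unfolding sz_Pair by (rule add_left_mono)
   hence "sz (E k G, answers k G) ^ d <= (sz (E k G) + 4 * ?Z (E k G)) ^ d" by (rule power_mono) simp
   thus ?thesis using cd[of "(E k G, answers k G)"] mult_le_mono2 order_trans by blast
  qed
  moreover
  have len: "sz (rev ?x) = 1 + length ?x"
  proof -
   have "sz ys = 1 + length ys" for ys :: "bool list" by (induction ys) auto
   thus ?thesis by (simp only: length_rev)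
  qed
  have szE: "sz (E k G) = length ?x + A k + 1 - 1"
   using len by (simp add: frame_def frame_simps(1) A_def qof_def lead_enc_nat)
  moreover have "length ?x <= sz (E k G)" using szE by simp
  ultimately have "t <= ?Tot (E k G)" using t(2) by linarith
  also have "... <= c' * sz (E k G) ^ d'" by (rule cd')
  also have "... <= c' * (2 * A k * length ?x) ^ d'"
  proof (intro mult_le_mono2 power_mono)
   have x: "1 <= length ?x" "1 <= A k" by (simp_all add: A_def)
   have "l + a + 1 - 1 <= 2 * a * l" if "1 <= l" "1 <= a" for l a :: nat
   proof -
    have "l * 1 + 1 * a <= l * a + l * a" using that by (intro add_mono mult_le_mono) simp_all
    thus ?thesis by (simp add: algebra_simps)
   qed
   from this[OF x] show "sz (E k G) <= 2 * A k * length ?x" unfolding szE .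
  qed simp
  also have "... = f k * length ?x ^ d'" by (simp only: f_def power_mult_distrib mult.assoc)
  finally show ?thesis using o by blast
 qed
 have q: "qof b (rev (enc_nat k)) = b ^ k" for k using lead_enc_nat[of k "[]"] by (simp add: qof_def)
 have "computable_nat_fun f"
 proof (rule computable_frame)
  show "PT (%E :: frame. c' * (2 * (snd (fst (fst (fst E))) + snd (fst (fst E)) + snd (fst E) + snd E + 5)) ^ d')"
   by (intro PTs PT_power)
 qed (simp add: frame_def q f_def A_def)
 moreover have "computable_nat_fun par"
 proof (rule computable_frame)
  show "PT (%E :: frame. snd (fst (fst E)))" by (intro PTs)
 qed (simp add: frame_def)
 ultimately show ?thesis
  unfolding sharp_W1_hard_def parameterized_Turing_reducible_def
  using run by (intro exI[of _ "p_main ?p"] exI[of _ f] exI[of _ par] exI[of _ d']) (auto simp: clique_problem_def)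
qed

end

section \<open>Deciding satisfiability with a fast algorithm for one \<open>k\<close>\<close>

text \<open>The constants wired into the algorithm: \<open>k\<close>, the block size
  \<open>q\<close>, the edges of a base graph, the cap \<open>M\<close>, the divisor
  \<open>rho\<close> that governs the number of leaves, and the thresholds of the
  sparsification.\<close>

type_synonym prm = "(nat * nat) * (nat * nat) list * nat * nat * nat * nat * nat"

definition zT :: "prm * bool list => (lit * lit * lit) list" where "zT z = triples (parse (rev (snd z)))"
definition zL :: "prm * bool list => nat" where "zL z = length (lits (zT z))"
definition zv :: "prm * bool list => nat list" where "zv z = dedup (map snd (lits (zT z)))"

abbreviation "pk z \<equiv> fst (fst (fst z))"
abbreviation "pq z \<equiv> snd (fst (fst z))"
abbreviation "phl z \<equiv> fst (snd (fst z))"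
abbreviation "pM z \<equiv> fst (snd (snd (fst z)))"
abbreviation "prho z \<equiv> fst (snd (snd (snd (fst z))))"
abbreviation "pa z \<equiv> fst (snd (snd (snd (snd (fst z)))))"
abbreviation "pb z \<equiv> fst (snd (snd (snd (snd (snd (fst z))))))"
abbreviation "pc z \<equiv> snd (snd (snd (snd (snd (snd (fst z))))))"

text \<open>\<open>q\<close> groups of \<open>zg\<close> variables and \<open>q\<close> groups of
  \<open>zh\<close> clauses suffice, the \<open>+ 1\<close> replacing rounding up. A label is a
  subset of the numbers below \<open>zl\<close>, with room for one bit per variable and two per
  clause. There are at most \<open>2 ^ zm\<close> leaves.\<close>

definition zg :: "prm * bool list => nat" where "zg z = length (zv z) div pq z + 1"
definition zh :: "prm * bool list => nat" where "zh z = ((1 + pa z + pc z) * zL z) div pq z + 1"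
definition zl :: "prm * bool list => nat" where "zl z = zg z + 2 * zh z"
definition zm :: "prm * bool list => nat" where "zm z = zL z div prho z + 1"

lemma PT_zT: "PT z ==> PT (%e. zT (z e))"
 unfolding zT_def by (intro PTs PT_triples PT_parse)

lemma PT_zL: "PT z ==> PT (%e. zL (z e))"
 unfolding zL_def by (intro PT_length PT_lits PT_zT)

lemma PT_zv: "PT z ==> PT (%e. zv (z e))"
 unfolding zv_def by (intro PTs PT_dedup PT_lits PT_zT)

lemma PT_zg: "PT z ==> PT (%e. zg (z e))"
 unfolding zg_def by (intro PTs PT_zv)

lemma PT_zh: "PT z ==> PT (%e. zh (z e))"
 unfolding zh_def by (intro PTs PT_zL)

lemma PT_zl: "PT z ==> PT (%e. zl (z e))"
 unfolding zl_def by (intro PTs PT_zg PT_zh)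

lemma PT_zm: "PT z ==> PT (%e. zm (z e))"
 unfolding zm_def by (intro PTs PT_zL)

type_synonym sst = "((prm * bool list) * nat) * nat"

definition sst :: "prm * bool list => sst" where "sst z = ((z, 2 ^ zm z), 2 ^ zl z)"

definition leaves :: "sst => lit state list" where
 "leaves S = (let z = fst (fst S) in spars (snd (fst S)) (4 * (pa z + pb z) * zL z + 1) (pa z) (pb z) (pc z) (zT z))"

definition leaf_items :: "(sat_env, nat list) queries => sst => (bool * bool list) list list" where
 "leaf_items Q S = (let z = fst (fst S) in
  map (%s. Q (pM z) (pk z) (pq z) (phl z) ((zv z, leaf_clauses (zT z) s), (zg z, zh z)) (psubs (snd S) [0..<zl z]) [])
   (leaves S))"

abbreviation "lans Q g S \<equiv> rev (map (%it. rev (map (%w. (fst w, g (snd w))) it)) (leaf_items Q S))"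

definition sat_final :: "nat => sst * (bool * big3) list list => big3" where
 "sat_final c w = (if EX a:set (snd w).
   ~ (nob (fst (sum_ans 1 (c + pk (fst (fst (fst w))) * (snd (fst w) + 1)) a)) <= nob (snd (sum_ans 1 (c + pk (fst (fst (fst w))) * (snd (fst w) + 1)) a)) &
     nob (snd (sum_ans 1 (c + pk (fst (fst (fst w))) * (snd (fst w) + 1)) a)) <= nob (fst (sum_ans 1 (c + pk (fst (fst (fst w))) * (snd (fst w) + 1)) a)))
  then (Big 1, Big 0, Big 1) else (Big 0, Big 0, Big 1))"

lemma PT_sat_final: "PT (sat_final c)"
proof -
 have "PT (%w. sat_final c w)"
  unfolding sat_final_def
  by (intro PTs PT_ble PT_sum_ans)
 thus ?thesis by simp
qed

lemma PT_leaf_items: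
 assumes "PTQ Q"
 shows "PT (leaf_items Q)"
proof -
 have "PT (%S. leaf_items Q S)"
  unfolding leaf_items_def leaves_def Let_def
  by (intro PTs PT_queries[OF assms] PT_leaf_clauses PT_psubs PT_spars PT_zT PT_zL PT_zv PT_zg PT_zh PT_zl)
 thus ?thesis by simp
qed

lemma div_cover: fixes n q :: nat assumes "0 < q" shows "n < q * (n div q + 1)"
proof -
 have "q * (n div q) + n mod q = n" by (rule mult_div_mod_eq)
 thus ?thesis unfolding distrib_left mult_1_right using mod_less_divisor[OF assms, of n] by linarith
qed

text \<open>The factor of the base graph is nonzero, so a leaf is satisfiable exactly if its signed
  sum of answers does not vanish, and the formula is satisfiable if some leaf is.\<close>

lemma sat_correct:
 assumes F: "three_cnf F"
  and th: "0 < a" "0 < b" "0 < c'" "1 < y"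
   "1 / y ^ (2 * (a + b)) + 1 / y ^ (2 * (a + b) * a) <= 1"
   "1 / y ^ 2 + 1 / y ^ (2 * (a + b) * b) <= 1" "1 / y ^ (2 * (a + b)) + 1 / y ^ c' <= 1"
   "y ^ (4 * (a + b)) = 2 powr (1 / real rho)" "0 < rho"
  and z: "z = (((k, q), hl, M0, rho, a, b, c'), rev (enc_cnf F))" "S = sst z"
  and k: "2 * q <= k" "0 < q" "good_hl k q hl" "2 ^ (q * q) <= M0" "2 ^ k <= M0" "altsum \<Phi> k q (hl_edges hl) ~= 0"
  and Q: "qspec mem \<Phi> satCp Q" "ALL V y v. mem k V y v --> sum_form \<Phi> V v & rep3 (ans y) v"
  and c: "\<Phi> ` graphs <= of_nat ` {0..c}"
 shows "!!it w. it : set (leaf_items Q S) ==> w : set it ==> EX v. mem k (k * (2 ^ zl z + 1)) (snd w) v"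
  "sat_final c (S, lans Q ans S) =
   (if satisfiable F then (Big 1, Big 0, Big 1) else (Big 0, Big 0, Big 1))"
proof -
 let ?T = "triples F"
 interpret sp: sparsify a b c' ?T y
  by unfold_locales (rule th(1) th(2) th(3) th(4) th(5) th(6) th(7) | erule triples_sym)+
 have zT: "zT z = ?T" by (simp add: zT_def z parse_cnf)
 have nL: "zL z = card (set (lits ?T))" unfolding zL_def zT unfolding lits_def length_dedup dedup(1) ..
 have lv: "leaves S = spars (2 ^ zm z) (4 * (a + b) * zL z + 1) a b c' ?T"
  by (simp add: leaves_def z(2) sst_def Let_def zT) (simp add: z(1))
 have M: "y ^ (4 * (a + b) * card (set (lits ?T))) <= real (2 ^ zm z)"
 proof -
  have "y ^ (4 * (a + b) * card (set (lits ?T))) = (2 powr (1 / real rho)) ^ zL z" by (simp only: power_mult[of y "4 * (a + b)" "card (set (lits (triples F)))"] th(8) nL)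
  also have "... = 2 powr (real (zL z) / real rho)" by (simp add: powr_realpow[symmetric] powr_powr)
  also have "... <= 2 powr real (zm z)"
  proof (intro powr_mono)
   have "zm z = zL z div rho + 1" by (simp add: zm_def z(1))
   hence "zL z < rho * zm z" using div_cover[OF th(9), of "zL z"] by simp
   hence "real (zL z) <= real (rho * zm z)" by (simp only: of_nat_le_iff less_imp_le)
   thus "real (zL z) / real rho <= real (zm z)" using th(9) by (simp add: divide_le_eq mult.commute)
  qed simp
  finally show ?thesis by (simp add: powr_realpow)
 qed
 note SP = sp.spars_correct[OF M, of "4 * (a + b) * zL z + 1", folded lv, unfolded nL, simplified]
 let ?xs = "psubs (2 ^ zl z) [0..<zl z]"
 have xs: "distinct ?xs" "set ` set ?xs = Pow (set [0..<zl z])" "inj_on set (set ?xs)"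
  using psubs_props[of "[0..<zl z]" "2 ^ zl z"] by auto
 have lx: "length ?xs = 2 ^ zl z"
  using distinct_card[OF xs(1)] card_image[OF xs(3)] xs(2) by (simp add: card_Pow)
 define env where "env s = ((zv z, leaf_clauses ?T s), (zg z, zh z))" for s
 define it where "it s = Q M0 k q hl (env s) ?xs []" for s
 have items: "leaf_items Q S = map it (leaves S)"
  by (simp add: leaf_items_def z(2) sst_def Let_def zT it_def env_def) (simp add: z(1))
 have "ALL s. EX f. (ALL w:set (it s). mem k (k * (2 ^ zl z + 1)) (snd w) (f w)) &
   (\<Sum>w\<leftarrow>it s. sg (fst w) * f w) = altsum \<Phi> k q (hl_edges hl) * of_nat (card (bicliques k q ?xs [] (satCp (env s))))"
  using Q(1)[unfolded qspec_def, rule_format, OF k(1,3,4,5) xs(1)] unfolding it_def lx by blast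
 from choice[OF this] obtain f where f0: "ALL s. (ALL w:set (it s). mem k (k * (2 ^ zl z + 1)) (snd w) (f s w)) &
   (\<Sum>w\<leftarrow>it s. sg (fst w) * f s w) = altsum \<Phi> k q (hl_edges hl) * of_nat (card (bicliques k q ?xs [] (satCp (env s))))"
  by blast
 have f: "!!s w. w : set (it s) ==> mem k (k * (2 ^ zl z + 1)) (snd w) (f s w)"
  "!!s. (\<Sum>w\<leftarrow>it s. sg (fst w) * f s w) = altsum \<Phi> k q (hl_edges hl) * of_nat (card (bicliques k q ?xs [] (satCp (env s))))"
  using f0 by blast+
 show "EX v. mem k (k * (2 ^ zl z + 1)) (snd w) v" if i: "i : set (leaf_items Q S)" "w : set i" for i w
 proof -
  obtain s where "i = it s" using i(1) unfolding items set_map by blast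
  thus ?thesis using f(1) i(2) by blast
 qed
 let ?l = "c + k * (2 ^ zl z + 1)"
 have sum: "ival (sum_ans 1 ?l (rev (map (%w. (fst w, ans (snd w))) (it s)))) =
   altsum \<Phi> k q (hl_edges hl) * of_nat (card (bicliques k q ?xs [] (satCp (env s))))" for s
 proof -
  have "ival (sum_ans 1 ?l (rev (map (%w. (fst w, (%w. ans (snd w)) w)) (it s)))) = of_nat 1 * (\<Sum>w\<leftarrow>it s. sg (fst w) * f s w)"
  proof (rule sum_answers)
   fix w assume "w : set (it s)"
   hence sf: "sum_form \<Phi> (k * (2 ^ zl z + 1)) (f s w)" "rep3 (ans (snd w)) (f s w)" using Q(2) f(1) by blast+
   have v: "\<exists>m\<le>c. \<Phi> G = of_nat m" if "G : graphs" for G using c that by auto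
   have "of_nat 1 * \<Phi> G : \<int>" "\<bar>of_nat 1 * \<Phi> G\<bar> <= of_nat c" if G: "G : graphs" for G
    using v[OF G] by auto
   thus "rep3 (ans (snd w)) (f s w) & of_nat 1 * f s w : \<int> & \<bar>of_nat 1 * f s w\<bar> < 2 ^ (?l + 1)"
    using sum_form_int[OF sf(1), of 1] sum_form_abs(2)[OF sf(1), of 1 c] sf(2) by blast
  qed
  thus ?thesis using f(2) by simp
 qed
 have bic: "card (bicliques k q ?xs [] (satCp (env s))) ~= 0 \<longleftrightarrow> (EX al. sat_cl (holds al) (leaf_clauses ?T s))"
  if s: "s : set (leaves S)" for s
  unfolding env_def
 proof (rule sat_bicliques)
  show "distinct (zv z)" unfolding zv_def by (rule dedup)
  show "snd ` set (concat (leaf_clauses ?T s)) <= set (zv z)"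
   unfolding zv_def dedup zT using SP(4)[OF s] by auto
  have "zg z = length (zv z) div q + 1" by (simp add: zg_def z(1))
  thus "length (zv z) <= q * zg z" using div_cover[OF k(2), of "length (zv z)"] by simp
  show "length (leaf_clauses ?T s) <= q * zh z"
  proof -
   have "length (leaf_clauses ?T s) <= (1 + a + c') * zL z" unfolding nL using SP(2)[OF s] by simp
   moreover have "zh z = (1 + a + c') * zL z div q + 1" by (simp add: zh_def z(1))
   hence "(1 + a + c') * zL z <= q * zh z" using div_cover[OF k(2), of "(1 + a + c') * zL z"] by simp
   ultimately show ?thesis by (rule_tac le_trans)
  qed
  show "length C <= 3" if "C : set (leaf_clauses ?T s)" for C using SP(5)[OF s that] .
 qed (use k xs in "auto simp: zl_def")
 have nz: "(~ (nob (fst a) <= nob (snd a) & nob (snd a) <= nob (fst a))) = (ival a ~= 0)" for a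
  by (auto simp: ival_def)
 have "satisfiable F \<longleftrightarrow> (EX al. sat_T (holds al) ?T)" by (rule triples_sat[OF F])
 also have "... \<longleftrightarrow> (EX al. EX s:set (leaves S). sat_cl (holds al) (leaf_clauses ?T s))" using SP(3) by blast
 also have "... \<longleftrightarrow> (EX s:set (leaves S). card (bicliques k q ?xs [] (satCp (env s))) ~= 0)" using bic by blast
 also have "... \<longleftrightarrow> (EX s:set (leaves S). ival (sum_ans 1 ?l (rev (map (%w. (fst w, ans (snd w))) (it s)))) ~= 0)"
  unfolding sum using k(6) by simp
 also have "... \<longleftrightarrow> (EX a:set (lans Q ans S). ival (sum_ans 1 ?l a) ~= 0)"
  unfolding items by simp
 finally have s: "satisfiable F = ..." .
 have l: "c + pk (fst (fst (fst (S, w)))) * (snd (fst (S, w)) + 1) = ?l" for w :: "(bool * big3) list list"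
  by (simp add: z sst_def)
 show "sat_final c (S, lans Q ans S) =
   (if satisfiable F then (Big 1, Big 0, Big 1) else (Big 0, Big 0, Big 1))"
  unfolding sat_final_def l nz s by (simp only: snd_conv)
qed

text \<open>The order of the quantifiers is essential. The polynomial \<open>G\<close> is fixed
  before the algorithm \<open>prg\<close> and the constants \<pi>: its degree determines
  \<open>rho\<close>, the thresholds and \<delta>, none of which may depend on the algorithm. Only
  the additive constant \<open>n0\<close> may.\<close>

lemma eth_run:
 fixes Q :: "(sat_env, nat list) queries"
 assumes "PTQ Q"
 shows "EX G. PB G & (\<forall>prg \<pi>. EX p n0. ALL x e tu.
  (ALL it:set (leaf_items Q (sst (\<pi>, e))). ALL w:set it. EX v t. outputs prg (snd w) v t & t <= tu) -->
  impl {} x p {e} (%e. sat_final c (sst (\<pi>, e), lans Q (sim_val prg) (sst (\<pi>, e))))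
   (%e. n0 + G (sst (\<pi>, e)) * (tu + 1)))"
proof -
 have 1: "PI (%z. 2 ^ zm z :: nat)" by (rule PI_comp[OF PI_power]) (intro PT_zm PT_id)
 have 2: "PI (%z :: (prm * bool list) * nat. 2 ^ zl (fst z) :: nat)" by (rule PI_comp[OF PI_power]) (intro PTs PT_zl)
 have "AC sst" using AC_step[OF AC_step[OF AC_id 1] 2] by (simp add: sst_def[abs_def])
 then obtain pA TA where A: "!!P x. impl P x pA UNIV sst (%z. TA (sst z))" "PB TA" by (rule ACE) blast
 note PTi = PT_leaf_items[OF assms]
 obtain pI TI where I: "!!P x. impl P x pI UNIV (leaf_items Q) TI" "PB TI" by (rule PTE[OF PTi]) blast
 obtain pV TV where V: "!!P x. impl P x pV UNIV (sat_final c) TV" "PB TV" by (rule PTE[OF PT_sat_final]) blast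
 obtain cV dV where cd: "!!v. TV v <= cV * sz v ^ dV" using V(2) unfolding PB_def by blast
 obtain pm where pm: "qmap_prog pm"
  using impl_qmap by blast
 let ?Z = "%S. sz (leaf_items Q S)"
 define H where "H S = 300 + ?Z S * (600 + ?Z S * (8 * ?Z S + 470))" for S
 define G where "G S = TA S + (TI S + H S + 50) + cV * (sz S + 4 * ?Z S) ^ dV" for S
 have "PB H" unfolding H_def by (intro PB_add PB_mult PB_const PT_size PTi)
 hence "PB G" unfolding G_def by (intro PB_add PB_mult PB_const PB_power PB_sz PT_size PTi A I)
 moreover have "EX p n0. ALL x e tu.
  (ALL it:set (leaf_items Q (sst (\<pi>, e))). ALL w:set it. EX v t. outputs prg (snd w) v t & t <= tu) -->
  impl {} x p {e} (%e. sat_final c (sst (\<pi>, e), lans Q (sim_val prg) (sst (\<pi>, e))))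
   (%e. n0 + G (sst (\<pi>, e)) * (tu + 1))" for prg \<pi>
 proof -
  obtain pC nC where C: "ALL P x. impl P x pC (UNIV :: bool list set) (%_. \<pi>) (%_. nC)" using impl_const' by blast
  let ?p = "Seq (Seq (Seq (p_pair pC (seqs [])) pA) (p_pair (seqs []) (Seq pI (p_rmap (pm (p_sim prg)))))) pV"
  have "impl {} x ?p {e} (%e. sat_final c (sst (\<pi>, e), lans Q (sim_val prg) (sst (\<pi>, e))))
   (%e. (nC + 41) + G (sst (\<pi>, e)) * (tu + 1))"
   if h: "ALL it:set (leaf_items Q (sst (\<pi>, e))). ALL w:set it. EX v t. outputs prg (snd w) v t & t <= tu" for x e tu
  proof -
   let ?S = "sst (\<pi>, e)"
   let ?its = "leaf_items Q ?S"
   let ?D = "{y. EX v t. outputs prg y v t}" and ?T = "%y. 20 * sim_time prg y + 8 * length y + 50"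
   let ?a = "%it. rev (map (%w. (fst w, sim_val prg (snd w))) it)"
   let ?TT = "%qs :: (bool * bool list) list. 300 + (\<Sum>z\<leftarrow>qs. ?T (snd z) + 400)"
   have q: "impl {} x (pm (p_sim prg)) {qs :: (bool * bool list) list. snd ` set qs <= ?D} ?a ?TT"
    using pm[unfolded qmap_prog_def, rule_format, OF impl_sim] .
   have dom: "set ?its <= {qs. snd ` set qs <= ?D}" using h by blast
   have TT: "?TT qs + 300 <= (600 + ?Z ?S * (8 * ?Z ?S + 470)) * (tu + 1)" if it: "qs : set ?its" for qs
   proof -
    have s: "sz qs <= ?Z ?S" by (rule sz_mem[OF it])
    hence l: "length qs <= ?Z ?S" using length_le_sz[of qs] by simp
    have "?T (snd w) + 400 <= (8 * ?Z ?S + 470) * (tu + 1)" if w: "w : set qs" for w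
    proof -
     have "sim_time prg (snd w) <= tu" using h it w outputs_sim(2) by blast
     moreover have "length (snd w) <= ?Z ?S"
      using sz_mem[OF w] s length_le_sz[of "snd w"] by (simp add: sz_prod_def)
     ultimately have "?T (snd w) + 400 <= 20 * tu + 8 * ?Z ?S + 450" by linarith
     also have "... <= (8 * ?Z ?S + 470) * (tu + 1)" by (simp add: algebra_simps)
     finally show ?thesis .
    qed
    from sum_list_length_bound[of qs "%w. ?T (snd w) + 400", OF this l]
    have "?TT qs + 300 <= 600 + ?Z ?S * ((8 * ?Z ?S + 470) * (tu + 1))" by simp
    also have "... <= (600 + ?Z ?S * (8 * ?Z ?S + 470)) * (tu + 1)" by (simp add: algebra_simps)
    finally show ?thesis .
   qed
   have "300 + (\<Sum>qs\<leftarrow>?its. ?TT qs + 300) <= 300 + ?Z ?S * ((600 + ?Z ?S * (8 * ?Z ?S + 470)) * (tu + 1))"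
    using sum_list_length_bound[of ?its "%qs. ?TT qs + 300", OF TT] length_le_sz[of ?its] by simp
   also have "... <= H ?S * (tu + 1)" unfolding H_def by (simp add: algebra_simps)
   finally have Hb: "300 + (\<Sum>qs\<leftarrow>?its. ?TT qs + 300) <= H ?S * (tu + 1)" .
   have m: "impl {} x (p_rmap (pm (p_sim prg))) {?its} (%its. rev (map ?a its)) (%_. H ?S * (tu + 1))"
    by (rule impl_mono[OF impl_rmap[OF q]]) (use dom Hb in auto)
   have m2: "impl {} x (Seq pI (p_rmap (pm (p_sim prg)))) {?S} (%S. rev (map ?a (leaf_items Q S))) (%S. TI S + H ?S * (tu + 1))"
    by (rule impl_comp[OF impl_sub[OF I(1)] m]) auto
   have m3: "impl {} x (p_pair (seqs []) (Seq pI (p_rmap (pm (p_sim prg))))) {?S} (%S. (S, rev (map ?a (leaf_items Q S))))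
     (%S. 1 + (TI S + H ?S * (tu + 1)) + 40)"
    by (rule impl_pair[OF impl_sub[OF impl_id] m2]) simp
   have "impl {} x (Seq (p_pair pC (seqs [])) pA) UNIV (%e. sst (\<pi>, e)) (%e. (nC + 1 + 40) + TA (sst (\<pi>, e)))"
    by (rule impl_comp[OF impl_pair[OF C[rule_format] impl_id] A(1)]) simp
   hence m1: "impl {} x (Seq (p_pair pC (seqs [])) pA) {e} (%e. sst (\<pi>, e)) (%e. (nC + 1 + 40) + TA (sst (\<pi>, e)))"
    by (rule impl_sub) simp
   have "sz (rev (map ?a ?its)) <= 4 * ?Z ?S"
   proof -
    have "sz (map ?a its) <= 4 * sz its" for its :: "(bool * bool list) list list"
    proof (induction its)
     case (Cons it its)
     thus ?case using sz_answers[of "%w. sim_val prg (snd w)" it] by simp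
    qed simp
    thus ?thesis by (simp add: sz_rev)
   qed
   hence "sz (?S, rev (map ?a ?its)) <= sz ?S + 4 * ?Z ?S" by simp
   hence "sz (?S, rev (map ?a ?its)) ^ dV <= (sz ?S + 4 * ?Z ?S) ^ dV" by (rule power_mono) simp
   hence TVb: "TV (?S, rev (map ?a ?its)) <= cV * (sz ?S + 4 * ?Z ?S) ^ dV"
    using cd mult_le_mono2 order_trans by blast
   have fin: "(nC + 1 + 40 + ta + (1 + (ti + hh * (tu + 1)) + 40)) + tv <= (nC + 41) + (ta + (ti + hh + 50) + u) * (tu + 1)"
    if "tv <= u" for ta ti hh tv u :: nat
    using that by (simp add: algebra_simps)
   show ?thesis
    by (rule impl_mono[OF impl_comp[OF impl_comp[OF m1 m3] V(1)]]) (use fin[OF TVb] in "auto simp: G_def")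
  qed
  thus ?thesis by (intro exI[of _ ?p] exI[of _ "nC + 41"]) blast
 qed
 ultimately show ?thesis by (intro exI[of _ G]) blast
qed

lemma size_product:
 fixes l m x p :: nat
 assumes "1 <= l" "1 <= m" "1 <= x"
 shows "p + (l + 1) + (m + 1) + (x + 1) <= (p + 6) * (l * m * x)"
proof -
 have "l * 1 * 1 <= l * m * x" "1 * m * 1 <= l * m * x" "1 * 1 * x <= l * m * x"
  by (intro mult_le_mono; use assms in simp)+
 hence "l <= l * m * x" "m <= l * m * x" "x <= l * m * x" by (simp_all only: mult_1 mult_1_right)
 moreover have "1 <= l * m * x" using assms by simp
 moreover from this have "p * 1 <= p * (l * m * x)" by (intro mult_le_mono2)
 moreover have "(p + 6) * (l * m * x) = p * (l * m * x) + 6 * (l * m * x)" by (rule add_mult_distrib)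
 ultimately show ?thesis by linarith
qed

text \<open>With padding there are at most \<open>n + 3\<close> variables and twice as many
  literals. This makes the exponents \<open>n / rho\<close> and \<open>n / q\<close> up to constant
  factors and summands.\<close>

lemma bounds_M_X:
 assumes z: "z = (((k, q), hl, M0, rho, a, b, c'), rev (enc_cnf F))" and pos: "0 < rho" "0 < q" and n: "n = card (cnf_vars F)"
 shows "real (2 ^ zm z) <= 2 powr ((2 * real n + 6) / real rho + 1)"
  "real (2 ^ zl z) <= 2 powr ((real n + 3) * (5 + 4 * real a + 4 * real c') / real q + 3)"
proof -
 have zT: "zT z = triples F" by (simp add: zT_def z parse_cnf)
 have L: "zL z <= 2 * (n + 3)"
  unfolding zL_def zT n using card_lits[of F] unfolding lits_def length_dedup dedup(1) .
 have L': "real (zL z) <= 2 * real n + 6"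
 proof -
  have "real (zL z) <= real (2 * (n + 3))" using L by (simp only: of_nat_le_iff)
  thus ?thesis by simp
 qed
 have V: "length (zv z) <= n + 3"
  unfolding zv_def length_dedup zT n set_map using card_lit_vars[of F] .
 have dv: "real (m div j) <= real m / real j" for m j :: nat
  by (metis floor_divide_of_nat_eq of_int_floor_le of_int_of_nat_eq)
 have "real (zm z) <= real (zL z) / real rho + 1" using dv[of "zL z" rho] by (simp add: zm_def z)
 also have "... <= (2 * real n + 6) / real rho + 1"
  using L' by (intro add_right_mono divide_right_mono) simp_all
 finally have "2 powr real (zm z) <= 2 powr ((2 * real n + 6) / real rho + 1)" by (intro powr_mono) simp_all
 thus "real (2 ^ zm z) <= 2 powr ((2 * real n + 6) / real rho + 1)" by (simp add: powr_realpow)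
 have g: "real (zg z) <= (real n + 3) / real q + 1"
 proof -
  have "real (zg z) <= real (length (zv z)) / real q + 1" using dv[of "length (zv z)" q] by (simp add: zg_def z)
  also have "... <= (real n + 3) / real q + 1" using V by (intro add_right_mono divide_right_mono) simp_all
  finally show ?thesis .
 qed
 have h: "real (zh z) <= (1 + real a + real c') * (2 * (real n + 3)) / real q + 1"
 proof -
  have "zh z = (1 + a + c') * zL z div q + 1" by (simp add: zh_def z)
  hence "real (zh z) <= real ((1 + a + c') * zL z) / real q + 1" using dv[of "(1 + a + c') * zL z" q] by simp
  also have "... <= (1 + real a + real c') * (2 * (real n + 3)) / real q + 1"
  proof (intro add_right_mono divide_right_mono)
   have "real (zL z) <= 2 * (real n + 3)" using L' by simp
   hence "(1 + real a + real c') * real (zL z) <= (1 + real a + real c') * (2 * (real n + 3))" by (intro mult_left_mono) simp_all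
   thus "real ((1 + a + c') * zL z) <= (1 + real a + real c') * (2 * (real n + 3))"
    by (simp only: of_nat_mult of_nat_add of_nat_1)
  qed simp
  finally show ?thesis .
 qed
 have "real (zl z) = real (zg z) + 2 * real (zh z)" by (simp add: zl_def)
 also have "... <= ((real n + 3) / real q + 1) + 2 * ((1 + real a + real c') * (2 * (real n + 3)) / real q + 1)"
  by (intro add_mono g mult_left_mono h) simp
 also have "... = (real n + 3) * (5 + 4 * real a + 4 * real c') / real q + 3" using pos by (simp add: field_simps)
 finally have "2 powr real (zl z) <= 2 powr ((real n + 3) * (5 + 4 * real a + 4 * real c') / real q + 3)" by (intro powr_mono) simp_all
 thus "real (2 ^ zl z) <= 2 powr ((real n + 3) * (5 + 4 * real a + 4 * real c') / real q + 3)" by (simp add: powr_realpow)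
qed

text \<open>The largest power of \<open>p\<close> that leaves room for \<open>p\<close> blocks is
  smaller than \<open>k\<close> by a factor less than \<open>p ^ 2\<close>, a constant that depends
  on \<open>c\<close> only.\<close>

lemma block_size:
 fixes p k :: nat
 assumes "2 <= p" "p <= k"
 obtains e where "p * p ^ e <= k" "k < p ^ 2 * p ^ e"
proof -
 obtain m where m: "p ^ m <= k" "k < p ^ (m + 1)" using ex_power_ivl1[of p k] assms by auto
 have "m ~= 0" using m(2) assms(2) by (intro notI) simp
 then obtain e where "m = Suc e" by (cases m) auto
 thus ?thesis using m by (intro that[of e]) (simp_all add: power2_eq_square mult.assoc)
qed

lemma exists_base_list:
 assumes iso: "iso_invariant \<Phi>" and mono: "edge_monotone \<Phi>" and nt: "nontrivial_on \<Phi> k"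
  and c: "\<Phi> ` graphs <= of_nat ` {0..c}" and p: "prime p" "3 <= p" "c < p" and q: "q = p ^ e" "p * q <= k"
 obtains hl where "good_hl k q hl" "altsum \<Phi> k q (hl_edges hl) ~= 0"
proof -
 have v: "\<exists>m\<le>c. \<Phi> G = of_nat m" if "G : graphs" for G using c that by auto
 have 1: "of_nat 1 * \<Phi> G : \<int>" if "G : graphs" for G using v[OF that] by auto
 have 2: "\<bar>of_nat 1 * \<Phi> G - of_nat 1 * \<Phi> G'\<bar> < of_nat p" if gg: "G : graphs" "G' : graphs" for G G'
 proof -
  obtain m where m1: "m <= c" "\<Phi> G = of_nat m" using v[OF gg(1)] by blast
  obtain m' where m2: "m' <= c" "\<Phi> G' = of_nat m'" using v[OF gg(2)] by blast
  note m = m1 m2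
  have "(of_nat m :: rat) <= of_nat c" "(of_nat m' :: rat) <= of_nat c" "(of_nat c :: rat) < of_nat p"
   "(0 :: rat) <= of_nat m" "(0 :: rat) <= of_nat m'"
   using m p(3) by (simp_all only: of_nat_le_iff of_nat_less_iff of_nat_0_le_iff)
  thus ?thesis unfolding m of_nat_1 mult_1 by linarith
 qed
 have "0 < q" using p q by simp
 hence "p <= k div q" using q by (simp add: less_eq_div_iff_mult_less_eq)
 from exists_base[OF iso mono nt _ 1 p(1,2) 2 q(1) this]
 obtain H where H: "H <= pairs {..<k}" "H Int biedges q = {}" "altsum \<Phi> k q H ~= 0" by auto
 obtain C where C: "C <= {(i, j). i < j & j < k & ~ (i < q & q <= j & j < 2 * q)}"
  "(%(i, j). {i, j}) ` C = H" by (rule exists_hl[OF H(1,2)])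
 have "C <= {..<k} \<times> {..<k}" using C(1) by auto
 hence "finite C" by (rule finite_subset) simp
 then obtain hl where hl: "set hl = C" using finite_list by blast
 show ?thesis
 proof (rule that)
  show "good_hl k q hl" using C(1) unfolding good_hl_def hl by auto
  show "altsum \<Phi> k q (hl_edges hl) ~= 0" using H(3) C(2) by (simp add: hl_edges_def hl)
 qed
qed

text \<open>The budget \<open>eps * n\<close> is split: one half for the number of leaves, one
  quarter for the polynomial dependence on the number of labels, and one quarter for the time of the
  queries. The rest does not depend on \<open>n\<close> with its factor and is a constant.\<close>

lemma exponent_bound:
 fixes eps dlt :: real and D q k p rho w :: nat and n :: real
 assumes "0 < eps" "0 < rho" "4 * real D <= eps * real rho" "0 < w" "0 < q" "k < p ^ 2 * q"
  and "4 * real D * real w * (real p)\<^sup>2 <= eps * real k" "0 < dlt" "dlt * (4 * real w * (real p)\<^sup>2) <= eps" "0 <= n"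
 shows "real D * ((2 * n + 6) / real rho + 1) + (real D + dlt * real k) * ((n + 3) * real w / real q + 3) <=
  eps * n + (real D * (6 / real rho + 1) + (real D + dlt * real k) * (3 * real w / real q + 3))"
proof -
 have kq: "real k <= (real p)\<^sup>2 * real q"
 proof -
  have "real k <= real (p ^ 2 * q)" using assms(6) by (simp only: of_nat_le_iff)
  thus ?thesis by simp
 qed
 have 1: "2 * real D / real rho <= eps / 2" using assms(2,3) by (simp add: divide_le_eq)
 have 2: "dlt * real k * real w / real q <= eps / 4"
 proof -
  have "dlt * real k * real w <= dlt * ((real p)\<^sup>2 * real q) * real w"
   using kq assms(8) by (intro mult_right_mono mult_left_mono) simp_all
  also have "... = (dlt * (4 * real w * (real p)\<^sup>2)) / 4 * real q" by simp
  also have "... <= eps / 4 * real q" using assms(9) by (intro mult_right_mono divide_right_mono) simp_all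
  finally show ?thesis using assms(5) by (simp add: divide_le_eq)
 qed
 have 3: "real D * real w / real q <= eps / 4"
 proof (cases "p = 0")
  case True
  thus ?thesis using assms(6) by simp
 next
  case False
  have "(4 * real D * real w) * (real p)\<^sup>2 <= eps * ((real p)\<^sup>2 * real q)"
   using assms(7) mult_left_mono[OF kq, of eps] assms(1) by linarith
  also have "... = (eps * real q) * (real p)\<^sup>2" by simp
  finally have "4 * real D * real w <= eps * real q" using False by (simp add: mult_le_cancel_right)
  thus ?thesis using assms(5) by (simp add: divide_le_eq)
 qed
 have "real D * ((2 * n + 6) / real rho + 1) + (real D + dlt * real k) * ((n + 3) * real w / real q + 3) =
  n * (2 * real D / real rho + dlt * real k * real w / real q + real D * real w / real q) +
  (real D * (6 / real rho + 1) + (real D + dlt * real k) * (3 * real w / real q + 3))"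
  using assms(2,5) by (simp add: field_simps)
 moreover have "n * (2 * real D / real rho + dlt * real k * real w / real q + real D * real w / real q) <= n * eps"
  using 1 2 3 assms(10) by (intro mult_left_mono) linarith+
 ultimately show ?thesis by (simp add: mult.commute)
qed

section \<open>A fast algorithm contradicts the Exponential-Time Hypothesis\<close>

definition solver :: "(nat => bool list => rat => bool) => (graph => rat) => prog => real => real => bool" where
 "solver mem \<Phi> prg C s \<longleftrightarrow> (ALL V y v. mem V y v -->
  sum_form \<Phi> V v & (EX t. outputs prg y v t & real t <= C * (real V + 1) powr s))"

definition sat_algorithm :: "real => bool" where
 "sat_algorithm eps \<longleftrightarrow> (\<exists>p (C::real) (d::nat). ALL F. three_cnf F -->
      (EX t. outputs p (enc_cnf F) (if satisfiable F then 1 else 0) t &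
         real t <= C * 2 powr (eps * real (card (cnf_vars F))) * real (length (enc_cnf F)) ^ d))"

text \<open>\<open>dlt0\<close> and \<open>k0\<close> come before \<Phi>, \<open>k\<close> and the
  algorithm, so they can only depend on \<open>c\<close> and on the query family.\<close>

definition hard_from :: "nat => (sat_env, nat list) queries => real => nat => bool" where
 "hard_from c Q dlt0 k0 \<longleftrightarrow> (\<forall>dlt k \<Phi> mem prg C. 0 < dlt --> dlt <= dlt0 --> k0 <= k --> iso_invariant \<Phi> --> edge_monotone \<Phi> -->
  nontrivial_on \<Phi> k --> \<Phi> ` graphs <= of_nat ` {0..c} --> qspec mem \<Phi> satCp Q --> 0 <= C -->
  ~ solver (mem k) \<Phi> prg C (dlt * real k))"

text \<open>A query graph has at most \<open>k * (X + 1)\<close> vertices for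
  \<open>X = 2 ^ zl z\<close> labels, and \<open>M = 2 ^ zm z\<close> bounds the number of leaves.
  The total time is polynomial in both, of a degree independent of \<open>k\<close>, times the query
  time, which is a power of \<open>X\<close> with exponent \<open>dlt * k\<close>.\<close>

lemma no_algorithm:
 fixes Q :: "(sat_env, nat list) queries"
 assumes PTQ: "PTQ Q" and eps: "0 < eps" "~ sat_algorithm eps" and p: "prime p" "3 <= p" "c < p"
 shows "\<exists>dlt0>0. EX k0. hard_from c Q dlt0 k0"
proof -
 obtain G where G: "PB G" "\<forall>prg \<pi>. EX p n0. ALL x e tu.
  (ALL it:set (leaf_items Q (sst (\<pi>, e))). ALL w:set it. EX v t. outputs prg (snd w) v t & t <= tu) -->
  impl {} x p {e} (%e. sat_final c (sst (\<pi>, e), lans Q (sim_val prg) (sst (\<pi>, e))))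
   (%e. n0 + G (sst (\<pi>, e)) * (tu + 1))"
  using eth_run[OF PTQ, of c] by (elim exE conjE) (rule that)
 obtain cG d where cG: "!!S. G S <= cG * sz S ^ d" using G(1) unfolding PB_def by blast
 \<comment> \<open>A positive exponent lets \<open>sz (sst z) ^ D\<close> also dominate the terms
   linear in the size.\<close>
 define D where "D = d + 1"
 have GD: "G S <= cG * sz S ^ D" for S
  using cG[of S] sz_power_mono[of d D S] mult_le_mono2 order_trans unfolding D_def by (metis le_add1)
 \<comment> \<open>Large enough that the leaves, at most \<open>2 ^ zm\<close> many, use half of the
   budget even after raising to the power \<open>D\<close>.\<close>
 define rho where "rho = nat \<lceil>4 * real D / eps\<rceil> + 1"
 have rho: "0 < rho" "4 * real D <= eps * real rho"
 proof -
  have "4 * real D / eps <= real rho" unfolding rho_def by linarith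
  thus "4 * real D <= eps * real rho" using eps(1) by (simp add: divide_le_eq mult.commute)
 qed (simp add: rho_def)
 \<comment> \<open>This \<open>r\<close> turns \<open>exp (2 * r)\<close> into
   \<open>2 powr (1 / rho)\<close>, the number of leaves per literal.\<close>
 have "0 < ln 2 / (2 * real rho)" using rho by simp
 then obtain a b c' y where th: "0 < a" "0 < b" "0 < c'" "1 < y"
   "1 / y ^ (2 * (a + b)) + 1 / y ^ (2 * (a + b) * a) <= 1"
   "1 / y ^ 2 + 1 / y ^ (2 * (a + b) * b) <= 1" "1 / y ^ (2 * (a + b)) + 1 / y ^ c' <= 1"
   "y ^ (4 * (a + b)) = exp (2 * (ln 2 / (2 * real rho)))" by (rule exists_thresholds)
 have th8: "y ^ (4 * (a + b)) = 2 powr (1 / real rho)" unfolding th(8) by (simp add: powr_def)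
 \<comment> \<open>From \<open>zl = zg + 2 * zh\<close>: one bit per variable and twice
   \<open>(1 + a + c') * 2\<close> for its two literals give \<open>5 + 4 * a + 4 * c'\<close> bits
   per variable, divided by \<open>q\<close>.\<close>
 define w where "w = 5 + 4 * a + 4 * c'"
 have w: "0 < w" by (simp add: w_def)
 \<comment> \<open>Since \<open>k / q < p ^ 2\<close>, this makes \<open>dlt * k * w / q\<close> at
   most \<open>eps / 4\<close>. The choice of \<open>k0\<close> does the same for
   \<open>D * w / q\<close>, because \<open>q\<close> grows with \<open>k\<close>.\<close>
 define dlt0 where "dlt0 = eps / (4 * real w * (real p)\<^sup>2)"
 define k0 where "k0 = p + nat \<lceil>4 * real D * real w * (real p)\<^sup>2 / eps\<rceil>"
 have "0 < dlt0" unfolding dlt0_def using eps(1) w p by simp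
 moreover have "~ solver (mem k) \<Phi> prg C0 (dlt * real k)"
  if dlt: "0 < dlt" "dlt <= dlt0" and k: "k0 <= k" and \<Phi>: "iso_invariant \<Phi>" "edge_monotone \<Phi>" "nontrivial_on \<Phi> k"
   "\<Phi> ` graphs <= of_nat ` {0..c}" and Q: "qspec mem \<Phi> satCp Q" and C0: "0 <= C0"
  for dlt k \<Phi> mem prg C0
 proof
  assume "solver (mem k) \<Phi> prg C0 (dlt * real k)"
  note solve = this[unfolded solver_def]
  have kp: "p <= k" "4 * real D * real w * (real p)\<^sup>2 <= eps * real k"
  proof -
   show "p <= k" using k by (simp add: k0_def)
   have "4 * real D * real w * (real p)\<^sup>2 / eps <= real k0" unfolding k0_def by linarith
   also have "... <= real k" using k by simp
   finally show "4 * real D * real w * (real p)\<^sup>2 <= eps * real k" using eps(1) by (simp add: divide_le_eq mult.commute)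
  qed
  have dlt': "dlt * (4 * real w * (real p)\<^sup>2) <= eps"
   using dlt(2) w p unfolding dlt0_def by (simp add: le_divide_eq)
  obtain e where e: "p * p ^ e <= k" "k < p ^ 2 * p ^ e" 
   by (rule block_size[OF order_trans[OF _ p(2)] kp(1)]) simp_all
  define q where "q = p ^ e"
  have q: "0 < q" "2 * q <= k"
  proof -
   show "0 < q" using p by (simp add: q_def)
   have "2 * q <= p * q" using p by (intro mult_le_mono1) simp
   thus "2 * q <= k" using e(1) unfolding q_def by (rule order_trans)
  qed
  obtain hl where hl: "good_hl k q hl" "altsum \<Phi> k q (hl_edges hl) ~= 0"
   using exists_base_list[OF \<Phi> p q_def] e(1) unfolding q_def by blast
  define M0 where "M0 = (2 :: nat) ^ (q * q) + 2 ^ k"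
  define \<pi> where "\<pi> = ((k, q), hl, M0, rho, a, b, c')"
  obtain pr n0 where pr: "ALL x e tu.
  (ALL it:set (leaf_items Q (sst (\<pi>, e))). ALL w:set it. EX v t. outputs prg (snd w) v t & t <= tu) -->
  impl {} x pr {e} (%e. sat_final c (sst (\<pi>, e), lans Q (sim_val prg) (sst (\<pi>, e))))
   (%e. n0 + G (sst (\<pi>, e)) * (tu + 1))"
   using G(2) by (elim allE[of _ prg] allE[of _ \<pi>] exE) (rule that)
  define K1 where "K1 = real (n0 + cG + 40) * real (sz \<pi> + 6) ^ D * ((C0 + 1) * (3 * real k) powr (dlt * real k))"
  define K2 where "K2 = real D * (6 / real rho + 1) + (real D + dlt * real k) * (3 * real w / real q + 3)"
  have "EX t. outputs (p_main pr) (enc_cnf F) (if satisfiable F then 1 else 0) t &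
         real t <= (K1 * 2 powr K2) * 2 powr (eps * real (card (cnf_vars F))) * real (length (enc_cnf F)) ^ D"
   if F: "three_cnf F" for F
  proof -
   define n where "n = card (cnf_vars F)"
   define z where "z = (\<pi>, rev (enc_cnf F))"
   define len where "len = length (enc_cnf F)"
   have z: "z = (((k, q), hl, M0, rho, a, b, c'), rev (enc_cnf F))" by (simp add: z_def \<pi>_def)
   have M0: "2 ^ (q * q) <= M0" "2 ^ k <= M0" by (simp_all add: M0_def)
   have sv: "ALL V y v. mem k V y v --> sum_form \<Phi> V v & rep3 (sim_val prg y) v"
    using solve outputs_sim(1) by blast
   note cor = sat_correct[where ans = "sim_val prg", OF F th(1-7) th8 rho(1) z refl q(2,1) hl(1) M0 hl(2) Q sv \<Phi>(4)]
   define X where "X = (2 :: nat) ^ zl z"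
   define M where "M = (2 :: nat) ^ zm z"
   define tu where "tu = nat \<lfloor>C0 * (real (k * (X + 1)) + 1) powr (dlt * real k)\<rfloor>"
   have tau: "ALL it:set (leaf_items Q (sst (\<pi>, rev (enc_cnf F)))). ALL w:set it. EX v t. outputs prg (snd w) v t & t <= tu"
   proof (intro ballI)
    fix it w assume "it : set (leaf_items Q (sst (\<pi>, rev (enc_cnf F))))" "w : set it"
    from cor(1)[unfolded z_def, OF this]
    obtain v where "mem k (k * (X + 1)) (snd w) v" unfolding X_def z_def by blast
    then obtain t where t: "outputs prg (snd w) v t" "real t <= C0 * (real (k * (X + 1)) + 1) powr (dlt * real k)"
     using solve by blast
    hence "t <= tu" unfolding tu_def by linarith
    thus "EX v t. outputs prg (snd w) v t & t <= tu" using t(1) by blast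
   qed
   have im: "impl {} (enc_cnf F) pr {rev (enc_cnf F)}
    (%e. sat_final c (sst (\<pi>, e), lans Q (sim_val prg) (sst (\<pi>, e))))
    (%e. n0 + G (sst (\<pi>, e)) * (tu + 1))"
    using pr tau by blast
   have r: "rep3 (sat_final c (sst (\<pi>, rev (enc_cnf F)), lans Q (sim_val prg) (sst (\<pi>, rev (enc_cnf F)))))
    (if satisfiable F then 1 else 0)"
    using cor(2) unfolding z_def by (simp add: rep3_def)
   obtain t where t: "outputs (p_main pr) (enc_cnf F) (if satisfiable F then 1 else 0) t"
    "t <= n0 + G (sst z) * (tu + 1) + 20 * len + 20"
    using main_outputs[OF im r] unfolding z_def len_def by blast
   have lens: "1 <= len" "1 <= M" "1 <= X" unfolding len_def M_def X_def enc_cnf_def enc_list_def by simp_all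
   have "sz (rev (enc_cnf F)) = len + 1"
   proof -
    have "sz ys = length ys + 1" for ys :: "bool list" by (induction ys) auto
    thus ?thesis by (simp only: length_rev len_def)
   qed
   hence szS: "sz (sst z) = sz \<pi> + (len + 1) + (M + 1) + (X + 1)"
    unfolding sst_def M_def X_def z_def by (simp only: sz_Pair sz_nat Suc_eq_plus1)
   hence szS2: "sz (sst z) <= (sz \<pi> + 6) * (len * M * X)" using size_product[OF lens] by simp
   have "t <= (n0 + cG + 40) * (sz (sst z) ^ D * (tu + 1))"
   proof -
    have s1: "1 <= sz (sst z)" "len <= sz (sst z)" using szS by simp_all
    have s2: "sz (sst z) ^ 1 <= sz (sst z) ^ D" using s1(1) by (intro power_increasing) (simp_all add: D_def)
    define u where "u = sz (sst z) ^ D * (tu + 1)"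
    have "sz (sst z) ^ D * 1 <= u" unfolding u_def by (intro mult_le_mono2) simp
    hence u: "len <= u" "1 <= u" using s1 s2 by simp_all
    have g: "G (sst z) * (tu + 1) <= cG * u" using mult_le_mono1[OF GD[of "sst z"], of "tu + 1"] by (simp only: u_def mult.assoc)
    have n: "n0 * 1 <= n0 * u" using u(2) by (intro mult_le_mono2)
    have "(n0 + cG + 40) * u = n0 * u + cG * u + 40 * u" by (simp only: add_mult_distrib)
    thus ?thesis using t(2) g n u unfolding u_def[symmetric] by linarith
   qed
   also have "... <= (n0 + cG + 40) * (((sz \<pi> + 6) * (len * M * X)) ^ D * (tu + 1))"
    using szS2 by (intro mult_le_mono2 mult_le_mono1 power_mono) simp_all
   finally have "real t <= real ((n0 + cG + 40) * (((sz \<pi> + 6) * (len * M * X)) ^ D * (tu + 1)))" by (simp only: of_nat_le_iff)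
   also have "... = real (n0 + cG + 40) * real (sz \<pi> + 6) ^ D * (real len ^ D * (real M ^ D * real X ^ D * (real tu + 1)))"
    by (simp only: of_nat_mult of_nat_power power_mult_distrib of_nat_add of_nat_1 mult_ac)
   also have "... <= real (n0 + cG + 40) * real (sz \<pi> + 6) ^ D * (real len ^ D *
     (2 powr (eps * real n + K2) * ((C0 + 1) * (3 * real k) powr (dlt * real k))))"
   proof (intro mult_left_mono)
    let ?m = "(2 * real n + 6) / real rho + 1" and ?x = "(real n + 3) * real w / real q + 3"
    have mx: "real M <= 2 powr ?m" "real X <= 2 powr ?x"
     using bounds_M_X[OF z rho(1) q(1) n_def] unfolding M_def X_def w_def by simp_all
    have X1: "1 <= real X" using lens by simp
    have k1: "1 <= real k" using q by simp
    have "real tu <= C0 * (real (k * (X + 1)) + 1) powr (dlt * real k)"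
    proof -
     have "0 <= C0 * (real (k * (X + 1)) + 1) powr (dlt * real k)" using C0 by simp
     thus ?thesis unfolding tu_def by (simp add: of_nat_nat)
    qed
    also have "... <= C0 * (3 * real k * real X) powr (dlt * real k)"
    proof (intro mult_left_mono powr_mono2)
     have "real k * 1 <= real k * real X" "1 * 1 <= real k * real X" using X1 k1 by (intro mult_mono; simp)+
     hence "real k * real X + real k + 1 <= 3 * (real k * real X)" by linarith
     thus "real (k * (X + 1)) + 1 <= 3 * real k * real X" by (simp add: algebra_simps)
    qed (use dlt C0 in simp_all)
    finally have t1: "real tu <= C0 * (3 * real k * real X) powr (dlt * real k)" .
    have t2: "1 <= (3 * real k * real X) powr (dlt * real k)"
    proof (rule ge_one_powr_ge_zero)
     have "1 * 1 <= (3 * real k) * real X" using X1 k1 by (intro mult_mono) simp_all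
     thus "1 <= 3 * real k * real X" by simp
    qed (use dlt in simp)
    have "real tu + 1 <= (C0 + 1) * (3 * real k * real X) powr (dlt * real k)"
     using t1 t2 by (simp add: algebra_simps)
    also have "... = ((C0 + 1) * (3 * real k) powr (dlt * real k)) * real X powr (dlt * real k)"
     by (simp add: powr_mult)
    finally have T: "real tu + 1 <= ..." .
    have xd: "real X ^ D * real X powr (dlt * real k) <= 2 powr ((real D + dlt * real k) * ?x)"
    proof -
     have "real X ^ D * real X powr (dlt * real k) = real X powr (real D + dlt * real k)"
      using X1 by (simp add: powr_add powr_realpow)
     also have "... <= (2 powr ?x) powr (real D + dlt * real k)" using mx(2) dlt X1 by (intro powr_mono2) simp_all
     finally show ?thesis by (simp add: powr_powr mult.commute)
    qed
    have md: "real M ^ D <= 2 powr (real D * ?m)"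
    proof -
     have "real M ^ D <= (2 powr ?m) ^ D" using mx(1) by (intro power_mono) simp_all
     thus ?thesis by (simp add: powr_realpow[symmetric] powr_powr mult.commute)
    qed
    have "real M ^ D * real X ^ D * (real tu + 1) <= real M ^ D * real X ^ D * (((C0 + 1) * (3 * real k) powr (dlt * real k)) * real X powr (dlt * real k))"
     by (intro mult_left_mono[OF T]) simp
    also have "... = (real M ^ D * (real X ^ D * real X powr (dlt * real k))) * ((C0 + 1) * (3 * real k) powr (dlt * real k))"
     by (simp only: mult_ac)
    also have "... <= (2 powr (real D * ?m) * 2 powr ((real D + dlt * real k) * ?x)) * ((C0 + 1) * (3 * real k) powr (dlt * real k))"
     using md xd C0 by (intro mult_right_mono mult_mono) simp_all
    finally have f1: "real M ^ D * real X ^ D * (real tu + 1) <=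
      (2 powr (real D * ?m) * 2 powr ((real D + dlt * real k) * ?x)) * ((C0 + 1) * (3 * real k) powr (dlt * real k))" .
    have "2 powr (real D * ?m) * 2 powr ((real D + dlt * real k) * ?x) = 2 powr (real D * ?m + (real D + dlt * real k) * ?x)"
     by (simp add: powr_add)
    also have "... <= 2 powr (eps * real n + K2)"
     unfolding K2_def
     by (intro powr_mono exponent_bound[OF eps(1) rho w q(1) _ kp(2) dlt(1) dlt']) (use e(2) in "simp_all add: q_def")
    finally have "2 powr (real D * ?m) * 2 powr ((real D + dlt * real k) * ?x) <= 2 powr (eps * real n + K2)" .
    hence "(2 powr (real D * ?m) * 2 powr ((real D + dlt * real k) * ?x)) * ((C0 + 1) * (3 * real k) powr (dlt * real k)) <=
      2 powr (eps * real n + K2) * ((C0 + 1) * (3 * real k) powr (dlt * real k))"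
     using C0 by (intro mult_right_mono) simp_all
    with f1 show "real M ^ D * real X ^ D * (real tu + 1) <= 2 powr (eps * real n + K2) * ((C0 + 1) * (3 * real k) powr (dlt * real k))"
     by (rule order_trans)
   qed simp_all
   also have "... = (K1 * 2 powr K2) * 2 powr (eps * real n) * real len ^ D"
    by (simp add: K1_def powr_add mult_ac)
   finally show ?thesis using t(1) unfolding n_def len_def by blast
  qed
  thus False using eps(2) unfolding sat_algorithm_def by blast
 qed
 ultimately show ?thesis unfolding hard_from_def by blast
qed

section \<open>Both problems as instances of the reduction\<close>

lemma finite_denominator:
 assumes "finite (A :: rat set)"
 shows "\<exists>N>0. ALL v:A. of_nat N * v : \<int>"
 using assms
proof induction
 case (insert v A)
 then obtain N where N: "0 < N" "ALL v:A. of_nat N * v : \<int>" by blast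
 obtain a b where ab: "quotient_of v = (a, b)" by (cases "quotient_of v")
 have b: "0 < b" "v = of_int a / of_int b" using quotient_of_denom_pos[OF ab] quotient_of_div[OF ab] by auto
 have "of_nat (nat b) * v = of_int a" using b by simp
 hence "of_nat N * (of_nat (nat b) * v) : \<int>" by simp
 moreover have "of_nat (nat b) * (of_nat N * w) : \<int>" if "w : A" for w
  by (rule Ints_mult) (use N(2) that in auto)
 ultimately have "ALL w:insert v A. of_nat (N * nat b) * w : \<int>" by (auto simp: mult_ac)
 thus ?case using N(1) b(1) by (intro exI[of _ "N * nat b"]) auto
qed (auto intro: exI[of _ 1])

lemma finite_abs_bound:
 assumes "finite (A :: rat set)"
 shows "EX B. ALL v:A. \<bar>of_nat N * v\<bar> <= of_nat B"
proof -
 obtain B where "(SUM v:A. \<bar>of_nat N * v\<bar>) < of_nat B" using reals_Archimedean2 by blast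
 hence B: "(SUM v:A. \<bar>of_nat N * v\<bar>) <= of_nat B" by (rule less_imp_le)
 have "\<bar>of_nat N * v\<bar> <= (SUM v:A. \<bar>of_nat N * v\<bar>)" if "v : A" for v
  using that assms by (intro member_le_sum) auto
 thus ?thesis using B order_trans by blast
qed

lemma PT_enc_nat: "PT f ==> PT (%e. enc_nat (f e))"
 unfolding enc_nat_def by (intro PTs PT_replicate)

text \<open>For the coloured problem the test strings use the complete graph as pattern and the
  identity as colouring, so that every graph on the same vertices is admissible.\<close>

lemma hard_both:
 assumes gp: "graph_parameter \<Phi>" and mono: "edge_monotone \<Phi>" and fin: "finite (\<Phi> ` graphs)" and nt: "nontrivial \<Phi>"
 shows "sharp_W1_hard (indsub_problem \<Phi>)" "sharp_W1_hard (cp_indsub_problem \<Phi>)"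
proof -
 have iso: "iso_invariant \<Phi>" using gp by (simp add: graph_parameter_def)
 obtain prg where prg: "!!G. G : input_graphs ==> EX t. outputs prg (enc_graph G) (\<Phi> G) t"
  using gp unfolding graph_parameter_def computable_graph_fun_def by blast
 obtain N where N: "0 < N" "!!G. G : graphs ==> of_nat N * \<Phi> G : \<int>"
  using finite_denominator[OF fin] by blast
 obtain B where B: "!!G. G : graphs ==> \<bar>of_nat N * \<Phi> G\<bar> <= of_nat B"
  using finite_abs_bound[OF fin, of N] by blast
 \<comment> \<open>Scaled values lie between \<open>-B\<close> and \<open>B\<close>, so their
   differences are below \<open>b\<close>, and the summand 2 makes \<open>b\<close> an odd
   prime.\<close>
 obtain b where b: "prime b" "2 * B + 2 < b" using bigger_prime by blast
 have b3: "3 <= b" using b(2) by simp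
 have df: "\<bar>of_nat N * \<Phi> G - of_nat N * \<Phi> G'\<bar> < of_nat b" if gg: "G : graphs" "G' : graphs" for G G'
 proof -
  have "\<bar>of_nat N * \<Phi> G - of_nat N * \<Phi> G'\<bar> <= of_nat B + of_nat B"
   using B[OF gg(1)] B[OF gg(2)] by linarith
  also have "... < (of_nat b :: rat)" using b(2) by (simp only: of_nat_add[symmetric] of_nat_less_iff)
  finally show ?thesis .
 qed
 have cv: "card (verts (cgr n)) = n" "card (verts (egr n)) = n" for n by (simp_all add: cgr_egr)
 show "sharp_W1_hard (indsub_problem \<Phi>)"
 proof (rule reduction.hard)
  show "reduction \<Phi> (indsub_problem \<Phi>) (%k. imem (enc_nat k) \<Phi> k)
   (%M k q hl c xs x0. ind_queries (enc_nat k) M k q hl (clCp c) xs x0)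
   (%n. enc_nat n @ cgr_bits n) (%n. enc_nat n @ egr_bits n) N B b prg"
  proof (unfold_locales; (fact functional_indsub_problem iso mono nt fin N B b b3 df prg)?)
   show "PTQ (%M k q hl c xs x0. ind_queries (enc_nat k) M k q hl (clCp c) xs x0)"
    unfolding PTQ_def by (intro PTs PT_ind_queries[OF PT_clCp] PT_enc_nat)
   show "qspec (%k. imem (enc_nat k) \<Phi> k) \<Phi> clCp (%M k q hl c xs x0. ind_queries (enc_nat k) M k q hl (clCp c) xs x0)"
    by (rule qspec_ind[OF iso])
   show "(y, k, v) : indsub_problem \<Phi> & sum_form \<Phi> V v" if m: "imem (enc_nat k) \<Phi> k V y v" for k V y v
    using sum_form_imem[OF m] m unfolding imem_def indsub_problem_def by blast
   show "PT (%n. enc_nat n @ cgr_bits n)" "PT (%n. enc_nat n @ egr_bits n)"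
    by (intro PTs PT_enc_nat PT_cgr_bits)+
   show "(enc_nat n @ cgr_bits n, n, \<Phi> (cgr n)) : indsub_problem \<Phi>" for n
    unfolding indsub_problem_def
    using cgr_in(1)[of n] indsub_full[OF cgr_in(1)[of n], of \<Phi>] by (auto simp: cv cgr_bits[symmetric] intro!: exI[of _ "cgr n"])
   show "(enc_nat n @ egr_bits n, n, \<Phi> (egr n)) : indsub_problem \<Phi>" for n
    unfolding indsub_problem_def
    using cgr_in(2)[of n] indsub_full[OF cgr_in(2)[of n], of \<Phi>] by (auto simp: cv cgr_bits[symmetric] intro!: exI[of _ "egr n"])
  qed
 qed
 show "sharp_W1_hard (cp_indsub_problem \<Phi>)"
 proof (rule reduction.hard)
  have enc: "enc_colored (cgr n) G (%v. v) = cgr_bits n @ enc_graph G @ concat (map enc_nat [0..<n])"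
   if "card (verts G) = n" for n G
   using that by (simp add: enc_colored_def cgr_bits enc_coloring_def)
  have mem: "(cgr_bits n @ enc_graph G @ concat (map enc_nat [0..<n]), n, \<Phi> G) : cp_indsub_problem \<Phi>"
   if G: "G : input_graphs" "verts G = {..<n}" for n G
  proof -
   have "graph_hom (%v. v) G (cgr n)"
    using G by (auto simp: graph_hom_def cgr_egr pairs_def input_graphs_def graphs_def)
   moreover have "cp_indsub \<Phi> (cgr n) G (%v. v) = \<Phi> G" by (rule cp_indsub_full[OF G(1)]) (simp add: cgr_egr G)
   ultimately have "(enc_colored (cgr n) G (%v. v), card (verts (cgr n)), \<Phi> G) : cp_indsub_problem \<Phi>"
    unfolding cp_indsub_problem_def using cgr_in(1)[of n] G(1) by force
   thus ?thesis using enc[of G n] G(2) by (simp add: cv)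
  qed
  show "reduction \<Phi> (cp_indsub_problem \<Phi>) (cmem \<Phi>)
   (%M k q hl c xs x0. cp_queries M k q hl (clCp c) xs x0)
   (%n. cgr_bits n @ cgr_bits n @ concat (map enc_nat [0..<n])) (%n. cgr_bits n @ egr_bits n @ concat (map enc_nat [0..<n])) N B b prg"
  proof (unfold_locales; (fact functional_cp_indsub_problem iso mono nt fin N B b b3 df prg)?)
   show "PTQ (%M k q hl c xs x0. cp_queries M k q hl (clCp c) xs x0)"
    unfolding PTQ_def by (intro PTs PT_cp_queries[OF PT_clCp])
   show "qspec (cmem \<Phi>) \<Phi> clCp (%M k q hl c xs x0. cp_queries M k q hl (clCp c) xs x0)"
    by (rule qspec_cp[OF iso])
   show "(y, k, v) : cp_indsub_problem \<Phi> & sum_form \<Phi> V v" if m: "cmem \<Phi> k V y v" for k V y v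
    using sum_form_cmem[OF m] m unfolding cmem_def cp_indsub_problem_def by blast
   show "PT (%n. cgr_bits n @ cgr_bits n @ concat (map enc_nat [0..<n]))" "PT (%n. cgr_bits n @ egr_bits n @ concat (map enc_nat [0..<n]))"
    by (intro PTs PT_enc_nat PT_cgr_bits)+
   show "(cgr_bits n @ cgr_bits n @ concat (map enc_nat [0..<n]), n, \<Phi> (cgr n)) : cp_indsub_problem \<Phi>" for n
    using mem[OF cgr_in(1)[of n]] by (simp add: cgr_egr cgr_bits)
   show "(cgr_bits n @ egr_bits n @ concat (map enc_nat [0..<n]), n, \<Phi> (egr n)) : cp_indsub_problem \<Phi>" for n
    using mem[OF cgr_in(2)[of n]] by (simp add: cgr_egr cgr_bits)
  qed
 qed
qed

section \<open>Lower bounds under the Exponential-Time Hypothesis\<close>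

text \<open>The finitely many exceptions of the asymptotic bound are absorbed by the constant; with
  \<open>n + 1\<close> instead of \<open>n\<close> the power is at least 1 everywhere, also at
  0.\<close>

lemma bigo_bound:
 fixes T :: "nat => real" and s :: real
 assumes "T : O(%n. real n powr s)" "0 <= s"
 obtains C where "0 <= C" "!!n. T n <= C * (real n + 1) powr s"
proof -
 obtain c where c: "0 < c" "eventually (%n. norm (T n) <= c * norm (real n powr s)) sequentially"
  by (rule landau_o.bigE[OF assms(1)]) blast
 then obtain n0 where n0: "!!n. n0 <= n ==> \<bar>T n\<bar> <= c * real n powr s"
  unfolding eventually_sequentially by auto
 let ?C = "c + (\<Sum>n<n0. \<bar>T n\<bar>)"
 have s0: "0 <= (\<Sum>n<n0. \<bar>T n\<bar>)" by (intro sum_nonneg) simp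
 have "T n <= ?C * (real n + 1) powr s" for n
 proof (cases "n0 <= n")
  case True
  have "T n <= c * real n powr s" using n0[OF True] by linarith
  also have "... <= ?C * (real n + 1) powr s"
   using c s0 assms(2) by (intro mult_mono powr_mono2) simp_all
  finally show ?thesis .
 next
  case False
  have "T n <= (\<Sum>n<n0. \<bar>T n\<bar>)"
   using member_le_sum[of n "{..<n0}" "%n. \<bar>T n\<bar>"] False by simp
  also have "... <= ?C * 1" using c by simp
  also have "... <= ?C * (real n + 1) powr s"
   using c s0 assms(2) by (intro mult_left_mono ge_one_powr_ge_zero) simp_all
  finally show ?thesis .
 qed
 thus ?thesis using that[of ?C] c s0 by simp
qed

lemma reads_all_length: "reads_all_outputs p x v t ==> length x <= t"
proof -
 assume "reads_all_outputs p x v t"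
 then obtain R s where R: "exec {} x p (%_. 0) t R {} s" "{..<length x} <= R"
  unfolding reads_all_outputs_def oracle_run_def by blast
 have "finite R" "card R <= t" using exec_card_read[OF R(1)] by auto
 hence "card {..<length x} <= t" using card_mono[OF _ R(2)] by linarith
 thus ?thesis by simp
qed

lemma reads_all_outputs: "reads_all_outputs p x v t ==> outputs p x v t"
 unfolding reads_all_outputs_def outputs_def by blast

lemma length_enc_graph: "card (verts G) * card (verts G) <= length (enc_graph G)"
 by (simp add: enc_graph_def Let_def)

text \<open>An algorithm that reads an adjacency matrix takes at least \<open>n * n\<close> steps,
  more than any linear bound permits.\<close>

lemma small_exponent:
 fixes s C :: real
 assumes "s <= 1" "0 <= C" "!!n :: nat. EX t. real (n * n) <= real t & real t <= C * (real n + 1) powr s"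
 shows False
proof -
 define n where "n = nat \<lceil>2 * C\<rceil> + 1"
 have n: "2 * C < real n" "1 <= real n" unfolding n_def by linarith+
 obtain t where "real (n * n) <= real t" "real t <= C * (real n + 1) powr s" using assms(3) by blast
 hence "real n * real n <= C * (real n + 1) powr s" by simp
 also have "... <= C * (real n + 1) powr 1" using assms(1,2) by (intro mult_left_mono powr_mono) simp_all
 also have "... <= C * (2 * real n)" using n assms(2) by (intro mult_left_mono) simp_all
 also have "... = (2 * C) * real n" by simp
 also have "... < real n * real n" using n by (intro mult_strict_right_mono) simp_all
 finally show False by simp
qed

text \<open>Below \<open>k1\<close> the exponent is at most 1 and the length of the input refutes
  the bound; from \<open>k1\<close> on \<open>hard_from\<close> applies.\<close>

lemma time_lower_bound:
 assumes big: "T : O(%n. real n powr (dlt * real k))" "0 < dlt"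
  and mem: "!!V y v. mem k V y v ==> sum_form \<Phi> V v & (EX m t. m <= V & reads_all_outputs prg y v t & real t <= T m)"
  and large: "!!n. EX y v t. n * n <= length y & reads_all_outputs prg y v t & real t <= T n"
  and k: "k < k1 ==> dlt * real k <= 1" "k1 <= k ==> hard_from c Q dlt0 k0" "dlt <= dlt0" "k0 <= k1"
  and \<Phi>: "iso_invariant \<Phi>" "edge_monotone \<Phi>" "nontrivial_on \<Phi> k" "\<Phi> ` graphs <= of_nat ` {0..c}" "qspec mem \<Phi> satCp Q"
 shows False
proof -
 have pos: "0 <= dlt * real k" using big(2) by simp
 obtain C where C: "0 <= C" "!!n. T n <= C * (real n + 1) powr (dlt * real k)" by (rule bigo_bound[OF big(1) pos]) blast
 show False
 proof (cases "k < k1")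
  case True
  show False
  proof (rule small_exponent[OF k(1)[OF True] C(1)])
   fix n
   obtain y v t where t: "n * n <= length y" "reads_all_outputs prg y v t" "real t <= T n" using large by blast
   have "n * n <= t" using reads_all_length[OF t(2)] t(1) by simp
   hence "real (n * n) <= real t" by (simp only: of_nat_le_iff)
   thus "EX t. real (n * n) <= real t & real t <= C * (real n + 1) powr (dlt * real k)"
    using t(3) C(2)[of n] by (intro exI[of _ t]) linarith
  qed
 next
  case False
  hence k1: "k1 <= k" by simp
  have "sum_form \<Phi> V v & (EX t. outputs prg y v t & real t <= C * (real V + 1) powr (dlt * real k))"
   if m: "mem k V y v" for V y v
  proof -
   obtain m' t where t: "m' <= V" "reads_all_outputs prg y v t" "real t <= T m'" using mem[OF m] by blast
   \<comment> \<open>\<open>T\<close> need not be monotone, so it is first replaced by its power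
     bound, which grows with the number of vertices.\<close>
   have "real t <= C * (real m' + 1) powr (dlt * real k)" using t(3) C(2) order_trans by blast
   also have "... <= C * (real V + 1) powr (dlt * real k)" using C(1) t(1) pos by (intro mult_left_mono powr_mono2) simp_all
   finally show ?thesis using mem[OF m] reads_all_outputs[OF t(2)] by blast
  qed
  hence "solver (mem k) \<Phi> prg C (dlt * real k)" unfolding solver_def by blast
  moreover have "k0 <= k" using k(4) k1 by simp
  ultimately show False using k(2)[OF k1] k(3) big(2) \<Phi> C(1) unfolding hard_from_def by blast
 qed
qed

lemma egr_hom: "0 < k ==> graph_hom (%_. 0) (egr n) (egr k)"
 by (auto simp: graph_hom_def cgr_egr)

theorem theorem1:
  shows "(\<forall>\<Phi> :: graph \<Rightarrow> rat.
            graph_parameter \<Phi> \<longrightarrow> edge_monotone \<Phi> \<longrightarrow> finite (\<Phi> ` graphs) \<longrightarrow> nontrivial \<Phi> \<longrightarrow>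
            sharp_W1_hard (indsub_problem \<Phi>) \<and> sharp_W1_hard (cp_indsub_problem \<Phi>)) \<and>
         (ETH \<longrightarrow>
            (\<forall>c :: nat. \<exists>\<delta> :: real. \<delta> > 0 \<and>
               (\<forall>\<Phi> :: graph \<Rightarrow> rat.
                  graph_parameter \<Phi> \<longrightarrow> edge_monotone \<Phi> \<longrightarrow> \<Phi> ` graphs \<subseteq> of_nat ` {0..c} \<longrightarrow>
                  (\<forall>k :: nat. k \<ge> 3 \<longrightarrow> nontrivial_on \<Phi> k \<longrightarrow>
                     \<not> (\<exists>T. T \<in> O(\<lambda>n. real n powr (\<delta> * real k)) \<and> indsub_solvable_in \<Phi> k T) \<and>
                     \<not> (\<exists>T. T \<in> O(\<lambda>n. real n powr (\<delta> * real k)) \<and> cp_indsub_solvable_in \<Phi> k T)))))"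
proof (intro conjI impI allI)
 fix c :: nat
 assume ETH
 then obtain eps :: real where eps: "0 < eps" "~ sat_algorithm eps" unfolding ETH_def sat_algorithm_def by blast
 obtain p :: nat where p: "prime p" "c + 3 < p" using bigger_prime by blast
 have p3: "3 <= p" "c < p" using p by simp_all
 let ?Qi = "%M k q hl c xs x0. ind_queries [] M k q hl (satCp c) xs x0"
 let ?Qc = "%M k q hl c xs x0. cp_queries M k q hl (satCp c) xs x0"
 have Pi: "PTQ ?Qi" unfolding PTQ_def by (intro PT_ind_queries[OF PT_satCp] PTs)
 have Pc: "PTQ ?Qc" unfolding PTQ_def by (intro PT_cp_queries[OF PT_satCp] PTs)
 obtain dlti ki where i: "0 < dlti" "hard_from c ?Qi dlti ki" using no_algorithm[OF Pi eps p(1) p3] by blast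
 obtain dltc kc where cc: "0 < dltc" "hard_from c ?Qc dltc kc" using no_algorithm[OF Pc eps p(1) p3] by blast
 define k0 where "k0 = max ki kc"
 \<comment> \<open>The last term gives exponents at most 1 for all \<open>k\<close> below the
   threshold \<open>k0\<close>, which depends on \<open>c\<close> only.\<close>
 define dlt where "dlt = min (min dlti dltc) (1 / (real k0 + 1))"
 have dlt: "0 < dlt" "dlt <= dlti" "dlt <= dltc" "dlt <= 1 / (real k0 + 1)" using i(1) cc(1) by (auto simp: dlt_def)
 have kk: "ki <= k0" "kc <= k0" by (simp_all add: k0_def)
 have small: "dlt * real k <= 1" if "k < k0" for k
 proof -
  have "dlt * real k <= (1 / (real k0 + 1)) * (real k0 + 1)" using dlt that by (intro mult_mono) simp_all
  thus ?thesis by simp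
 qed
 show "\<exists>dlt :: real. dlt > 0 &
       (\<forall>\<Phi> :: graph => rat.
         graph_parameter \<Phi> --> edge_monotone \<Phi> --> \<Phi> ` graphs <= of_nat ` {0..c} -->
         (\<forall>k :: nat. k >= 3 --> nontrivial_on \<Phi> k -->
          ~ (EX T. T : O(%n. real n powr (dlt * real k)) & indsub_solvable_in \<Phi> k T) &
          ~ (EX T. T : O(%n. real n powr (dlt * real k)) & cp_indsub_solvable_in \<Phi> k T)))"
 proof (intro exI[of _ dlt] conjI allI impI notI)
  show "0 < dlt" by (rule dlt)
  fix \<Phi> :: "graph => rat" and k :: nat
  assume gp: "graph_parameter \<Phi>" and mono: "edge_monotone \<Phi>" and cod: "\<Phi> ` graphs <= of_nat ` {0..c}"
   and k3: "3 <= k" and nt: "nontrivial_on \<Phi> k"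
  have iso: "iso_invariant \<Phi>" using gp by (simp add: graph_parameter_def)
  have len: "n * n <= length (enc_graph (egr n))" for n using length_enc_graph[of "egr n"] by (simp add: cgr_egr)
  show False if ex: "EX T. T : O(%n. real n powr (dlt * real k)) & indsub_solvable_in \<Phi> k T"
  proof -
   obtain T where T: "T : O(%n. real n powr (dlt * real k))" "indsub_solvable_in \<Phi> k T" using ex by blast
   obtain prg where prg: "!!G. G : input_graphs ==> EX t. reads_all_outputs prg (enc_graph G) (indsub \<Phi> k G) t & real t <= T (card (verts G))"
    using T(2) unfolding indsub_solvable_in_def by blast
   show False
   proof (rule time_lower_bound[OF T(1) dlt(1) _ _ small i(2) dlt(2) kk(1) iso mono nt cod qspec_ind[OF iso, where pre = "%_. []"]])
    fix n
    show "EX y v t. n * n <= length y & reads_all_outputs prg y v t & real t <= T n"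
     using len prg[OF cgr_in(2)[of n]] by (auto simp: cgr_egr)
   next
    fix V y v
    assume m: "imem [] \<Phi> k V y v"
    thus "sum_form \<Phi> V v & (EX m t. m <= V & reads_all_outputs prg y v t & real t <= T m)"
     using sum_form_imem[OF m] prg unfolding imem_def by fastforce
   qed
  qed
  show False if ex: "EX T. T : O(%n. real n powr (dlt * real k)) & cp_indsub_solvable_in \<Phi> k T"
  proof -
   obtain T where T: "T : O(%n. real n powr (dlt * real k))" "cp_indsub_solvable_in \<Phi> k T" using ex by blast
   obtain prg where prg: "!!H G c. H : input_graphs ==> G : input_graphs ==> card (verts H) = k ==> graph_hom c G H ==>
     EX t. reads_all_outputs prg (enc_colored H G c) (cp_indsub \<Phi> H G c) t & real t <= T (card (verts G))"
    using T(2) unfolding cp_indsub_solvable_in_def by blast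
   show False
   proof (rule time_lower_bound[OF T(1) dlt(1) _ _ small cc(2) dlt(3) kk(2) iso mono nt cod qspec_cp[OF iso]])
    fix n
    \<comment> \<open>Edgeless graphs admit the constant colouring, and their encodings already
      contain \<open>n * n\<close> bits. Vertex 0 of the pattern exists because \<open>k\<close> is
      positive.\<close>
    have "graph_hom (%_. 0) (egr n) (egr k)" using k3 by (intro egr_hom) simp
    then obtain t where t: "reads_all_outputs prg (enc_colored (egr k) (egr n) (%_. 0)) (cp_indsub \<Phi> (egr k) (egr n) (%_. 0)) t" "real t <= T n"
     using prg[OF cgr_in(2)[of k] cgr_in(2)[of n], of "%_. 0"] by (auto simp: cgr_egr)
    have "n * n <= length (enc_colored (egr k) (egr n) (%_. 0))" using len[of n] by (simp add: enc_colored_def)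
    thus "EX y v t. n * n <= length y & reads_all_outputs prg y v t & real t <= T n" using t by blast
   next
    fix V y v
    assume m: "cmem \<Phi> k V y v"
    thus "sum_form \<Phi> V v & (EX m t. m <= V & reads_all_outputs prg y v t & real t <= T m)"
     using sum_form_cmem[OF m] prg unfolding cmem_def by blast
   qed
  qed
 qed
qed (use hard_both in blast)+

end
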